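(* Let $\mathcal{S}$ be a straight-line program (SLP) of size $n$ representing a string $S$ of length $N$. One can solve the longest common extension problem on $S$ using $O(n)$ space and $O(\log N + \log^2 \ell)$ query time, where $\ell$ is the length of the longest common extension returned by the query.
   Context: A straight-line program (SLP) is a context-free grammar in which every rule has exactly one variable on the left-hand side and on the right-hand side either exactly two variables or exactly one terminal symbol; it is acyclic and each variable derives exactly one string. Its size $n$ is the number of rules, and $S$ is the string derived by the start variable. The longest common extension problem asks to support queries $\mathsf{lce}(i,j)$: given positions $i,j$ of $S$, return the length of the longest common prefix of the suffixes $S[i,N]$ and $S[j,N]$. Space is measured in machine words (word-RAM model). *)

theory Defs
  imports Complex_Main "HOL-Library.Sublist"
begin

section \<open>Straight-line programs\<close>

text \<open>In the right-hand side of a rule, \<open>Inl\<close> marks variables and \<open>Inr\<close> marks terminals.\<close>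

record ('v, 'a) cfg =
  rules :: "('v \<times> ('v + 'a) list) set"
  start :: 'v

inductive derive_step :: "('v, 'a) cfg \<Rightarrow> ('v + 'a) list \<Rightarrow> ('v + 'a) list \<Rightarrow> bool"
  for G where
  "(X, rhs) \<in> rules G \<Longrightarrow> derive_step G (us @ [Inl X] @ vs) (us @ rhs @ vs)"

definition derives :: "('v, 'a) cfg \<Rightarrow> 'v \<Rightarrow> 'a list \<Rightarrow> bool" where
  "derives G X s \<longleftrightarrow> (derive_step G)\<^sup>*\<^sup>* [Inl X] (map Inr s)"

definition variables :: "('v, 'a) cfg \<Rightarrow> 'v set" where
  "variables G = {start G} \<union> fst ` rules G \<union> {Y. \<exists>(X, rhs) \<in> rules G. Inl Y \<in> set rhs}"

definition uses :: "('v, 'a) cfg \<Rightarrow> ('v \<times> 'v) set" where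
  "uses G = {(X, Y). \<exists>rhs. (X, rhs) \<in> rules G \<and> Inl Y \<in> set rhs}"

definition is_slp :: "('v, 'a) cfg \<Rightarrow> bool" where
  "is_slp G \<longleftrightarrow>
     finite (rules G) \<and>
     (\<forall>(X, rhs) \<in> rules G. (\<exists>Y Z. rhs = [Inl Y, Inl Z]) \<or> (\<exists>a. rhs = [Inr a])) \<and>
     acyclic (uses G) \<and>
     (\<forall>X \<in> variables G. \<exists>!s. derives G X s)"

definition slp_size :: "('v, 'a) cfg \<Rightarrow> nat" where
  "slp_size G = card (rules G)"

definition slp_represents :: "('v, 'a) cfg \<Rightarrow> 'a list \<Rightarrow> bool" where
  "slp_represents G S \<longleftrightarrow> is_slp G \<and> derives G (start G) S"


section \<open>Longest common extensions\<close>

text \<open>Positions are counted from 1, so that \<open>drop (i - 1) S\<close> is the suffix \<open>S[i, N]\<close>.\<close>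

definition lce :: "'a list \<Rightarrow> nat \<Rightarrow> nat \<Rightarrow> nat" where
  "lce S i j = length (longest_common_prefix (drop (i - 1) S) (drop (j - 1) S))"


section \<open>The word RAM\<close>

text \<open>
  A unit-cost RAM with words of \<open>w\<close> bits, represented by the natural numbers below \<open>2 ^ w\<close>.
  The word length is a parameter of the semantics and not a type, since one program has to work
  for all word lengths. Programs are while-programs over registers; as a program mentions only
  finitely many registers, the registers account for a constant number of words. The memory is a
  list of words, and its length is the space that is used. An access outside of this list is an
  error: \<open>exec\<close> relates such a run to no final state.
\<close>

type_synonym reg = nat

datatype binop = Add | Sub | Mult | Div | Mod | And | Or | Xor | ShiftL | ShiftR

datatype cmp = Less reg reg | LessEq reg reg | Equal reg reg | NotEqual reg reg

datatype prog =
    Skip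
  | Const reg nat
  | Op binop reg reg reg
  | Load reg reg
  | Store reg reg
  | Seq prog prog
  | Cond cmp prog prog
  | While cmp prog

type_synonym state = "(reg \<Rightarrow> nat) \<times> nat list"

fun binop_val :: "nat \<Rightarrow> binop \<Rightarrow> nat \<Rightarrow> nat \<Rightarrow> nat" where
  "binop_val w Add x y = (x + y) mod 2 ^ w"
| "binop_val w Sub x y = (x + (2 ^ w - y)) mod 2 ^ w"
| "binop_val w Mult x y = (x * y) mod 2 ^ w"
| "binop_val w Div x y = x div y"
| "binop_val w Mod x y = x mod y"
| "binop_val w And x y = and x y"
| "binop_val w Or x y = or x y"
| "binop_val w Xor x y = xor x y"
| "binop_val w ShiftL x y = push_bit y x mod 2 ^ w"
| "binop_val w ShiftR x y = drop_bit y x"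

fun cmp_val :: "cmp \<Rightarrow> (reg \<Rightarrow> nat) \<Rightarrow> bool" where
  "cmp_val (Less a b) r \<longleftrightarrow> r a < r b"
| "cmp_val (LessEq a b) r \<longleftrightarrow> r a \<le> r b"
| "cmp_val (Equal a b) r \<longleftrightarrow> r a = r b"
| "cmp_val (NotEqual a b) r \<longleftrightarrow> r a \<noteq> r b"

text \<open>\<open>exec w p s t s'\<close>: on words of \<open>w\<close> bits, \<open>p\<close> started in \<open>s\<close> terminates in \<open>s'\<close>
  after exactly \<open>t\<close> instructions, where each evaluation of a test counts as an instruction.\<close>

inductive exec :: "nat \<Rightarrow> prog \<Rightarrow> state \<Rightarrow> nat \<Rightarrow> state \<Rightarrow> bool" for w where
  Skip: "exec w Skip s 0 s"
| Const: "exec w (Const a k) (r, m) 1 (r(a := k mod 2 ^ w), m)"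
| Op: "exec w (Op f a b c) (r, m) 1 (r(a := binop_val w f (r b) (r c)), m)"
| Load: "r b < length m \<Longrightarrow> exec w (Load a b) (r, m) 1 (r(a := m ! r b), m)"
| Store: "r a < length m \<Longrightarrow> exec w (Store a b) (r, m) 1 (r, m[r a := r b])"
| Seq: "exec w p s t s' \<Longrightarrow> exec w q s' t' s'' \<Longrightarrow> exec w (Seq p q) s (t + t') s''"
| CondTrue: "cmp_val c (fst s) \<Longrightarrow> exec w p s t s' \<Longrightarrow> exec w (Cond c p q) s (Suc t) s'"
| CondFalse: "\<not> cmp_val c (fst s) \<Longrightarrow> exec w q s t s' \<Longrightarrow> exec w (Cond c p q) s (Suc t) s'"
| WhileFalse: "\<not> cmp_val c (fst s) \<Longrightarrow> exec w (While c p) s 1 s"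
| WhileTrue: "cmp_val c (fst s) \<Longrightarrow> exec w p s t s' \<Longrightarrow> exec w (While c p) s' t' s'' \<Longrightarrow>
    exec w (While c p) s (Suc (t + t')) s''"

inductive_cases exec_elims:
  "exec w Skip s t s'"
  "exec w (Const a k) s t s'"
  "exec w (Op f a b c) s t s'"
  "exec w (Load a b) s t s'"
  "exec w (Store a b) s t s'"
  "exec w (Seq p q) s t s'"
  "exec w (Cond c p q) s t s'"

inductive_cases exec_WhileE: "exec w (While c p) s t s'"

lemma exec_deterministic:
  "exec w p s t s' \<Longrightarrow> exec w p s u s'' \<Longrightarrow> u = t \<and> s'' = s'"
proof (induction arbitrary: u s'' rule: exec.induct)
  case (Seq p s t s' q t' s'')
  from Seq.prems show ?case
    by (rule exec_elims(6)) (use Seq.IH in blast)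
next
  case (CondTrue c s p t s' q)
  from CondTrue.prems show ?case
    by (rule exec_elims(7)) (use CondTrue.hyps CondTrue.IH in blast)+
next
  case (CondFalse c s q t s' p)
  from CondFalse.prems show ?case
    by (rule exec_elims(7)) (use CondFalse.hyps CondFalse.IH in blast)+
next
  case (WhileFalse c s p)
  from WhileFalse.prems show ?case
    by (rule exec_WhileE) (use WhileFalse.hyps in auto)
next
  case (WhileTrue c s p t s' t' s'')
  from WhileTrue.prems show ?case
    by (rule exec_WhileE) (use WhileTrue.hyps WhileTrue.IH in blast)+
qed (erule exec_elims; simp)+


section \<open>Data structures for longest common extension queries\<close>

text \<open>
  A query finds the positions in registers 0 and 1 and leaves its answer in register 0. It may
  write to memory; \<open>D\<close> collects the memory contents that can be met between two queries, so an
  arbitrarily long sequence of queries is answered. The working space of a query is part of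
  \<open>space\<close>. The time bound depends on the answer.
\<close>

definition query_regs :: "nat \<Rightarrow> nat \<Rightarrow> reg \<Rightarrow> nat" where
  "query_regs i j = (\<lambda>_. 0)(0 := i, 1 := j)"

definition solves_lce ::
  "nat \<Rightarrow> prog \<Rightarrow> 'a list \<Rightarrow> real \<Rightarrow> (nat \<Rightarrow> real) \<Rightarrow> bool" where
  "solves_lce w p S space time \<longleftrightarrow>
     (\<exists>D. D \<noteq> {} \<and>
       (\<forall>m \<in> D. real (length m) \<le> space \<and> (\<forall>x \<in> set m. x < 2 ^ w)) \<and>
       (\<forall>m \<in> D. \<forall>i \<in> {1..length S}. \<forall>j \<in> {1..length S}.
          \<exists>t r m'. exec w p (query_regs i j, m) t (r, m') \<and>
            r 0 = lce S i j \<and> m' \<in> D \<and> real t \<le> time (lce S i j)))"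

end

theory Submission
  imports Defs "HOL-Computational_Algebra.Computational_Algebra" "HOL-Library.Log_Nat"
    "HOL-Library.Discrete_Functions" "HOL-Number_Theory.Cong"
begin

text \<open>
  The SLP is first balanced locally: there is a family \<open>F\<close> of \<open>O(n)\<close> strings, closed under taking
  the two halves of a fixed factorization, in which every string \<open>s\<close> has a derivation tree of height
  \<open>O(log (length s))\<close>. To get it, decompose the SLP along heavy paths. The light siblings on either side of a
  heavy path form a word of a trie (words are stored with the heavy end at the root), and it suffices to build
  the words of a trie with weighted letters. A word is split where its prefix weight passes a multiple
  of a large power of two; nodes whose depth lies in a sparse residue class modulo \<open>2 ^ k\<close>
  store the pieces belonging to level \<open>k\<close>, which costs \<open>O(k / 2 ^ k)\<close> per node of the trie.

  Every string of \<open>F\<close> carries its Karp-Rabin hash modulo a prime \<open>P\<close> of \<open>O(log N)\<close> bits for which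
  no two distinct substrings of equal length of \<open>S\<close> collide.

  A query runs in phases with a guess \<open>D\<close> for the answer. A phase collects \<open>O(log N)\<close> strings of \<open>F\<close>
  of length at most \<open>D\<close> whose concatenation is the window of length \<open>D\<close> at each of the two positions,
  together with the hashes of all prefixes of the concatenation. After that, two prefixes of the
  windows are compared in time \<open>O(log D)\<close>, by a binary search for the item and a descent of
  its tree. If the windows agree, \<open>D\<close> is squared, and otherwise a binary search for the answer takes
  \<open>O((log D)\<^sup>2)\<close>. The first guess has \<open>(log D)\<^sup>2\<close> of order \<open>log N\<close>, which pays
  for the collecting, and the costs \<open>(log D)\<^sup>2\<close> of the later phases form a geometric series.
\<close>

section \<open>Words of a trie\<close>

abbreviation bit_length :: "nat \<Rightarrow> nat" where "bit_length \<equiv> floorlog 2"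

lemma bit_length_le_iff: "bit_length n \<le> b \<longleftrightarrow> n < 2 ^ b"
  by (simp add: floorlog_le_iff)

lemma less_bit_length_iff: "b < bit_length n \<longleftrightarrow> 2 ^ b \<le> n"
  using bit_length_le_iff[of n b] by linarith

lemma less_two_power_bit_length: "n < 2 ^ bit_length n"
  by (simp flip: bit_length_le_iff)

lemma bit_length_pos_iff: "0 < bit_length n \<longleftrightarrow> 0 < n"
  by (simp add: less_bit_length_iff Suc_le_eq)

definition lastn :: "nat \<Rightarrow> 'b list \<Rightarrow> 'b list" where
  "lastn L z = drop (length z - L) z"

lemma length_lastn [simp]: "length (lastn L z) = min L (length z)"
  by (simp add: lastn_def)

lemma lastn_all: "length z \<le> L \<Longrightarrow> lastn L z = z"
  by (simp add: lastn_def)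

lemma set_lastn: "set (lastn L z) \<subseteq> set z"
  by (simp add: lastn_def set_drop_subset)

lemma lastn_add: "lastn (L + M) z = lastn L (take (length z - M) z) @ lastn M z"
proof -
  have "drop (length z - (L + M)) (take (length z - M) z @ drop (length z - M) z) =
      drop (length z - M - L) (take (length z - M) z) @ drop (length z - M) z"
    unfolding drop_append by (simp add: diff_diff_eq add.commute)
  then show ?thesis by (simp add: lastn_def)
qed

inductive has_tree :: "'b list set \<Rightarrow> ('b \<Rightarrow> nat) \<Rightarrow> 'b list \<Rightarrow> nat \<Rightarrow> bool" for F g where
  leaf: "[x] \<in> F \<Longrightarrow> g x \<le> h \<Longrightarrow> has_tree F g [x] h"
| node: "has_tree F g u h \<Longrightarrow> has_tree F g v h \<Longrightarrow> u @ v \<in> F \<Longrightarrow> h < h' \<Longrightarrow> has_tree F g (u @ v) h'"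

lemma has_tree_mono: "has_tree F g u h \<Longrightarrow> h \<le> h' \<Longrightarrow> has_tree F g u h'"
  by (erule has_tree.cases) (auto intro: has_tree.intros)

lemma has_tree_subset: "has_tree F g u h \<Longrightarrow> F \<subseteq> F' \<Longrightarrow> has_tree F' g u h"
  by (induction rule: has_tree.induct) (auto intro: has_tree.intros)

lemma has_tree_nonempty: "has_tree F g u h \<Longrightarrow> u \<noteq> []"
  by (induction rule: has_tree.induct) auto

lemma has_tree_in: "has_tree F g u h \<Longrightarrow> u \<in> F"
  by (induction rule: has_tree.induct) auto

lemma has_tree_append:
  assumes "u \<noteq> [] \<Longrightarrow> has_tree F g u h" "v \<noteq> [] \<Longrightarrow> has_tree F g v h" "u @ v \<in> F" "u @ v \<noteq> []"
  shows "has_tree F g (u @ v) (Suc h)"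
proof (cases "u = [] \<or> v = []")
  case True
  then show ?thesis using assms by (auto intro: has_tree_mono)
next
  case False
  then show ?thesis using assms by (auto intro: has_tree.node)
qed

definition tree_bound :: "(nat \<Rightarrow> nat) \<Rightarrow> 'b list set \<Rightarrow> 'b list \<Rightarrow> bool" where
  "tree_bound e F u \<longleftrightarrow>
     (\<forall>g h j. (\<forall>x \<in> set u. g x \<le> h) \<longrightarrow> length u \<le> 2 ^ j \<longrightarrow> has_tree F g u (h + e j))"

lemma tree_boundI:
  "(\<And>g h j. (\<And>x. x \<in> set u \<Longrightarrow> g x \<le> h) \<Longrightarrow> length u \<le> 2 ^ j \<Longrightarrow> has_tree F g u (h + e j)) \<Longrightarrow>
    tree_bound e F u"
  unfolding tree_bound_def by blast

lemma tree_boundD: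
  "tree_bound e F u \<Longrightarrow> (\<And>x. x \<in> set u \<Longrightarrow> g x \<le> h) \<Longrightarrow> length u \<le> 2 ^ j \<Longrightarrow> has_tree F g u (h + e j)"
  unfolding tree_bound_def by blast

lemma tree_bound_mono:
  assumes "tree_bound e F u" "F \<subseteq> F'" "\<And>j. e j \<le> e' j"
  shows "tree_bound e' F' u"
proof (rule tree_boundI)
  fix g :: "'a \<Rightarrow> nat" and h j
  assume "\<And>x. x \<in> set u \<Longrightarrow> g x \<le> h" "length u \<le> 2 ^ j"
  then have "has_tree F g u (h + e j)" by (rule tree_boundD[OF assms(1)])
  then show "has_tree F' g u (h + e' j)"
    using assms(2,3) by (auto intro: has_tree_subset has_tree_mono)
qed

lemma tree_bound_nonempty: "tree_bound e F u \<Longrightarrow> u \<noteq> []"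
  using tree_boundD[of e F u "\<lambda>_. 0" 0 "length u"] has_tree_nonempty less_exp less_imp_le by blast

lemma tree_bound_append:
  assumes u: "tree_bound e F u" and v: "tree_bound e' F v" and mem: "u @ v \<in> F"
    and height: "\<And>j. length (u @ v) \<le> 2 ^ j \<Longrightarrow>
      \<exists>i i'. length u \<le> 2 ^ i \<and> length v \<le> 2 ^ i' \<and> e i < e'' j \<and> e' i' < e'' j"
  shows "tree_bound e'' F (u @ v)"
proof (rule tree_boundI)
  fix g :: "'a \<Rightarrow> nat" and h j
  assume leaves: "\<And>x. x \<in> set (u @ v) \<Longrightarrow> g x \<le> h" and len: "length (u @ v) \<le> 2 ^ j"
  obtain i i' where i: "length u \<le> 2 ^ i" "length v \<le> 2 ^ i'" "e i < e'' j" "e' i' < e'' j"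
    using height[OF len] by blast
  have "has_tree F g u (h + e i)" using leaves i(1) by (intro tree_boundD[OF u]) auto
  moreover have "has_tree F g v (h + e' i')" using leaves i(2) by (intro tree_boundD[OF v]) auto
  ultimately have "has_tree F g u (h + max (e i) (e' i'))" "has_tree F g v (h + max (e i) (e' i'))"
    by (auto elim: has_tree_mono)
  then show "has_tree F g (u @ v) (h + e'' j)" by (rule has_tree.node) (use mem i in auto)
qed

locale trie =
  fixes T :: "'b list set" and wt :: "'b \<Rightarrow> nat"
  assumes finite_T: "finite T" and Nil_T: "[] \<in> T"
    and butlast_T: "v @ [x] \<in> T \<Longrightarrow> v \<in> T"
    and wt_pos: "0 < wt x"
begin

lemma take_T: "v \<in> T \<Longrightarrow> take i v \<in> T"
proof (induction v rule: rev_induct)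
  case (snoc x v)
  then show ?case using butlast_T[OF snoc.prems] by (cases "i \<le> length v") auto
qed simp

subsection \<open>Sparse levels\<close>

text \<open>The residues are chosen greedily, the rarer extension to the next bit each time, so that
  a level has at most \<open>card T / 2 ^ k\<close> elements.\<close>

primrec residue :: "nat \<Rightarrow> nat" where
  "residue 0 = 0"
| "residue (Suc k) =
    (if 2 * card {v \<in> T. length v mod 2 ^ Suc k = residue k} \<le> card {v \<in> T. length v mod 2 ^ k = residue k}
     then residue k else residue k + 2 ^ k)"

definition level :: "nat \<Rightarrow> 'b list set" where
  "level k = {v \<in> T. length v mod 2 ^ k = residue k}"

lemma level_0 [simp]: "level 0 = T"
  by (simp add: level_def)

lemma level_subset_T: "level k \<subseteq> T"
  by (auto simp: level_def)

lemma finite_level: "finite (level k)"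
  using finite_T by (simp add: level_def)

lemma residue_less: "residue k < 2 ^ k"
  by (induction k) auto

lemma mod_Suc_power_cases:
  "n mod 2 ^ Suc k = n mod 2 ^ k \<or> n mod 2 ^ Suc k = n mod 2 ^ k + 2 ^ k" for n :: nat
proof -
  have "n mod (2 ^ k * 2) = 2 ^ k * (n div 2 ^ k mod 2) + n mod 2 ^ k" by (rule mod_mult2_eq)
  moreover have "n div 2 ^ k mod 2 = 0 \<or> n div 2 ^ k mod 2 = 1" by linarith
  ultimately show ?thesis by (auto simp: mult.commute)
qed

lemma mod_eq_iff_mod_Suc_power:
  "n mod 2 ^ k = r \<longleftrightarrow> n mod 2 ^ Suc k = r \<or> n mod 2 ^ Suc k = r + 2 ^ k"
  if "r < 2 ^ k" for n r :: nat
proof -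
  have "x = r \<longleftrightarrow> y = r \<or> y = r + m" if "y = x \<or> y = x + m" "x < m" "r < m" for x y m :: nat
    using that by auto
  from this[OF mod_Suc_power_cases _ that] show ?thesis by simp
qed

lemma level_Suc_subset: "level (Suc k) \<subseteq> level k"
proof
  fix v assume "v \<in> level (Suc k)"
  moreover have "residue (Suc k) = residue k \<or> residue (Suc k) = residue k + 2 ^ k" by simp
  ultimately show "v \<in> level k"
    using mod_eq_iff_mod_Suc_power[OF residue_less, of "length v" k] unfolding level_def by auto
qed

lemma level_antimono: "i \<le> j \<Longrightarrow> level j \<subseteq> level i"
  using level_Suc_subset by (rule lift_Suc_antimono_le)

lemma card_level_Suc: "2 * card (level (Suc k)) \<le> card (level k)"
proof -
  let ?low = "{v \<in> T. length v mod 2 ^ Suc k = residue k}"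
  let ?high = "{v \<in> T. length v mod 2 ^ Suc k = residue k + 2 ^ k}"
  have "level k = ?low \<union> ?high"
    unfolding level_def using mod_eq_iff_mod_Suc_power[OF residue_less] by blast
  moreover have "?low \<inter> ?high = {}" by auto
  ultimately have card_sum: "card (level k) = card ?low + card ?high"
    using finite_T by (simp add: card_Un_disjoint)
  show ?thesis
  proof (cases "2 * card ?low \<le> card (level k)")
    case True
    then have "level (Suc k) = ?low" by (simp add: level_def)
    with True show ?thesis by simp
  next
    case False
    then have "level (Suc k) = ?high" by (simp add: level_def)
    with False card_sum show ?thesis by simp
  qed
qed

lemma card_level: "card (level k) * 2 ^ k \<le> card T"
proof (induction k)
  case (Suc k)
  have "card (level (Suc k)) * 2 ^ Suc k = (2 * card (level (Suc k))) * 2 ^ k" by simp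
  also have "\<dots> \<le> card (level k) * 2 ^ k" using card_level_Suc by (intro mult_right_mono) auto
  finally show ?case using Suc by linarith
qed simp

lemma level_eq_empty:
  assumes "card T \<le> k" shows "level k = {}"
proof (rule ccontr)
  assume "level k \<noteq> {}"
  then have "1 \<le> card (level k)" using finite_level by (simp add: Suc_leI card_gt_0_iff)
  then have "1 * 2 ^ k \<le> card T" using card_level[of k] by (meson le_trans mult_le_mono1)
  moreover have "k < 2 ^ k" by simp
  ultimately show False using assms by linarith
qed

lemma ex_take_in_level:
  assumes "z \<in> T" "2 ^ k \<le> length z"
  shows "\<exists>L < 2 ^ k. take (length z - L) z \<in> level k"
proof -
  define d where "d = length z - residue k"
  have "length z - d mod 2 ^ k = residue k + d div 2 ^ k * 2 ^ k"
    using residue_less[of k] assms(2) div_mult_mod_eq[of d "2 ^ k"] unfolding d_def by linarith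
  then have "(length z - d mod 2 ^ k) mod 2 ^ k = residue k" using residue_less by simp
  then have "take (length z - d mod 2 ^ k) z \<in> level k" using take_T[OF assms(1)] by (simp add: level_def)
  then show ?thesis by (intro exI[of _ "d mod 2 ^ k"]) simp
qed

lemma take_in_level: "z \<in> level k \<Longrightarrow> 2 ^ k \<le> length z \<Longrightarrow> take (length z - 2 ^ k) z \<in> level k"
  by (auto simp: level_def take_T le_mod_geq)

lemma take_in_level_Suc:
  assumes z: "z \<in> level k" "z \<notin> level (Suc k)" "2 ^ k \<le> length z"
  shows "take (length z - 2 ^ k) z \<in> level (Suc k)"
proof -
  let ?n = "length z" and ?m = "2 ^ k :: nat"
  have y: "take (?n - ?m) z \<in> level k" using take_in_level[OF z(1,3)] .
  have "?n mod 2 ^ Suc k \<noteq> (?n - ?m) mod 2 ^ Suc k"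
  proof
    assume "?n mod 2 ^ Suc k = (?n - ?m) mod 2 ^ Suc k"
    then have "2 ^ Suc k dvd ?n - (?n - ?m)" by (metis diff_le_self mod_eq_dvd_iff_nat)
    then have "2 ^ Suc k dvd ?m" using z(3) by simp
    then have "(2::nat) ^ Suc k \<le> 2 ^ k" by (rule dvd_imp_le) simp
    then show False by simp
  qed
  moreover have "?n mod 2 ^ Suc k \<in> {residue k, residue k + ?m}"
      "(?n - ?m) mod 2 ^ Suc k \<in> {residue k, residue k + ?m}"
    using z(1) y mod_eq_iff_mod_Suc_power[OF residue_less] by (auto simp: level_def)
  moreover have "residue (Suc k) \<in> {residue k, residue k + ?m}" by simp
  moreover have "?n mod 2 ^ Suc k \<noteq> residue (Suc k)" using z(1,2) by (simp add: level_def)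
  ultimately have "(?n - ?m) mod 2 ^ Suc k = residue (Suc k)" by (metis insertE singletonD)
  then show ?thesis using y by (simp add: level_def)
qed

subsection \<open>Blocks and the pieces that support a suffix\<close>

definition blocks :: "'b list set" where
  "blocks = {lastn (2 ^ i) z | i z. z \<in> level i \<and> z \<noteq> []}"

lemma lastn_in_blocks: "z \<in> level i \<Longrightarrow> z \<noteq> [] \<Longrightarrow> lastn (2 ^ i) z \<in> blocks"
  by (auto simp: blocks_def)

lemma tree_bound_lastn_power:
  "z \<in> level i \<Longrightarrow> z \<noteq> [] \<Longrightarrow> tree_bound (\<lambda>j. j) blocks (lastn (2 ^ i) z)"
proof (induction i arbitrary: z)
  case 0
  then obtain y x where z: "z = y @ [x]" by (metis rev_exhaust)
  then have "[x] \<in> blocks" using lastn_in_blocks[OF 0] by (simp add: lastn_def)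
  then show ?case by (intro tree_boundI) (auto simp: z lastn_def intro: has_tree.leaf)
next
  case (Suc i)
  have z: "z \<in> level i" using Suc.prems level_Suc_subset by blast
  show ?case
  proof (cases "length z \<le> 2 ^ i")
    case True
    then show ?thesis using Suc.IH[OF z Suc.prems(2)] by (simp add: lastn_all)
  next
    case False
    define y where "y = take (length z - 2 ^ i) z"
    have y: "y \<in> level i" "y \<noteq> []" using take_in_level[OF z] False by (auto simp: y_def)
    have split: "lastn (2 ^ Suc i) z = lastn (2 ^ i) y @ lastn (2 ^ i) z"
      using lastn_add[of "2 ^ i" "2 ^ i" z] by (simp add: y_def mult_2)
    show ?thesis unfolding split
    proof (rule tree_bound_append[OF Suc.IH[OF y] Suc.IH[OF z Suc.prems(2)]])
      show "lastn (2 ^ i) y @ lastn (2 ^ i) z \<in> blocks" using lastn_in_blocks[OF Suc.prems] split by simp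
    next
      fix j assume "length (lastn (2 ^ i) y @ lastn (2 ^ i) z) \<le> 2 ^ j"
      moreover have "0 < length (lastn (2 ^ i) y)" "length (lastn (2 ^ i) z) = 2 ^ i" using y False by auto
      ultimately have "(2::nat) ^ i < 2 ^ j" unfolding length_append by linarith
      then show "\<exists>k l. length (lastn (2 ^ i) y) \<le> 2 ^ k \<and> length (lastn (2 ^ i) z) \<le> 2 ^ l \<and> k < j \<and> l < j"
        by (intro exI[of _ i]) simp
    qed
  qed
qed

lemma tree_bound_block: "u \<in> blocks \<Longrightarrow> tree_bound (\<lambda>j. j) blocks u"
  using tree_bound_lastn_power unfolding blocks_def by blast

definition supports :: "nat \<Rightarrow> (nat \<Rightarrow> nat) \<Rightarrow> 'b list \<Rightarrow> 'b list set \<Rightarrow> bool" where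
  "supports n e u E \<longleftrightarrow> finite E \<and> card E \<le> n \<and> u \<in> blocks \<union> E \<and> (\<forall>x \<in> E. tree_bound e (blocks \<union> E) x)"

lemma supports_tree_bound:
  assumes "supports n e u E" "\<And>j. j \<le> e j" "blocks \<union> E \<subseteq> F" shows "tree_bound e F u"
  using assms tree_bound_mono[OF tree_bound_block] tree_bound_mono[where e = e and e' = e]
  unfolding supports_def by (meson Un_iff le_sup_iff order_refl)

lemma supports_mono: "supports n e u E \<Longrightarrow> n \<le> n' \<Longrightarrow> (\<And>j. e j \<le> e' j) \<Longrightarrow> supports n' e' u E"
  unfolding supports_def by (auto intro: tree_bound_mono)

lemma supports_insert:
  assumes "supports n e u E" "tree_bound e (blocks \<union> insert x E) x"
  shows "supports (Suc n) e x (insert x E)"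
  unfolding supports_def
proof (intro conjI ballI)
  fix y assume "y \<in> insert x E"
  then consider "y = x" | "tree_bound e (blocks \<union> E) y" using assms(1) by (auto simp: supports_def)
  then show "tree_bound e (blocks \<union> insert x E) y"
    by cases (use assms(2) in \<open>auto elim: tree_bound_mono\<close>)
qed (use assms(1) in \<open>auto simp: supports_def card_insert_if\<close>)

lemma lastn_append_block:
  assumes "2 ^ i < L" "L \<le> length z"
  defines "y \<equiv> take (length z - 2 ^ i) z"
  shows "lastn L z = lastn (L - 2 ^ i) y @ lastn (2 ^ i) z" "length (lastn (L - 2 ^ i) y) = L - 2 ^ i"
    "length (lastn (2 ^ i) z) = 2 ^ i"
  using lastn_add[of "L - 2 ^ i" "2 ^ i" z] assms by auto

lemma ex_supports_aligned:
  assumes "z \<in> level i" "0 < L" "L \<le> 2 ^ i" "L \<le> length z"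
  shows "\<exists>E. supports i (\<lambda>j. j) (lastn L z) E"
  using assms
proof (induction i arbitrary: z L)
  case 0
  then have "L = 2 ^ 0" "z \<noteq> []" by auto
  then have "lastn L z \<in> blocks" using lastn_in_blocks[OF 0(1)] by simp
  then show ?case by (intro exI[of _ "{}"]) (simp add: supports_def)
next
  case (Suc i)
  have z: "z \<in> level i" using Suc.prems level_Suc_subset by blast
  show ?case
  proof (cases "L \<le> 2 ^ i")
    case True
    then show ?thesis using Suc.IH[OF z Suc.prems(2) True Suc.prems(4)]
      by (meson le_SucI supports_mono order_refl)
  next
    case False
    define y where "y = take (length z - 2 ^ i) z"
    have split: "lastn L z = lastn (L - 2 ^ i) y @ lastn (2 ^ i) z"
      and len: "length (lastn (L - 2 ^ i) y) = L - 2 ^ i" "length (lastn (2 ^ i) z) = 2 ^ i"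
      using lastn_append_block[of i L z] False Suc.prems(4) unfolding y_def by auto
    have y: "y \<in> level i" "L - 2 ^ i \<le> length y"
      using take_in_level[OF z] False Suc.prems(4) by (auto simp: y_def)
    have "0 < L - 2 ^ i" "L - 2 ^ i \<le> 2 ^ i" using False Suc.prems(3) by auto
    from Suc.IH[OF y(1) this y(2)] obtain E where E: "supports i (\<lambda>j. j) (lastn (L - 2 ^ i) y) E"
      by blast
    have block: "tree_bound (\<lambda>j. j) blocks (lastn (2 ^ i) z)"
      using z Suc.prems by (intro tree_bound_lastn_power) auto
    have "tree_bound (\<lambda>j. j) (blocks \<union> insert (lastn L z) E) (lastn (L - 2 ^ i) y @ lastn (2 ^ i) z)"
    proof (rule tree_bound_append[OF supports_tree_bound[OF E] tree_bound_mono[OF block]])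
      fix j assume "length (lastn (L - 2 ^ i) y @ lastn (2 ^ i) z) \<le> 2 ^ j"
      then have "(2::nat) ^ i < 2 ^ j" unfolding length_append len using False by linarith
      then show "\<exists>k l. length (lastn (L - 2 ^ i) y) \<le> 2 ^ k \<and> length (lastn (2 ^ i) z) \<le> 2 ^ l \<and> k < j \<and> l < j"
        using len Suc.prems(3) by (intro exI[of _ i]) simp
    qed (use split in auto)
    then show ?thesis using supports_insert[OF E] split by (intro exI) simp
  qed
qed

definition supported_from :: "nat \<Rightarrow> nat \<Rightarrow> 'b list \<Rightarrow> 'b list set \<Rightarrow> bool" where
  "supported_from i k u E \<longleftrightarrow>
     supports (2 * k - i) (\<lambda>j. 2 * j + 1) u E \<and> tree_bound (\<lambda>j. j + (j - i) + 1) (blocks \<union> E) u"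

lemma supported_from_aligned:
  assumes "supports i (\<lambda>j. j) u E" "i \<le> k" shows "supported_from i k u E"
  unfolding supported_from_def
proof
  show "supports (2 * k - i) (\<lambda>j. 2 * j + 1) u E"
    using assms(1) by (rule supports_mono) (use assms(2) in auto)
  have "tree_bound (\<lambda>j. j) (blocks \<union> E) u" using assms(1) by (rule supports_tree_bound) auto
  then show "tree_bound (\<lambda>j. j + (j - i) + 1) (blocks \<union> E) u" by (rule tree_bound_mono) auto
qed

lemma supported_from_Suc: "supported_from (Suc i) k u E \<Longrightarrow> supported_from i k u E"
  unfolding supported_from_def by (auto elim!: supports_mono tree_bound_mono)

lemma supported_from_append:
  assumes E: "supported_from (Suc i) k u E" and block: "tree_bound (\<lambda>j. j) blocks v"
    and len: "0 < length u" "length v = 2 ^ i" and "i < k"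
  shows "supported_from i k (u @ v) (insert (u @ v) E)"
proof -
  have u: "tree_bound (\<lambda>j. j + (j - Suc i) + 1) (blocks \<union> E) u" using E by (simp add: supported_from_def)
  have bound: "tree_bound (\<lambda>j. j + (j - i) + 1) (blocks \<union> insert (u @ v) E) (u @ v)"
  proof (rule tree_bound_append[OF tree_bound_mono[OF u] tree_bound_mono[OF block]])
    fix j assume j: "length (u @ v) \<le> 2 ^ j"
    then have "(2::nat) ^ i < 2 ^ j" unfolding length_append using len by linarith
    then have "i < j" by simp
    then show "\<exists>l l'. length u \<le> 2 ^ l \<and> length v \<le> 2 ^ l' \<and>
        l + (l - Suc i) + 1 < j + (j - i) + 1 \<and> l' < j + (j - i) + 1"
      using j len by (intro exI[of _ j] exI[of _ i]) auto
  qed auto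
  have "tree_bound (\<lambda>j. 2 * j + 1) (blocks \<union> insert (u @ v) E) (u @ v)"
    using bound by (rule tree_bound_mono) auto
  with E have "supports (Suc (2 * k - Suc i)) (\<lambda>j. 2 * j + 1) (u @ v) (insert (u @ v) E)"
    by (auto simp: supported_from_def intro: supports_insert)
  moreover have "Suc (2 * k - Suc i) \<le> 2 * k - i" using \<open>i < k\<close> by simp
  ultimately show ?thesis using bound unfolding supported_from_def by (blast intro: supports_mono)
qed

lemma ex_supported_from_level:
  assumes "i \<le> k" "p \<in> level i" "0 < L" "L \<le> length p" "L \<le> 2 ^ k"
  shows "\<exists>E. supported_from i k (lastn L p) E"
  using assms
proof (induction "k - i" arbitrary: i p L)
  case 0
  then show ?case using ex_supports_aligned[of p i L] supported_from_aligned by fastforce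
next
  case (Suc n)
  then have n: "n = k - Suc i" "Suc i \<le> k" by auto
  consider (short) "L \<le> 2 ^ i" | (deeper) "p \<in> level (Suc i)" | (split) "2 ^ i < L" "p \<notin> level (Suc i)"
    by linarith
  then show ?case
  proof cases
    case short
    then show ?thesis using ex_supports_aligned[of p i L] supported_from_aligned Suc.prems by blast
  next
    case deeper
    from Suc.hyps(1)[OF n this Suc.prems(3-5)] show ?thesis using supported_from_Suc by blast
  next
    case split
    define y where "y = take (length p - 2 ^ i) p"
    have lastn: "lastn L p = lastn (L - 2 ^ i) y @ lastn (2 ^ i) p"
      and len: "length (lastn (L - 2 ^ i) y) = L - 2 ^ i" "length (lastn (2 ^ i) p) = 2 ^ i"
      using lastn_append_block[of i L p] split(1) Suc.prems(4) unfolding y_def by auto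
    have y: "y \<in> level (Suc i)" "0 < L - 2 ^ i" "L - 2 ^ i \<le> length y" "L - 2 ^ i \<le> 2 ^ k"
      using take_in_level_Suc[OF Suc.prems(2) split(2)] split(1) Suc.prems(4,5) by (auto simp: y_def)
    from Suc.hyps(1)[OF n y] obtain E where "supported_from (Suc i) k (lastn (L - 2 ^ i) y) E" by blast
    moreover have "tree_bound (\<lambda>j. j) blocks (lastn (2 ^ i) p)"
      using Suc.prems split(1) by (intro tree_bound_lastn_power) auto
    ultimately show ?thesis unfolding lastn using supported_from_append len y(2) n(2) by (metis Suc_le_eq)
  qed
qed

definition hops :: "'b list \<Rightarrow> nat \<Rightarrow> nat \<Rightarrow> 'b list set" where
  "hops p L k = (if p \<in> T \<and> 0 < L \<and> L \<le> length p \<and> L \<le> 2 ^ k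
     then (SOME E. supports (2 * k) (\<lambda>j. 2 * j + 1) (lastn L p) E) else {})"

lemma supports_hops:
  assumes "p \<in> T" "0 < L" "L \<le> length p" "L \<le> 2 ^ k"
  shows "supports (2 * k) (\<lambda>j. 2 * j + 1) (lastn L p) (hops p L k)"
proof -
  have "\<exists>E. supports (2 * k) (\<lambda>j. 2 * j + 1) (lastn L p) E"
    using ex_supported_from_level[of 0 k p L] assms by (auto simp: supported_from_def)
  then show ?thesis using assms by (simp add: hops_def someI_ex)
qed

lemma finite_hops: "finite (hops p L k)" and card_hops: "card (hops p L k) \<le> 2 * k"
  and tree_bound_hops: "u \<in> hops p L k \<Longrightarrow> tree_bound (\<lambda>j. 2 * j + 1) (blocks \<union> hops p L k) u"
proof -
  have "hops p L k = {} \<or> supports (2 * k) (\<lambda>j. 2 * j + 1) (lastn L p) (hops p L k)"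
    using supports_hops unfolding hops_def by presburger
  then show "finite (hops p L k)" "card (hops p L k) \<le> 2 * k"
    "u \<in> hops p L k \<Longrightarrow> tree_bound (\<lambda>j. 2 * j + 1) (blocks \<union> hops p L k) u"
    by (auto simp: supports_def)
qed

subsection \<open>Cells of prefix weights\<close>

definition weight :: "'b list \<Rightarrow> nat" where "weight u = sum_list (map wt u)"

lemma weight_Nil [simp]: "weight [] = 0" and weight_append [simp]: "weight (u @ v) = weight u + weight v"
  and weight_Cons [simp]: "weight (x # v) = wt x + weight v"
  by (simp_all add: weight_def)

lemma length_le_weight: "length u \<le> weight u"
proof (induction u)
  case (Cons x u)
  then show ?case using wt_pos[of x] by simp
qed simp

lemma weight_eq_0 [simp]: "weight u = 0 \<longleftrightarrow> u = []"
  using length_le_weight[of u] by (cases u) (use wt_pos in auto)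

lemma wt_le_weight: "x \<in> set u \<Longrightarrow> wt x \<le> weight u"
  by (simp add: weight_def member_le_sum_list)

lemma weight_take_drop: "weight (take i v) + weight (drop i v) = weight v"
  by (metis weight_append append_take_drop_id)

lemma weight_take_le: "weight (take i v) \<le> weight v"
  using weight_take_drop[of i v] by linarith

lemma weight_take_mono: "i \<le> j \<Longrightarrow> weight (take i v) \<le> weight (take j v)"
  using weight_take_le[of i "take j v"] by (simp add: min_def split: if_splits)

lemma weight_take_less: "i < length v \<Longrightarrow> weight (take i v) < weight v"
  using weight_take_drop[of i v] weight_eq_0[of "drop i v"] by (simp del: weight_eq_0)

definition rank :: "'b list \<Rightarrow> nat" where "rank v = bit_length (weight v)"

lemma rank_take: "rank (take i v) \<le> rank v"
  by (simp add: rank_def floorlog_mono weight_take_le)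

text \<open>The weights are divided into cells of length \<open>2 ^ r\<close>; \<open>last_cell r v\<close> is the part of \<open>v\<close> whose
  prefix weights lie in the last one.\<close>

definition cell_start :: "nat \<Rightarrow> 'b list \<Rightarrow> nat" where
  "cell_start r v = (LEAST i. weight (take i v) div 2 ^ r = weight v div 2 ^ r)"

definition last_cell :: "nat \<Rightarrow> 'b list \<Rightarrow> 'b list" where "last_cell r v = drop (cell_start r v) v"

lemma cell_start_le: "weight (take i v) div 2 ^ r = weight v div 2 ^ r \<Longrightarrow> cell_start r v \<le> i"
  unfolding cell_start_def by (rule Least_le)

lemma cell_start_le_length: "cell_start r v \<le> length v"
  by (rule cell_start_le) simp

lemma weight_take_cell_start: "weight (take (cell_start r v) v) div 2 ^ r = weight v div 2 ^ r"
  unfolding cell_start_def by (rule LeastI[of _ "length v"]) simp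

lemma same_cell_after_start:
  "cell_start r v \<le> i \<Longrightarrow> weight (take i v) div 2 ^ r = weight v div 2 ^ r"
  using div_le_mono[OF weight_take_mono[of "cell_start r v" i v], of "2 ^ r"]
    div_le_mono[OF weight_take_le[of i v], of "2 ^ r"] weight_take_cell_start[of r v] by simp

lemma smaller_cell_before_start:
  "i < cell_start r v \<Longrightarrow> weight (take i v) div 2 ^ r < weight v div 2 ^ r"
  using not_less_Least[of i "\<lambda>i. weight (take i v) div 2 ^ r = weight v div 2 ^ r"]
    div_le_mono[OF weight_take_le[of i v], of "2 ^ r"] unfolding cell_start_def by fastforce

lemma cell_start_equality:
  assumes "weight (take s v) div 2 ^ r = weight v div 2 ^ r"
    "\<And>i. i < s \<Longrightarrow> weight (take i v) div 2 ^ r \<noteq> weight v div 2 ^ r"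
  shows "cell_start r v = s"
  unfolding cell_start_def using assms by (intro Least_equality) (auto simp: not_less[symmetric])

lemma cell_start_take:
  assumes "cell_start r v \<le> i" "i \<le> length v"
  shows "cell_start r (take i v) = cell_start r v"
proof (rule cell_start_equality)
  show "weight (take (cell_start r v) (take i v)) div 2 ^ r = weight (take i v) div 2 ^ r"
    using assms same_cell_after_start[OF assms(1)] weight_take_cell_start[of r v] by (simp add: min_def)
next
  fix j assume "j < cell_start r v"
  then show "weight (take j (take i v)) div 2 ^ r \<noteq> weight (take i v) div 2 ^ r"
    using assms same_cell_after_start[OF assms(1)] smaller_cell_before_start[of j r v] by (simp add: min_def)
qed

lemma last_cell_take:
  assumes "cell_start r v \<le> i" "i \<le> length v"
  shows "last_cell r v = last_cell r (take i v) @ drop i v"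
  using assms cell_start_take[OF assms] unfolding last_cell_def
  by (metis (no_types, lifting) append_take_drop_id drop_append length_take min.absorb2
      diff_is_0_eq drop0)

lemma div_power_eq_mono: "x div 2 ^ r = y div 2 ^ r \<Longrightarrow> r \<le> t \<Longrightarrow> x div 2 ^ t = y div (2 ^ t :: nat)"
  by (metis div_mult2_eq le_add_diff_inverse power_add)

lemma cell_start_antimono: "r \<le> t \<Longrightarrow> cell_start t v \<le> cell_start r v"
  by (rule cell_start_le) (rule div_power_eq_mono[OF weight_take_cell_start])

lemma cell_start_eq_0: "rank v \<le> r \<Longrightarrow> cell_start r v = 0"
  by (rule cell_start_equality) (auto simp: rank_def bit_length_le_iff)

lemma last_cell_rank [simp]: "last_cell (rank v) v = v"
  by (simp add: last_cell_def cell_start_eq_0)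

lemma last_cell_0 [simp]: "last_cell 0 v = []"
  using weight_take_cell_start[of 0 v] weight_take_less[of "cell_start 0 v" v]
  by (auto simp: last_cell_def not_le[symmetric])

lemma last_cell_eq_Nil_iff: "last_cell r v = [] \<longleftrightarrow> length v \<le> cell_start r v"
  by (simp add: last_cell_def)

lemma weight_before_last_cell: "weight (take (cell_start r v) v) + weight (last_cell r v) = weight v"
  by (simp add: last_cell_def weight_take_drop)

lemma less_add_if_div_eq:
  "x div m = y div m \<Longrightarrow> 0 < m \<Longrightarrow> y < x + m" for x y m :: nat
  by (metis add.commute add_less_le_mono div_mult_mod_eq mod_less_divisor mult.commute
      times_div_less_eq_dividend)

lemma weight_last_cell_less: "weight (last_cell r v) < 2 ^ r"
  using less_add_if_div_eq[OF weight_take_cell_start[of r v]] weight_before_last_cell[of r v] by simp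

lemma set_last_cell: "set (last_cell r v) \<subseteq> set v"
  by (simp add: last_cell_def set_drop_subset)

lemma bit_length_wt_last_cell: "x \<in> set (last_cell r v) \<Longrightarrow> bit_length (wt x) \<le> r"
  using wt_le_weight[of x "last_cell r v"] weight_last_cell_less[of r v] by (simp add: bit_length_le_iff)

lemma rank_eq_if_same_cell:
  assumes "weight q \<le> weight v" "weight q div 2 ^ r = weight v div 2 ^ r" "r < rank v"
  shows "rank q = rank v"
proof (rule antisym)
  show "rank q \<le> rank v" using assms(1) by (simp add: rank_def floorlog_mono)
  define t where "t = rank v - 1"
  have t: "r \<le> t" "rank v = Suc t" using assms(3) by (auto simp: t_def)
  then have "2 ^ t \<le> weight v" by (simp add: rank_def flip: less_bit_length_iff)
  then have "0 < weight v div 2 ^ t" by (simp add: div_greater_zero_iff)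
  then have "0 < weight q div 2 ^ t" using div_power_eq_mono[OF assms(2) t(1)] by simp
  then have "2 ^ t \<le> weight q" by (simp add: div_greater_zero_iff)
  then show "rank v \<le> rank q" unfolding t(2) by (simp add: rank_def Suc_le_eq less_bit_length_iff)
qed

subsection \<open>Splitting a cell into its halves\<close>

definition splits :: "nat \<Rightarrow> 'b list \<Rightarrow> bool" where
  "splits s v \<longleftrightarrow> cell_start (Suc s) v < cell_start s v"

definition before_cell :: "nat \<Rightarrow> 'b list \<Rightarrow> 'b list" where
  "before_cell s v = take (cell_start s v - 1) v"

definition cut_letter :: "nat \<Rightarrow> 'b list \<Rightarrow> 'b" where
  "cut_letter s v = v ! (cell_start s v - 1)"

definition halves :: "nat \<Rightarrow> 'b list \<Rightarrow> 'b list set" where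
  "halves s v = (if splits s v then {v, before_cell s v} else {v})"

lemma self_in_halves [simp]: "v \<in> halves s v"
  by (simp add: halves_def)

lemma last_cell_no_split:
  assumes "\<not> splits s v"
  shows "cell_start s v = cell_start (Suc s) v" "last_cell (Suc s) v = last_cell s v"
  using assms cell_start_antimono[of s "Suc s" v] by (auto simp: splits_def last_cell_def)

lemma cell_start_before_cell:
  assumes "splits s v"
  shows "cell_start s (before_cell s v) = cell_start (Suc s) v"
proof -
  let ?S = "cell_start (Suc s) v" and ?i = "cell_start s v - 1" and ?b = "weight v div 2 ^ s"
  have i: "?S \<le> ?i" "?i < cell_start s v" using assms by (auto simp: splits_def)
  have div_Suc: "x div 2 ^ Suc s = x div 2 ^ s div 2" for x :: nat by (metis div_mult2_eq power_Suc2)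
  have cell: "weight (take j v) div 2 ^ s = ?b - 1" if "?S \<le> j" "j < cell_start s v" for j
  proof -
    have "weight (take j v) div 2 ^ s < ?b" using smaller_cell_before_start that by blast
    moreover have "weight (take j v) div 2 ^ s div 2 = ?b div 2"
      using same_cell_after_start[OF that(1)] unfolding div_Suc .
    ultimately show ?thesis by linarith
  qed
  show ?thesis
  proof (rule cell_start_equality)
    show "weight (take ?S (before_cell s v)) div 2 ^ s = weight (before_cell s v) div 2 ^ s"
      using cell[of ?S] cell[of ?i] i by (simp add: before_cell_def min_def)
  next
    fix j assume j: "j < ?S"
    then have "weight (take j v) div 2 ^ Suc s \<noteq> weight (take ?i v) div 2 ^ Suc s"
      using smaller_cell_before_start[OF j] same_cell_after_start[of "Suc s" v ?i] i by simp
    then show "weight (take j (before_cell s v)) div 2 ^ s \<noteq> weight (before_cell s v) div 2 ^ s"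
      using j i unfolding div_Suc by (auto simp: before_cell_def min_def)
  qed
qed

lemma last_cell_split:
  assumes "splits s v"
  shows "last_cell (Suc s) v = (last_cell s (before_cell s v) @ [cut_letter s v]) @ last_cell s v"
proof -
  let ?S = "cell_start (Suc s) v" and ?i = "cell_start s v - 1"
  have i: "?S \<le> ?i" "Suc ?i = cell_start s v" "?i < length v"
    using assms cell_start_le_length[of s v] by (auto simp: splits_def)
  have "drop ?S v = drop ?S (take ?i v @ [v ! ?i] @ drop (Suc ?i) v)"
    using id_take_nth_drop[OF i(3)] by simp
  also have "\<dots> = drop ?S (take ?i v) @ [v ! ?i] @ drop (Suc ?i) v" using i by simp
  finally show ?thesis
    unfolding last_cell_def cell_start_before_cell[OF assms] i(2) cut_letter_def
    by (simp add: before_cell_def)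
qed

lemma cut_letter_in:
  assumes "splits s v" shows "cut_letter s v \<in> set v" "cut_letter s v \<in> set (last_cell (Suc s) v)"
  using set_last_cell[of "Suc s" v] last_cell_split[OF assms] by auto

lemma halvesD:
  assumes "z \<in> halves s v"
  shows "cell_start (Suc s) v \<le> cell_start s z" "set (last_cell s z) \<subseteq> set (last_cell (Suc s) v)"
    "weight (last_cell s z) \<le> weight (last_cell (Suc s) v)" "\<exists>i. z = take i v"
proof -
  consider "z = v" | "splits s v" "z = before_cell s v"
    using assms by (auto simp: halves_def split: if_splits)
  then have "cell_start (Suc s) v \<le> cell_start s z \<and> set (last_cell s z) \<subseteq> set (last_cell (Suc s) v) \<and>
    weight (last_cell s z) \<le> weight (last_cell (Suc s) v) \<and> (\<exists>i. z = take i v)"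
  proof cases
    case 1
    then show ?thesis
      using cell_start_antimono[of s "Suc s" v] last_cell_split[of s v] last_cell_no_split(2)[of s v]
      by (cases "splits s v") (auto intro: exI[of _ "length v"])
  next
    case 2
    then show ?thesis using cell_start_before_cell[OF 2(1)] last_cell_split[OF 2(1)]
      by (auto simp: before_cell_def)
  qed
  then show "cell_start (Suc s) v \<le> cell_start s z" "set (last_cell s z) \<subseteq> set (last_cell (Suc s) v)"
    "weight (last_cell s z) \<le> weight (last_cell (Suc s) v)" "\<exists>i. z = take i v" by blast+
qed

lemma positive_level_if_no_split:
  assumes "\<not> splits s v" "rank v = Suc s + k" shows "0 < k"
proof (rule ccontr)
  assume "\<not> 0 < k"
  then have rank: "rank v = Suc s" using assms by simp
  then have "cell_start s v = 0" using last_cell_no_split(1)[OF assms(1)] cell_start_eq_0 by simp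
  then have "weight v div 2 ^ s = 0" using weight_take_cell_start[of s v] by simp
  then have "weight v < 2 ^ s" by (simp add: div_eq_0_iff)
  then have "rank v \<le> s" by (simp add: rank_def bit_length_le_iff)
  then show False using rank by simp
qed

subsection \<open>The stored pieces\<close>

definition hop_length :: "nat \<Rightarrow> nat \<Rightarrow> 'b list \<Rightarrow> nat" where
  "hop_length s k z = (if length (last_cell s z) \<le> 2 ^ k then length (last_cell s z)
     else (SOME L. L < 2 ^ k \<and> take (length z - L) z \<in> level k))"

definition cell_pieces :: "nat \<Rightarrow> nat \<Rightarrow> 'b list \<Rightarrow> 'b list set" where
  "cell_pieces s k v =
     {last_cell (Suc s) v} \<union> (if splits s v then {last_cell s (before_cell s v) @ [cut_letter s v]} else {}) \<union>
     (\<Union>z \<in> halves s v. insert (last_cell s z) (hops z (hop_length s k z) k))"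

definition pieces_at :: "nat \<Rightarrow> 'b list \<Rightarrow> 'b list set" where
  "pieces_at k v =
     insert (lastn (2 ^ k) v) (if k < rank v then cell_pieces (rank v - Suc k) (Suc k) v else {})"

definition pieces :: "'b list set" where "pieces = (\<Union>k. \<Union>v \<in> level k. pieces_at k v) - {[]}"

lemma finite_cell_pieces: "finite (cell_pieces s k v)"
  by (auto simp: cell_pieces_def halves_def finite_hops)

lemma card_cell_pieces: "card (cell_pieces s k v) \<le> 4 * k + 4"
proof -
  have insert_hops: "card (insert (last_cell s z) (hops z (hop_length s k z) k)) \<le> 2 * k + 1" for z
    using card_hops[of z "hop_length s k z" k] finite_hops by (simp add: card_insert_if)
  have halves: "finite (halves s v)" "card (halves s v) \<le> 2" by (auto simp: halves_def card_insert_if)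
  have "card (\<Union>z \<in> halves s v. insert (last_cell s z) (hops z (hop_length s k z) k)) \<le>
      (\<Sum>z \<in> halves s v. card (insert (last_cell s z) (hops z (hop_length s k z) k)))"
    by (rule card_UN_le[OF halves(1)])
  also have "\<dots> \<le> card (halves s v) * (2 * k + 1)"
    using sum_bounded_above[of "halves s v" _ "2 * k + 1"] insert_hops by simp
  also have "\<dots> \<le> 2 * (2 * k + 1)" using halves(2) by (rule mult_right_mono) simp
  finally have "card (\<Union>z \<in> halves s v. insert (last_cell s z) (hops z (hop_length s k z) k)) \<le> 4 * k + 2"
    by simp
  moreover have "card ({last_cell (Suc s) v} \<union>
      (if splits s v then {last_cell s (before_cell s v) @ [cut_letter s v]} else {})) \<le> 2"
    by (simp add: card_insert_if)
  ultimately show ?thesis unfolding cell_pieces_def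
    by (intro le_trans[OF card_Un_le]) linarith
qed

lemma finite_pieces_at: "finite (pieces_at k v)"
  by (simp add: pieces_at_def finite_cell_pieces)

lemma card_pieces_at: "card (pieces_at k v) \<le> 4 * k + 9"
  using card_cell_pieces[of "rank v - Suc k" "Suc k" v]
  by (simp add: pieces_at_def finite_cell_pieces card_insert_if)

lemma sum_level_sizes: "(\<Sum>k<K. (4 * real k + 9) / 2 ^ k) = 26 - (8 * real K + 26) / 2 ^ K"
proof (induction K)
  case (Suc K)
  have "(\<Sum>k<Suc K. (4 * real k + 9) / 2 ^ k) = 26 - (8 * real K + 26) / 2 ^ K + (4 * real K + 9) / 2 ^ K"
    by (simp add: Suc)
  also have "\<dots> = 26 - (8 * real (Suc K) + 26) / 2 ^ Suc K" by (simp add: field_simps)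
  finally show ?case .
qed simp

lemma pieces_bounded_levels: "pieces = (\<Union>k<card T. \<Union>v \<in> level k. pieces_at k v) - {[]}"
proof -
  have "k < card T" if "v \<in> level k" for k v using level_eq_empty[of k] that by (cases "k < card T") auto
  then show ?thesis unfolding pieces_def by blast
qed

lemma finite_pieces: "finite pieces"
  unfolding pieces_bounded_levels by (simp add: finite_level finite_pieces_at)

lemma card_level_pieces: "real (card (\<Union>v \<in> level k. pieces_at k v)) \<le> real (card T) * ((4 * real k + 9) / 2 ^ k)"
proof -
  have "card (\<Union>v \<in> level k. pieces_at k v) \<le> (\<Sum>v\<in>level k. card (pieces_at k v))"
    by (rule card_UN_le[OF finite_level])
  also have "\<dots> \<le> card (level k) * (4 * k + 9)"
    using sum_bounded_above[of "level k" "\<lambda>v. card (pieces_at k v)" "4 * k + 9"] card_pieces_at by simp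
  finally have "real (card (\<Union>v \<in> level k. pieces_at k v)) \<le> real (card (level k) * (4 * k + 9))"
    by (rule of_nat_mono)
  also have "real (card (level k) * 2 ^ k) \<le> real (card T)" using card_level by (rule of_nat_mono)
  then have "real (card (level k)) \<le> real (card T) / 2 ^ k" by (simp add: field_simps)
  then have "real (card (level k)) * real (4 * k + 9) \<le> real (card T) / 2 ^ k * real (4 * k + 9)"
    by (rule mult_right_mono) simp
  then have "real (card (level k) * (4 * k + 9)) \<le> real (card T) * ((4 * real k + 9) / 2 ^ k)" by simp
  finally show ?thesis .
qed

lemma card_pieces: "card pieces \<le> 26 * card T"
proof -
  let ?U = "\<Union>k<card T. \<Union>v \<in> level k. pieces_at k v"
  have "card pieces \<le> card ?U" unfolding pieces_bounded_levels
    by (rule card_mono) (auto simp: finite_level finite_pieces_at)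
  also have "\<dots> \<le> (\<Sum>k<card T. card (\<Union>v \<in> level k. pieces_at k v))" by (rule card_UN_le) simp
  finally have "real (card pieces) \<le> (\<Sum>k<card T. real (card (\<Union>v \<in> level k. pieces_at k v)))"
    by (simp flip: of_nat_sum)
  also have "\<dots> \<le> (\<Sum>k<card T. real (card T) * ((4 * real k + 9) / 2 ^ k))"
    by (intro sum_mono card_level_pieces)
  also have "\<dots> = real (card T) * (26 - (8 * real (card T) + 26) / 2 ^ card T)"
    by (simp only: sum_distrib_left[symmetric] sum_level_sizes)
  also have "\<dots> \<le> real (card T) * 26" by (intro mult_left_mono) auto
  finally show ?thesis by linarith
qed

lemma pieces_at_subset_pieces: "v \<in> level k \<Longrightarrow> pieces_at k v - {[]} \<subseteq> pieces"
  unfolding pieces_def by blast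

lemma blocks_subset_pieces: "blocks \<subseteq> pieces"
proof
  fix u assume "u \<in> blocks"
  then obtain i z where z: "z \<in> level i" "z \<noteq> []" "u = lastn (2 ^ i) z" unfolding blocks_def by blast
  then have "u \<in> pieces_at i z" "length u \<noteq> 0" by (auto simp: pieces_at_def)
  then show "u \<in> pieces" using pieces_at_subset_pieces[OF z(1)] by auto
qed

lemma letter_in_pieces:
  assumes "v \<in> T" "x \<in> set v" shows "[x] \<in> pieces"
proof -
  obtain i where i: "i < length v" "v ! i = x" using assms(2) by (auto simp: in_set_conv_nth)
  then have "lastn (2 ^ 0) (take (Suc i) v) = [x]" by (simp add: lastn_def take_Suc_conv_app_nth)
  moreover have "take (Suc i) v \<in> level 0" "take (Suc i) v \<noteq> []" using assms(1) i take_T by auto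
  ultimately have "[x] \<in> blocks" using lastn_in_blocks by metis
  then show ?thesis using blocks_subset_pieces by blast
qed

lemma cell_pieces_subset_pieces:
  assumes "v \<in> level k" "rank v = Suc s + k"
  shows "cell_pieces s (Suc k) v - {[]} \<subseteq> pieces"
  using pieces_at_subset_pieces[OF assms(1)] assms(2) by (auto simp: pieces_at_def)

lemma cell_in_pieces:
  assumes "v \<in> level k" "rank v = Suc s + k"
  shows "last_cell (Suc s) v \<noteq> [] \<Longrightarrow> last_cell (Suc s) v \<in> pieces"
    and "splits s v \<Longrightarrow> last_cell s (before_cell s v) @ [cut_letter s v] \<in> pieces"
    and "z \<in> halves s v \<Longrightarrow> last_cell s z \<noteq> [] \<Longrightarrow> last_cell s z \<in> pieces"
  by (rule subsetD[OF cell_pieces_subset_pieces[OF assms]]; auto simp: cell_pieces_def)+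

lemma hops_subset_pieces:
  assumes "v \<in> level k" "rank v = Suc s + k" "z \<in> halves s v"
  shows "hops z (hop_length s (Suc k) z) (Suc k) \<subseteq> pieces"
proof
  fix u assume u: "u \<in> hops z (hop_length s (Suc k) z) (Suc k)"
  then have "u \<noteq> []" using tree_bound_nonempty[OF tree_bound_hops] by blast
  moreover have "u \<in> cell_pieces s (Suc k) v" using u assms(3) by (auto simp: cell_pieces_def)
  ultimately show "u \<in> pieces" using cell_pieces_subset_pieces[OF assms(1,2)] by blast
qed

subsection \<open>Trees for the words and the pieces\<close>

text \<open>\<open>refines s z q r k\<close>: when a tree for \<open>last_cell s z\<close> is built, the prefix \<open>q\<close> of \<open>z\<close> is where the
  recursion goes on, with \<open>last_cell r q = last_cell s q\<close>.\<close>

definition refines :: "nat \<Rightarrow> 'b list \<Rightarrow> 'b list \<Rightarrow> nat \<Rightarrow> nat \<Rightarrow> bool" where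
  "refines s z q r k \<longleftrightarrow> q \<in> level k \<and> rank q = r + k \<and> r \<le> s \<and> cell_start r q = cell_start s z \<and>
     (\<exists>i \<le> length z. cell_start s z < i \<and> q = take i z)"

lemma ex_refines:
  assumes "take i z \<in> level k" "cell_start s z < i" "i \<le> length z" "rank z \<le> s + k"
  shows "\<exists>r k'. refines s z (take i z) r k' \<and> last_cell r (take i z) = last_cell s (take i z)"
proof -
  define r where "r = min (rank (take i z)) s"
  have start: "cell_start s (take i z) = cell_start s z" using assms by (intro cell_start_take) auto
  have "cell_start r (take i z) = cell_start s (take i z)"
    using cell_start_eq_0[of "take i z"] by (auto simp: r_def min_def)
  moreover have "rank (take i z) - r \<le> k" using rank_take[of i z] assms(4) by (simp add: r_def)
  then have "take i z \<in> level (rank (take i z) - r)" using level_antimono assms(1) by blast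
  ultimately have "refines s z (take i z) r (rank (take i z) - r)"
    unfolding refines_def using assms(2,3) start by (auto simp: r_def)
  moreover have "last_cell r (take i z) = last_cell s (take i z)"
    using \<open>cell_start r (take i z) = cell_start s (take i z)\<close> by (simp add: last_cell_def)
  ultimately show ?thesis by blast
qed

lemma refinesD:
  assumes "refines s z q r k"
  shows "q \<in> level k" "rank q = r + k" "r \<le> s" "last_cell r q \<noteq> []"
    "set (last_cell r q) \<subseteq> set (last_cell s z)" "weight (last_cell r q) \<le> weight (last_cell s z)"
    "\<exists>i. q = take i z" "set q \<subseteq> set z" "rank q \<le> rank z"
proof -
  obtain i where i: "i \<le> length z" "cell_start s z < i" "q = take i z"
    using assms unfolding refines_def by blast
  have start: "cell_start r q = cell_start s z" "cell_start s q = cell_start s z"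
    using assms i cell_start_take[of s z i] by (auto simp: refines_def)
  then have "last_cell s z = last_cell r q @ drop i z"
    using last_cell_take[of s z i] i by (simp add: last_cell_def)
  then show "set (last_cell r q) \<subseteq> set (last_cell s z)" "weight (last_cell r q) \<le> weight (last_cell s z)"
    by auto
  show "last_cell r q \<noteq> []" using i start(1) by (simp add: last_cell_eq_Nil_iff)
  show "set q \<subseteq> set z" "rank q \<le> rank z" using i(3) by (simp_all add: rank_take set_take_subset)
qed (use assms in \<open>auto simp: refines_def\<close>)

lemma refines_rank_eq:
  assumes q: "refines s z q r k'" and z: "z \<in> halves s v" and v: "rank v = Suc s + k" "0 < k"
  shows "rank q = rank v"
proof -
  obtain j where j: "z = take j v" using halvesD(4)[OF z] by blast
  obtain i where i: "i \<le> length z" "cell_start s z < i" "q = take i z"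
    using q unfolding refines_def by blast
  then have "q = take i v" using j by (simp add: min_absorb1)
  moreover have "cell_start (Suc s) v \<le> i" using halvesD(1)[OF z] i(2) by simp
  ultimately show ?thesis
    using same_cell_after_start[of "Suc s" v i] v
    by (intro rank_eq_if_same_cell[of _ _ "Suc s"]) (auto simp: weight_take_le)
qed

lemma refines_level_mono:
  assumes "refines s z q r k'" "z \<in> halves s v" "rank v = Suc s + k"
  shows "k \<le> k'" "0 < k \<Longrightarrow> k < k'"
  using refines_rank_eq[OF assms] refinesD(2,3)[OF assms(1)] assms(3) by (cases k; simp)+

definition confined :: "nat \<Rightarrow> nat \<Rightarrow> 'b list \<Rightarrow> bool" where
  "confined b r v \<longleftrightarrow> cell_start b v \<le> cell_start r v"

lemma confined_if_le: "r \<le> b \<Longrightarrow> confined b r v"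
  by (simp add: confined_def cell_start_antimono)

lemma less_if_splits_confined: "splits s v \<Longrightarrow> confined b (Suc s) v \<Longrightarrow> s < b"
  using cell_start_antimono[of b s v] by (auto simp: splits_def confined_def not_less[symmetric])

lemma confined_refines:
  assumes "confined b s z" "refines s z q r k" shows "confined b r q"
proof -
  obtain i where i: "i \<le> length z" "cell_start s z < i" "q = take i z" "cell_start r q = cell_start s z"
    using assms(2) unfolding refines_def by blast
  moreover have "cell_start b (take i z) = cell_start b z"
    using assms(1) i by (intro cell_start_take) (auto simp: confined_def)
  ultimately show ?thesis using assms(1) by (simp add: confined_def)
qed

lemma has_tree_hop:
  assumes v: "v \<in> level k" "rank v = Suc s + k" and z: "z \<in> halves s v" "z \<in> T"
    and L: "L = hop_length s (Suc k) z" "0 < L" "L \<le> length (last_cell s z)" "L \<le> 2 ^ Suc k" "L \<le> 2 ^ j"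
    and leaves: "\<And>x. x \<in> set (last_cell s z) \<Longrightarrow> g x \<le> h"
  shows "has_tree pieces g (lastn L z) (h + (2 * j + 1))"
proof (rule tree_boundD[where e = "\<lambda>j. 2 * j + 1"])
  have "L \<le> length z" using L(3) by (simp add: last_cell_def)
  then have "supports (2 * Suc k) (\<lambda>j. 2 * j + 1) (lastn L z) (hops z L (Suc k))"
    using z(2) L by (intro supports_hops) auto
  then show "tree_bound (\<lambda>j. 2 * j + 1) pieces (lastn L z)"
    by (rule supports_tree_bound) (use blocks_subset_pieces hops_subset_pieces[OF v z(1)] L(1) in auto)
  have "lastn L z = lastn L (last_cell s z)"
    using L(3) cell_start_le_length[of s z] by (simp add: lastn_def last_cell_def)
  then show "\<And>x. x \<in> set (lastn L z) \<Longrightarrow> g x \<le> h" using leaves set_lastn[of L "last_cell s z"] by auto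
  show "length (lastn L z) \<le> 2 ^ j" using L(5) by simp
qed

lemma has_tree_half:
  assumes v: "v \<in> level k" "rank v = Suc s + k" and z: "z \<in> halves s v" "last_cell s z \<noteq> []"
    and leaves: "\<And>x. x \<in> set (last_cell s z) \<Longrightarrow> g x \<le> h"
    and j: "Suc k \<le> j \<or> length (last_cell s z) \<le> 2 ^ j" "h + 2 * j + 1 \<le> X"
    and refine: "\<And>q r k'. 2 ^ Suc k < length (last_cell s z) \<Longrightarrow> refines s z q r k' \<Longrightarrow>
      has_tree pieces g (last_cell r q) X"
  shows "has_tree pieces g (last_cell s z) (Suc X)"
proof -
  obtain i where "z = take i v" using halvesD(4)[OF z(1)] by blast
  then have zT: "z \<in> T" "rank z \<le> s + Suc k"
    using v level_subset_T take_T rank_take[of i v] by auto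
  have hop: "has_tree pieces g (lastn L z) X"
    if L: "L = hop_length s (Suc k) z" "0 < L" "L \<le> length (last_cell s z)" "L \<le> 2 ^ Suc k" for L
  proof (rule has_tree_mono[OF has_tree_hop[OF v z(1) zT(1) L _ leaves]])
    show "L \<le> 2 ^ j" using j(1) L(3,4) power_increasing[of "Suc k" j "2::nat"] by linarith
    show "h + (2 * j + 1) \<le> X" using j(2) by simp
  qed
  show ?thesis
  proof (cases "length (last_cell s z) \<le> 2 ^ Suc k")
    case True
    then have "has_tree pieces g (lastn (length (last_cell s z)) z) X"
      using z(2) by (intro hop) (auto simp: hop_length_def)
    moreover have "lastn (length (last_cell s z)) z = last_cell s z"
      using cell_start_le_length[of s z] by (simp add: last_cell_def lastn_def)
    ultimately show ?thesis by (auto elim: has_tree_mono)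
  next
    case False
    define L where "L = hop_length s (Suc k) z"
    have "\<exists>L. L < 2 ^ Suc k \<and> take (length z - L) z \<in> level (Suc k)"
      using ex_take_in_level[OF zT(1), of "Suc k"] False by (auto simp: last_cell_def)
    from someI_ex[OF this] have L: "L < 2 ^ Suc k" "take (length z - L) z \<in> level (Suc k)"
      using False by (auto simp: L_def hop_length_def)
    define q where "q = take (length z - L) z"
    have start: "cell_start s z < length z - L" using L(1) False by (simp add: last_cell_def)
    obtain r k' where "refines s z q r k'" "last_cell r q = last_cell s q"
      using ex_refines[OF L(2) start _ zT(2)] unfolding q_def by auto
    then have "has_tree pieces g (last_cell s q) X" using refine[of q r k'] False by simp
    moreover have "has_tree pieces g (lastn L z) X" if "lastn L z \<noteq> []"
      using that L(1) False start by (intro hop) (auto simp: L_def[symmetric] lastn_def)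
    moreover have "last_cell s z = last_cell s q @ lastn L z"
      using last_cell_take[of s z "length z - L"] start by (simp add: lastn_def q_def)
    ultimately show ?thesis
      using has_tree_append z(2) cell_in_pieces(3)[OF v z] by metis
  qed
qed

lemma has_tree_split:
  assumes v: "v \<in> level k" "rank v = Suc s + k" "splits s v"
    and halves: "\<And>z. z \<in> halves s v \<Longrightarrow> last_cell s z \<noteq> [] \<Longrightarrow> has_tree pieces g (last_cell s z) (Suc X)"
    and letter: "g (cut_letter s v) \<le> Suc X"
  shows "has_tree pieces g (last_cell (Suc s) v) (X + 3)"
proof -
  let ?p = "last_cell s (before_cell s v)"
  have "[cut_letter s v] \<in> pieces"
    using letter_in_pieces level_subset_T v(1) cut_letter_in(1)[OF v(3)] by blast
  then have "has_tree pieces g [cut_letter s v] (Suc X)" using letter by (rule has_tree.leaf)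
  then have left: "has_tree pieces g (?p @ [cut_letter s v]) (Suc (Suc X))"
    using halves[of "before_cell s v"] v(3) cell_in_pieces(2)[OF v]
    by (intro has_tree_append) (auto simp: halves_def)
  have right: "has_tree pieces g (last_cell s v) (Suc (Suc X))" if "last_cell s v \<noteq> []"
    using has_tree_mono[OF halves[OF _ that]] by simp
  have "(?p @ [cut_letter s v]) @ last_cell s v \<in> pieces"
    using cell_in_pieces(1)[OF v(1,2)] unfolding last_cell_split[OF v(3)] by simp
  then have "has_tree pieces g ((?p @ [cut_letter s v]) @ last_cell s v) (Suc (Suc (Suc X)))"
    by (intro has_tree_append[OF left right]) auto
  then show ?thesis unfolding last_cell_split[OF v(3)] by (simp add: numeral_3_eq_3)
qed

lemma has_tree_last_cell:
  assumes "v \<in> level k" "rank v = r + k" "last_cell r v \<noteq> []"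
    "\<And>x. x \<in> set v \<Longrightarrow> g x \<le> 5 * bit_length (wt x) + M"
  shows "has_tree pieces g (last_cell r v) (3 * r + 2 * rank v + M + 2)"
  using assms
proof (induction r arbitrary: v k rule: less_induct)
  case (less r)
  then obtain s where s: "r = Suc s" by (cases r) auto
  have v: "v \<in> level k" "rank v = Suc s + k" using less.prems s by auto
  let ?X = "3 * s + 2 * rank v + M + 2"
  have half: "has_tree pieces g (last_cell s z) (Suc ?X)" if z: "z \<in> halves s v" "last_cell s z \<noteq> []" for z
  proof (rule has_tree_half[OF v z, where j = "Suc k" and h = "5 * s + M"])
    obtain i where i: "z = take i v" using halvesD(4)[OF z(1)] by blast
    then have zv: "set z \<subseteq> set v" "rank z \<le> rank v" by (simp_all add: rank_take set_take_subset)
    show "5 * s + M + 2 * Suc k + 1 \<le> ?X" using v(2) by simp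
    show "g x \<le> 5 * s + M" if x: "x \<in> set (last_cell s z)" for x
    proof -
      have "x \<in> set v" using x set_last_cell zv(1) by blast
      then show ?thesis using less.prems(4)[of x] bit_length_wt_last_cell[OF x] by linarith
    qed
    fix q r' k' assume q: "refines s z q r' k'"
    have "has_tree pieces g (last_cell r' q) (3 * r' + 2 * rank q + M + 2)"
      using refinesD[OF q] zv(1) less.prems(4) s by (intro less.IH[of r' q k']) auto
    then show "has_tree pieces g (last_cell r' q) ?X"
      by (rule has_tree_mono) (use refinesD(3,9)[OF q] zv(2) in linarith)
  qed simp
  show ?case
  proof (cases "splits s v")
    case True
    have "bit_length (wt (cut_letter s v)) \<le> Suc s"
      using bit_length_wt_last_cell cut_letter_in(2)[OF True] by blast
    then have "g (cut_letter s v) \<le> Suc ?X" using less.prems(4)[OF cut_letter_in(1)[OF True]] v(2) by linarith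
    from has_tree_split[OF v True half this] show ?thesis by (simp add: s)
  next
    case False
    then have "last_cell r v = last_cell s v" using last_cell_no_split(2) s by simp
    moreover have "has_tree pieces g (last_cell s v) (Suc ?X)"
      using half[of v] less.prems(3) calculation by (simp add: halves_def)
    ultimately show ?thesis using s by (auto elim: has_tree_mono)
  qed
qed

lemma has_tree_no_split:
  assumes v: "v \<in> level k" "rank v = Suc s + k" "\<not> splits s v"
    and cell: "last_cell (Suc s) v \<noteq> []" "weight (last_cell (Suc s) v) < 2 ^ b"
    and leaves: "\<And>x. x \<in> set (last_cell (Suc s) v) \<Longrightarrow> g x \<le> h"
    and refine: "\<And>q r k'. refines s v q r k' \<Longrightarrow> has_tree pieces g (last_cell r q) (Y + (b - k'))"
    and Y: "h + 2 * b + 1 < Y"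
  shows "has_tree pieces g (last_cell (Suc s) v) (Y + (b - k))"
proof -
  note eq = last_cell_no_split(2)[OF v(3)]
  have v_half: "v \<in> halves s v" by (simp add: halves_def)
  have len: "length (last_cell s v) < 2 ^ b" using length_le_weight[of "last_cell s v"] cell(2) eq by simp
  have "has_tree pieces g (last_cell s v) (Suc (Y + (b - k) - 1))"
  proof (rule has_tree_half[OF v(1,2) v_half, where j = b and h = h])
    fix q r k' assume long: "2 ^ Suc k < length (last_cell s v)" and q: "refines s v q r k'"
    have "(2::nat) ^ Suc k < 2 ^ b" using long len by linarith
    then have "Suc k < b" by (simp del: power_Suc)
    moreover have "k < k'" using refines_level_mono(2)[OF q v_half v(2)] positive_level_if_no_split[OF v(3,2)] .
    ultimately have "Y + (b - k') \<le> Y + (b - k) - 1" by linarith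
    with refine[OF q] show "has_tree pieces g (last_cell r q) (Y + (b - k) - 1)" by (rule has_tree_mono)
  qed (use cell(1) eq len leaves Y in auto)
  moreover have "Suc (Y + (b - k) - 1) = Y + (b - k)" using Y by simp
  ultimately show ?thesis unfolding eq by simp
qed

lemma has_tree_light_split:
  assumes v: "v \<in> level k" "rank v = Suc s + k" "splits s v"
    and weight: "weight (last_cell (Suc s) v) < 2 ^ b"
    and leaves: "\<And>x. x \<in> set (last_cell (Suc s) v) \<Longrightarrow> g x \<le> h"
    and refine: "\<And>z q r k'. z \<in> halves s v \<Longrightarrow> refines s z q r k' \<Longrightarrow>
      has_tree pieces g (last_cell r q) (Y + (b - k'))"
    and Y: "h + 2 * b + 1 \<le> Y"
  shows "has_tree pieces g (last_cell (Suc s) v) (Y + 3 + (b - k))"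
proof -
  have "has_tree pieces g (last_cell (Suc s) v) (Y + (b - k) + 3)"
  proof (rule has_tree_split[OF v])
    fix z assume z: "z \<in> halves s v" "last_cell s z \<noteq> []"
    show "has_tree pieces g (last_cell s z) (Suc (Y + (b - k)))"
    proof (rule has_tree_half[OF v(1,2) z, where j = b and h = h])
      show "Suc k \<le> b \<or> length (last_cell s z) \<le> 2 ^ b"
        using length_le_weight[of "last_cell s z"] halvesD(3)[OF z(1)] weight by simp
      fix q r k' assume q: "refines s z q r k'"
      from refine[OF z(1) q] show "has_tree pieces g (last_cell r q) (Y + (b - k))"
        by (rule has_tree_mono) (use refines_level_mono(1)[OF q z(1) v(2)] in linarith)
    qed (use halvesD(2)[OF z(1)] leaves Y in auto)
  next
    show "g (cut_letter s v) \<le> Suc (Y + (b - k))" using leaves[OF cut_letter_in(2)[OF v(3)]] Y by simp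
  qed
  then show ?thesis by (simp add: algebra_simps)
qed

lemma has_tree_confined_cell:
  assumes "v \<in> level k" "rank v = r + k" "last_cell r v \<noteq> []" "weight (last_cell r v) < 2 ^ b"
    "confined b r v"
    and "\<And>x. x \<in> set (last_cell r v) \<Longrightarrow> g x \<le> h"
  shows "has_tree pieces g (last_cell r v) (h + 2 * b + 1 + 3 * min r b + (b - k))"
  using assms
proof (induction r arbitrary: v k rule: less_induct)
  case (less r)
  then obtain s where s: "r = Suc s" by (cases r) auto
  have v: "v \<in> level k" "rank v = Suc s + k" using less.prems s by auto
  have refine: "has_tree pieces g (last_cell r' q) (h + 2 * b + 1 + 3 * min r' b + (b - k'))"
    if z: "z \<in> halves s v" and q: "refines s z q r' k'" and "confined b r' q" for z q r' k'
  proof (rule less.IH)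
    show "weight (last_cell r' q) < 2 ^ b"
      using refinesD(6)[OF q] halvesD(3)[OF z] less.prems(4) s by simp
    show "\<And>x. x \<in> set (last_cell r' q) \<Longrightarrow> g x \<le> h"
      using refinesD(5)[OF q] halvesD(2)[OF z] less.prems(6) s by blast
  qed (use that refinesD[OF q] s in auto)
  show ?case
  proof (cases "splits s v")
    case True
    then have "s < b" using less_if_splits_confined less.prems(5) s by simp
    have "has_tree pieces g (last_cell (Suc s) v) (h + 2 * b + 1 + 3 * s + 3 + (b - k))"
    proof (rule has_tree_light_split[OF v True])
      fix z q r' k' assume z: "z \<in> halves s v" and q: "refines s z q r' k'"
      have "confined b r' q" using refinesD(3)[OF q] \<open>s < b\<close> by (intro confined_if_le) simp
      from refine[OF z q this] show "has_tree pieces g (last_cell r' q) (h + 2 * b + 1 + 3 * s + (b - k'))"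
        by (rule has_tree_mono) (use refinesD(3)[OF q] in linarith)
    qed (use less.prems s in auto)
    then show ?thesis unfolding s by (rule has_tree_mono) (use \<open>s < b\<close> in simp)
  next
    case False
    have "has_tree pieces g (last_cell (Suc s) v) (h + 2 * b + 1 + 3 * min r b + (b - k))"
    proof (rule has_tree_no_split[OF v False])
      fix q r' k' assume q: "refines s v q r' k'"
      have "confined b s v" using less.prems(5) last_cell_no_split(1)[OF False] s by (simp add: confined_def)
      from refine[OF self_in_halves q confined_refines[OF this q]]
      show "has_tree pieces g (last_cell r' q) (h + 2 * b + 1 + 3 * min r b + (b - k'))"
        by (rule has_tree_mono) (use refinesD(3)[OF q] s in auto)
    next
      have "0 < b" using less.prems(3,4) by (cases b) auto
      then show "h + 2 * b + 1 < h + 2 * b + 1 + 3 * min r b" using s by simp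
    qed (use less.prems s in auto)
    then show ?thesis by (simp add: s)
  qed
qed

lemma same_cell_if_between_multiples:
  assumes "m * 2 ^ b \<le> x" "x < m * 2 ^ b + 2 ^ b" "m * 2 ^ b \<le> y" "y < m * 2 ^ b + 2 ^ b"
  shows "x div 2 ^ b = y div (2 ^ b :: nat)"
proof -
  have "x div 2 ^ b = m" if "m * 2 ^ b \<le> x" "x < m * 2 ^ b + 2 ^ b" for x
    using that by (intro div_nat_eqI) (simp_all add: algebra_simps)
  then show ?thesis using assms by metis
qed

text \<open>The positions on either side of a multiple of a large power of two stay on that side, so a word
  of weight below \<open>2 ^ b\<close> is confined to one cell of length \<open>2 ^ b\<close> after its first split.\<close>

lemma confined_halves:
  assumes split: "splits s v" and weight: "weight (last_cell (Suc s) v) < 2 ^ b" and z: "z \<in> halves s v"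
  shows "confined b s z"
proof (cases "s \<le> b")
  case True
  then show ?thesis by (rule confined_if_le)
next
  case False
  let ?S = "cell_start (Suc s) v" and ?i = "cell_start s v" and ?p = "before_cell s v"
  define m where "m = weight v div 2 ^ s * 2 ^ (s - b)"
  have boundary: "weight v div 2 ^ s * 2 ^ s = m * 2 ^ b"
    using False by (simp add: m_def mult.assoc flip: power_add)
  have "weight ?p div 2 ^ s < weight v div 2 ^ s"
    using split smaller_cell_before_start[of "?i - 1" s v] by (simp add: before_cell_def splits_def)
  then have below: "weight ?p < m * 2 ^ b"
    unfolding boundary[symmetric] by (simp add: div_less_iff_less_mult)
  have S_le: "?S \<le> ?i - 1" using split by (simp add: splits_def)
  have total: "weight (take ?S v) + weight (last_cell (Suc s) v) = weight v" by (rule weight_before_last_cell)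
  have S_p: "weight (take ?S v) \<le> weight ?p" using S_le by (simp add: before_cell_def weight_take_mono)
  consider (after) "z = v" | (before) "z = ?p" using z split by (auto simp: halves_def)
  then show ?thesis
  proof cases
    case after
    have "m * 2 ^ b \<le> weight (take ?i v)"
      using weight_take_cell_start[of s v] by (metis boundary div_times_less_eq_dividend)
    moreover have "weight v < m * 2 ^ b + 2 ^ b" using total weight below S_p by linarith
    ultimately have "cell_start b v \<le> ?i"
      using weight_take_le[of ?i v] by (intro cell_start_le same_cell_if_between_multiples[of m]) linarith+
    then show ?thesis by (simp add: confined_def after)
  next
    case before
    have m: "m * 2 ^ b = (m - 1) * 2 ^ b + 2 ^ b" using below by (cases m) auto
    have "(m - 1) * 2 ^ b \<le> weight (take ?S v)"
      using total weight m boundary div_times_less_eq_dividend[of "weight v" "2 ^ s"] by linarith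
    moreover have "take ?S v = take ?S ?p" using S_le by (simp add: before_cell_def min_absorb1)
    ultimately have "cell_start b ?p \<le> ?S"
      using S_p below m by (intro cell_start_le same_cell_if_between_multiples[of "m - 1"]) auto
    then show ?thesis by (simp add: confined_def before cell_start_before_cell[OF split])
  qed
qed

lemma has_tree_light_cell:
  assumes "v \<in> level k" "rank v = r + k" "last_cell r v \<noteq> []" "weight (last_cell r v) < 2 ^ b"
    and "\<And>x. x \<in> set (last_cell r v) \<Longrightarrow> g x \<le> h"
  shows "has_tree pieces g (last_cell r v) (h + 5 * b + 4 + (b - k))"
  using assms
proof (induction r arbitrary: v k rule: less_induct)
  case (less r)
  then obtain s where s: "r = Suc s" by (cases r) auto
  have v: "v \<in> level k" "rank v = Suc s + k" using less.prems s by auto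
  show ?case
  proof (cases "splits s v")
    case True
    have "has_tree pieces g (last_cell (Suc s) v) (h + 5 * b + 1 + 3 + (b - k))"
    proof (rule has_tree_light_split[OF v True])
      fix z q r' k' assume z: "z \<in> halves s v" and q: "refines s z q r' k'"
      have "confined b s z" using confined_halves[OF True _ z] less.prems(4) s by simp
      then have "has_tree pieces g (last_cell r' q) (h + 2 * b + 1 + 3 * min r' b + (b - k'))"
        using refinesD[OF q] halvesD(2,3)[OF z] less.prems(4,5) s confined_refines[OF _ q]
        by (intro has_tree_confined_cell) auto
      then show "has_tree pieces g (last_cell r' q) (h + 5 * b + 1 + (b - k'))"
        by (rule has_tree_mono) simp
    qed (use less.prems s in auto)
    then show ?thesis unfolding s by (rule has_tree_mono) simp
  next
    case False
    have "has_tree pieces g (last_cell (Suc s) v) (h + 5 * b + 4 + (b - k))"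
    proof (rule has_tree_no_split[OF v False])
      fix q r' k' assume q: "refines s v q r' k'"
      show "has_tree pieces g (last_cell r' q) (h + 5 * b + 4 + (b - k'))"
        using refinesD[OF q] halvesD(2,3)[OF self_in_halves, of s v] less.prems(4,5) s
        by (intro less.IH) auto
    qed (use less.prems s in auto)
    then show ?thesis by (simp add: s)
  qed
qed

lemma has_tree_light_half:
  assumes v: "v \<in> level k" "rank v = Suc s + k" and z: "z \<in> halves s v" "last_cell s z \<noteq> []"
    and weight: "weight (last_cell s z) < 2 ^ b" and leaves: "\<And>x. x \<in> set (last_cell s z) \<Longrightarrow> g x \<le> h"
  shows "has_tree pieces g (last_cell s z) (Suc (h + 6 * b + 4))"
proof (rule has_tree_half[OF v z, where j = b and h = h])
  show "Suc k \<le> b \<or> length (last_cell s z) \<le> 2 ^ b"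
    using length_le_weight[of "last_cell s z"] weight by simp
  fix q r k' assume q: "refines s z q r k'"
  have "has_tree pieces g (last_cell r q) (h + 5 * b + 4 + (b - k'))"
    using refinesD[OF q] weight leaves by (intro has_tree_light_cell) auto
  then show "has_tree pieces g (last_cell r q) (h + 6 * b + 4)" by (rule has_tree_mono) simp
qed (use leaves in auto)

lemma has_tree_if_tree_bound:
  assumes "tree_bound (\<lambda>j. 2 * j + 1) pieces u" "weight u < 2 ^ b" "\<And>x. x \<in> set u \<Longrightarrow> g x \<le> h"
  shows "has_tree pieces g u (h + 6 * b + 6)"
proof (rule has_tree_mono[OF tree_boundD[OF assms(1,3)]])
  show "length u \<le> 2 ^ b" using assms(2) length_le_weight[of u] by simp
qed auto

lemma has_tree_cell_piece:
  assumes v: "v \<in> level k" "rank v = Suc s + k"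
    and u: "u \<in> cell_pieces s (Suc k) v" "u \<in> pieces" "u \<noteq> []"
    and weight: "weight u < 2 ^ b" and leaves: "\<And>x. x \<in> set u \<Longrightarrow> g x \<le> h"
  shows "has_tree pieces g u (h + 6 * b + 6)"
proof -
  from u(1) consider (cell) "u = last_cell (Suc s) v" | (half) z where "z \<in> halves s v" "u = last_cell s z"
    | (letter) "splits s v" "u = last_cell s (before_cell s v) @ [cut_letter s v]"
    | (hop) z where "z \<in> halves s v" "u \<in> hops z (hop_length s (Suc k) z) (Suc k)"
    unfolding cell_pieces_def by (auto split: if_splits)
  then show ?thesis
  proof cases
    case cell
    have "has_tree pieces g u (h + 5 * b + 4 + (b - k))"
      using has_tree_light_cell[OF v, of b g h] u(3) weight leaves cell by simp
    then show ?thesis by (rule has_tree_mono) simp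
  next
    case half
    then have "has_tree pieces g u (Suc (h + 6 * b + 4))"
      using has_tree_light_half[OF v half(1)] u(3) weight leaves by auto
    then show ?thesis by (rule has_tree_mono) simp
  next
    case letter
    have "has_tree pieces g (last_cell s (before_cell s v)) (Suc (h + 6 * b + 4))"
      if "last_cell s (before_cell s v) \<noteq> []"
      using has_tree_light_half[OF v _ that] letter weight leaves by (simp add: halves_def)
    moreover have "[cut_letter s v] \<in> pieces"
      using letter_in_pieces level_subset_T v(1) cut_letter_in(1)[OF letter(1)] by blast
    then have "has_tree pieces g [cut_letter s v] (Suc (h + 6 * b + 4))"
      using leaves[of "cut_letter s v"] letter(2) by (intro has_tree.leaf) auto
    ultimately have "has_tree pieces g u (Suc (Suc (h + 6 * b + 4)))"
      unfolding letter(2) using u(2) letter(2) by (intro has_tree_append) auto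
    then show ?thesis by (simp add: numeral_eq_Suc)
  next
    case hop
    have "tree_bound (\<lambda>j. 2 * j + 1) pieces u"
      using tree_bound_hops[OF hop(2)] blocks_subset_pieces hops_subset_pieces[OF v hop(1)]
      by (auto elim: tree_bound_mono)
    then show ?thesis using weight leaves by (rule has_tree_if_tree_bound)
  qed
qed

lemma has_tree_piece:
  assumes u: "u \<in> pieces" and weight: "weight u < 2 ^ b" and leaves: "\<And>x. x \<in> set u \<Longrightarrow> g x \<le> h"
  shows "has_tree pieces g u (h + 6 * b + 6)"
proof -
  obtain k v where v: "v \<in> level k" "u \<in> pieces_at k v" "u \<noteq> []" using u unfolding pieces_def by auto
  show ?thesis
  proof (cases "u = lastn (2 ^ k) v")
    case True
    then have "v \<noteq> []" using v(3) by (auto simp: lastn_def)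
    then have "u \<in> blocks" using True lastn_in_blocks v(1) by simp
    then have "tree_bound (\<lambda>j. 2 * j + 1) pieces u"
      using tree_bound_mono[OF tree_bound_block blocks_subset_pieces] by auto
    then show ?thesis using weight leaves by (rule has_tree_if_tree_bound)
  next
    case False
    then have "rank v = Suc (rank v - Suc k) + k" "u \<in> cell_pieces (rank v - Suc k) (Suc k) v"
      using v(2) by (auto simp: pieces_at_def split: if_splits)
    then show ?thesis using has_tree_cell_piece v(1,3) u weight leaves by blast
  qed
qed

lemma has_tree_word:
  assumes "v \<in> T" "v \<noteq> []" "\<And>x. x \<in> set v \<Longrightarrow> g x \<le> 5 * bit_length (wt x) + M"
  shows "has_tree pieces g v (5 * rank v + M + 2)"
  using has_tree_last_cell[of v 0 "rank v" g M] assms by (simp add: algebra_simps)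

end

section \<open>Locally balanced families\<close>

lemma has_tree_restrict: "has_tree F g u h \<Longrightarrow> set u \<subseteq> X \<Longrightarrow> has_tree {y \<in> F. set y \<subseteq> X} g u h"
proof (induction rule: has_tree.induct)
  case (node u h v h')
  then have "has_tree {y \<in> F. set y \<subseteq> X} g u h" "has_tree {y \<in> F. set y \<subseteq> X} g v h" by auto
  then show ?case by (rule has_tree.node) (use node in auto)
qed (auto intro: has_tree.leaf)

abbreviation height_le :: "'a list set \<Rightarrow> 'a list \<Rightarrow> nat \<Rightarrow> bool" where
  "height_le F \<equiv> has_tree F (\<lambda>_. 0)"

text \<open>A word of light siblings is stored with the heavy end first, so the siblings to the left of a heavy
  path come in reverse order.\<close>

definition glue :: "bool \<Rightarrow> 'a list list \<Rightarrow> 'a list" where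
  "glue side y = concat (if side then y else rev y)"

lemma glue_Nil [simp]: "glue side [] = []" and glue_single [simp]: "glue side [x] = x"
  by (auto simp: glue_def)

lemma glue_append: "glue side (u @ v) = (if side then glue side u @ glue side v else glue side v @ glue side u)"
  by (simp add: glue_def)

lemma height_le_glue:
  assumes "has_tree F g u h" "\<And>y. y \<in> F \<Longrightarrow> glue side y \<in> B" "\<And>x. x \<in> set u \<Longrightarrow> height_le B x (g x)"
  shows "height_le B (glue side u) h"
  using assms
proof (induction rule: has_tree.induct)
  case (leaf x h)
  then show ?case using has_tree_mono[OF leaf.prems(2)[of x] leaf.hyps(2)] by simp
next
  case (node u h v h')
  then have "height_le B (glue side u) h" "height_le B (glue side v) h" by auto
  moreover have "glue side (u @ v) \<in> B" using node by blast
  ultimately show ?case using has_tree.node[OF _ _ _ node.hyps(4)] by (cases side) (auto simp: glue_append)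
qed

definition string_weight :: "'a list \<Rightarrow> nat" where "string_weight x = max 1 (length x)"

locale string_trie = trie T string_weight for T :: "'a list list set" +
  fixes V :: "'a list set" and side :: bool
  assumes Nil_V: "[] \<notin> V"
begin

definition glued :: "'a list set" where "glued = glue side ` {y \<in> pieces. set y \<subseteq> V}"

lemma finite_glued: "finite glued"
  using finite_pieces by (simp add: glued_def)

lemma card_glued: "card glued \<le> 26 * card T"
proof -
  have "card glued \<le> card {y \<in> pieces. set y \<subseteq> V}"
    unfolding glued_def using finite_pieces by (intro card_image_le) simp
  also have "\<dots> \<le> card pieces" using finite_pieces by (intro card_mono) auto
  also have "\<dots> \<le> 26 * card T" by (rule card_pieces)
  finally show ?thesis .
qed

lemma weight_eq_length_glue:
  assumes "set y \<subseteq> V" shows "weight y = length (glue side y)"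
proof -
  have "weight y = (\<Sum>x\<leftarrow>y. length x)" unfolding weight_def
    using assms Nil_V by (intro arg_cong[of _ _ sum_list] map_cong) (auto simp: string_weight_def max_def Suc_le_eq)
  then show ?thesis by (simp add: glue_def length_concat rev_map[symmetric] sum_list_rev)
qed

lemma height_le_glue_if_has_tree:
  assumes "has_tree pieces g y h" "set y \<subseteq> V" "glued \<subseteq> B" "\<And>x. x \<in> set y \<Longrightarrow> height_le B x (g x)"
  shows "height_le B (glue side y) h"
  using has_tree_restrict[OF assms(1,2)] by (rule height_le_glue) (use assms(3,4) in \<open>auto simp: glued_def\<close>)

lemma height_le_glue_word:
  assumes y: "y \<in> T" "y \<noteq> []" "set y \<subseteq> V" and B: "glued \<subseteq> B"
    and letters: "\<And>x. x \<in> set y \<Longrightarrow> height_le B x (9 * bit_length (length x))"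
    and b: "\<And>x. x \<in> set y \<Longrightarrow> bit_length (length x) < b" "length (glue side y) < 2 ^ b"
  shows "height_le B (glue side y) (9 * b - 2)"
proof -
  have "has_tree pieces (\<lambda>x. 9 * bit_length (length x)) y (5 * rank y + 4 * (b - 1) + 2)"
  proof (rule has_tree_word[OF y(1,2)])
    fix x assume "x \<in> set y"
    then have "bit_length (length x) \<le> b - 1" "x \<noteq> []" using b(1)[of x] y(3) Nil_V by auto
    moreover from \<open>x \<noteq> []\<close> have "string_weight x = length x" by (cases x) (simp_all add: string_weight_def)
    ultimately show "9 * bit_length (length x) \<le> 5 * bit_length (string_weight x) + 4 * (b - 1)" by simp
  qed
  then have "height_le B (glue side y) (5 * rank y + 4 * (b - 1) + 2)"
    using y(3) B letters by (rule height_le_glue_if_has_tree)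
  moreover have "rank y \<le> b" using b(2) weight_eq_length_glue[OF y(3)]
    by (simp add: rank_def bit_length_le_iff)
  moreover have "0 < b" using b(1)[of "hd y"] y(2) by auto
  ultimately show ?thesis by (auto elim: has_tree_mono)
qed

lemma glue_word_in_glued:
  assumes "y \<in> T" "y \<noteq> []" "set y \<subseteq> V" shows "glue side y \<in> glued"
  using has_tree_in[OF has_tree_word[OF assms(1,2), of "\<lambda>_. 0" 0]] assms(3) by (auto simp: glued_def)

lemma height_le_glued:
  assumes s: "s \<in> glued" and B: "glued \<subseteq> B" and V: "\<And>x. x \<in> V \<Longrightarrow> height_le B x (9 * bit_length (length x))"
  shows "height_le B s (21 * bit_length (length s))"
proof -
  obtain y where y: "y \<in> pieces" "set y \<subseteq> V" "s = glue side y" using s by (auto simp: glued_def)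
  let ?b = "bit_length (length s)"
  have weight: "weight y = length s" using weight_eq_length_glue y by simp
  have "y \<noteq> []" using y(1) by (auto simp: pieces_def)
  then have "0 < weight y" using weight_eq_0[of y] by linarith
  then have "0 < ?b" by (simp add: bit_length_pos_iff weight)
  have "has_tree pieces (\<lambda>x. 9 * bit_length (length x)) y (9 * ?b + 6 * ?b + 6)"
  proof (rule has_tree_piece[OF y(1)])
    show "weight y < 2 ^ ?b" unfolding weight by (rule less_two_power_bit_length)
    fix x assume "x \<in> set y"
    then have "length x \<le> length s"
      using wt_le_weight[of x y] weight by (simp add: string_weight_def)
    then show "9 * bit_length (length x) \<le> 9 * ?b" by (simp add: floorlog_mono)
  qed
  then have "height_le B s (9 * ?b + 6 * ?b + 6)"
    unfolding y(3) using y(2) B V by (intro height_le_glue_if_has_tree) auto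
  then show ?thesis by (rule has_tree_mono) (use \<open>0 < ?b\<close> in simp)
qed

end

definition closed_family :: "'a list set \<Rightarrow> bool" where
  "closed_family V \<longleftrightarrow> [] \<notin> V \<and> (\<forall>s \<in> V. length s = 1 \<or> (\<exists>u \<in> V. \<exists>v \<in> V. s = u @ v))"

lemma closed_familyE:
  assumes "closed_family V" "s \<in> V" "length s \<noteq> 1"
  obtains u v where "u \<in> V" "v \<in> V" "s = u @ v" "u \<noteq> []" "v \<noteq> []"
  using assms unfolding closed_family_def by metis

lemma bit_length_half: "0 < x \<Longrightarrow> 2 * x \<le> n \<Longrightarrow> bit_length x < bit_length n"
proof -
  assume x: "0 < x" "2 * x \<le> n"
  obtain b where b: "bit_length x = Suc b" using x(1) by (metis bit_length_pos_iff gr0_implies_Suc)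
  then have "2 ^ b \<le> x" by (simp flip: less_bit_length_iff)
  then show ?thesis using x(2) by (simp add: b less_bit_length_iff)
qed

locale finite_closed_family =
  fixes V :: "'a list set"
  assumes finite_V: "finite V" and closed_V: "closed_family V"
begin

lemma Nil_notin: "[] \<notin> V"
  using closed_V by (simp add: closed_family_def)

definition left_factor :: "'a list \<Rightarrow> 'a list" where
  "left_factor s = (SOME u. u \<in> V \<and> (\<exists>v \<in> V. s = u @ v))"

definition right_factor :: "'a list \<Rightarrow> 'a list" where
  "right_factor s = drop (length (left_factor s)) s"

lemma factors:
  assumes "s \<in> V" "length s \<noteq> 1"
  shows "left_factor s \<in> V" "right_factor s \<in> V" "s = left_factor s @ right_factor s"
proof -
  have "\<exists>u. u \<in> V \<and> (\<exists>v \<in> V. s = u @ v)" using closed_familyE[OF closed_V assms] by blast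
  from someI_ex[OF this] obtain v where v: "left_factor s \<in> V" "v \<in> V" "s = left_factor s @ v"
    unfolding left_factor_def by blast
  moreover have "right_factor s = v" unfolding right_factor_def by (subst v(3)) simp
  ultimately show "left_factor s \<in> V" "right_factor s \<in> V" "s = left_factor s @ right_factor s" by auto
qed

definition heavy_is_left :: "'a list \<Rightarrow> bool" where
  "heavy_is_left s \<longleftrightarrow> length (right_factor s) \<le> length (left_factor s)"

definition heavy_child :: "'a list \<Rightarrow> 'a list" where
  "heavy_child s = (if heavy_is_left s then left_factor s else right_factor s)"

definition light_child :: "'a list \<Rightarrow> 'a list" where
  "light_child s = (if heavy_is_left s then right_factor s else left_factor s)"

lemma heavy_light_child:
  assumes "s \<in> V" "length s \<noteq> 1"
  shows "heavy_child s \<in> V" "light_child s \<in> V" "length (heavy_child s) < length s"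
    "2 * length (light_child s) \<le> length s"
    "s = (if heavy_is_left s then heavy_child s @ light_child s else light_child s @ heavy_child s)"
proof -
  have lengths: "length s = length (left_factor s) + length (right_factor s)"
    using arg_cong[OF factors(3)[OF assms], of length] by simp
  have "left_factor s \<noteq> []" "right_factor s \<noteq> []" using factors(1,2)[OF assms] Nil_notin by auto
  then show "length (heavy_child s) < length s" using lengths by (simp add: heavy_child_def)
  show "2 * length (light_child s) \<le> length s"
    using lengths by (auto simp: light_child_def heavy_is_left_def)
qed (use factors[OF assms] in \<open>auto simp: heavy_child_def light_child_def\<close>)

function light_siblings :: "bool \<Rightarrow> 'a list \<Rightarrow> 'a list list" where
  "light_siblings side s = (if s \<in> V \<and> length s \<noteq> 1
     then light_siblings side (heavy_child s) @ (if side = heavy_is_left s then [light_child s] else []) else [])"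
  by auto
termination by (relation "measure (\<lambda>(_, s). length s)") (auto simp: heavy_light_child)

function heavy_leaf :: "'a list \<Rightarrow> 'a list" where
  "heavy_leaf s = (if s \<in> V \<and> length s \<noteq> 1 then heavy_leaf (heavy_child s) else s)"
  by auto
termination by (relation "measure length") (auto simp: heavy_light_child)

declare light_siblings.simps [simp del] heavy_leaf.simps [simp del]

lemma light_siblings_leaf: "length s = 1 \<Longrightarrow> light_siblings side s = []"
  and heavy_leaf_leaf: "length s = 1 \<Longrightarrow> heavy_leaf s = s"
  by (simp_all add: light_siblings.simps[of side s] heavy_leaf.simps[of s])

lemma light_siblings_node:
    "s \<in> V \<Longrightarrow> length s \<noteq> 1 \<Longrightarrow> light_siblings side s =
      light_siblings side (heavy_child s) @ (if side = heavy_is_left s then [light_child s] else [])"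
  and heavy_leaf_node: "s \<in> V \<Longrightarrow> length s \<noteq> 1 \<Longrightarrow> heavy_leaf s = heavy_leaf (heavy_child s)"
  by (simp_all add: light_siblings.simps[of side s] heavy_leaf.simps[of s])

lemma heavy_path_induct [consumes 1, case_names leaf node]:
  assumes "s \<in> V" "\<And>s. s \<in> V \<Longrightarrow> length s = 1 \<Longrightarrow> Q s"
    "\<And>s. s \<in> V \<Longrightarrow> length s \<noteq> 1 \<Longrightarrow> Q (heavy_child s) \<Longrightarrow> Q s"
  shows "Q s"
  using assms(1)
proof (induction "length s" arbitrary: s rule: less_induct)
  case less
  show ?case
    using assms(2,3) less heavy_light_child(1,3)[OF less.prems] by (cases "length s = 1") blast+
qed

lemma heavy_leaf_in:
  assumes "s \<in> V" shows "heavy_leaf s \<in> V" "length (heavy_leaf s) = 1"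
  using assms by (induction rule: heavy_path_induct) (simp_all add: heavy_leaf_leaf heavy_leaf_node)

lemma light_siblings_in:
  assumes "s \<in> V" shows "x \<in> set (light_siblings side s) \<Longrightarrow> x \<in> V \<and> 2 * length x \<le> length s"
  using assms
proof (induction rule: heavy_path_induct)
  case (node s)
  note child = heavy_light_child[OF node.hyps(1,2)]
  have "x = light_child s \<or> x \<in> set (light_siblings side (heavy_child s))"
    using node.prems light_siblings_node[OF node.hyps(1,2)] by (auto split: if_splits)
  then show ?case using node.IH child(2-4) by auto
qed (simp add: light_siblings_leaf)

lemma heavy_path_decomposition:
  assumes "s \<in> V"
  shows "s = glue False (light_siblings False s) @ heavy_leaf s @ glue True (light_siblings True s)"
  using assms
proof (induction rule: heavy_path_induct)
  case (node s)
  have "s = (if heavy_is_left s then heavy_child s @ light_child s else light_child s @ heavy_child s)"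
    by (rule heavy_light_child(5)[OF node.hyps(1,2)])
  also have "\<dots> = glue False (light_siblings False s) @ heavy_leaf s @ glue True (light_siblings True s)"
    using arg_cong[OF node.IH, of "\<lambda>t. if heavy_is_left s then t @ light_child s else light_child s @ t"]
    by (simp add: light_siblings_node[OF node.hyps] heavy_leaf_node[OF node.hyps] glue_append)
  finally show ?case .
qed (simp add: light_siblings_leaf heavy_leaf_leaf)

lemma butlast_light_siblings:
  "s \<in> V \<Longrightarrow> light_siblings side s = v @ [x] \<Longrightarrow> v \<in> insert [] (light_siblings side ` V)"
proof (induction rule: heavy_path_induct)
  case (node s)
  then show ?case using heavy_light_child(1)[OF node.hyps(1,2)] light_siblings_node[OF node.hyps(1,2)]
    by (auto split: if_splits)
qed (simp add: light_siblings_leaf)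

sublocale light: string_trie "insert [] (light_siblings side ` V)" V side for side
proof
  fix v x assume "v @ [x] \<in> insert [] (light_siblings side ` V)"
  then obtain s where "s \<in> V" "light_siblings side s = v @ [x]" by auto
  then show "v \<in> insert [] (light_siblings side ` V)" by (rule butlast_light_siblings)
qed (use finite_V Nil_notin in \<open>auto simp: string_weight_def\<close>)

definition heavy_suffix :: "'a list \<Rightarrow> 'a list" where
  "heavy_suffix s = heavy_leaf s @ glue True (light_siblings True s)"

definition balanced :: "'a list set" where
  "balanced = V \<union> heavy_suffix ` V \<union> light.glued False \<union> light.glued True"

lemma glued_subset_balanced: "light.glued side \<subseteq> balanced"
  by (cases side) (auto simp: balanced_def)

lemma finite_balanced: "finite balanced"
  using finite_V light.finite_glued by (simp add: balanced_def)

lemma card_balanced: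
  assumes "V \<noteq> {}" shows "card balanced \<le> 106 * card V"
proof -
  have "1 \<le> card V" using assms finite_V by (simp add: Suc_leI card_gt_0_iff)
  then have words: "card (insert [] (light_siblings side ` V)) \<le> 2 * card V" for side
    using card_image_le[OF finite_V, of "light_siblings side"] finite_V by (simp add: card_insert_if)
  have glued: "card (light.glued side) \<le> 52 * card V" for side
    using light.card_glued[of side] words[of side] by linarith
  have "card (heavy_suffix ` V) \<le> card V" by (rule card_image_le[OF finite_V])
  then show ?thesis
    using glued[of False] glued[of True] card_Un_le[of V "heavy_suffix ` V"]
      card_Un_le[of "V \<union> heavy_suffix ` V" "light.glued False"]
      card_Un_le[of "V \<union> heavy_suffix ` V \<union> light.glued False" "light.glued True"]
    unfolding balanced_def by linarith
qed

lemma height_le_heavy_suffix: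
  assumes s: "s \<in> V" and right: "light_siblings True s \<noteq> [] \<Longrightarrow> height_le balanced (glue True (light_siblings True s)) h"
  shows "height_le balanced (heavy_suffix s) (Suc h)"
proof -
  obtain a where a: "heavy_leaf s = [a]" using heavy_leaf_in(2)[OF s] by (cases "heavy_leaf s") auto
  have "heavy_leaf s \<in> balanced" using heavy_leaf_in(1)[OF s] by (simp add: balanced_def)
  then have leaf: "height_le balanced (heavy_leaf s) h" unfolding a by (intro has_tree.leaf) auto
  have "height_le balanced (glue True (light_siblings True s)) h" if "glue True (light_siblings True s) \<noteq> []"
    using that right by (cases "light_siblings True s = []") auto
  moreover have "heavy_suffix s \<in> balanced" using s by (simp add: balanced_def)
  ultimately show ?thesis
    unfolding heavy_suffix_def by (intro has_tree_append[OF leaf]) (auto simp: a)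
qed

lemma height_le_V: "s \<in> V \<Longrightarrow> height_le balanced s (9 * bit_length (length s))"
proof (induction "length s" arbitrary: s rule: less_induct)
  case less
  let ?b = "bit_length (length s)" and ?L = "glue False (light_siblings False s)"
  note decomposition = heavy_path_decomposition[OF less.prems, folded heavy_suffix_def]
  have "s \<noteq> []" using less.prems Nil_notin by auto
  then have "0 < ?b" by (simp add: bit_length_pos_iff)
  have side: "height_le balanced (glue side (light_siblings side s)) (9 * ?b - 2)"
    if "light_siblings side s \<noteq> []" for side
  proof (rule light.height_le_glue_word[OF _ that _ glued_subset_balanced])
    show "set (light_siblings side s) \<subseteq> V" using light_siblings_in[OF less.prems] by auto
    show "length (glue side (light_siblings side s)) < 2 ^ ?b"
      using arg_cong[OF decomposition, of length] less_two_power_bit_length[of "length s"]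
      by (cases side) (auto simp: heavy_suffix_def)
    fix x assume "x \<in> set (light_siblings side s)"
    then have x: "x \<in> V" "2 * length x \<le> length s" "0 < length x"
      using light_siblings_in[OF less.prems] Nil_notin by auto
    then show "bit_length (length x) < ?b" by (intro bit_length_half)
    have "length x < length s" using x(2,3) by linarith
    then show "height_le balanced x (9 * bit_length (length x))" using x(1) by (rule less.hyps)
  qed (use less.prems in auto)
  have "height_le balanced (?L @ heavy_suffix s) (Suc (Suc (9 * ?b - 2)))"
  proof (rule has_tree_append)
    show "?L \<noteq> [] \<Longrightarrow> height_le balanced ?L (Suc (9 * ?b - 2))"
      using side[of False] by (cases "light_siblings False s = []") (auto elim: has_tree_mono)
    show "height_le balanced (heavy_suffix s) (Suc (9 * ?b - 2))"
      using less.prems side by (rule height_le_heavy_suffix)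
    show "?L @ heavy_suffix s \<in> balanced" "?L @ heavy_suffix s \<noteq> []"
      using decomposition less.prems \<open>s \<noteq> []\<close> by (auto simp: balanced_def)
  qed
  moreover have "Suc (Suc (9 * ?b - 2)) = 9 * ?b" using \<open>0 < ?b\<close> by simp
  ultimately show ?case using decomposition by simp
qed

lemma height_le_balanced:
  assumes "s \<in> balanced" shows "height_le balanced s (22 * bit_length (length s))"
proof -
  have height_le_glued: "height_le balanced t (21 * bit_length (length t))" if "t \<in> light.glued side"
    for t side
    using that glued_subset_balanced height_le_V by (rule light.height_le_glued)
  consider (V) "s \<in> V" | (glued) side where "s \<in> light.glued side" | (suffix) t
    where "t \<in> V" "s = heavy_suffix t"
    using assms by (auto simp: balanced_def)
  then show ?thesis
  proof cases
    case V
    from height_le_V[OF this] show ?thesis by (rule has_tree_mono) simp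
  next
    case glued
    then have "height_le balanced s (21 * bit_length (length s))" by (rule height_le_glued)
    then show ?thesis by (rule has_tree_mono) simp
  next
    case suffix
    let ?R = "glue True (light_siblings True t)"
    have length_s: "length s = Suc (length ?R)"
      using heavy_leaf_in(2)[OF suffix(1)] suffix(2) by (simp add: heavy_suffix_def)
    then have "0 < bit_length (length s)" by (simp add: bit_length_pos_iff)
    have "height_le balanced s (Suc (21 * bit_length (length s)))" unfolding suffix(2)
    proof (rule height_le_heavy_suffix[OF suffix(1)])
      assume "light_siblings True t \<noteq> []"
      then have "?R \<in> light.glued True"
        using suffix(1) light_siblings_in[OF suffix(1)] by (intro light.glue_word_in_glued) auto
      from height_le_glued[OF this] show "height_le balanced ?R (21 * bit_length (length (heavy_suffix t)))"
        by (rule has_tree_mono) (use length_s suffix(2) in \<open>simp add: floorlog_mono\<close>)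
    qed
    then show ?thesis by (rule has_tree_mono) (use \<open>0 < bit_length (length s)\<close> in simp)
  qed
qed

end

theorem ex_balanced_family:
  assumes "finite V" "closed_family V" "V \<noteq> {}"
  obtains F where "finite F" "V \<subseteq> F" "card F \<le> 106 * card V"
    "\<And>s. s \<in> F \<Longrightarrow> height_le F s (22 * bit_length (length s))"
proof -
  interpret finite_closed_family V using assms by unfold_locales
  show thesis
  proof
    show "V \<subseteq> balanced" by (auto simp: balanced_def)
  qed (use finite_balanced card_balanced[OF assms(3)] height_le_balanced in blast)+
qed

lemma closed_family_insert_append:
  assumes "closed_family U" "closed_family V" "u \<in> U" "v \<in> V"
  shows "closed_family (insert (u @ v) (U \<union> V))"
  unfolding closed_family_def
proof (intro conjI ballI)
  show "[] \<notin> insert (u @ v) (U \<union> V)" using assms by (auto simp: closed_family_def)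
  fix s assume "s \<in> insert (u @ v) (U \<union> V)"
  then consider "s = u @ v" | "s \<in> U" | "s \<in> V" by blast
  then show "length s = 1 \<or> (\<exists>x\<in>insert (u @ v) (U \<union> V). \<exists>y\<in>insert (u @ v) (U \<union> V). s = x @ y)"
    by cases (use assms in \<open>unfold closed_family_def, blast+\<close>)
qed

lemma ex_small_closed_subfamily:
  assumes "closed_family V" "s \<in> V"
  shows "\<exists>V' \<subseteq> V. closed_family V' \<and> s \<in> V' \<and> finite V' \<and> card V' \<le> 2 * length s - 1"
  using assms(2)
proof (induction "length s" arbitrary: s rule: less_induct)
  case less
  show ?case
  proof (cases "length s = 1")
    case True
    then show ?thesis using less.prems by (intro exI[of _ "{s}"]) (auto simp: closed_family_def)
  next
    case False
    then obtain u v where uv: "u \<in> V" "v \<in> V" "s = u @ v" "u \<noteq> []" "v \<noteq> []"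
      using closed_familyE assms(1) less.prems by blast
    obtain U where U: "U \<subseteq> V" "closed_family U" "u \<in> U" "finite U" "card U \<le> 2 * length u - 1"
      using less.hyps[of u] uv by auto
    obtain W where W: "W \<subseteq> V" "closed_family W" "v \<in> W" "finite W" "card W \<le> 2 * length v - 1"
      using less.hyps[of v] uv by auto
    have "card (insert s (U \<union> W)) \<le> Suc (card U + card W)"
      using card_Un_le[of U W] U(4) W(4) by (simp add: card_insert_if)
    also have "\<dots> \<le> 2 * length s - 1" using U(5) W(5) uv(3-5) by (cases u; cases v) auto
    finally show ?thesis
      using U W less.prems closed_family_insert_append[of U W u v] uv(3)
      by (intro exI[of _ "insert s (U \<union> W)"]) auto
  qed
qed

lemma closed_family_length_le:
  assumes "closed_family V" "finite V" "s \<in> V"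
  shows "length s \<le> 2 ^ card {t \<in> V. length t < length s}"
  using assms(3)
proof (induction "length s" arbitrary: s rule: less_induct)
  case less
  show ?case
  proof (cases "length s = 1")
    case True
    then show ?thesis by simp
  next
    case False
    then obtain u v where uv: "u \<in> V" "v \<in> V" "s = u @ v" "u \<noteq> []" "v \<noteq> []"
      using closed_familyE assms(1) less.prems by blast
    define y where "y = (if length v \<le> length u then u else v)"
    have y: "y \<in> V" "length y < length s" "length s \<le> 2 * length y" using uv by (auto simp: y_def)
    let ?shorter = "\<lambda>s. {t \<in> V. length t < length s}"
    have "card (insert y (?shorter y)) \<le> card (?shorter s)" using y assms(2) by (intro card_mono) auto
    then have "(2::nat) ^ Suc (card (?shorter y)) \<le> 2 ^ card (?shorter s)"
      using assms(2) by (intro power_increasing) auto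
    moreover have "length y \<le> 2 ^ card (?shorter y)" using less.hyps y by blast
    ultimately show ?thesis using y(3) by simp
  qed
qed

lemma closed_family_bit_length_le:
  assumes "closed_family V" "finite V" "s \<in> V"
  shows "bit_length (length s) \<le> card V"
proof -
  have "card {t \<in> V. length t < length s} < card V"
    using assms(2,3) by (intro psubset_card_mono) auto
  then have "(2::nat) ^ card {t \<in> V. length t < length s} < 2 ^ card V" by simp
  then have "length s < 2 ^ card V" using closed_family_length_le[OF assms] by linarith
  then show ?thesis by (simp add: bit_length_le_iff)
qed

section \<open>The strings derived by a straight-line program\<close>

lemma derive_step_context: "derive_step G x y \<Longrightarrow> derive_step G (p @ x @ q) (p @ y @ q)"
proof (induction rule: derive_step.induct)
  case (1 X rhs us vs)
  from derive_step.intros[OF this, of "p @ us" "vs @ q"] show ?case by simp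
qed

lemma derive_context: "(derive_step G)\<^sup>*\<^sup>* x y \<Longrightarrow> (derive_step G)\<^sup>*\<^sup>* (p @ x @ q) (p @ y @ q)"
  by (induction rule: rtranclp_induct) (auto intro: rtranclp.rtrancl_into_rtrancl derive_step_context)

lemma derive_step_rule: "(X, rhs) \<in> rules G \<Longrightarrow> derive_step G [Inl X] rhs"
  using derive_step.intros[of X rhs G "[]" "[]"] by simp

lemma derives_imp_rule:
  assumes "derives G X s" shows "\<exists>rhs. (X, rhs) \<in> rules G"
proof -
  have "[Inl X] \<noteq> map Inr s" by auto
  then obtain y where "derive_step G [Inl X] y"
    using assms unfolding derives_def by (meson converse_rtranclpE)
  then show ?thesis by (cases rule: derive_step.cases) (auto simp: Cons_eq_append_conv)
qed

lemma derives_terminal: "(X, [Inr a]) \<in> rules G \<Longrightarrow> derives G X [a]"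
  unfolding derives_def by (auto dest: derive_step_rule)

lemma derives_append:
  assumes "(X, [Inl Y, Inl Z]) \<in> rules G" "derives G Y s" "derives G Z t"
  shows "derives G X (s @ t)"
proof -
  have "derive_step G [Inl X] [Inl Y, Inl Z]" using assms(1) by (rule derive_step_rule)
  moreover have "(derive_step G)\<^sup>*\<^sup>* [Inl Y, Inl Z] (map Inr s @ [Inl Z])"
    using derive_context[of G "[Inl Y]" "map Inr s" "[]" "[Inl Z]"] assms(2) by (simp add: derives_def)
  moreover have "(derive_step G)\<^sup>*\<^sup>* (map Inr s @ [Inl Z]) (map Inr s @ map Inr t)"
    using derive_context[of G "[Inl Z]" "map Inr t" "map Inr s" "[]"] assms(3) by (simp add: derives_def)
  ultimately show ?thesis unfolding derives_def map_append
    by (meson converse_rtranclp_into_rtranclp rtranclp_trans)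
qed

lemma derives_nonempty:
  assumes "is_slp G" "derives G X s" shows "s \<noteq> []"
proof -
  have step: "y \<noteq> []" if "derive_step G x y" "x \<noteq> []" for x y
    using that assms(1) by (auto simp: is_slp_def elim!: derive_step.cases)
  have "(derive_step G)\<^sup>*\<^sup>* x y \<Longrightarrow> x \<noteq> [] \<Longrightarrow> y \<noteq> []" for x y
    by (induction rule: rtranclp_induct) (auto dest: step)
  then show ?thesis using assms(2) unfolding derives_def by (metis list.map_disc_iff list.distinct(1))
qed

definition derived_string :: "('v, 'a) cfg \<Rightarrow> 'v \<Rightarrow> 'a list" where
  "derived_string G X = (THE s. derives G X s)"

context
  fixes G :: "('v, 'a) cfg"
  assumes slp: "is_slp G"
begin

lemma derives_derived_string: "X \<in> variables G \<Longrightarrow> derives G X (derived_string G X)"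
  using slp unfolding is_slp_def derived_string_def by (blast intro: theI')

lemma derived_string_eq: "X \<in> variables G \<Longrightarrow> derives G X s \<Longrightarrow> derived_string G X = s"
  using slp derives_derived_string unfolding is_slp_def by blast

lemma finite_rules: "finite (rules G)"
  using slp by (simp add: is_slp_def)

lemma variables_subset: "variables G \<subseteq> fst ` rules G"
  using derives_derived_string derives_imp_rule by force

lemma finite_variables: "finite (variables G)"
  using finite_subset[OF variables_subset] finite_rules by simp

lemma card_variables_le: "card (variables G) \<le> slp_size G"
  unfolding slp_size_def using card_mono[OF _ variables_subset] card_image_le[OF finite_rules, of fst] finite_rules
  by (meson finite_imageI le_trans)

lemma closed_family_derived_strings: "closed_family (derived_string G ` variables G)"
  unfolding closed_family_def
proof (intro conjI ballI)
  show "[] \<notin> derived_string G ` variables G" using derives_nonempty[OF slp derives_derived_string] by force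
  fix s assume "s \<in> derived_string G ` variables G"
  then obtain X where X: "X \<in> variables G" "s = derived_string G X" by blast
  obtain rhs where rhs: "(X, rhs) \<in> rules G"
    using derives_imp_rule[OF derives_derived_string[OF X(1)]] by blast
  then consider (pair) Y Z where "rhs = [Inl Y, Inl Z]" | (terminal) a where "rhs = [Inr a]"
    using slp by (fastforce simp: is_slp_def)
  then show "length s = 1 \<or>
      (\<exists>u \<in> derived_string G ` variables G. \<exists>v \<in> derived_string G ` variables G. s = u @ v)"
  proof cases
    case pair
    have YZ: "Y \<in> variables G" "Z \<in> variables G" using rhs pair unfolding variables_def by force+
    then have "derives G X (derived_string G Y @ derived_string G Z)"
      using derives_append[OF _ derives_derived_string derives_derived_string] rhs pair by simp
    then show ?thesis using derived_string_eq X YZ by auto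
  next
    case terminal
    then show ?thesis using derives_terminal rhs derived_string_eq X by fastforce
  qed
qed

end

lemma slp_closed_family:
  assumes "slp_represents G S"
  obtains V where "closed_family V" "finite V" "S \<in> V" "card V \<le> slp_size G" "card V \<le> 2 * length S"
proof -
  have slp: "is_slp G" and S: "derives G (start G) S" using assms by (auto simp: slp_represents_def)
  let ?V = "derived_string G ` variables G"
  have "S \<in> ?V" using derived_string_eq[OF slp _ S] by (force simp: variables_def)
  then obtain V where V: "V \<subseteq> ?V" "closed_family V" "S \<in> V" "finite V" "card V \<le> 2 * length S - 1"
    using ex_small_closed_subfamily[OF closed_family_derived_strings[OF slp]] by blast
  have "card V \<le> card ?V" using V(1) finite_variables[OF slp] by (intro card_mono) auto
  also have "\<dots> \<le> slp_size G"
    using card_image_le[OF finite_variables[OF slp]] card_variables_le[OF slp] by (rule le_trans)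
  finally show thesis using that[OF V(2,4,3)] V(5) by linarith
qed

section \<open>Primes and hashes\<close>

text \<open>The identity 1/(m (n choose m)) = 1/(m (n-1 choose m)) - 1/((m+1) (n choose m+1)) of Leibniz' harmonic
  triangle, without denominators.\<close>

lemma leibniz_triangle:
  fixes m n :: nat
  assumes "0 < m" "m < n"
  defines "a \<equiv> int (m * ((n - 1) choose m))" and "b \<equiv> int (Suc m * (n choose Suc m))"
    and "c \<equiv> int (m * (n choose m))"
  shows "a * b = c * (b - a)"
proof -
  obtain k where n: "n = Suc k" using assms(2) by (cases n) auto
  have b: "b = int n * int (k choose m)"
    using Suc_times_binomial_eq[of k m] unfolding b_def n by (metis of_nat_mult mult.commute)
  have "int (n - m) * int (n choose m) = int n * int (k choose m)"
    using binomial_absorb_comp[of n m] n by (metis diff_Suc_1 of_nat_mult)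
  then have "int n * int (k choose m) = (int n - int m) * int (n choose m)"
    using assms(2) by (simp add: of_nat_diff)
  then have "int m * int (k choose m) * (int n * int (k choose m)) =
      int m * int (k choose m) * ((int n - int m) * int (n choose m))" by simp
  also have "\<dots> = int m * int (n choose m) * (int n * int (k choose m) - int m * int (k choose m))"
    by (simp add: algebra_simps)
  finally show ?thesis unfolding b by (simp add: a_def c_def n)
qed

lemma mult_choose_dvd_Lcm:
  "0 < m \<Longrightarrow> m \<le> n \<Longrightarrow> n \<le> N \<Longrightarrow> m * (n choose m) dvd Lcm {1..N}"
proof (induction "n - m" arbitrary: m n)
  case 0
  then show ?case by (auto intro: dvd_Lcm)
next
  case (Suc d)
  then have m: "0 < m" "m < n" by auto
  define a b c where "a = int (m * ((n - 1) choose m))" and "b = int (Suc m * (n choose Suc m))"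
    and "c = int (m * (n choose m))"
  have "m * ((n - 1) choose m) dvd Lcm {1..N}" "Suc m * (n choose Suc m) dvd Lcm {1..N}"
    using Suc.hyps(1)[of "n - 1" m] Suc.hyps(1)[of n "Suc m"] Suc.hyps(2) Suc.prems m by auto
  then have "a dvd int (Lcm {1..N})" "b dvd int (Lcm {1..N})"
    unfolding a_def b_def by (metis int_dvd_int_iff)+
  then obtain x y where xy: "int (Lcm {1..N}) = a * x" "int (Lcm {1..N}) = b * y" unfolding dvd_def by blast
  have "0 < m * ((n - 1) choose m)" "0 < Suc m * (n choose Suc m)"
    using m by (simp_all add: zero_less_binomial)
  then have "a * b \<noteq> 0" unfolding a_def b_def by (metis mult_eq_0_iff of_nat_eq_0_iff less_irrefl)
  moreover have "a * b * (c * (x - y)) = c * (b * (a * x) - a * (b * y))" by (simp add: algebra_simps)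
  moreover have "\<dots> = c * (b - a) * int (Lcm {1..N})" unfolding xy[symmetric] by (simp add: algebra_simps)
  moreover have "a * b = c * (b - a)" unfolding a_def b_def c_def using m by (rule leibniz_triangle)
  ultimately have "int (Lcm {1..N}) = c * (x - y)" by simp
  then show ?case unfolding c_def by (metis dvd_triv_left int_dvd_int_iff)
qed

lemma Lcm_atLeastAtMost_pos: "0 < Lcm {1..N::nat}"
  by (rule Nat.gr0I) (simp add: Lcm_0_iff_nat)

lemma two_power_le_Lcm:
  assumes "0 < n" shows "2 ^ (2 * n - 1) \<le> Lcm {1..2 * n}"
proof -
  have "n * (2 * n choose n) \<le> Lcm {1..2 * n}"
    using mult_choose_dvd_Lcm[of n "2 * n" "2 * n"] assms Lcm_atLeastAtMost_pos by (intro dvd_imp_le) auto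
  then have "real (n * (2 * n choose n)) \<le> real (Lcm {1..2 * n})" by (rule of_nat_mono)
  moreover have "4 ^ n \<le> 2 * real (n * (2 * n choose n))"
    using central_binomial_lower_bound[OF assms] assms by (simp add: field_simps)
  moreover have "(4::real) ^ n = 2 ^ (2 * n)" by (simp add: power_mult)
  moreover have "(2::real) ^ (2 * n) = 2 * real (2 ^ (2 * n - 1))" using assms by (simp flip: power_Suc)
  ultimately have "real (2 ^ (2 * n - 1)) \<le> real (Lcm {1..2 * n})" by linarith
  then show ?thesis by (simp only: of_nat_le_iff)
qed

lemma prime_power_dvd_Lcm_le:
  assumes "prime p" "p ^ k dvd Lcm {1..n::nat}" "0 < k"
  shows "p ^ k \<le> n"
  using assms(2)
proof (induction n)
  case 0
  then show ?case using assms by (auto simp: prime_gt_1_nat)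
next
  case (Suc n)
  have "{1..Suc n} = insert (Suc n) {1..n}" by auto
  then have Lcm_Suc: "Lcm {1..Suc n} = lcm (Suc n) (Lcm {1..n})" by simp
  have "lcm (Suc n) (Lcm {1..n}) \<noteq> 0" using Lcm_atLeastAtMost_pos[of n] by simp
  then have "k \<le> multiplicity p (lcm (Suc n) (Lcm {1..n}))"
    using Suc.prems assms Lcm_Suc by (intro multiplicity_geI) auto
  also have "\<dots> = max (multiplicity p (Suc n)) (multiplicity p (Lcm {1..n}))"
    using Lcm_atLeastAtMost_pos[of n] by (intro multiplicity_lcm) (use assms in auto)
  finally have "p ^ k dvd Suc n \<or> p ^ k dvd Lcm {1..n}"
    by (auto simp: le_max_iff_disj intro: multiplicity_dvd')
  then show ?case using Suc.IH by (auto dest: dvd_imp_le)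
qed

lemma Lcm_le_if_no_prime_between:
  assumes "\<And>p. prime p \<Longrightarrow> p \<le> m \<Longrightarrow> p \<le> (y::nat)" "0 < m"
  shows "Lcm {1..m} \<le> m ^ y"
proof -
  let ?L = "Lcm {1..m}"
  have "?L \<noteq> 0" using Lcm_atLeastAtMost_pos[of m] by linarith
  have factor: "p \<in> {1..y}" "p ^ multiplicity p ?L \<le> m" if "p \<in> prime_factors ?L" for p
  proof -
    have p: "prime p" "p dvd ?L" using that by auto
    then have "0 < multiplicity p ?L"
      using \<open>?L \<noteq> 0\<close> by (simp add: prime_multiplicity_gt_zero_iff)
    then show "p ^ multiplicity p ?L \<le> m" by (intro prime_power_dvd_Lcm_le[OF p(1)] multiplicity_dvd)
    have "p ^ 1 \<le> m" using p by (intro prime_power_dvd_Lcm_le[OF p(1)]) auto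
    then show "p \<in> {1..y}" using assms(1)[OF p(1)] prime_gt_0_nat[OF p(1)] by simp
  qed
  have "?L = (\<Prod>p \<in> prime_factors ?L. p ^ multiplicity p ?L)"
    by (rule prime_factorization_nat[OF Lcm_atLeastAtMost_pos])
  also have "\<dots> \<le> (\<Prod>p \<in> prime_factors ?L. m)" by (rule prod_mono) (use factor(2) in blast)
  also have "\<dots> = m ^ card (prime_factors ?L)" by simp
  also have "\<dots> \<le> m ^ y"
  proof (rule power_increasing)
    have "card (prime_factors ?L) \<le> card {1..y}" using factor(1) by (intro card_mono subsetI) blast+
    then show "card (prime_factors ?L) \<le> y" by simp
  qed (use assms(2) in simp)
  finally show ?thesis .
qed

lemma ex_prime_between_powers:
  assumes "3 \<le> e" shows "\<exists>p. prime p \<and> 2 ^ e < p \<and> p \<le> (2 ^ (2 * e) :: nat)"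
proof (rule ccontr)
  assume no_prime: "\<not> ?thesis"
  let ?m = "2 ^ (2 * e) :: nat" and ?y = "2 ^ e :: nat"
  have m: "?m = 2 * 2 ^ (2 * e - 1)" using assms by (simp flip: power_Suc)
  have "2 ^ (?m - 1) \<le> Lcm {1..?m}"
    using two_power_le_Lcm[of "2 ^ (2 * e - 1)"] unfolding m[symmetric] by simp
  also have "\<dots> \<le> ?m ^ ?y" using no_prime not_less by (intro Lcm_le_if_no_prime_between) auto
  also have "\<dots> = 2 ^ (2 * e * ?y)" by (simp add: power_mult)
  finally have upper: "?m - 1 \<le> 2 * e * ?y" by simp
  have e_less: "2 * e + 1 \<le> ?y" using assms by (induction e rule: dec_induct) auto
  then have "(2 * e + 1) * ?y \<le> ?y * ?y" by (rule mult_right_mono) simp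
  moreover have "?m = ?y * ?y" by (simp add: mult_2 power_add)
  moreover have "1 < ?y" using e_less assms by linarith
  ultimately show False using upper by (simp add: algebra_simps)
qed

lemma synthetic_div_not_all_dvd:
  fixes f :: "int poly"
  assumes "p dvd poly f a" "\<exists>i. \<not> p dvd coeff f i"
  shows "\<exists>i. \<not> p dvd coeff (synthetic_div f a) i"
proof (rule ccontr)
  assume "\<not> ?thesis"
  then have q: "p dvd coeff (synthetic_div f a) i" for i by blast
  have "f = [:-a, 1:] * synthetic_div f a + [:poly f a:]" using synthetic_div_correct'[of a f] by simp
  then have "p dvd coeff f i" for i
    by (rule ssubst) (use q assms(1) in \<open>auto simp: coeff_pCons split: nat.splits\<close>)
  then show False using assms(2) by blast
qed

lemma roots_mod_prime_subset:
  fixes f :: "int poly" and p :: int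
  assumes "prime p" "a \<in> {0..<p}" "p dvd poly f a"
  shows "{x \<in> {0..<p}. p dvd poly f x} \<subseteq> insert a {x \<in> {0..<p}. p dvd poly (synthetic_div f a) x}"
proof
  fix x assume x: "x \<in> {x \<in> {0..<p}. p dvd poly f x}"
  have "f = [:-a, 1:] * synthetic_div f a + [:poly f a:]" using synthetic_div_correct'[of a f] by simp
  from arg_cong[OF this, of "\<lambda>f. poly f x"]
  have "poly f x = (x - a) * poly (synthetic_div f a) x + poly f a" by (simp add: algebra_simps)
  then have "p dvd (x - a) * poly (synthetic_div f a) x" using x assms(3) by (simp add: dvd_add_left_iff)
  then consider (same) "p dvd x - a" | (root) "p dvd poly (synthetic_div f a) x"
    using assms(1) by (auto simp: prime_dvd_mult_iff)
  then show "x \<in> insert a {x \<in> {0..<p}. p dvd poly (synthetic_div f a) x}"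
  proof cases
    case same
    then have "x mod p = a mod p" by (simp add: mod_eq_dvd_iff)
    then show ?thesis using x assms(2) by simp
  qed (use x in auto)
qed

lemma card_roots_mod_prime:
  fixes f :: "int poly" and p :: int
  assumes "prime p" "degree f \<le> n" "\<exists>i. \<not> p dvd coeff f i"
  shows "card {x \<in> {0..<p}. p dvd poly f x} \<le> n"
  using assms(2,3)
proof (induction n arbitrary: f)
  case 0
  then obtain c where f: "f = [:c:]" by (metis degree_eq_zeroE le_zero_eq)
  obtain i where "\<not> p dvd coeff f i" using 0(2) by blast
  then have "\<not> p dvd c" unfolding f by (cases i) auto
  then have "{x \<in> {0..<p}. p dvd poly f x} = {}" by (simp add: f)
  then show ?case by (simp only: card.empty le0)
next
  case (Suc n)
  let ?roots = "\<lambda>f. {x \<in> {0..<p}. p dvd poly f x}"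
  show ?case
  proof (cases "\<exists>a \<in> {0..<p}. p dvd poly f a")
    case False
    then have "?roots f = {}" by auto
    then show ?thesis by (simp only: card.empty le0)
  next
    case True
    then obtain a where a: "a \<in> {0..<p}" "p dvd poly f a" by blast
    let ?q = "synthetic_div f a"
    have fin: "finite (?roots ?q)" by (rule finite_subset[of _ "{0..<p}"]) auto
    have "card (?roots f) \<le> card (insert a (?roots ?q))"
      using fin by (intro card_mono roots_mod_prime_subset assms(1) a) auto
    also have "\<dots> \<le> Suc (card (?roots ?q))" unfolding card_insert_if[OF fin] by simp
    also have "\<dots> \<le> Suc n"
      using Suc.IH[of ?q] synthetic_div_not_all_dvd[OF a(2) Suc.prems(2)] Suc.prems(1)
      by (simp add: degree_synthetic_div)
    finally show ?thesis .
  qed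
qed

primrec hash :: "('a \<Rightarrow> nat) \<Rightarrow> nat \<Rightarrow> 'a list \<Rightarrow> nat" where
  "hash c r [] = 0"
| "hash c r (x # u) = c x * r ^ length u + hash c r u"

lemma hash_append: "hash c r (u @ v) = hash c r u * r ^ length v + hash c r v"
  by (induction u) (auto simp: algebra_simps power_add)

definition hash_poly :: "('a \<Rightarrow> nat) \<Rightarrow> 'a list \<Rightarrow> int poly" where
  "hash_poly c u = Poly (rev (map (\<lambda>x. int (c x)) u))"

lemma poly_hash_poly: "poly (hash_poly c u) (int r) = int (hash c r u)"
  by (induction u) (auto simp: hash_poly_def Poly_snoc poly_monom)

lemma coeff_hash_poly: "coeff (hash_poly c u) i = (if i < length u then int (c (rev u ! i)) else 0)"
  by (simp add: hash_poly_def nth_default_def rev_map)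

lemma degree_hash_poly_diff:
  assumes "length u = length v" "length u \<le> n"
  shows "degree (hash_poly c u - hash_poly c v) \<le> n - 1"
proof (rule degree_le, intro allI impI)
  fix i assume "n - 1 < i"
  then have "length u \<le> i" using assms(2) by linarith
  then show "coeff (hash_poly c u - hash_poly c v) i = 0" using assms(1) by (simp add: coeff_hash_poly)
qed

lemma hash_poly_diff_not_all_dvd:
  assumes uv: "length u = length v" "u \<noteq> v"
    and c: "inj_on c (set u \<union> set v)" "\<And>x. x \<in> set u \<union> set v \<Longrightarrow> c x < p"
  shows "\<exists>i. \<not> int p dvd coeff (hash_poly c u - hash_poly c v) i"
proof -
  have "rev u \<noteq> rev v" using uv(2) by simp
  then obtain i where i: "i < length u" "rev u ! i \<noteq> rev v ! i"
    using uv(1) by (metis length_rev nth_equalityI)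
  have "rev u ! i \<in> set u" "rev v ! i \<in> set v"
    using i(1) uv(1) by (metis length_rev nth_mem set_rev)+
  then have "c (rev u ! i) \<noteq> c (rev v ! i)" "c (rev u ! i) < p" "c (rev v ! i) < p"
    using i(2) c inj_onD[OF c(1)] by auto
  then have "int (c (rev u ! i)) mod int p \<noteq> int (c (rev v ! i)) mod int p" by (simp flip: of_nat_mod)
  then have "\<not> int p dvd coeff (hash_poly c u - hash_poly c v) i"
    using i(1) uv(1) by (simp add: coeff_hash_poly mod_eq_dvd_iff)
  then show ?thesis by blast
qed

lemma card_collisions:
  assumes p: "prime p" and uv: "length u = length v" "u \<noteq> v" "length u \<le> n"
    and c: "inj_on c (set u \<union> set v)" "\<And>x. x \<in> set u \<union> set v \<Longrightarrow> c x < p"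
  shows "card {r \<in> {..<p}. hash c r u mod p = hash c r v mod p} \<le> n - 1"
proof -
  let ?collisions = "{r \<in> {..<p}. hash c r u mod p = hash c r v mod p}"
  let ?f = "hash_poly c u - hash_poly c v"
  let ?roots = "{x \<in> {0..<int p}. int p dvd poly ?f x}"
  have "int ` ?collisions \<subseteq> ?roots"
  proof safe
    fix r assume "hash c r u mod p = hash c r v mod p"
    then have "int (hash c r u) mod int p = int (hash c r v) mod int p" by (metis zmod_int)
    then show "int p dvd poly ?f (int r)" by (simp add: poly_hash_poly mod_eq_dvd_iff)
  qed auto
  then have "card (int ` ?collisions) \<le> card ?roots"
    by (intro card_mono finite_subset[of ?roots "{0..<int p}"]) auto
  also have "\<dots> \<le> n - 1"
    using p degree_hash_poly_diff[OF uv(1,3)] hash_poly_diff_not_all_dvd[OF uv(1,2) c]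
    by (intro card_roots_mod_prime) auto
  finally show ?thesis by (simp add: card_image)
qed

definition collision_free :: "('a \<Rightarrow> nat) \<Rightarrow> nat \<Rightarrow> nat \<Rightarrow> 'a list \<Rightarrow> bool" where
  "collision_free c r p S \<longleftrightarrow> (\<forall>i j d. i + d \<le> length S \<longrightarrow> j + d \<le> length S \<longrightarrow>
     hash c r (take d (drop i S)) mod p = hash c r (take d (drop j S)) mod p \<longrightarrow>
     take d (drop i S) = take d (drop j S))"

lemma ex_collision_free_base:
  assumes p: "prime p" and S: "S \<noteq> []" "length S ^ 4 < p"
    and c: "inj_on c (set S)" "\<And>x. x \<in> set S \<Longrightarrow> c x < p"
  shows "\<exists>r. 0 < r \<and> r < p \<and> collision_free c r p S"
proof (rule ccontr)
  assume no_base: "\<not> ?thesis"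
  define N where "N = length S"
  let ?sub = "\<lambda>i d. take d (drop i S)"
  let ?bad = "\<lambda>(i, j, d). {r \<in> {..<p}. hash c r (?sub i d) mod p = hash c r (?sub j d) mod p}"
  let ?I = "{(i, j, d) \<in> {..<N} \<times> {..<N} \<times> {1..N}. i + d \<le> N \<and> j + d \<le> N \<and> ?sub i d \<noteq> ?sub j d}"
  have fin: "finite ?I" by (rule finite_subset[of _ "{..<N} \<times> {..<N} \<times> {1..N}"]) auto
  have "card ?I \<le> card ({..<N} \<times> {..<N} \<times> {1..N})" by (rule card_mono) auto
  then have card_I: "card ?I \<le> N ^ 3" by (simp add: card_cartesian_product power3_eq_cube)
  have card_bad: "card (?bad ijd) \<le> N - 1" if ijd: "ijd \<in> ?I" for ijd
  proof -
    obtain i j d where [simp]: "ijd = (i, j, d)" by (cases ijd)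
    have sub: "set (?sub i d) \<union> set (?sub j d) \<subseteq> set S" by (meson in_set_dropD in_set_takeD subsetI Un_iff)
    have "card {r \<in> {..<p}. hash c r (?sub i d) mod p = hash c r (?sub j d) mod p} \<le> N - 1"
    proof (rule card_collisions[OF p])
      show "inj_on c (set (?sub i d) \<union> set (?sub j d))" using c(1) sub by (rule inj_on_subset)
      show "\<And>x. x \<in> set (?sub i d) \<union> set (?sub j d) \<Longrightarrow> c x < p" using c(2) sub by blast
    qed (use ijd in \<open>auto simp: N_def\<close>)
    then show ?thesis by simp
  qed
  have "{1..<p} \<subseteq> (\<Union>ijd \<in> ?I. ?bad ijd)"
  proof
    fix r assume r: "r \<in> {1..<p}"
    then obtain i j d where ijd: "i + d \<le> N" "j + d \<le> N" "?sub i d \<noteq> ?sub j d"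
      "hash c r (?sub i d) mod p = hash c r (?sub j d) mod p"
      using no_base unfolding collision_free_def N_def by auto
    then have "(i, j, d) \<in> ?I" by (cases "d = 0") auto
    then show "r \<in> (\<Union>ijd \<in> ?I. ?bad ijd)" by (rule UN_I) (use r ijd(4) in simp)
  qed
  then have "card {1..<p} \<le> card (\<Union>ijd \<in> ?I. ?bad ijd)" using fin by (intro card_mono) auto
  also have "\<dots> \<le> (\<Sum>ijd \<in> ?I. card (?bad ijd))" by (rule card_UN_le[OF fin])
  also have "\<dots> \<le> card ?I * (N - 1)" using sum_bounded_above[of ?I "\<lambda>ijd. card (?bad ijd)"] card_bad by simp
  also have "\<dots> \<le> N ^ 3 * (N - 1)" using card_I by (rule mult_right_mono) simp
  also have "\<dots> = N ^ 4 - N ^ 3" by (simp add: power4_eq_xxxx power3_eq_cube diff_mult_distrib2)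
  finally have "p - 1 \<le> N ^ 4 - N ^ 3" by simp
  moreover have "1 \<le> N" using S(1) by (simp add: N_def Suc_le_eq)
  then have "1 \<le> N ^ 3" "N ^ 3 \<le> N ^ 4" by (auto intro: power_increasing)
  ultimately show False using S(2) unfolding N_def by linarith
qed

section \<open>Total correctness with time bounds\<close>

definition runs :: "nat \<Rightarrow> prog \<Rightarrow> state \<Rightarrow> nat \<Rightarrow> (state \<Rightarrow> bool) \<Rightarrow> bool" where
  "runs w p s T Q \<longleftrightarrow> (\<exists>t s'. exec w p s t s' \<and> t \<le> T \<and> Q s')"

lemma runs_mono: "runs w p s T Q \<Longrightarrow> T \<le> T' \<Longrightarrow> (\<And>s. Q s \<Longrightarrow> Q' s) \<Longrightarrow> runs w p s T' Q'"
  unfolding runs_def by (meson le_trans)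

lemma runsI: "exec w p s t s' \<Longrightarrow> t \<le> T \<Longrightarrow> Q s' \<Longrightarrow> runs w p s T Q"
  unfolding runs_def by blast

primrec block :: "prog list \<Rightarrow> prog" where
  "block [] = Skip"
| "block (p # ps) = Seq p (block ps)"

declare block.simps [simp del]

lemma runs_block_Nil [simp]: "runs w (block []) s T Q \<longleftrightarrow> Q s"
proof
  show "runs w (block []) s T Q \<Longrightarrow> Q s" unfolding runs_def block.simps by (blast elim: exec_elims(1))
  show "Q s \<Longrightarrow> runs w (block []) s T Q" unfolding block.simps by (rule runsI[OF exec.Skip]) auto
qed

lemma runs_block_Cons:
  "runs w (block (p # ps)) s T Q \<longleftrightarrow> (\<exists>t s'. exec w p s t s' \<and> t \<le> T \<and> runs w (block ps) s' (T - t) Q)"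
proof
  assume "runs w (block (p # ps)) s T Q"
  then obtain t u where u: "exec w (Seq p (block ps)) s t u" "t \<le> T" "Q u"
    unfolding block.simps runs_def by blast
  from u(1) obtain t1 t2 s' where "exec w p s t1 s'" "exec w (block ps) s' t2 u" "t = t1 + t2"
    by (rule exec_elims(6)) blast
  moreover from this have "runs w (block ps) s' (T - t1) Q" "t1 \<le> T"
    using u(2,3) by (auto intro: runsI)
  ultimately show "\<exists>t s'. exec w p s t s' \<and> t \<le> T \<and> runs w (block ps) s' (T - t) Q" by blast
next
  assume "\<exists>t s'. exec w p s t s' \<and> t \<le> T \<and> runs w (block ps) s' (T - t) Q"
  then obtain t s' t' u where run: "exec w p s t s'" "exec w (block ps) s' t' u" "t \<le> T" "t' \<le> T - t" "Q u"
    unfolding runs_def by blast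
  then show "runs w (block (p # ps)) s T Q"
    unfolding block.simps by (intro runsI[OF exec.Seq[OF run(1,2)]]) auto
qed

lemma runs_block_step:
  assumes "exec w i s 1 s'"
  shows "runs w (block (i # ps)) s T Q \<longleftrightarrow> 0 < T \<and> runs w (block ps) s' (T - 1) Q"
proof
  assume "runs w (block (i # ps)) s T Q"
  then obtain t u where "exec w i s t u" "t \<le> T" "runs w (block ps) u (T - t) Q"
    unfolding runs_block_Cons by blast
  with exec_deterministic[OF assms] show "0 < T \<and> runs w (block ps) s' (T - 1) Q" by fastforce
next
  assume "0 < T \<and> runs w (block ps) s' (T - 1) Q"
  with assms show "runs w (block (i # ps)) s T Q"
    unfolding runs_block_Cons by (intro exI[of _ 1] exI[of _ s']) simp
qed

lemma runs_Const [simp]: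
  "runs w (block (Const a k # ps)) (r, m) T Q \<longleftrightarrow> 0 < T \<and> runs w (block ps) (r(a := k mod 2 ^ w), m) (T - 1) Q"
  by (rule runs_block_step) (rule exec.Const)

lemma runs_Op [simp]:
  "runs w (block (Op f a b c # ps)) (r, m) T Q \<longleftrightarrow>
    0 < T \<and> runs w (block ps) (r(a := binop_val w f (r b) (r c)), m) (T - 1) Q"
  by (rule runs_block_step) (rule exec.Op)

lemma runs_Load:
  "r b < length m \<Longrightarrow> runs w (block (Load a b # ps)) (r, m) T Q \<longleftrightarrow>
    0 < T \<and> runs w (block ps) (r(a := m ! r b), m) (T - 1) Q"
  by (rule runs_block_step) (rule exec.Load)

lemma runs_Store:
  "r a < length m \<Longrightarrow> runs w (block (Store a b # ps)) (r, m) T Q \<longleftrightarrow>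
    0 < T \<and> runs w (block ps) (r, m[r a := r b]) (T - 1) Q"
  by (rule runs_block_step) (rule exec.Store)

lemma runs_nested_block: "runs w (block (xs @ ps)) s T Q \<Longrightarrow> runs w (block (block xs # ps)) s T Q"
proof (induction xs arbitrary: s T)
  case Nil
  then show ?case
    unfolding runs_block_Cons[of _ "block []"]
    by (intro exI[of _ 0] exI[of _ s]) (simp add: block.simps(1) exec.Skip)
next
  case (Cons x xs)
  then obtain t1 s1 where x: "exec w x s t1 s1" "t1 \<le> T" "runs w (block (block xs # ps)) s1 (T - t1) Q"
    unfolding append_Cons runs_block_Cons[of _ x] by blast
  then obtain t2 s2 where xs: "exec w (block xs) s1 t2 s2" "t2 \<le> T - t1"
    "runs w (block ps) s2 (T - t1 - t2) Q"
    unfolding runs_block_Cons by blast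
  have "exec w (block (x # xs)) s (t1 + t2) s2" unfolding block.simps by (rule exec.Seq[OF x(1) xs(1)])
  then show ?case
    unfolding runs_block_Cons[of _ "block (x # xs)"]
    using x(2) xs(2,3) by (intro exI[of _ "t1 + t2"] exI[of _ s2]) simp
qed

lemma runs_Cond:
  assumes "0 < T" "cmp_val c (fst s) \<Longrightarrow> runs w (block (xs @ ps)) s (T - 1) Q"
    "\<not> cmp_val c (fst s) \<Longrightarrow> runs w (block (ys @ ps)) s (T - 1) Q"
  shows "runs w (block (Cond c (block xs) (block ys) # ps)) s T Q"
proof -
  have "\<exists>t s'. exec w (Cond c (block xs) (block ys)) s (Suc t) s' \<and> t \<le> T - 1 \<and> runs w (block ps) s' (T - 1 - t) Q"
    using runs_nested_block[OF assms(2)] runs_nested_block[OF assms(3)] unfolding runs_block_Cons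
    by (cases "cmp_val c (fst s)") (blast intro: exec.CondTrue exec.CondFalse)+
  then obtain t s' where "exec w (Cond c (block xs) (block ys)) s (Suc t) s'" "t \<le> T - 1"
    "runs w (block ps) s' (T - 1 - t) Q" by blast
  then show ?thesis unfolding runs_block_Cons using assms(1) by (intro exI[of _ "Suc t"] exI[of _ s']) auto
qed

lemma runs_While_budget:
  assumes "I r m n"
    and step: "\<And>r m n. I r m n \<Longrightarrow> cmp_val c r \<Longrightarrow>
      \<exists>k. runs w p (r, m) k (\<lambda>(r', m'). \<exists>n'. I r' m' n' \<and> Suc k + n' \<le> n)"
    and exit: "\<And>r m n. I r m n \<Longrightarrow> \<not> cmp_val c r \<Longrightarrow> 0 < n \<and> runs w (block ps) (r, m) T Q"
    and "n + T \<le> T'"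
  shows "runs w (block (While c p # ps)) (r, m) T' Q"
  using assms(1,4)
proof (induction n arbitrary: r m T' rule: less_induct)
  case (less n)
  show ?case
  proof (cases "cmp_val c r")
    case False
    then have "exec w (While c p) (r, m) 1 (r, m)" by (intro exec.WhileFalse) simp
    moreover have "runs w (block ps) (r, m) (T' - 1) Q" "1 \<le> T'"
      using exit[OF less.prems(1) False] less.prems(2) by (auto elim: runs_mono)
    ultimately show ?thesis unfolding runs_block_Cons by blast
  next
    case True
    then obtain k t r1 m1 n1 where body: "exec w p (r, m) t (r1, m1)" "t \<le> k" "I r1 m1 n1" "Suc k + n1 \<le> n"
      using step[OF less.prems(1)] unfolding runs_def by blast
    have "runs w (block (While c p # ps)) (r1, m1) (T' - Suc t) Q"
      by (rule less.IH[OF _ body(3)]) (use body less.prems(2) in auto)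
    then obtain t' s' where rest: "exec w (While c p) (r1, m1) t' s'" "t' \<le> T' - Suc t"
      "runs w (block ps) s' (T' - Suc t - t') Q" unfolding runs_block_Cons by blast
    have "exec w (While c p) (r, m) (Suc (t + t')) s'"
      using True body(1) rest(1) by (intro exec.WhileTrue) auto
    moreover have "Suc (t + t') \<le> T'" using body less.prems(2) rest(2) by linarith
    ultimately show ?thesis unfolding runs_block_Cons
      using rest(3) by (intro exI[of _ "Suc (t + t')"] exI[of _ s']) auto
  qed
qed

lemma runs_While:
  assumes "I r m n"
    and step: "\<And>r m n. I r m n \<Longrightarrow> cmp_val c r \<Longrightarrow> runs w p (r, m) k (\<lambda>(r', m'). \<exists>n' < n. I r' m' n')"
    and "\<And>r m n. I r m n \<Longrightarrow> \<not> cmp_val c r \<Longrightarrow> runs w (block ps) (r, m) T Q"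
    and "Suc (n * Suc k) + T \<le> T'"
  shows "runs w (block (While c p # ps)) (r, m) T' Q"
proof (rule runs_While_budget[where I = "\<lambda>r m b. \<exists>n. I r m n \<and> b = Suc (n * Suc k)"])
  fix r m b assume "\<exists>n. I r m n \<and> b = Suc (n * Suc k)" and c: "cmp_val c r"
  then obtain n where n: "I r m n" "b = Suc (n * Suc k)" by blast
  have "runs w p (r, m) k (\<lambda>(r', m'). \<exists>b'. (\<exists>n. I r' m' n \<and> b' = Suc (n * Suc k)) \<and> Suc k + b' \<le> b)"
  proof (rule runs_mono[OF step[OF n(1) c] order_refl])
    fix s assume "case s of (r', m') \<Rightarrow> \<exists>n' < n. I r' m' n'"
    then obtain r' m' n' where s: "s = (r', m')" "I r' m' n'" "n' < n" by (cases s) auto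
    then have "Suc n' * Suc k \<le> n * Suc k" by (intro mult_right_mono) auto
    then show "case s of (r', m') \<Rightarrow> \<exists>b'. (\<exists>n. I r' m' n \<and> b' = Suc (n * Suc k)) \<and> Suc k + b' \<le> b"
      using s n(2) by auto
  qed
  then show "\<exists>k'. runs w p (r, m) k' (\<lambda>(r', m'). \<exists>b'. (\<exists>n. I r' m' n \<and> b' = Suc (n * Suc k)) \<and> Suc k' + b' \<le> b)"
    by blast
qed (use assms in auto)

lemma binop_val_less: "x < 2 ^ w \<Longrightarrow> y < 2 ^ w \<Longrightarrow> binop_val w f x y < 2 ^ w"
proof (cases "f \<in> {And, Or, Xor}")
  case True
  then show "x < 2 ^ w \<Longrightarrow> y < 2 ^ w \<Longrightarrow> binop_val w f x y < 2 ^ w"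
    by (auto simp flip: take_bit_nat_eq_self_iff)
next
  case False
  then show "x < 2 ^ w \<Longrightarrow> y < 2 ^ w \<Longrightarrow> binop_val w f x y < 2 ^ w"
    by (cases f) (auto simp: drop_bit_eq_div
      intro: le_less_trans[OF div_le_dividend] le_less_trans[OF mod_less_eq_dividend])
qed

definition word_state :: "nat \<Rightarrow> state \<Rightarrow> bool" where
  "word_state w = (\<lambda>(r, m). (\<forall>a. r a < 2 ^ w) \<and> (\<forall>x \<in> set m. x < 2 ^ w))"

lemma exec_word_state: "exec w p s t s' \<Longrightarrow> word_state w s \<Longrightarrow> word_state w s'"
proof (induction rule: exec.induct)
  case (Store r a m b)
  then show ?case using set_update_subset_insert[of m "r a" "r b"] by (auto simp: word_state_def)
qed (auto simp: word_state_def binop_val_less)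

definition reg_frame :: "reg set \<Rightarrow> (reg \<Rightarrow> nat) \<Rightarrow> (reg \<Rightarrow> nat) \<Rightarrow> bool" where
  "reg_frame X r r' \<longleftrightarrow> (\<forall>a. a \<notin> X \<longrightarrow> r' a = r a)"

lemma reg_frameD: "reg_frame X r r' \<Longrightarrow> a \<notin> X \<Longrightarrow> r' a = r a"
  by (simp add: reg_frame_def)

lemma reg_frame_refl [simp]: "reg_frame X r r"
  by (simp add: reg_frame_def)

lemma reg_frame_trans: "reg_frame X r r' \<Longrightarrow> reg_frame Y r' r'' \<Longrightarrow> X \<subseteq> Z \<Longrightarrow> Y \<subseteq> Z \<Longrightarrow> reg_frame Z r r''"
  unfolding reg_frame_def by (metis subsetD)

lemma reg_frame_mono: "reg_frame X r r' \<Longrightarrow> X \<subseteq> Y \<Longrightarrow> reg_frame Y r r'"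
  by (auto simp: reg_frame_def)

lemma reg_frame_update [simp]: "a \<in> X \<Longrightarrow> reg_frame X r (r'(a := v)) \<longleftrightarrow> reg_frame X r r'"
  by (auto simp: reg_frame_def)

definition mem_frame :: "nat set \<Rightarrow> nat list \<Rightarrow> nat list \<Rightarrow> bool" where
  "mem_frame X m m' \<longleftrightarrow> length m' = length m \<and> (\<forall>a. a \<notin> X \<longrightarrow> m' ! a = m ! a)"

lemma mem_frame_length: "mem_frame X m m' \<Longrightarrow> length m' = length m"
  by (simp add: mem_frame_def)

lemma mem_frameD: "mem_frame X m m' \<Longrightarrow> a \<notin> X \<Longrightarrow> m' ! a = m ! a"
  by (simp add: mem_frame_def)

lemma mem_frame_refl [simp]: "mem_frame X m m"
  by (simp add: mem_frame_def)

lemma mem_frame_trans: "mem_frame X m m' \<Longrightarrow> mem_frame Y m' m'' \<Longrightarrow> X \<subseteq> Z \<Longrightarrow> Y \<subseteq> Z \<Longrightarrow> mem_frame Z m m''"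
  unfolding mem_frame_def by (metis subsetD)

lemma mem_frame_mono: "mem_frame X m m' \<Longrightarrow> X \<subseteq> Y \<Longrightarrow> mem_frame Y m m'"
  by (auto simp: mem_frame_def)

lemma mem_frame_update [simp]: "a \<in> X \<Longrightarrow> mem_frame X m (m'[a := v]) \<longleftrightarrow> mem_frame X m m'"
  unfolding mem_frame_def by (metis length_list_update nth_list_update_neq)

definition segment :: "nat list \<Rightarrow> nat \<Rightarrow> nat \<Rightarrow> nat list" where
  "segment m a n = map (\<lambda>i. m ! (a + i)) [0..<n]"

lemma length_segment [simp]: "length (segment m a n) = n"
  by (simp add: segment_def)

lemma segment_0 [simp]: "segment m a 0 = []"
  by (simp add: segment_def)

lemma segment_Suc: "segment m a (Suc n) = m ! a # segment m (Suc a) n"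
  unfolding segment_def upt_conv_Cons[OF zero_less_Suc] map_Suc_upt[symmetric] by simp

lemma segment_eqI: "length ds = n \<Longrightarrow> (\<And>i. i < n \<Longrightarrow> m ! (a + i) = ds ! i) \<Longrightarrow> segment m a n = ds"
  by (rule nth_equalityI) (auto simp: segment_def)

lemma segment_cong: "(\<And>i. i < n \<Longrightarrow> m' ! (a + i) = m ! (a + i)) \<Longrightarrow> segment m' a n = segment m a n"
  by (simp add: segment_def)

lemma segment_mem_frame: "mem_frame X m m' \<Longrightarrow> {a..<a + n} \<inter> X = {} \<Longrightarrow> segment m' a n = segment m a n"
  by (rule segment_cong, rule mem_frameD) (auto simp: disjoint_iff)

section \<open>Registers\<close>

text \<open>
  Registers 2 to 8 and 35 to 43 do not change after the setup of a query, and those from 50 on are scratch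
  space of the arithmetic, with the digits of a product from 100 on. When prefixes of the windows are
  compared, \<open>r_skip\<close> holds their length.
\<close>

abbreviation (input) r_answer :: reg where "r_answer \<equiv> 0"
abbreviation (input) r_arg :: reg where "r_arg \<equiv> 1"
abbreviation (input) r_one :: reg where "r_one \<equiv> 2"
abbreviation (input) r_base :: reg where "r_base \<equiv> 3"
abbreviation (input) r_inv :: reg where "r_inv \<equiv> 4"
abbreviation (input) r_root :: reg where "r_root \<equiv> 5"
abbreviation (input) r_i :: reg where "r_i \<equiv> 6"
abbreviation (input) r_j :: reg where "r_j \<equiv> 7"
abbreviation (input) r_room :: reg where "r_room \<equiv> 8"
abbreviation (input) r_guess :: reg where "r_guess \<equiv> 9"
abbreviation (input) r_equal :: reg where "r_equal \<equiv> 10"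
abbreviation (input) r_window :: reg where "r_window \<equiv> 11"
abbreviation (input) r_low :: reg where "r_low \<equiv> 12"
abbreviation (input) r_high :: reg where "r_high \<equiv> 13"
abbreviation (input) r_middle :: reg where "r_middle \<equiv> 14"
abbreviation (input) r_items :: reg where "r_items \<equiv> 15"
abbreviation (input) r_count :: reg where "r_count \<equiv> 16"
abbreviation (input) r_count_i :: reg where "r_count_i \<equiv> 17"
abbreviation (input) r_count_j :: reg where "r_count_j \<equiv> 18"
abbreviation (input) r_skip :: reg where "r_skip \<equiv> 19"
abbreviation (input) r_rest :: reg where "r_rest \<equiv> 20"
abbreviation (input) r_top :: reg where "r_top \<equiv> 21"
abbreviation (input) r_node :: reg where "r_node \<equiv> 22"
abbreviation (input) r_len :: reg where "r_len \<equiv> 23"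
abbreviation (input) r_item :: reg where "r_item \<equiv> 24"
abbreviation (input) r_total :: reg where "r_total \<equiv> 25"
abbreviation (input) r_temp :: reg where "r_temp \<equiv> 26"
abbreviation (input) r_temp2 :: reg where "r_temp2 \<equiv> 27"
abbreviation (input) r_first :: reg where "r_first \<equiv> 28"
abbreviation (input) r_last :: reg where "r_last \<equiv> 29"
abbreviation (input) r_probe :: reg where "r_probe \<equiv> 30"
abbreviation (input) r_hash_in :: reg where "r_hash_in \<equiv> 31"
abbreviation (input) r_hash_node :: reg where "r_hash_node \<equiv> 32"
abbreviation (input) r_hash_out :: reg where "r_hash_out \<equiv> 33"
abbreviation (input) r_acc :: reg where "r_acc \<equiv> 34"
abbreviation (input) r_zero :: reg where "r_zero \<equiv> 35"
abbreviation (input) r_item_size :: reg where "r_item_size \<equiv> 36"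
abbreviation (input) r_stack :: reg where "r_stack \<equiv> 37"
abbreviation (input) r_items_i :: reg where "r_items_i \<equiv> 38"
abbreviation (input) r_items_j :: reg where "r_items_j \<equiv> 39"
abbreviation (input) r_acc_i :: reg where "r_acc_i \<equiv> 40"
abbreviation (input) r_acc_j :: reg where "r_acc_j \<equiv> 41"
abbreviation (input) r_sqrt :: reg where "r_sqrt \<equiv> 42"
abbreviation (input) r_length :: reg where "r_length \<equiv> 43"
abbreviation (input) r_done :: reg where "r_done \<equiv> 44"
abbreviation (input) r_next :: reg where "r_next \<equiv> 45"
abbreviation (input) r_digit :: reg where "r_digit \<equiv> 50"
abbreviation (input) r_src :: reg where "r_src \<equiv> 51"
abbreviation (input) r_mult :: reg where "r_mult \<equiv> 52"
abbreviation (input) r_carry :: reg where "r_carry \<equiv> 53"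
abbreviation (input) r_left :: reg where "r_left \<equiv> 54"
abbreviation (input) r_right :: reg where "r_right \<equiv> 55"
abbreviation (input) r_dst :: reg where "r_dst \<equiv> 56"
abbreviation (input) r_offset :: reg where "r_offset \<equiv> 57"
abbreviation (input) r_flag :: reg where "r_flag \<equiv> 58"
abbreviation (input) r_word :: reg where "r_word \<equiv> 59"
abbreviation (input) r_word2 :: reg where "r_word2 \<equiv> 60"
abbreviation (input) r_ptr :: reg where "r_ptr \<equiv> 61"
abbreviation (input) r_ptr2 :: reg where "r_ptr2 \<equiv> 62"

abbreviation scratch :: "reg set" where "scratch \<equiv> {50..}"

abbreviation Move :: "reg \<Rightarrow> reg \<Rightarrow> prog" where "Move a b \<equiv> Op Add a b r_zero"

lemma sub_word: "y \<le> x \<Longrightarrow> x < 2 ^ w \<Longrightarrow> binop_val w Sub x y = x - y"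
proof -
  assume "y \<le> x" "x < 2 ^ w"
  then have "x + (2 ^ w - y) = (x - y) + 2 ^ w" "x - y < 2 ^ w" by linarith+
  then show "binop_val w Sub x y = x - y" by (simp only: binop_val.simps mod_add_self2 mod_less)
qed

section \<open>Arithmetic on digits\<close>

abbreviation digits_val :: "nat \<Rightarrow> nat list \<Rightarrow> nat" where "digits_val b \<equiv> horner_sum (\<lambda>d. d) b"

lemma digits_val_inj:
  assumes "length xs = length ys" "\<forall>d \<in> set xs. d < b" "\<forall>d \<in> set ys. d < b"
    "digits_val b xs = digits_val b ys"
  shows "xs = ys"
  using assms
proof (induction xs ys rule: list_induct2)
  case (Cons x xs y ys)
  have eq: "x + b * digits_val b xs = y + b * digits_val b ys" and less: "x < b" "y < b"
    using Cons.prems by auto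
  have "x = y" using arg_cong[OF eq, of "\<lambda>n. n mod b"] less by simp
  then show ?case using Cons eq less by auto
qed simp

definition digits :: "nat \<Rightarrow> nat \<Rightarrow> nat \<Rightarrow> nat list" where
  "digits b n x = map (\<lambda>i. x div b ^ i mod b) [0..<n]"

lemma length_digits [simp]: "length (digits b n x) = n"
  by (simp add: digits_def)

lemma digits_less: "0 < b \<Longrightarrow> d \<in> set (digits b n x) \<Longrightarrow> d < b"
  by (auto simp: digits_def)

lemma digits_val_digits: "x < b ^ n \<Longrightarrow> digits_val b (digits b n x) = x"
proof (induction n arbitrary: x)
  case (Suc n)
  have "digits b (Suc n) x = x mod b # digits b n (x div b)"
    unfolding digits_def upt_conv_Cons[OF zero_less_Suc] map_Suc_upt[symmetric]
    by (simp add: div_mult2_eq)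
  moreover have "x div b < b ^ n" using Suc.prems by (simp add: less_mult_imp_div_less mult.commute)
  ultimately show ?case using Suc.IH by simp
qed (simp add: digits_def)

lemma digit_step_less:
  assumes "x < b" "y < b" "t < b" "c < (b::nat)" shows "x * y + t + c < b * b"
proof -
  obtain k where b: "b = Suc k" using assms by (cases b) auto
  have "x * y \<le> k * k" using assms b by (intro mult_le_mono) auto
  moreover have "t \<le> k" "c \<le> k" using assms b by auto
  ultimately show ?thesis using b by simp
qed

primrec add_multiple :: "reg list \<Rightarrow> prog list" where
  "add_multiple [] = []"
| "add_multiple (t # ts) = [Load r_digit r_src, Op Mult r_digit r_digit r_mult, Op Add r_digit r_digit t,
     Op Add r_digit r_digit r_carry, Op Mod t r_digit r_base, Op Div r_carry r_digit r_base,
     Op Add r_src r_src r_one] @ add_multiple ts"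

lemma runs_add_multiple_Cons:
  assumes "r r_base = \<beta>" "r r_one = 1" "\<beta> * \<beta> \<le> 2 ^ w" "length m \<le> 2 ^ w" "r r_src + 1 < length m"
    "100 \<le> t" "m ! r r_src < \<beta>" "r r_mult < \<beta>" "r t < \<beta>" "r r_carry < \<beta>"
  defines "u \<equiv> m ! r r_src * r r_mult + r t + r r_carry"
  assumes "runs w (block (add_multiple ts @ ps))
    (r(r_digit := u, t := u mod \<beta>, r_carry := u div \<beta>, r_src := r r_src + 1), m) T Q" "7 + T \<le> T'"
  shows "runs w (block (add_multiple (t # ts) @ ps)) (r, m) T' Q"
proof -
  have "u < \<beta> * \<beta>" unfolding u_def using assms by (intro digit_step_less) auto
  then have "m ! r r_src * r r_mult mod 2 ^ w = m ! r r_src * r r_mult"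
    "(m ! r r_src * r r_mult + r t) mod 2 ^ w = m ! r r_src * r r_mult + r t" "u mod 2 ^ w = u"
    "(r r_src + 1) mod 2 ^ w = r r_src + 1"
    unfolding u_def using assms(3-5) by auto
  moreover have "51 \<noteq> t" "52 \<noteq> t" "53 \<noteq> t" "2 \<noteq> t" "3 \<noteq> t" "50 \<noteq> t" using assms(6) by auto
  ultimately have "runs w (block (add_multiple (t # ts) @ ps)) (r, m) (7 + T) Q"
    using assms(1,2,5,12) by (simp add: runs_Load u_def)
  then show ?thesis using assms(13) by (rule runs_mono) auto
qed

lemma runs_add_multiple:
  assumes "r r_base = \<beta>" "r r_one = 1" "0 < \<beta>" "\<beta> * \<beta> \<le> 2 ^ w" "length m \<le> 2 ^ w"
    "r r_src + length ts < length m"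
    "distinct ts" "\<forall>t \<in> set ts. 100 \<le> t \<and> r t < \<beta>" "r r_mult < \<beta>" "r r_carry < \<beta>"
    "\<forall>d \<in> set (segment m (r r_src) (length ts)). d < \<beta>"
    and "\<And>r'. digits_val \<beta> (map r' ts) + \<beta> ^ length ts * r' r_carry =
        digits_val \<beta> (map r ts) + r r_mult * digits_val \<beta> (segment m (r r_src) (length ts)) + r r_carry \<Longrightarrow>
      \<forall>t \<in> set ts. r' t < \<beta> \<Longrightarrow> reg_frame ({r_digit, r_src, r_carry} \<union> set ts) r r' \<Longrightarrow>
      runs w (block ps) (r', m) T Q"
    and "7 * length ts + T \<le> T'"
  shows "runs w (block (add_multiple ts @ ps)) (r, m) T' Q"
  using assms
proof (induction ts arbitrary: r T')
  case Nil
  then have "runs w (block ps) (r, m) T Q" by simp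
  then show ?case using Nil.prems(13) by (auto elim: runs_mono)
next
  case (Cons t ts)
  let ?u = "m ! r r_src * r r_mult + r t + r r_carry"
  let ?r = "r(r_digit := ?u, t := ?u mod \<beta>, r_carry := ?u div \<beta>, r_src := r r_src + 1)"
  have t: "100 \<le> t" "r t < \<beta>" "t \<notin> set ts" and word: "m ! r r_src < \<beta>"
    using Cons.prems by (auto simp: segment_Suc)
  then have "?u div \<beta> < \<beta>"
    using digit_step_less[of "m ! r r_src" \<beta> "r r_mult" "r t" "r r_carry"] Cons.prems(3,9,10)
    by (simp add: div_less_iff_less_mult)
  have map_ts: "map ?r ts = map r ts" using Cons.prems(8) t by auto
  show ?case
  proof (rule runs_add_multiple_Cons[OF Cons.prems(1,2,4,5) _ t(1) word Cons.prems(9) t(2) Cons.prems(10)])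
    show "runs w (block (add_multiple ts @ ps)) (?r, m) (7 * length ts + T) Q"
    proof (rule Cons.IH)
      show "\<forall>d \<in> set (segment m (?r r_src) (length ts)). d < \<beta>"
        using Cons.prems(11) t(1) by (simp add: segment_Suc)
      show "\<forall>t' \<in> set ts. 100 \<le> t' \<and> ?r t' < \<beta>" using Cons.prems(8) map_ts by (simp add: map_eq_conv)
      fix r' assume val: "digits_val \<beta> (map r' ts) + \<beta> ^ length ts * r' r_carry = digits_val \<beta> (map ?r ts) +
          ?r r_mult * digits_val \<beta> (segment m (?r r_src) (length ts)) + ?r r_carry"
        and digits: "\<forall>t \<in> set ts. r' t < \<beta>" and frame: "reg_frame ({r_digit, r_src, r_carry} \<union> set ts) ?r r'"
      have r't: "r' t = ?u mod \<beta>" using reg_frameD[OF frame, of t] t by auto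
      have "digits_val \<beta> (map r' (t # ts)) + \<beta> ^ length (t # ts) * r' r_carry =
          ?u mod \<beta> + \<beta> * (digits_val \<beta> (map r' ts) + \<beta> ^ length ts * r' r_carry)"
        by (simp add: r't algebra_simps)
      also have "\<dots> = (?u mod \<beta> + \<beta> * (?u div \<beta>)) +
          \<beta> * (digits_val \<beta> (map r ts) + r r_mult * digits_val \<beta> (segment m (Suc (r r_src)) (length ts)))"
        unfolding val map_ts using t(1) by (simp add: algebra_simps)
      finally have "digits_val \<beta> (map r' (t # ts)) + \<beta> ^ length (t # ts) * r' r_carry =
          digits_val \<beta> (map r (t # ts)) + r r_mult * digits_val \<beta> (segment m (r r_src) (length (t # ts))) + r r_carry"
        by (simp add: segment_Suc algebra_simps)
      moreover have "reg_frame ({r_digit, r_src, r_carry} \<union> set (t # ts)) r r'"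
        by (rule reg_frame_trans[OF _ frame, of "{r_digit, t, r_src, r_carry}"]) auto
      ultimately show "runs w (block ps) (r', m) T Q"
        using Cons.prems(3) digits r't by (intro Cons.prems(12)) auto
    qed (use Cons.prems t \<open>?u div \<beta> < \<beta>\<close> in auto)
  qed (use Cons.prems in auto)
qed

section \<open>Arithmetic modulo a prime\<close>

text \<open>
  Residues modulo \<open>P\<close> are stored as digits in a base \<open>\<beta>\<close> of half the word length and multiplied by
  Montgomery's method, as the word RAM has no double-word product. Since \<open>P \<le> \<beta> ^ 16\<close>, 18 digits leave
  room for the carries.
\<close>

definition ndigits :: nat where "ndigits = 18"

lemma ndigits_pos [simp]: "0 < ndigits"
  by (simp add: ndigits_def)

definition digit_regs :: "nat \<Rightarrow> reg list" where "digit_regs i = [100 + i..<100 + i + ndigits]"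

lemma length_digit_regs [simp]: "length (digit_regs i) = ndigits"
  and distinct_digit_regs [simp]: "distinct (digit_regs i)"
  and set_digit_regs: "set (digit_regs i) = {100 + i..<100 + i + ndigits}"
  by (auto simp: digit_regs_def)

lemma digit_regs_Cons: "digit_regs i = (100 + i) # [100 + Suc i..<100 + i + ndigits]"
  unfolding digit_regs_def by (subst upt_conv_Cons) auto

lemma digit_regs_snoc: "digit_regs (Suc i) = [100 + Suc i..<100 + i + ndigits] @ [100 + i + ndigits]"
proof -
  have succ: "100 + Suc i + ndigits = Suc (100 + i + ndigits)" by simp
  show ?thesis unfolding digit_regs_def succ using ndigits_pos by (intro upt_Suc_append) linarith
qed

definition modulus_addr :: nat where "modulus_addr = 10"
definition unit_addr :: nat where "unit_addr = modulus_addr + ndigits"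

definition add_product :: "nat \<Rightarrow> prog list" where
  "add_product i = [Const (100 + i + ndigits) 0, Load r_mult r_left, Op Add r_left r_left r_one,
     Move r_src r_right, Const r_carry 0] @ add_multiple (digit_regs i)"

definition shift_digits :: "nat \<Rightarrow> prog list" where
  "shift_digits i = [Op Mult r_mult (100 + i) r_inv, Op Mod r_mult r_mult r_base, Const r_src modulus_addr,
     Const r_carry 0] @ add_multiple (digit_regs i)"

primrec multiply_digits :: "nat \<Rightarrow> nat \<Rightarrow> prog list" where
  "multiply_digits i 0 = []"
| "multiply_digits i (Suc n) = add_product i @ shift_digits i @ multiply_digits (Suc i) n"

definition clear :: "reg list \<Rightarrow> prog list" where "clear as = map (\<lambda>a. Const a 0) as"

primrec store_regs :: "reg list \<Rightarrow> prog list" where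
  "store_regs [] = []"
| "store_regs (a # as) = [Store r_dst a, Op Add r_dst r_dst r_one] @ store_regs as"

definition multiply :: "prog list" where
  "multiply = clear (digit_regs 0) @ multiply_digits 0 ndigits"

definition store_product :: "prog list" where
  "store_product = [Move r_dst r_hash_out] @ store_regs (digit_regs ndigits)"

lemma runs_clear:
  assumes "\<And>r'. \<forall>a \<in> set as. r' a = 0 \<Longrightarrow> reg_frame (set as) r r' \<Longrightarrow> runs w (block ps) (r', m) T Q"
    and "length as + T \<le> T'"
  shows "runs w (block (clear as @ ps)) (r, m) T' Q"
  using assms
proof (induction as arbitrary: r T')
  case Nil
  then have "runs w (block ps) (r, m) T Q" by simp
  then show ?case using Nil.prems(2) by (auto simp: clear_def elim: runs_mono)
next
  case (Cons a as)
  have "runs w (block (clear as @ ps)) (r(a := 0), m) (T' - 1) Q"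
  proof (rule Cons.IH)
    fix r' assume zero: "\<forall>a \<in> set as. r' a = 0" and frame: "reg_frame (set as) (r(a := 0)) r'"
    from zero reg_frameD[OF frame, of a] have "\<forall>a \<in> set (a # as). r' a = 0" by auto
    moreover have "reg_frame (set (a # as)) r r'" by (rule reg_frame_trans[OF _ frame, of "{a}"]) auto
    ultimately show "runs w (block ps) (r', m) T Q" by (rule Cons.prems(1))
  qed (use Cons.prems(2) in simp)
  with Cons.prems(2) show ?case by (simp add: clear_def)
qed

lemma runs_store_regs:
  assumes "r r_one = 1" "r r_dst + length as < length m" "length m \<le> 2 ^ w" "r_dst \<notin> set as"
    and "\<And>r' m'. segment m' (r r_dst) (length as) = map r as \<Longrightarrow>
      mem_frame {r r_dst..<r r_dst + length as} m m' \<Longrightarrow> reg_frame {r_dst} r r' \<Longrightarrow> runs w (block ps) (r', m') T Q"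
    and "2 * length as + T \<le> T'"
  shows "runs w (block (store_regs as @ ps)) (r, m) T' Q"
  using assms
proof (induction as arbitrary: r m T')
  case Nil
  then have "runs w (block ps) (r, m) T Q" by simp
  then show ?case using Nil.prems(6) by (auto elim: runs_mono)
next
  case (Cons a as)
  let ?m = "m[r r_dst := r a]" and ?r = "r(r_dst := r r_dst + 1)"
  have "runs w (block (store_regs as @ ps)) (?r, ?m) (2 * length as + T) Q"
  proof (rule Cons.IH)
    fix r' m' assume seg: "segment m' (?r r_dst) (length as) = map ?r as"
      and memory: "mem_frame {?r r_dst..<?r r_dst + length as} ?m m'" and regs: "reg_frame {r_dst} ?r r'"
    have "m' ! r r_dst = r a" using mem_frameD[OF memory, of "r r_dst"] Cons.prems(2) by simp
    moreover have "map ?r as = map r as" using Cons.prems(4) by auto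
    ultimately have "segment m' (r r_dst) (length (a # as)) = map r (a # as)"
      using seg by (simp add: segment_Suc)
    moreover have "mem_frame {r r_dst..<r r_dst + length (a # as)} m m'"
      by (rule mem_frame_trans[OF _ memory, of "{r r_dst}"]) auto
    moreover have "reg_frame {r_dst} r r'" by (rule reg_frame_trans[OF _ regs, of "{r_dst}"]) auto
    ultimately show "runs w (block ps) (r', m') T Q" by (rule Cons.prems(5))
  qed (use Cons.prems in auto)
  then have "runs w (block (store_regs (a # as) @ ps)) (r, m) (2 + (2 * length as + T)) Q"
    using Cons.prems(1-4) by (simp add: runs_Store)
  then show ?case using Cons.prems(6) by (auto elim: runs_mono)
qed

definition multiply_time :: nat where "multiply_time = ndigits + ndigits * (9 + 14 * ndigits)"

locale montgomery =
  fixes w \<beta> P pinv :: nat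
  assumes base_ge_2: "2 \<le> \<beta>" and base_square_le: "\<beta> * \<beta> \<le> 2 ^ w"
    and modulus_gt_1: "1 < P" and modulus_le: "4 * P \<le> \<beta> ^ (ndigits - 1)"
    and inverse: "(P * pinv + 1) mod \<beta> = 0" and inverse_less: "pinv < \<beta>"
begin

lemma base_pos [simp]: "0 < \<beta>"
  using base_ge_2 by simp

lemma capacity: "4 * (\<beta> * P) \<le> \<beta> ^ ndigits"
proof -
  have "\<beta> * (4 * P) \<le> \<beta> * \<beta> ^ (ndigits - 1)" using modulus_le by (rule mult_left_mono) simp
  also have "\<dots> = \<beta> ^ ndigits" by (simp flip: power_Suc)
  finally show ?thesis by simp
qed

definition reduce :: "nat \<Rightarrow> nat" where
  "reduce v = (v + v mod \<beta> * pinv mod \<beta> * P) div \<beta>"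

lemma base_mult_reduce: "\<beta> * reduce v = v + v mod \<beta> * pinv mod \<beta> * P"
proof -
  let ?d = "v mod \<beta>"
  have "(v + ?d * pinv mod \<beta> * P) mod \<beta> = (?d + ?d * pinv * P) mod \<beta>"
    by (metis mod_add_eq mod_mod_trivial mod_mult_left_eq)
  also have "\<dots> = ?d * (P * pinv + 1) mod \<beta>" by (simp add: algebra_simps)
  also have "\<dots> = 0" using inverse by (metis mod_mult_right_eq mult_0_right mod_0)
  finally show ?thesis unfolding reduce_def using mult_div_mod_eq[of \<beta>] by (metis add.right_neutral)
qed

primrec product :: "nat \<Rightarrow> nat list \<Rightarrow> nat \<Rightarrow> nat" where
  "product b [] v = v"
| "product b (x # xs) v = product b xs (reduce (v + x * b))"

lemma digit_products_less:
  assumes "v < 2 * P" "x < \<beta>" "b \<le> P" "q < \<beta>"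
  shows "v + x * b + q * P < 2 * (\<beta> * P)" and "v + x * b + q * P < \<beta> ^ ndigits"
proof -
  obtain k where k: "\<beta> = Suc k" using base_pos by (cases \<beta>) auto
  have "x * b \<le> k * P" "q * P \<le> k * P" using assms k by (auto intro!: mult_le_mono simp del: mult_le_cancel2)
  then show "v + x * b + q * P < 2 * (\<beta> * P)"
    using assms(1) unfolding k mult_Suc add_mult_distrib2 by linarith
  then show "v + x * b + q * P < \<beta> ^ ndigits" using capacity by linarith
qed

lemma reduce_less: "v < 2 * P \<Longrightarrow> x < \<beta> \<Longrightarrow> b \<le> P \<Longrightarrow> reduce (v + x * b) < 2 * P"
proof -
  assume "v < 2 * P" "x < \<beta>" "b \<le> P"
  then have "\<beta> * reduce (v + x * b) < \<beta> * (2 * P)"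
    unfolding base_mult_reduce using digit_products_less(1)[of v x b "(v + x * b) mod \<beta> * pinv mod \<beta>"]
    by (simp add: mult.left_commute)
  then show ?thesis by simp
qed

lemma product_less: "v < 2 * P \<Longrightarrow> b \<le> P \<Longrightarrow> \<forall>x \<in> set xs. x < \<beta> \<Longrightarrow> product b xs v < 2 * P"
  by (induction xs arbitrary: v) (auto simp: reduce_less)

lemma product_eq:
  "\<exists>q < \<beta> ^ length xs. \<beta> ^ length xs * product b xs v = v + digits_val \<beta> xs * b + q * P"
proof (induction xs arbitrary: v)
  case (Cons x xs)
  let ?v = "v + x * b"
  obtain q where q: "q < \<beta> ^ length xs"
    "\<beta> ^ length xs * product b xs (reduce ?v) = reduce ?v + digits_val \<beta> xs * b + q * P"
    using Cons.IH by blast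
  let ?q = "?v mod \<beta> * pinv mod \<beta> + \<beta> * q"
  have "\<beta> ^ length (x # xs) * product b (x # xs) v = \<beta> * reduce ?v + \<beta> * (digits_val \<beta> xs * b + q * P)"
    using q(2) by (simp add: algebra_simps)
  also have "\<dots> = v + digits_val \<beta> (x # xs) * b + ?q * P"
    unfolding base_mult_reduce by (simp add: algebra_simps)
  finally have "\<beta> ^ length (x # xs) * product b (x # xs) v = v + digits_val \<beta> (x # xs) * b + ?q * P" .
  moreover have "?q < \<beta> ^ length (x # xs)"
  proof -
    have "\<beta> * Suc q \<le> \<beta> ^ length (x # xs)" using q(1) by (simp del: mult_Suc_right)
    moreover have "?v mod \<beta> * pinv mod \<beta> < \<beta>" by simp
    ultimately show ?thesis unfolding mult_Suc_right by linarith
  qed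
  ultimately show ?case by blast
qed simp

definition holds :: "nat \<Rightarrow> (reg \<Rightarrow> nat) \<Rightarrow> nat \<Rightarrow> bool" where
  "holds i r v \<longleftrightarrow> digits_val \<beta> (map r (digit_regs i)) = v \<and> (\<forall>a \<in> set (digit_regs i). r a < \<beta>)"

lemma holds_cong: "(\<And>a. a \<in> set (digit_regs i) \<Longrightarrow> r' a = r a) \<Longrightarrow> holds i r v \<Longrightarrow> holds i r' v"
  unfolding holds_def by (auto cong: map_cong)

lemma holds_low_digit: "holds i r v \<Longrightarrow> r (100 + i) = v mod \<beta>"
  by (auto simp: holds_def digit_regs_Cons)

lemma holds_shift:
  assumes "holds i r (\<beta> * v)" "r (100 + i + ndigits) = 0"
  shows "holds (Suc i) r v"
proof -
  have "r (100 + i) = 0" using holds_low_digit[OF assms(1)] by simp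
  with assms base_pos show ?thesis
    by (auto simp: holds_def digit_regs_Cons[of i] digit_regs_snoc horner_sum_append)
qed

definition arithmetic_regs :: "(reg \<Rightarrow> nat) \<Rightarrow> bool" where
  "arithmetic_regs r \<longleftrightarrow> r r_one = 1 \<and> r r_base = \<beta> \<and> r r_inv = pinv \<and> r r_zero = 0"

definition number :: "nat list \<Rightarrow> nat \<Rightarrow> bool" where
  "number m a \<longleftrightarrow> a + ndigits < length m \<and> (\<forall>d \<in> set (segment m a ndigits). d < \<beta>)"

abbreviation val :: "nat list \<Rightarrow> nat \<Rightarrow> nat" where "val m a \<equiv> digits_val \<beta> (segment m a ndigits)"

definition arithmetic_mem :: "nat list \<Rightarrow> bool" where
  "arithmetic_mem m \<longleftrightarrow> length m \<le> 2 ^ w \<and> 200 < length m \<and>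
    number m modulus_addr \<and> val m modulus_addr = P \<and> number m unit_addr \<and> val m unit_addr = 1"

lemma number_mem_frame:
  assumes "number m a" "mem_frame X m m'" "{a..<a + ndigits} \<inter> X = {}"
  shows "number m' a" "val m' a = val m a"
  using assms segment_mem_frame[OF assms(2,3)] by (auto simp: number_def mem_frame_length)

lemma arithmetic_regs_frame: "arithmetic_regs r \<Longrightarrow> reg_frame X r r' \<Longrightarrow> X \<inter> {2, 3, 4, 35} = {} \<Longrightarrow> arithmetic_regs r'"
  unfolding arithmetic_regs_def reg_frame_def by (auto simp: disjoint_iff)

lemma runs_add_to_digits:
  assumes "arithmetic_regs r" "length m \<le> 2 ^ w" "holds i r v" "number m (r r_src)" "r r_mult < \<beta>"
    "r r_carry = 0"
    "v + r r_mult * val m (r r_src) < \<beta> ^ ndigits"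
    and "\<And>r'. holds i r' (v + r r_mult * val m (r r_src)) \<Longrightarrow>
      reg_frame ({r_digit, r_src, r_carry} \<union> set (digit_regs i)) r r' \<Longrightarrow> runs w (block ps) (r', m) T Q"
    and "7 * ndigits + T \<le> T'"
  shows "runs w (block (add_multiple (digit_regs i) @ ps)) (r, m) T' Q"
proof (rule runs_add_multiple)
  fix r' assume sum: "digits_val \<beta> (map r' (digit_regs i)) + \<beta> ^ length (digit_regs i) * r' r_carry =
      digits_val \<beta> (map r (digit_regs i)) + r r_mult * digits_val \<beta> (segment m (r r_src) (length (digit_regs i))) + r r_carry"
    and less: "\<forall>a \<in> set (digit_regs i). r' a < \<beta>"
    and frame: "reg_frame ({r_digit, r_src, r_carry} \<union> set (digit_regs i)) r r'"
  let ?v = "v + r r_mult * val m (r r_src)"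
  have sum: "digits_val \<beta> (map r' (digit_regs i)) + \<beta> ^ ndigits * r' r_carry = ?v"
    using sum assms(3,6) by (simp add: holds_def)
  then have "r' r_carry = 0" using assms(7) by (cases "r' r_carry") auto
  with sum less have "holds i r' ?v" by (simp add: holds_def)
  then show "runs w (block ps) (r', m) T Q" using frame by (rule assms(8))
qed (use assms base_square_le in \<open>auto simp: arithmetic_regs_def holds_def number_def set_digit_regs\<close>)

lemma runs_add_product:
  assumes "arithmetic_regs r" "arithmetic_mem m" "holds i r v" "r r_left + 1 < length m"
    "number m (r r_right)"
    "m ! r r_left < \<beta>" "v + m ! r r_left * val m (r r_right) < \<beta> ^ ndigits"
    and "\<And>r'. holds i r' (v + m ! r r_left * val m (r r_right)) \<Longrightarrow> r' (100 + i + ndigits) = 0 \<Longrightarrow>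
      r' r_left = r r_left + 1 \<Longrightarrow> reg_frame ({50..54} \<union> {100..}) r r' \<Longrightarrow> runs w (block ps) (r', m) T Q"
    and "5 + 7 * ndigits + T \<le> T'"
  shows "runs w (block (add_product i @ ps)) (r, m) T' Q"
proof -
  let ?r = "r(100 + i + ndigits := 0, r_mult := m ! r r_left, r_left := r r_left + 1, r_src := r r_right, r_carry := 0)"
  have "runs w (block (add_multiple (digit_regs i) @ ps)) (?r, m) (7 * ndigits + T) Q"
  proof (rule runs_add_to_digits)
    show "holds i ?r v" by (rule holds_cong[OF _ assms(3)]) (simp add: set_digit_regs)
    fix r' assume digits: "holds i r' (v + ?r r_mult * val m (?r r_src))"
      and frame: "reg_frame ({r_digit, r_src, r_carry} \<union> set (digit_regs i)) ?r r'"
    show "runs w (block ps) (r', m) T Q"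
    proof (rule assms(8))
      show "r' (100 + i + ndigits) = 0" "r' r_left = r r_left + 1"
        using frame by (simp_all add: reg_frameD set_digit_regs)
      show "reg_frame ({50..54} \<union> {100..}) r r'"
        by (rule reg_frame_trans[OF _ frame, of "{50..54} \<union> {100..}"]) (auto simp: set_digit_regs)
    qed (use digits in simp)
  qed (use assms in \<open>auto simp: arithmetic_regs_def arithmetic_mem_def\<close>)
  moreover have "r r_left + 1 < 2 ^ w" "r r_right < 2 ^ w"
    using assms(2,4,5) by (auto simp: arithmetic_mem_def number_def)
  ultimately have "runs w (block (add_product i @ ps)) (r, m) (5 + (7 * ndigits + T)) Q"
    unfolding add_product_def using assms(1,4) by (simp add: runs_Load arithmetic_regs_def)
  then show ?thesis by (rule runs_mono) (use assms(9) in auto)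
qed

lemma runs_shift_digits:
  assumes "arithmetic_regs r" "arithmetic_mem m" "holds i r v" "r (100 + i + ndigits) = 0"
    "v + \<beta> * P \<le> \<beta> ^ ndigits"
    and "\<And>r'. holds (Suc i) r' (reduce v) \<Longrightarrow> reg_frame ({50..53} \<union> {100..}) r r' \<Longrightarrow> runs w (block ps) (r', m) T Q"
    and "4 + 7 * ndigits + T \<le> T'"
  shows "runs w (block (shift_digits i @ ps)) (r, m) T' Q"
proof -
  let ?q = "v mod \<beta> * pinv mod \<beta>"
  let ?r = "r(r_mult := ?q, r_src := modulus_addr, r_carry := 0)"
  have "runs w (block (add_multiple (digit_regs i) @ ps)) (?r, m) (7 * ndigits + T) Q"
  proof (rule runs_add_to_digits)
    show "holds i ?r v" by (rule holds_cong[OF _ assms(3)]) (simp add: set_digit_regs)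
    have "?q * P < \<beta> * P" using modulus_gt_1 by (intro mult_strict_right_mono) auto
    with assms(5) have "v + ?q * P < \<beta> ^ ndigits" by linarith
    then show "v + ?r r_mult * val m (?r r_src) < \<beta> ^ ndigits"
      using assms(2) by (simp add: arithmetic_mem_def)
    fix r' assume digits: "holds i r' (v + ?r r_mult * val m (?r r_src))"
      and frame: "reg_frame ({r_digit, r_src, r_carry} \<union> set (digit_regs i)) ?r r'"
    show "runs w (block ps) (r', m) T Q"
    proof (rule assms(6)[OF holds_shift])
      show "holds i r' (\<beta> * reduce v)"
        using digits assms(2) unfolding base_mult_reduce by (simp add: arithmetic_mem_def)
      show "r' (100 + i + ndigits) = 0" using frame assms(4) by (simp add: reg_frameD set_digit_regs)
      show "reg_frame ({50..53} \<union> {100..}) r r'"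
        by (rule reg_frame_trans[OF _ frame, of "{50..53}"]) (auto simp: set_digit_regs)
    qed
  qed (use assms in \<open>auto simp: arithmetic_regs_def arithmetic_mem_def\<close>)
  moreover have "v mod \<beta> * pinv < 2 ^ w"
    using mult_strict_mono'[of "v mod \<beta>" \<beta> pinv \<beta>] inverse_less base_square_le by simp
  moreover have "modulus_addr < 2 ^ w" using assms(2) by (simp add: arithmetic_mem_def modulus_addr_def)
  ultimately have "runs w (block (shift_digits i @ ps)) (r, m) (4 + (7 * ndigits + T)) Q"
    unfolding shift_digits_def using assms(1) holds_low_digit[OF assms(3)] by (simp add: arithmetic_regs_def)
  then show ?thesis by (rule runs_mono) (use assms(7) in auto)
qed

lemma runs_multiply_digits:
  assumes "arithmetic_regs r" "arithmetic_mem m" "holds i r v" "v < 2 * P" "r r_left + n < length m"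
    "\<forall>d \<in> set (segment m (r r_left) n). d < \<beta>" "number m (r r_right)" "val m (r r_right) \<le> P"
    and "\<And>r'. holds (i + n) r' (product (val m (r r_right)) (segment m (r r_left) n) v) \<Longrightarrow>
      reg_frame ({50..54} \<union> {100..}) r r' \<Longrightarrow> runs w (block ps) (r', m) T Q"
    and "n * (9 + 14 * ndigits) + T \<le> T'"
  shows "runs w (block (multiply_digits i n @ ps)) (r, m) T' Q"
  using assms
proof (induction n arbitrary: i r v T')
  case 0
  then have "runs w (block ps) (r, m) T Q" by simp
  then show ?case using 0(10) by (auto elim: runs_mono)
next
  case (Suc n)
  let ?b = "val m (r r_right)" and ?x = "m ! r r_left"
  let ?F = "{50..54} \<union> {100..}"
  have x: "?x < \<beta>" using Suc.prems(6) by (simp add: segment_Suc)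
  have less: "v + ?x * ?b + (\<beta> - 1) * P < \<beta> ^ ndigits" "v + ?x * ?b < 2 * (\<beta> * P)"
    using digit_products_less[OF Suc.prems(4) x Suc.prems(8)] base_pos by (fastforce dest: add_lessD1)+
  show ?case unfolding multiply_digits.simps append_assoc
  proof (rule runs_add_product[OF Suc.prems(1-3) _ Suc.prems(7) x])
    fix r1 assume r1: "holds i r1 (v + ?x * ?b)" "r1 (100 + i + ndigits) = 0" "r1 r_left = r r_left + 1"
      and frame1: "reg_frame ?F r r1"
    show "runs w (block (shift_digits i @ multiply_digits (Suc i) n @ ps)) (r1, m)
        (4 + 7 * ndigits + (n * (9 + 14 * ndigits) + T)) Q"
    proof (rule runs_shift_digits[OF _ Suc.prems(2) r1(1,2)])
      show "arithmetic_regs r1" by (rule arithmetic_regs_frame[OF Suc.prems(1) frame1]) auto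
      fix r2 assume r2: "holds (Suc i) r2 (reduce (v + ?x * ?b))"
        and frame2: "reg_frame ({50..53} \<union> {100..}) r1 r2"
      have frame: "reg_frame ?F r r2" by (rule reg_frame_trans[OF frame1 frame2]) auto
      then have r2_regs: "r2 r_right = r r_right" "r2 r_left = Suc (r r_left)"
        using reg_frameD[OF frame2, of r_left] r1(3) by (auto simp: reg_frameD)
      show "runs w (block (multiply_digits (Suc i) n @ ps)) (r2, m) (n * (9 + 14 * ndigits) + T) Q"
      proof (rule Suc.IH[OF _ Suc.prems(2) r2])
        show "arithmetic_regs r2" by (rule arithmetic_regs_frame[OF Suc.prems(1) frame]) auto
        show "reduce (v + ?x * ?b) < 2 * P" by (rule reduce_less[OF Suc.prems(4) x Suc.prems(8)])
        fix r' assume "holds (Suc i + n) r' (product (val m (r2 r_right)) (segment m (r2 r_left) n) (reduce (v + ?x * ?b)))"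
          "reg_frame ?F r2 r'"
        then show "runs w (block ps) (r', m) T Q"
          using frame by (intro Suc.prems(9)) (auto simp: r2_regs segment_Suc elim: reg_frame_trans)
      qed (use Suc.prems in \<open>auto simp: r2_regs segment_Suc\<close>)
    qed (use less capacity in auto)
  qed (use Suc.prems less in auto)
qed

lemma runs_multiply:
  assumes "arithmetic_regs r" "arithmetic_mem m" "number m (r r_left)" "number m (r r_right)"
    "val m (r r_right) \<le> P"
    and "\<And>r' v q. holds ndigits r' v \<Longrightarrow> \<beta> ^ ndigits * v = val m (r r_left) * val m (r r_right) + q * P \<Longrightarrow>
      q < \<beta> ^ ndigits \<Longrightarrow> v < 2 * P \<Longrightarrow> reg_frame ({50..54} \<union> {100..}) r r' \<Longrightarrow> runs w (block ps) (r', m) T Q"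
    and "multiply_time + T \<le> T'"
  shows "runs w (block (multiply @ ps)) (r, m) T' Q"
  unfolding multiply_def append_assoc
proof (rule runs_clear)
  fix r1 assume zero: "\<forall>a \<in> set (digit_regs 0). r1 a = 0" and frame: "reg_frame (set (digit_regs 0)) r r1"
  have r1_regs: "r1 r_left = r r_left" "r1 r_right = r r_right"
    using frame by (simp_all add: reg_frameD set_digit_regs)
  let ?xs = "segment m (r r_left) ndigits" and ?b = "val m (r r_right)"
  let ?v = "product ?b ?xs 0"
  have less: "\<forall>d \<in> set ?xs. d < \<beta>" using assms(3) by (simp add: number_def)
  show "runs w (block (multiply_digits 0 ndigits @ ps)) (r1, m) (ndigits * (9 + 14 * ndigits) + T) Q"
  proof (rule runs_multiply_digits)
    show "arithmetic_regs r1" by (rule arithmetic_regs_frame[OF assms(1) frame]) (auto simp: set_digit_regs)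
    have "digits_val \<beta> (map r1 (digit_regs 0)) = 0" using zero by (simp add: horner_sum_eq_sum)
    then show "holds 0 r1 0" using zero by (simp add: holds_def)
    fix r' assume "holds (0 + ndigits) r' (product (val m (r1 r_right)) (segment m (r1 r_left) ndigits) 0)"
      and frame': "reg_frame ({50..54} \<union> {100..}) r1 r'"
    then have "holds ndigits r' ?v" by (simp add: r1_regs)
    moreover obtain q where "q < \<beta> ^ ndigits" "\<beta> ^ ndigits * ?v = digits_val \<beta> ?xs * ?b + q * P"
      using product_eq[of ?xs ?b 0] by auto
    moreover have "?v < 2 * P" by (rule product_less[OF _ assms(5) less]) (use modulus_gt_1 in simp)
    moreover have "reg_frame ({50..54} \<union> {100..}) r r'"
      by (rule reg_frame_trans[OF frame frame']) (auto simp: set_digit_regs)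
    ultimately show "runs w (block ps) (r', m) T Q" by (intro assms(6))
  qed (use assms less modulus_gt_1 in \<open>auto simp: r1_regs number_def\<close>)
qed (use assms(7) in \<open>simp add: multiply_time_def\<close>)

lemma runs_store_product:
  assumes "arithmetic_regs r" "length m \<le> 2 ^ w" "holds ndigits r v" "r r_hash_out + ndigits < length m"
    and "\<And>r' m'. number m' (r r_hash_out) \<Longrightarrow> val m' (r r_hash_out) = v \<Longrightarrow>
      mem_frame {r r_hash_out..<r r_hash_out + ndigits} m m' \<Longrightarrow> reg_frame {r_dst} r r' \<Longrightarrow> runs w (block ps) (r', m') T Q"
    and "1 + 2 * ndigits + T \<le> T'"
  shows "runs w (block (store_product @ ps)) (r, m) T' Q"
proof -
  let ?r = "r(r_dst := r r_hash_out)"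
  have regs: "map ?r (digit_regs ndigits) = map r (digit_regs ndigits)" by (simp add: set_digit_regs)
  have "runs w (block (store_regs (digit_regs ndigits) @ ps)) (?r, m) (2 * ndigits + T) Q"
  proof (rule runs_store_regs)
    fix r' m' assume seg: "segment m' (?r r_dst) (length (digit_regs ndigits)) = map ?r (digit_regs ndigits)"
      and memory: "mem_frame {?r r_dst..<?r r_dst + length (digit_regs ndigits)} m m'"
      and frame: "reg_frame {r_dst} ?r r'"
    have seg: "segment m' (r r_hash_out) ndigits = map r (digit_regs ndigits)" using seg regs by simp
    show "runs w (block ps) (r', m') T Q"
    proof (rule assms(5))
      show "number m' (r r_hash_out)" "val m' (r r_hash_out) = v"
        using assms(3,4) mem_frame_length[OF memory] by (auto simp: number_def holds_def seg)
      show "reg_frame {r_dst} r r'" by (rule reg_frame_trans[OF _ frame, of "{r_dst}"]) auto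
    qed (use memory in simp)
  qed (use assms in \<open>auto simp: arithmetic_regs_def set_digit_regs\<close>)
  then have "runs w (block (store_product @ ps)) (r, m) (1 + (2 * ndigits + T)) Q"
    unfolding store_product_def using assms(1,2,4) by (simp add: arithmetic_regs_def)
  then show ?thesis by (rule runs_mono) (use assms(6) in auto)
qed

end

primrec copy_words :: "nat \<Rightarrow> prog list" where
  "copy_words 0 = []"
| "copy_words (Suc n) = [Load r_word r_ptr, Store r_ptr2 r_word, Op Add r_ptr r_ptr r_one, Op Add r_ptr2 r_ptr2 r_one] @
     copy_words n"

primrec compare_words :: "nat \<Rightarrow> prog list" where
  "compare_words 0 = []"
| "compare_words (Suc n) = [Load r_word r_ptr, Load r_word2 r_ptr2,
     Cond (Equal r_word r_word2) (block []) (block [Const r_flag 0]),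
     Op Add r_ptr r_ptr r_one, Op Add r_ptr2 r_ptr2 r_one] @ compare_words n"

lemma runs_copy_words:
  assumes "r r_one = 1" "length m \<le> 2 ^ w" "r r_ptr + n < length m" "r r_ptr2 + n < length m"
    "r r_ptr + n \<le> r r_ptr2 \<or> r r_ptr2 + n \<le> r r_ptr"
    and "\<And>r' m'. mem_frame {r r_ptr2..<r r_ptr2 + n} m m' \<Longrightarrow> segment m' (r r_ptr2) n = segment m (r r_ptr) n \<Longrightarrow>
      reg_frame {r_word, r_ptr, r_ptr2} r r' \<Longrightarrow> runs w (block ps) (r', m') T Q"
    and "4 * n + T \<le> T'"
  shows "runs w (block (copy_words n @ ps)) (r, m) T' Q"
  using assms
proof (induction n arbitrary: r m T')
  case 0
  then have "runs w (block ps) (r, m) T Q" by simp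
  then show ?case using 0(7) by (auto elim: runs_mono)
next
  case (Suc n)
  let ?m = "m[r r_ptr2 := m ! r r_ptr]"
  let ?r = "r(r_word := m ! r r_ptr, r_ptr := r r_ptr + 1, r_ptr2 := r r_ptr2 + 1)"
  have "runs w (block (copy_words n @ ps)) (?r, ?m) (4 * n + T) Q"
  proof (rule Suc.IH)
    fix r' m' assume memory: "mem_frame {?r r_ptr2..<?r r_ptr2 + n} ?m m'"
      and seg: "segment m' (?r r_ptr2) n = segment ?m (?r r_ptr) n"
      and regs: "reg_frame {r_word, r_ptr, r_ptr2} ?r r'"
    show "runs w (block ps) (r', m') T Q"
    proof (rule Suc.prems(6))
      have "segment ?m (Suc (r r_ptr)) n = segment m (Suc (r r_ptr)) n"
        using Suc.prems(5) by (intro segment_cong) (auto simp: nth_list_update)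
      moreover have "m' ! r r_ptr2 = m ! r r_ptr"
        using mem_frameD[OF memory, of "r r_ptr2"] Suc.prems(4) by simp
      ultimately show "segment m' (r r_ptr2) (Suc n) = segment m (r r_ptr) (Suc n)"
        using seg by (simp add: segment_Suc)
      show "mem_frame {r r_ptr2..<r r_ptr2 + Suc n} m m'"
        by (rule mem_frame_trans[OF _ memory, of "{r r_ptr2}"]) auto
      show "reg_frame {r_word, r_ptr, r_ptr2} r r'"
        by (rule reg_frame_trans[OF _ regs, of "{r_word, r_ptr, r_ptr2}"]) auto
    qed
  qed (use Suc.prems in auto)
  then have "runs w (block (copy_words (Suc n) @ ps)) (r, m) (4 + (4 * n + T)) Q"
    using Suc.prems(1-4) by (simp add: runs_Load runs_Store)
  then show ?case using Suc.prems(7) by (auto elim: runs_mono)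
qed

lemma runs_compare_words:
  assumes "r r_one = 1" "length m \<le> 2 ^ w" "r r_ptr + n < length m" "r r_ptr2 + n < length m"
    and "\<And>r'. r' r_flag = (if segment m (r r_ptr) n = segment m (r r_ptr2) n then r r_flag else 0) \<Longrightarrow>
      reg_frame {58..62} r r' \<Longrightarrow> runs w (block ps) (r', m) T Q"
    and "6 * n + T \<le> T'"
  shows "runs w (block (compare_words n @ ps)) (r, m) T' Q"
  using assms
proof (induction n arbitrary: r T')
  case 0
  then have "runs w (block ps) (r, m) T Q" by simp
  then show ?case using 0(6) by (auto elim: runs_mono)
next
  case (Suc n)
  let ?x = "m ! r r_ptr" and ?y = "m ! r r_ptr2"
  let ?loaded = "r(r_word := ?x, r_word2 := ?y)"
  define next_regs where "next_regs f = ?loaded(r_flag := f, r_ptr := r r_ptr + 1, r_ptr2 := r r_ptr2 + 1)"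
    for f
  have rest: "runs w (block (compare_words n @ ps)) (next_regs f, m) (6 * n + T) Q"
    if f: "f = (if ?x = ?y then r r_flag else 0)" for f
  proof (rule Suc.IH)
    fix r' assume "r' r_flag = (if segment m (next_regs f r_ptr) n = segment m (next_regs f r_ptr2) n
        then next_regs f r_flag else 0)" and frame: "reg_frame {58..62} (next_regs f) r'"
    then have "r' r_flag = (if segment m (r r_ptr) (Suc n) = segment m (r r_ptr2) (Suc n) then r r_flag else 0)"
      by (auto simp: f next_regs_def segment_Suc)
    moreover have "reg_frame {58..62} r r'"
      by (rule reg_frame_trans[OF _ frame, of "{58..62}"]) (auto simp: next_regs_def)
    ultimately show "runs w (block ps) (r', m) T Q" by (rule Suc.prems(5))
  qed (use Suc.prems in \<open>auto simp: next_regs_def\<close>)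
  have "runs w (block (Cond (Equal r_word r_word2) (block []) (block [Const r_flag 0]) # Op Add r_ptr r_ptr r_one #
      Op Add r_ptr2 r_ptr2 r_one # compare_words n @ ps)) (?loaded, m) (4 + (6 * n + T)) Q"
  proof (rule runs_Cond)
    assume "cmp_val (Equal r_word r_word2) (fst (?loaded, m))"
    then have "next_regs (r r_flag) = ?loaded(r_ptr := r r_ptr + 1, r_ptr2 := r r_ptr2 + 1)" "?x = ?y"
      by (auto simp: next_regs_def fun_eq_iff)
    then show "runs w (block ([] @ Op Add r_ptr r_ptr r_one # Op Add r_ptr2 r_ptr2 r_one # compare_words n @ ps))
        (?loaded, m) (4 + (6 * n + T) - 1) Q"
      using rest[of "r r_flag"] Suc.prems(1-4) by (auto elim: runs_mono)
  next
    assume "\<not> cmp_val (Equal r_word r_word2) (fst (?loaded, m))"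
    then show "runs w (block ([Const r_flag 0] @ Op Add r_ptr r_ptr r_one # Op Add r_ptr2 r_ptr2 r_one #
        compare_words n @ ps)) (?loaded, m) (4 + (6 * n + T) - 1) Q"
      using rest[of 0] Suc.prems(1-4) by (simp add: next_regs_def)
  qed simp
  then have "runs w (block (compare_words (Suc n) @ ps)) (r, m) (2 + (4 + (6 * n + T))) Q"
    using Suc.prems(3,4) by (simp add: runs_Load)
  then show ?case using Suc.prems(6) by (auto elim: runs_mono)
qed

definition add_node_hash :: "prog list" where
  "add_node_hash = [Const r_offset (3 + ndigits), Op Add r_src r_hash_node r_offset, Const r_mult 1, Const r_carry 0] @
     add_multiple (digit_regs ndigits)"

definition concat_hash :: "prog list" where
  "concat_hash = [Move r_left r_hash_in, Const r_offset 3, Op Add r_right r_hash_node r_offset] @ multiply @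
     add_node_hash @ store_product"

definition normalize_hash :: "prog list" where
  "normalize_hash = [Move r_left r_hash_in, Const r_right unit_addr] @ multiply @ store_product"

definition hash_time :: nat where "hash_time = multiply_time + 9 * ndigits + 8"

locale hashing = montgomery w \<beta> P pinv for w \<beta> P pinv :: nat +
  fixes c :: "'a \<Rightarrow> nat" and b :: nat
  assumes coprime_point: "coprime b P" and coprime_base: "coprime \<beta> P"
begin

text \<open>Values kept during a computation are only reduced below \<open>3 * P\<close>, so that no comparison with \<open>P\<close>
  is needed.\<close>

definition has_hash :: "nat list \<Rightarrow> nat \<Rightarrow> 'a list \<Rightarrow> bool" where
  "has_hash m a u \<longleftrightarrow> number m a \<and> 0 < val m a \<and> val m a < 3 * P \<and> [val m a = hash c b u] (mod P)"

definition node_hash :: "nat list \<Rightarrow> nat \<Rightarrow> 'a list \<Rightarrow> bool" where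
  "node_hash m a s \<longleftrightarrow> number m (a + 3) \<and> val m (a + 3) = b ^ length s * \<beta> ^ ndigits mod P \<and>
     number m (a + (3 + ndigits)) \<and> val m (a + (3 + ndigits)) = hash c b s mod P"

lemma cong_base_power_cancel: "[x * \<beta> ^ ndigits = y * \<beta> ^ ndigits] (mod P) \<longleftrightarrow> [x = y] (mod P)"
  using coprime_base by (simp add: cong_mult_rcancel_nat)

lemma has_hash_mem_frame:
  "has_hash m a u \<Longrightarrow> mem_frame X m m' \<Longrightarrow> {a..<a + ndigits} \<inter> X = {} \<Longrightarrow> has_hash m' a u"
  unfolding has_hash_def using number_mem_frame[of m a X m'] by simp

text \<open>Multiplication by the stored power \<open>b ^ length s * \<beta> ^ ndigits\<close> cancels the factor \<open>\<beta> ^ ndigits\<close>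
  that is lost in a Montgomery product.\<close>

lemma has_hash_append:
  assumes u: "has_hash m a u" and s: "node_hash m v s"
    and product: "\<beta> ^ ndigits * x = val m a * val m (v + 3) + q * P" "x < 2 * P"
    and sum: "number m' a'" "val m' a' = x + val m (v + (3 + ndigits))"
  shows "has_hash m' a' (u @ s)"
proof -
  have "coprime (b ^ length s * \<beta> ^ ndigits) P" using coprime_point coprime_base by simp
  then have "\<not> P dvd b ^ length s * \<beta> ^ ndigits" using modulus_gt_1 coprime_common_divisor_nat by fastforce
  then have "0 < val m (v + 3)" using s by (simp add: node_hash_def dvd_eq_mod_eq_0)
  then have "0 < val m a * val m (v + 3)" using u by (simp add: has_hash_def)
  then have "0 < x" using product(1) by (cases x) auto
  have "[x * \<beta> ^ ndigits = val m a * val m (v + 3)] (mod P)"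
    using product(1) by (simp add: cong_def mult.commute[of x])
  also have "[val m a * val m (v + 3) = hash c b u * (b ^ length s * \<beta> ^ ndigits)] (mod P)"
    using u s by (intro cong_mult) (auto simp: has_hash_def node_hash_def cong_def)
  finally have "[x = hash c b u * b ^ length s] (mod P)"
    unfolding mult.assoc[symmetric] cong_base_power_cancel .
  moreover have "[val m (v + (3 + ndigits)) = hash c b s] (mod P)"
    using s by (simp add: node_hash_def cong_def)
  ultimately have "[val m' a' = hash c b (u @ s)] (mod P)" unfolding sum(2) hash_append by (rule cong_add)
  moreover have "val m (v + (3 + ndigits)) < P" using s modulus_gt_1 by (simp add: node_hash_def)
  ultimately show ?thesis using \<open>0 < x\<close> product(2) sum by (simp add: has_hash_def)
qed

lemma runs_add_node_hash:
  assumes "arithmetic_regs r" "arithmetic_mem m" "node_hash m (r r_hash_node) s" "holds ndigits r x"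
    "x < 2 * P"
    and "\<And>r'. holds ndigits r' (x + val m (r r_hash_node + (3 + ndigits))) \<Longrightarrow> reg_frame scratch r r' \<Longrightarrow>
      runs w (block ps) (r', m) T Q"
    and "4 + 7 * ndigits + T \<le> T'"
  shows "runs w (block (add_node_hash @ ps)) (r, m) T' Q"
proof -
  let ?a = "r r_hash_node + (3 + ndigits)"
  have a: "number m ?a" "val m ?a < P" using assms(3) modulus_gt_1 by (auto simp: node_hash_def)
  have length: "length m \<le> 2 ^ w" "200 < length m" using assms(2) by (auto simp: arithmetic_mem_def)
  then have word: "?a < 2 ^ w" "0 < w" using a(1) by (auto simp: number_def intro: Nat.gr0I)
  let ?r = "r(r_offset := 3 + ndigits, r_src := ?a, r_mult := 1, r_carry := 0)"
  have "runs w (block (add_multiple (digit_regs ndigits) @ ps)) (?r, m) (7 * ndigits + T) Q"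
  proof (rule runs_add_to_digits)
    show "holds ndigits ?r x" by (rule holds_cong[OF _ assms(4)]) (simp add: set_digit_regs)
    show "x + ?r r_mult * val m (?r r_src) < \<beta> ^ ndigits"
      using digit_products_less(2)[of x 1 "val m ?a" 0] assms(5) a(2) base_ge_2 by simp
    fix r' assume "holds ndigits r' (x + ?r r_mult * val m (?r r_src))"
      and frame: "reg_frame ({r_digit, r_src, r_carry} \<union> set (digit_regs ndigits)) ?r r'"
    moreover have "reg_frame scratch r r'"
      by (rule reg_frame_trans[OF _ frame, of scratch]) (auto simp: set_digit_regs)
    ultimately show "runs w (block ps) (r', m) T Q" by (intro assms(6)) simp_all
  qed (use assms(1) a length base_ge_2 in \<open>auto simp: arithmetic_regs_def\<close>)
  then have "runs w (block (add_node_hash @ ps)) (r, m) (4 + (7 * ndigits + T)) Q"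
    unfolding add_node_hash_def using word assms(1) base_ge_2 by (simp add: arithmetic_regs_def)
  then show ?thesis by (rule runs_mono) (use assms(7) in auto)
qed

lemma runs_concat_hash:
  assumes "arithmetic_regs r" "arithmetic_mem m" "has_hash m (r r_hash_in) u" "node_hash m (r r_hash_node) s"
    "r r_hash_out + ndigits < length m"
    and "\<And>r' m'. has_hash m' (r r_hash_out) (u @ s) \<Longrightarrow>
      mem_frame {r r_hash_out..<r r_hash_out + ndigits} m m' \<Longrightarrow> reg_frame scratch r r' \<Longrightarrow> runs w (block ps) (r', m') T Q"
    and "hash_time + T \<le> T'"
  shows "runs w (block (concat_hash @ ps)) (r, m) T' Q"
proof -
  let ?v = "r r_hash_node"
  let ?r = "r(r_left := r r_hash_in, r_offset := 3, r_right := ?v + 3)"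
  have length: "length m \<le> 2 ^ w" "200 < length m" using assms(2) by (auto simp: arithmetic_mem_def)
  have power: "number m (?v + 3)" "val m (?v + 3) < P"
    using assms(4) modulus_gt_1 by (auto simp: node_hash_def)
  have "runs w (block (multiply @ add_node_hash @ store_product @ ps)) (?r, m) (5 + (multiply_time + (9 * ndigits + T))) Q"
  proof (rule runs_multiply[OF _ assms(2)])
    fix r1 x q assume x: "holds ndigits r1 x"
      "\<beta> ^ ndigits * x = val m (?r r_left) * val m (?r r_right) + q * P" "x < 2 * P"
      and frame1: "reg_frame ({50..54} \<union> {100..}) ?r r1"
    have frame1: "reg_frame scratch r r1" by (rule reg_frame_trans[OF _ frame1, of scratch]) auto
    then have r1: "arithmetic_regs r1" by (rule arithmetic_regs_frame[OF assms(1)]) auto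
    have r1_args: "r1 r_hash_node = ?v" "r1 r_hash_out = r r_hash_out"
      using frame1 by (simp_all add: reg_frameD)
    show "runs w (block (add_node_hash @ store_product @ ps)) (r1, m) (5 + 9 * ndigits + T) Q"
    proof (rule runs_add_node_hash[OF r1 assms(2) _ x(1,3)])
      fix r2 assume sum: "holds ndigits r2 (x + val m (r1 r_hash_node + (3 + ndigits)))"
        and "reg_frame scratch r1 r2"
      then have frame2: "reg_frame scratch r r2" by (intro reg_frame_trans[OF frame1]) auto
      then have r2: "arithmetic_regs r2" "r2 r_hash_out = r r_hash_out"
        using arithmetic_regs_frame[OF assms(1)] by (auto simp: reg_frameD)
      show "runs w (block (store_product @ ps)) (r2, m) (1 + 2 * ndigits + T) Q"
      proof (rule runs_store_product[OF r2(1) length(1) sum])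
        fix r' m' assume "number m' (r2 r_hash_out)"
          "val m' (r2 r_hash_out) = x + val m (r1 r_hash_node + (3 + ndigits))"
          "mem_frame {r2 r_hash_out..<r2 r_hash_out + ndigits} m m'" "reg_frame {r_dst} r2 r'"
        then show "runs w (block ps) (r', m') T Q"
          using frame2 has_hash_append[OF assms(3,4), of x q m' "r r_hash_out"] x(2,3)
          by (intro assms(6)) (auto simp: r1_args r2(2) elim: reg_frame_trans)
      qed (use assms(5) r2(2) in auto)
    qed (use assms(4) r1_args in auto)
  qed (use assms power in \<open>auto simp: arithmetic_regs_def has_hash_def\<close>)
  moreover have "r r_hash_in < 2 ^ w" "?v + 3 < 2 ^ w" "(3::nat) < 2 ^ w"
    using assms(3) power(1) length by (auto simp: has_hash_def number_def)
  ultimately have "runs w (block (concat_hash @ ps)) (r, m) (3 + (5 + (multiply_time + (9 * ndigits + T)))) Q"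
    unfolding concat_hash_def using assms(1) by (simp add: arithmetic_regs_def)
  then show ?thesis by (rule runs_mono) (use assms(7) in \<open>auto simp: hash_time_def\<close>)
qed

lemma montgomery_unit_le:
  assumes "\<beta> ^ ndigits * x = a + q * P" "a < 3 * P" "q < \<beta> ^ ndigits"
  shows "x \<le> P"
proof -
  have "3 * P \<le> 4 * (\<beta> * P)" using base_ge_2 by simp
  then have "a < \<beta> ^ ndigits" using assms(2) capacity by linarith
  moreover have "Suc q * P \<le> \<beta> ^ ndigits * P" using assms(3) by (intro mult_right_mono) auto
  ultimately have "\<beta> ^ ndigits * x < \<beta> ^ ndigits * Suc P" using assms(1) modulus_gt_1 by simp
  then show ?thesis by (simp del: mult_Suc_right)
qed

lemma runs_normalize_hash:
  assumes "arithmetic_regs r" "arithmetic_mem m" "has_hash m (r r_hash_in) u"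
    "r r_hash_out + ndigits < length m"
    and "\<And>r' m'. number m' (r r_hash_out) \<Longrightarrow> val m' (r r_hash_out) \<in> {1..P} \<Longrightarrow>
      [val m' (r r_hash_out) * \<beta> ^ ndigits = hash c b u] (mod P) \<Longrightarrow>
      mem_frame {r r_hash_out..<r r_hash_out + ndigits} m m' \<Longrightarrow> reg_frame scratch r r' \<Longrightarrow> runs w (block ps) (r', m') T Q"
    and "hash_time + T \<le> T'"
  shows "runs w (block (normalize_hash @ ps)) (r, m) T' Q"
proof -
  let ?r = "r(r_left := r r_hash_in, r_right := unit_addr)"
  note mem = assms(2)[unfolded arithmetic_mem_def]
  have "runs w (block (multiply @ store_product @ ps)) (?r, m) (multiply_time + (1 + 2 * ndigits + T)) Q"
  proof (rule runs_multiply[OF _ assms(2)])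
    fix r1 x q assume digits: "holds ndigits r1 x"
      and "\<beta> ^ ndigits * x = val m (?r r_left) * val m (?r r_right) + q * P" and q: "q < \<beta> ^ ndigits"
      and frame1: "reg_frame ({50..54} \<union> {100..}) ?r r1"
    then have x: "\<beta> ^ ndigits * x = val m (r r_hash_in) + q * P" using mem by simp
    have "x \<in> {1..P}"
      using montgomery_unit_le[OF x _ q] assms(3) x by (cases x) (auto simp: has_hash_def)
    have "[x * \<beta> ^ ndigits = val m (r r_hash_in)] (mod P)" using x by (simp add: cong_def mult.commute[of x])
    then have cong: "[x * \<beta> ^ ndigits = hash c b u] (mod P)"
      using assms(3) by (auto simp: has_hash_def elim: cong_trans)
    have frame1: "reg_frame scratch r r1" by (rule reg_frame_trans[OF _ frame1, of scratch]) auto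
    then have r1: "arithmetic_regs r1" "r1 r_hash_out = r r_hash_out"
      using arithmetic_regs_frame[OF assms(1)] by (auto simp: reg_frameD)
    show "runs w (block (store_product @ ps)) (r1, m) (1 + 2 * ndigits + T) Q"
    proof (rule runs_store_product[OF r1(1) _ digits])
      fix r' m' assume "number m' (r1 r_hash_out)" "val m' (r1 r_hash_out) = x"
        "mem_frame {r1 r_hash_out..<r1 r_hash_out + ndigits} m m'" "reg_frame {r_dst} r1 r'"
      then show "runs w (block ps) (r', m') T Q"
        using \<open>x \<in> {1..P}\<close> cong frame1 by (intro assms(5)) (auto simp: r1(2) elim: reg_frame_trans)
    qed (use assms(4) mem r1(2) in auto)
  qed (use assms modulus_gt_1 in \<open>auto simp: arithmetic_regs_def arithmetic_mem_def has_hash_def\<close>)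
  moreover have "r r_hash_in < 2 ^ w" "unit_addr < 2 ^ w"
    using assms(3) mem by (auto simp: has_hash_def number_def)
  ultimately have "runs w (block (normalize_hash @ ps)) (r, m) (2 + (multiply_time + (1 + 2 * ndigits + T))) Q"
    unfolding normalize_hash_def using assms(1) by (simp add: arithmetic_regs_def)
  then show ?thesis by (rule runs_mono) (use assms(6) in \<open>auto simp: hash_time_def\<close>)
qed

end

section \<open>The memory image\<close>

lemma segment_append: "segment (xs @ ys @ zs) (length xs) (length ys) = ys"
  by (rule segment_eqI) (simp_all add: nth_append)

definition item_size :: nat where "item_size = ndigits + 2"

text \<open>The number of words of the layout \<open>mem_size\<close>, with \<open>89 * bit_length N\<close> for the capacity of the stack.\<close>

definition index_size_bound :: "nat \<Rightarrow> nat \<Rightarrow> nat" where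
  "index_size_bound n N = 166 + 39 * n + 41 * (89 * bit_length N)"

locale lce_index = hashing w \<beta> P pinv c b for w \<beta> P pinv :: nat and c :: "'a \<Rightarrow> nat" and b :: nat +
  fixes F :: "'a list set" and S :: "'a list"
  assumes finite_F: "finite F" and S_in_F: "S \<in> F" and length_le: "s \<in> F \<Longrightarrow> length s \<le> length S"
    and height_le_F: "s \<in> F \<Longrightarrow> height_le F s (22 * bit_length (length s))"
    and collision_free: "collision_free c b P S"
    and words: "index_size_bound (card F) (length S) \<le> 2 ^ w" "2 * length S + 2 < 2 ^ w"
begin

abbreviation N :: nat where "N \<equiv> length S"

definition height :: "'a list \<Rightarrow> nat" where "height s = (LEAST h. height_le F s h)"

lemma height_le_height: "s \<in> F \<Longrightarrow> height_le F s (height s)"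
  unfolding height_def using height_le_F by (rule LeastI)

lemma height_least: "height_le F s h \<Longrightarrow> height s \<le> h"
  unfolding height_def by (rule Least_le)

lemma nonempty: "s \<in> F \<Longrightarrow> s \<noteq> []"
  using height_le_F has_tree_nonempty by blast

lemma N_pos: "0 < N"
  using nonempty[OF S_in_F] by simp

definition children :: "'a list \<Rightarrow> 'a list \<times> 'a list" where
  "children s = (SOME (u, v). u \<in> F \<and> v \<in> F \<and> s = u @ v \<and> height u < height s \<and> height v < height s)"

definition left :: "'a list \<Rightarrow> 'a list" where "left s = fst (children s)"
definition right :: "'a list \<Rightarrow> 'a list" where "right s = snd (children s)"

lemma children:
  assumes "s \<in> F" "2 \<le> length s"
  shows "left s \<in> F" "right s \<in> F" "s = left s @ right s" "height (left s) < height s"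
    "height (right s) < height s"
proof -
  have "\<exists>u v. u \<in> F \<and> v \<in> F \<and> s = u @ v \<and> height u < height s \<and> height v < height s"
    using height_le_height[OF assms(1)]
  proof cases
    case (leaf x)
    with assms(2) show ?thesis by simp
  next
    case (node u h v)
    then have "height u < height s" "height v < height s"
      using height_least[of u h] height_least[of v h] by auto
    with node show ?thesis using has_tree_in by blast
  qed
  then have "\<exists>uv. case uv of (u, v) \<Rightarrow> u \<in> F \<and> v \<in> F \<and> s = u @ v \<and> height u < height s \<and> height v < height s"
    by auto
  from someI_ex[OF this, folded children_def] show "left s \<in> F" "right s \<in> F" "s = left s @ right s"
    "height (left s) < height s" "height (right s) < height s"
    unfolding left_def right_def by (simp_all add: case_prod_beta)
qed

definition nodes :: "'a list list" where "nodes = (SOME xs. set xs = F \<and> length xs = card F)"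

lemma set_nodes: "set nodes = F" and length_nodes: "length nodes = card F"
proof -
  obtain xs where "set xs = F" "distinct xs" using finite_distinct_list[OF finite_F] by blast
  then have "set xs = F \<and> length xs = card F" using distinct_card[of xs] by simp
  then have "\<exists>xs. set xs = F \<and> length xs = card F" by blast
  from someI_ex[OF this] show "set nodes = F" "length nodes = card F" unfolding nodes_def by auto
qed

definition node_size :: nat where "node_size = 3 + 2 * ndigits"

definition addr :: "'a list \<Rightarrow> nat" where
  "addr s = 10 + 2 * ndigits + node_size * length (takeWhile (\<lambda>t. t \<noteq> s) nodes)"

text \<open>A leaf has no children, and its child fields are never read.\<close>

definition node_record :: "'a list \<Rightarrow> nat list" where
  "node_record s = [length s, if length s = 1 then 0 else addr (left s), if length s = 1 then 0 else addr (right s)] @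
     digits \<beta> ndigits (b ^ length s * \<beta> ^ ndigits mod P) @ digits \<beta> ndigits (hash c b s mod P)"

definition first_guess :: nat where "first_guess = 2 ^ floor_sqrt (bit_length N)"

definition cap :: nat where "cap = 1 + 4 * height S"
definition stack_addr :: nat where "stack_addr = 10 + 2 * ndigits + node_size * card F"
definition items_i_addr :: nat where "items_i_addr = stack_addr + cap + 1"
definition items_j_addr :: nat where "items_j_addr = items_i_addr + (cap + 2) * item_size"
definition acc_i_addr :: nat where "acc_i_addr = items_j_addr + (cap + 2) * item_size"
definition acc_j_addr :: nat where "acc_j_addr = acc_i_addr + ndigits + 1"
definition mem_size :: nat where "mem_size = acc_j_addr + ndigits + 2"

definition memory_header :: "nat list" where
  "memory_header = [addr S, \<beta>, pinv, first_guess, floor_sqrt N, stack_addr, items_i_addr, items_j_addr, acc_i_addr, acc_j_addr]"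

definition memory_image :: "nat list" where
  "memory_image = memory_header @ digits \<beta> ndigits P @ digits \<beta> ndigits 1 @ concat (map node_record nodes)"

definition index_mem :: "nat list \<Rightarrow> bool" where
  "index_mem m \<longleftrightarrow> length m = mem_size \<and> take stack_addr m = memory_image"

lemma length_node_record [simp]: "length (node_record s) = node_size"
  by (simp add: node_record_def node_size_def)

lemma length_memory_image: "length memory_image = stack_addr"
  by (simp add: memory_image_def memory_header_def stack_addr_def length_concat comp_def sum_list_triv length_nodes)

lemma cap_le: "cap \<le> 89 * bit_length N"
proof -
  have "1 \<le> bit_length N" using N_pos by (simp add: bit_length_pos_iff Suc_le_eq)
  then show ?thesis using height_least[OF height_le_F[OF S_in_F]] by (simp add: cap_def)
qed

lemma mem_size_eq: "mem_size = 166 + 39 * card F + 41 * cap"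
  by (simp add: mem_size_def acc_j_addr_def acc_i_addr_def items_j_addr_def items_i_addr_def stack_addr_def
      node_size_def item_size_def ndigits_def)

lemma mem_size_le_bound: "mem_size \<le> index_size_bound (card F) N"
  using cap_le unfolding mem_size_eq index_size_bound_def by linarith

lemma mem_size_le: "mem_size \<le> 2 ^ w"
  using mem_size_le_bound words(1) by (rule le_trans)

lemma mem_size_gt: "200 < mem_size"
proof -
  have "1 \<le> card F" using finite_F S_in_F by (auto simp: Suc_le_eq card_gt_0_iff)
  moreover have "1 \<le> cap" by (simp add: cap_def)
  ultimately show ?thesis unfolding mem_size_eq by linarith
qed

lemma mod_word: "x < mem_size \<Longrightarrow> x mod 2 ^ w = x"
  using mem_size_le by simp

lemma two_mod_word [simp]: "2 mod 2 ^ w = (2::nat)"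
  using mem_size_gt by (intro mod_word) simp

lemma word_length_nonzero [simp]: "w \<noteq> 0"
  using mem_size_gt mem_size_le by (intro notI) simp

lemma first_guess_less: "first_guess < 2 ^ w"
proof -
  have "first_guess \<le> 2 ^ bit_length N"
    unfolding first_guess_def by (intro power_increasing floor_sqrt_le) simp
  also have "\<dots> \<le> 2 * N"
    using less_bit_length_iff[of "bit_length N - 1" N] N_pos
    by (cases "bit_length N") (auto simp: bit_length_pos_iff)
  finally show ?thesis using words(2) by linarith
qed

lemma index_mem_frame: "index_mem m \<Longrightarrow> mem_frame X m m' \<Longrightarrow> X \<subseteq> {stack_addr..} \<Longrightarrow> index_mem m'"
proof -
  assume m: "index_mem m" and frame: "mem_frame X m m'" and X: "X \<subseteq> {stack_addr..}"
  have "take stack_addr m' = take stack_addr m"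
  proof (rule nth_equalityI)
    fix i assume "i < length (take stack_addr m')"
    then have "i < stack_addr" by simp
    moreover from this have "i \<notin> X" using X by fastforce
    ultimately show "take stack_addr m' ! i = take stack_addr m ! i" using mem_frameD[OF frame] by simp
  qed (simp add: mem_frame_length[OF frame])
  then show "index_mem m'" using m mem_frame_length[OF frame] by (simp add: index_mem_def)
qed

lemma addr_split:
  assumes "s \<in> F"
  obtains xs ys where "nodes = xs @ s # ys" "addr s = 10 + 2 * ndigits + node_size * length xs"
proof -
  let ?xs = "takeWhile (\<lambda>t. t \<noteq> s) nodes" and ?ys = "dropWhile (\<lambda>t. t \<noteq> s) nodes"
  have "s \<in> set nodes" using assms set_nodes by simp
  then have ys: "?ys \<noteq> []" by (auto simp: dropWhile_eq_Nil_conv)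
  then have "hd ?ys = s" using hd_dropWhile by blast
  then have "nodes = ?xs @ s # tl ?ys"
    using ys takeWhile_dropWhile_id[of "\<lambda>t. t \<noteq> s" nodes] by (metis list.collapse)
  then show thesis by (rule that) (simp add: addr_def)
qed

lemma addr_less:
  assumes "s \<in> F"
  shows "addr s + node_size \<le> stack_addr" "addr s + node_size < mem_size" "addr s < 2 ^ w"
proof -
  obtain xs ys where "nodes = xs @ s # ys" "addr s = 10 + 2 * ndigits + node_size * length xs"
    using addr_split[OF assms] .
  moreover from this have "node_size * Suc (length xs) \<le> node_size * card F"
    unfolding length_nodes[symmetric] by (intro mult_le_mono2) simp
  ultimately show end_le: "addr s + node_size \<le> stack_addr" by (simp add: stack_addr_def)
  then show "addr s + node_size < mem_size"
    by (simp add: mem_size_def acc_j_addr_def acc_i_addr_def items_j_addr_def items_i_addr_def)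
  then show "addr s < 2 ^ w" using mem_size_le by linarith
qed

lemma modulus_less: "P < \<beta> ^ ndigits"
proof -
  have "1 * P \<le> \<beta> * P" using base_ge_2 by (intro mult_right_mono) auto
  then show ?thesis using capacity modulus_gt_1 by linarith
qed

lemma number_append:
  assumes "length xs = a" "zs \<noteq> []" "x \<le> P"
  shows "number (xs @ digits \<beta> ndigits x @ zs) a" "val (xs @ digits \<beta> ndigits x @ zs) a = x"
proof -
  have seg: "segment (xs @ digits \<beta> ndigits x @ zs) a ndigits = digits \<beta> ndigits x"
    using segment_append[of xs "digits \<beta> ndigits x" zs] assms(1) by simp
  have "a + ndigits < length (xs @ digits \<beta> ndigits x @ zs)" using assms(1,2) by simp
  then show "number (xs @ digits \<beta> ndigits x @ zs) a"
    unfolding number_def seg using digits_less[OF base_pos] by blast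
  show "val (xs @ digits \<beta> ndigits x @ zs) a = x"
    unfolding seg using assms(3) modulus_less by (intro digits_val_digits) linarith
qed

lemma stack_addr_less: "stack_addr < mem_size"
  by (simp add: mem_size_def acc_j_addr_def acc_i_addr_def items_j_addr_def items_i_addr_def)

lemma index_mem_append:
  assumes "index_mem m"
  obtains zs where "m = memory_image @ zs" "zs \<noteq> []"
proof
  show "m = memory_image @ drop stack_addr m"
    using assms append_take_drop_id[of stack_addr m] by (simp add: index_mem_def)
  show "drop stack_addr m \<noteq> []" using assms stack_addr_less by (simp add: index_mem_def)
qed

lemma index_mem_node:
  assumes "index_mem m" "s \<in> F"
  shows "m ! addr s = length s" "node_hash m (addr s) s"
    "2 \<le> length s \<Longrightarrow> m ! (addr s + 1) = addr (left s)" "2 \<le> length s \<Longrightarrow> m ! (addr s + 2) = addr (right s)"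
proof -
  obtain zs where zs: "m = memory_image @ zs" "zs \<noteq> []" using index_mem_append[OF assms(1)] .
  obtain xs ys where nodes: "nodes = xs @ s # ys" "addr s = 10 + 2 * ndigits + node_size * length xs"
    using addr_split[OF assms(2)] .
  define pre where "pre = memory_header @ digits \<beta> ndigits P @ digits \<beta> ndigits 1 @ concat (map node_record xs)"
  define post where "post = concat (map node_record ys) @ zs"
  have m: "m = pre @ node_record s @ post" by (simp add: zs(1) memory_image_def nodes(1) pre_def post_def)
  have pre: "length pre = addr s"
    by (simp add: pre_def memory_header_def nodes(2) length_concat comp_def sum_list_triv)
  show "m ! addr s = length s" "2 \<le> length s \<Longrightarrow> m ! (addr s + 1) = addr (left s)"
    "2 \<le> length s \<Longrightarrow> m ! (addr s + 2) = addr (right s)"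
    by (simp_all add: m pre nth_append node_record_def)
  define child_fields where "child_fields = take 3 (node_record s)"
  define power_digits where "power_digits = digits \<beta> ndigits (b ^ length s * \<beta> ^ ndigits mod P)"
  define hash_digits where "hash_digits = digits \<beta> ndigits (hash c b s mod P)"
  have fields: "node_record s = child_fields @ power_digits @ hash_digits" "length child_fields = 3"
    by (simp_all add: child_fields_def node_record_def power_digits_def hash_digits_def)
  have "m = (pre @ child_fields) @ power_digits @ (hash_digits @ post)"
    "m = (pre @ child_fields @ power_digits) @ hash_digits @ post" by (simp_all add: m fields(1))
  then show "node_hash m (addr s) s"
    unfolding node_hash_def
    using number_append[of "pre @ child_fields" "addr s + 3" "hash_digits @ post"
    "b ^ length s * \<beta> ^ ndigits mod P"]
      number_append[of "pre @ child_fields @ power_digits" "addr s + (3 + ndigits)" post "hash c b s mod P"]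
      pre fields(2) zs(2) modulus_gt_1
    by (simp add: power_digits_def hash_digits_def post_def)
qed

lemma index_mem_header:
  assumes "index_mem m"
  shows "m ! 0 = addr S" "m ! 1 = \<beta>" "m ! 2 = pinv" "m ! 3 = first_guess" "m ! 4 = floor_sqrt N"
    "m ! 5 = stack_addr"
    "m ! 6 = items_i_addr" "m ! 7 = items_j_addr" "m ! 8 = acc_i_addr" "m ! 9 = acc_j_addr"
proof -
  obtain zs where "m = memory_image @ zs" "zs \<noteq> []" using index_mem_append[OF assms] .
  then have m: "m = memory_header @ drop 10 m" by (simp add: memory_image_def memory_header_def)
  show "m ! 0 = addr S" "m ! 1 = \<beta>" "m ! 2 = pinv" "m ! 3 = first_guess" "m ! 4 = floor_sqrt N"
    "m ! 5 = stack_addr"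
    "m ! 6 = items_i_addr" "m ! 7 = items_j_addr" "m ! 8 = acc_i_addr" "m ! 9 = acc_j_addr"
    by (subst m, simp add: memory_header_def nth_append)+
qed

lemma arithmetic_mem:
  assumes "index_mem m"
  shows "arithmetic_mem m"
proof -
  obtain zs where zs: "m = memory_image @ zs" "zs \<noteq> []" using index_mem_append[OF assms] .
  have "m = memory_header @ digits \<beta> ndigits P @ (digits \<beta> ndigits 1 @ concat (map node_record nodes) @ zs)"
    "m = (memory_header @ digits \<beta> ndigits P) @ digits \<beta> ndigits 1 @ (concat (map node_record nodes) @ zs)"
    by (simp_all add: zs(1) memory_image_def)
  moreover have "length memory_header = modulus_addr"
    "length (memory_header @ digits \<beta> ndigits P) = unit_addr"
    by (simp_all add: memory_header_def modulus_addr_def unit_addr_def)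
  moreover have "length m \<le> 2 ^ w" "200 < length m"
    using assms mem_size_le mem_size_gt by (auto simp: index_mem_def)
  ultimately show ?thesis unfolding arithmetic_mem_def
    using number_append[of memory_header modulus_addr _ P] number_append[of "memory_header @ digits \<beta> ndigits P" unit_addr _ 1]
      zs(2) modulus_gt_1 by (metis append_is_Nil_conv less_imp_le order_refl)
qed

lemma ex_index_mem: "\<exists>m. index_mem m \<and> (\<forall>x \<in> set m. x < 2 ^ w)"
proof (intro exI conjI)
  let ?m = "memory_image @ replicate (mem_size - stack_addr) 0"
  show "index_mem ?m" using stack_addr_less by (simp add: index_mem_def length_memory_image)
  have addr: "stack_addr < 2 ^ w" "items_i_addr < 2 ^ w" "items_j_addr < 2 ^ w" "acc_i_addr < 2 ^ w"
    "acc_j_addr < 2 ^ w"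
    using mem_size_le by (simp_all add: mem_size_def acc_j_addr_def acc_i_addr_def items_j_addr_def items_i_addr_def)
  have "\<beta> * 2 \<le> \<beta> * \<beta>" using base_ge_2 by (intro mult_le_mono2)
  then have base: "\<beta> < 2 ^ w" using base_square_le base_ge_2 by linarith
  moreover have "floor_sqrt N < 2 ^ w" using floor_sqrt_le[of N] words(2) by linarith
  ultimately have header: "\<forall>x \<in> set memory_header. x < 2 ^ w"
    using addr addr_less(3)[OF S_in_F] inverse_less first_guess_less by (auto simp: memory_header_def)
  have digits: "x < 2 ^ w" if "x \<in> set (digits \<beta> ndigits y)" for x y
    using digits_less[OF base_pos that] base by linarith
  have node: "x < 2 ^ w" if s: "s \<in> F" and x: "x \<in> set (node_record s)" for s x
  proof -
    have "length s < 2 ^ w" using length_le[OF s] words(2) by linarith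
    moreover have "length s \<noteq> 1 \<Longrightarrow> 2 \<le> length s" using nonempty[OF s] by (cases s) (auto simp: Suc_le_eq)
    ultimately show ?thesis using x digits addr_less(3) children[OF s]
      by (auto simp: node_record_def split: if_splits)
  qed
  show "\<forall>x \<in> set ?m. x < 2 ^ w" using header digits node by (auto simp: memory_image_def set_nodes)
qed

end

section \<open>Collecting the items of a window\<close>

definition pop :: "prog list" where
  "pop = [Op Sub r_top r_top r_one, Load r_node r_top, Load r_len r_node]"

definition expand :: "prog list" where
  "expand = [Op Add r_temp r_node r_one, Load r_temp r_temp, Const r_temp2 2, Op Add r_temp2 r_node r_temp2,
     Load r_temp2 r_temp2, Store r_top r_temp2, Op Add r_top r_top r_one, Store r_top r_temp, Op Add r_top r_top r_one]"

definition advance_item :: "prog list" where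
  "advance_item = [Op Add r_total r_total r_len, Op Add r_item r_item r_item_size, Store r_item r_total,
     Op Sub r_rest r_rest r_len, Op Add r_count r_count r_one]"

definition take_item :: "prog list" where
  "take_item = [Op Add r_temp r_item r_one, Store r_temp r_node, Op Add r_hash_in r_temp r_one, Move r_hash_node r_node,
     Op Add r_hash_out r_hash_in r_item_size] @ concat_hash @ advance_item"

definition collect_step :: "prog list" where
  "collect_step = pop @ [Cond (Less r_zero r_skip)
     (block [Cond (LessEq r_len r_skip) (block [Op Sub r_skip r_skip r_len]) (block expand)])
     (block [Cond (LessEq r_len r_rest) (block take_item) (block expand)])]"

text \<open>The first list of items starts with no items and with the hash \<open>P\<close> of the empty string.\<close>

definition start_items :: "prog list" where
  "start_items = [Move r_top r_stack, Store r_top r_root, Op Add r_top r_top r_one, Move r_item r_items,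
     Const r_total 0, Const r_count 0, Store r_item r_total, Const r_ptr modulus_addr, Op Add r_ptr2 r_item r_one,
     Op Add r_ptr2 r_ptr2 r_one] @ copy_words ndigits"

definition collect_items :: "prog list" where
  "collect_items = start_items @ [While (Less r_zero r_rest) (block collect_step)]"

definition take_item_time :: nat where "take_item_time = hash_time + 10"
definition collect_time :: nat where "collect_time = 4 * ndigits + 15 + take_item_time"

context lce_index
begin

abbreviation constant_regs :: "reg set" where "constant_regs \<equiv> {2..8} \<union> {35..43}"

definition layout_regs :: "(reg \<Rightarrow> nat) \<Rightarrow> bool" where
  "layout_regs r \<longleftrightarrow> arithmetic_regs r \<and> r r_root = addr S \<and> r r_item_size = item_size \<and> r r_stack = stack_addr \<and>
     r r_items_i = items_i_addr \<and> r r_items_j = items_j_addr \<and> r r_acc_i = acc_i_addr \<and> r r_acc_j = acc_j_addr"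

lemma layout_regs_frame: "layout_regs r \<Longrightarrow> reg_frame X r r' \<Longrightarrow> X \<inter> constant_regs = {} \<Longrightarrow> layout_regs r'"
proof -
  assume r: "layout_regs r" and "reg_frame X r r'" "X \<inter> constant_regs = {}"
  then have "r' a = r a" if "a \<in> constant_regs" for a using that by (intro reg_frameD[of X]) auto
  with r show "layout_regs r'" by (simp add: layout_regs_def arithmetic_regs_def)
qed

lemma layout_regsD:
  assumes "layout_regs r"
  shows "arithmetic_regs r" "r r_one = 1" "r r_zero = 0" "r r_root = addr S" "r r_item_size = item_size"
    "r r_stack = stack_addr" "r r_items_i = items_i_addr" "r r_items_j = items_j_addr"
    "r r_acc_i = acc_i_addr"
    "r r_acc_j = acc_j_addr"
  using assms by (auto simp: layout_regs_def arithmetic_regs_def)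

abbreviation items_area :: "nat \<Rightarrow> nat set" where "items_area base \<equiv> {base..<base + (cap + 2) * item_size}"

lemma items_area:
  assumes "base \<in> {items_i_addr, items_j_addr}"
  shows "stack_addr + cap < base" "base + (cap + 2) * item_size \<le> acc_i_addr"
  using assms by (auto simp: acc_i_addr_def items_j_addr_def items_i_addr_def)

lemma acc_area: "acc_i_addr + ndigits < acc_j_addr" "acc_j_addr + ndigits + 1 < mem_size"
  by (simp_all add: mem_size_def acc_j_addr_def)

definition stack :: "nat list \<Rightarrow> 'a list list \<Rightarrow> bool" where
  "stack m st \<longleftrightarrow> set st \<subseteq> F \<and> (\<forall>i < length st. m ! (stack_addr + i) = addr (rev st ! i))"

lemma stack_top: "stack m (v # st) \<Longrightarrow> m ! (stack_addr + length st) = addr v \<and> v \<in> F \<and> stack m st"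
  by (auto simp: stack_def nth_append dest: spec[of _ "length st"])

lemma stack_push:
  assumes "stack m st" "v \<in> F" "stack_addr + length st < length m"
  shows "stack (m[stack_addr + length st := addr v]) (v # st)"
  using assms by (auto simp: stack_def nth_append nth_list_update)

lemma stack_mem_frame:
  "stack m st \<Longrightarrow> mem_frame X m m' \<Longrightarrow> {stack_addr..<stack_addr + length st} \<inter> X = {} \<Longrightarrow> stack m' st"
  by (auto simp: stack_def disjoint_iff mem_frameD)

text \<open>Up to the factor 2, the number of nodes that are expanded until the boundary at position \<open>x\<close> is reached:
  only the node that contains \<open>x\<close> in its interior is expanded.\<close>

fun boundary_cost :: "nat \<Rightarrow> 'a list list \<Rightarrow> nat" where
  "boundary_cost x [] = 0"
| "boundary_cost x (v # st) =
     (if x = 0 then 0 else if x < length v then 2 * height v else boundary_cost (x - length v) st)"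

lemma boundary_cost_0 [simp]: "boundary_cost 0 st = 0"
  by (cases st) auto

lemma boundary_cost_children:
  assumes "v \<in> F" "2 \<le> length v"
  shows "boundary_cost x (left v # right v # st) \<le> boundary_cost x (v # st)"
    "0 < x \<Longrightarrow> x < length v \<Longrightarrow> boundary_cost x (left v # right v # st) + 2 \<le> boundary_cost x (v # st)"
proof -
  have "length v = length (left v) + length (right v)"
    using arg_cong[OF children(3)[OF assms], of length] by simp
  then show "boundary_cost x (left v # right v # st) \<le> boundary_cost x (v # st)"
    "0 < x \<Longrightarrow> x < length v \<Longrightarrow> boundary_cost x (left v # right v # st) + 2 \<le> boundary_cost x (v # st)"
    using children(4,5)[OF assms] by auto
qed

definition potential :: "nat \<Rightarrow> nat \<Rightarrow> 'a list list \<Rightarrow> nat" where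
  "potential x y st = length st + boundary_cost x st + boundary_cost (x + y) st"

lemma potential_expand:
  assumes "v \<in> F" "0 < x \<and> x < length v \<or> x = 0 \<and> 0 < y \<and> y < length v"
  shows "potential x y (left v # right v # st) < potential x y (v # st)"
proof -
  have "2 \<le> length v" using assms(2) by linarith
  from boundary_cost_children[OF assms(1) this] have
    "boundary_cost x (left v # right v # st) \<le> boundary_cost x (v # st)"
    "boundary_cost (x + y) (left v # right v # st) \<le> boundary_cost (x + y) (v # st)"
    "boundary_cost x (left v # right v # st) + 2 \<le> boundary_cost x (v # st) \<or>
      boundary_cost (x + y) (left v # right v # st) + 2 \<le> boundary_cost (x + y) (v # st)"
    using assms(2) by (auto simp del: boundary_cost.simps)
  then show ?thesis unfolding potential_def list.size by linarith
qed

lemma potential_skip: "0 < x \<Longrightarrow> length v \<le> x \<Longrightarrow> potential (x - length v) y st < potential x y (v # st)"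
  by (auto simp: potential_def)

lemma potential_take: "0 < y \<Longrightarrow> length v \<le> y \<Longrightarrow> potential 0 (y - length v) st < potential 0 y (v # st)"
  by (auto simp: potential_def)

text \<open>The record of item \<open>i\<close> holds the total length and the hash of the items before it, hence one more
  record than items.\<close>

definition prefix_record :: "nat list \<Rightarrow> nat \<Rightarrow> 'a list \<Rightarrow> bool" where
  "prefix_record m a u \<longleftrightarrow> m ! a = length u \<and> has_hash m (a + 2) u"

definition items :: "nat list \<Rightarrow> nat \<Rightarrow> 'a list list \<Rightarrow> bool" where
  "items m base its \<longleftrightarrow> set its \<subseteq> F \<and>
     (\<forall>i \<le> length its. prefix_record m (base + i * item_size) (concat (take i its))) \<and>
     (\<forall>i < length its. m ! (base + i * item_size + 1) = addr (its ! i))"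

lemma prefix_record_mem_frame:
  assumes "prefix_record m a u" "mem_frame X m m'" "X \<inter> {a..<a + item_size} \<subseteq> {Suc a}"
  shows "prefix_record m' a u"
proof -
  have unchanged: "k \<notin> X" if "a \<le> k" "k < a + item_size" "k \<noteq> Suc a" for k using assms(3) that by auto
  have "m' ! a = m ! a" by (rule mem_frameD[OF assms(2) unchanged]) (simp_all add: item_size_def)
  moreover have "{a + 2..<a + 2 + ndigits} \<inter> X = {}" using unchanged by (auto simp: item_size_def)
  ultimately show ?thesis
    using assms(1) has_hash_mem_frame[OF _ assms(2)] by (simp add: prefix_record_def)
qed

lemma Suc_mult_item_size_le: "i < n \<Longrightarrow> i * item_size + item_size \<le> n * item_size"
  using mult_le_mono1[of "Suc i" n item_size] by simp

lemma items_mem_frame: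
  assumes "items m base its" "mem_frame X m m'"
    "X \<inter> {base..<base + length its * item_size + item_size} \<subseteq> {Suc (base + length its * item_size)}"
  shows "items m' base its"
proof -
  let ?a = "\<lambda>i. base + i * item_size"
  have unchanged: "k \<notin> X" if "base \<le> k" "k < ?a (length its) + item_size" "k \<noteq> Suc (?a (length its))" for k
    using assms(3) that by auto
  show ?thesis unfolding items_def
  proof (intro conjI allI impI)
    show "set its \<subseteq> F" using assms(1) by (simp add: items_def)
  next
    fix i assume i: "i \<le> length its"
    have "X \<inter> {?a i..<?a i + item_size} \<subseteq> {Suc (?a i)}"
    proof (cases "i = length its")
      case True
      show ?thesis unfolding True by (rule order_trans[OF _ assms(3)]) auto
    next
      case False
      then have earlier: "?a i + item_size \<le> ?a (length its)"
        using Suc_mult_item_size_le[of i "length its"] i by simp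
      have "k \<notin> X" if "?a i \<le> k" "k < ?a i + item_size" for k
        by (rule unchanged) (use that earlier in linarith)+
      then show ?thesis by auto
    qed
    then show "prefix_record m' (?a i) (concat (take i its))"
      using assms(1) i by (intro prefix_record_mem_frame[OF _ assms(2)]) (simp_all add: items_def)
  next
    fix i assume i: "i < length its"
    then have "Suc (?a i) < ?a (length its)" using Suc_mult_item_size_le[OF i] by (simp add: item_size_def)
    then have "Suc (?a i) \<notin> X" by (intro unchanged) linarith+
    then show "m' ! (?a i + 1) = addr (its ! i)"
      using assms(1) mem_frameD[OF assms(2)] i by (simp add: items_def)
  qed
qed

lemma items_snoc:
  assumes "items m base its" "v \<in> F" "m ! (base + length its * item_size + 1) = addr v"
    "prefix_record m (base + Suc (length its) * item_size) (concat its @ v)"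
  shows "items m base (its @ [v])"
  using assms unfolding items_def by (auto simp: le_Suc_eq less_Suc_eq nth_append)

lemma items_Nil: "items m base [] \<longleftrightarrow> prefix_record m base []"
  by (simp add: items_def)

definition item_regs :: "nat \<Rightarrow> 'a list list \<Rightarrow> (reg \<Rightarrow> nat) \<Rightarrow> bool" where
  "item_regs base its r \<longleftrightarrow> r r_item = base + length its * item_size \<and> r r_total = length (concat its) \<and>
     r r_count = length its"

lemma runs_pop:
  assumes "index_mem m" "layout_regs r" "stack m (v # st)" "r r_top = stack_addr + length (v # st)"
    "length st \<le> cap"
    and "runs w (block ps) (r(r_top := stack_addr + length st, r_node := addr v, r_len := length v), m) T Q"
    and "3 + T \<le> T'"
  shows "runs w (block (pop @ ps)) (r, m) T' Q"
proof -
  have v: "m ! (stack_addr + length st) = addr v" "v \<in> F" using stack_top[OF assms(3)] by auto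
  have bounds: "Suc (stack_addr + length st) < mem_size" "addr v < mem_size"
    using items_area[of items_i_addr] acc_area assms(5) addr_less(2)[OF v(2)] by auto
  then have "binop_val w Sub (Suc (stack_addr + length st)) 1 = stack_addr + length st"
    using sub_word[of 1 "Suc (stack_addr + length st)" w] mem_size_le by simp
  then have "runs w (block (pop @ ps)) (r, m) (3 + T) Q"
    unfolding pop_def using assms(1,4,6) bounds v index_mem_node(1)[OF assms(1) v(2)] layout_regsD[OF assms(2)]
    by (simp add: runs_Load index_mem_def del: binop_val.simps(2))
  then show ?thesis by (rule runs_mono) (use assms(7) in auto)
qed

definition push_children :: "nat \<Rightarrow> 'a list \<Rightarrow> nat list \<Rightarrow> nat list" where
  "push_children a v m = m[a := addr (right v), Suc a := addr (left v)]"

lemma push_children_mem_frame: "{a, Suc a} \<subseteq> X \<Longrightarrow> mem_frame X m (push_children a v m)"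
  by (simp add: push_children_def)

lemma stack_push_children:
  assumes "stack m st" "v \<in> F" "2 \<le> length v" "stack_addr + length st + 1 < length m"
  shows "stack (push_children (stack_addr + length st) v m) (left v # right v # st)"
  using stack_push[OF stack_push[OF assms(1) children(2)[OF assms(2,3)]] children(1)[OF assms(2,3)]] assms(4)
  by (simp add: push_children_def)

lemma runs_expand:
  assumes "index_mem m" "layout_regs r" "v \<in> F" "2 \<le> length v" "r r_node = addr v" "r r_top + 2 < mem_size"
    and "runs w (block ps) (r(r_temp := addr (left v), r_temp2 := addr (right v), r_top := r r_top + 2),
      push_children (r r_top) v m) T Q"
    and "9 + T \<le> T'"
  shows "runs w (block (expand @ ps)) (r, m) T' Q"
proof -
  have "addr v + 2 < mem_size" using addr_less(2)[OF assms(3)] by (simp add: node_size_def)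
  moreover from this have "Suc (addr v) mod 2 ^ w = Suc (addr v)" "(addr v + 2) mod 2 ^ w = addr v + 2"
    by (auto intro!: mod_word)
  moreover have "Suc (r r_top) mod 2 ^ w = Suc (r r_top)"
    "Suc (Suc (r r_top)) mod 2 ^ w = Suc (Suc (r r_top))"
    using assms(6) by (auto intro!: mod_word)
  ultimately have "runs w (block (expand @ ps)) (r, m) (9 + T) Q"
    unfolding expand_def using assms index_mem_node(3,4)[OF assms(1,3,4)] layout_regsD[OF assms(2)]
    by (simp add: runs_Load runs_Store index_mem_def push_children_def)
  then show ?thesis by (rule runs_mono) (use assms(8) in auto)
qed

end

context lce_index
begin

lemma items_append_record:
  fixes m its base
  defines "cur \<equiv> base + length its * item_size"
  assumes "items m base its" "v \<in> F" "cur + 2 * item_size \<le> length m"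
    and hash: "has_hash m' (cur + item_size + 2) (concat its @ v)"
    and frame: "mem_frame {cur + item_size + 2..<cur + item_size + 2 + ndigits} (m[Suc cur := addr v]) m'"
  defines "m'' \<equiv> m'[cur + item_size := length (concat its) + length v]"
  shows "items m'' base (its @ [v])" "mem_frame {Suc cur..<cur + 2 * item_size} m m''"
proof -
  have size: "item_size = ndigits + 2" by (simp add: item_size_def)
  have length: "length m' = length m" using mem_frame_length[OF frame] by simp
  have "mem_frame ({Suc cur} \<union> {cur + item_size..<cur + 2 * item_size}) m (m[Suc cur := addr v])" by simp
  then have "mem_frame ({Suc cur} \<union> {cur + item_size..<cur + 2 * item_size}) m m'"
    by (rule mem_frame_trans[OF _ frame]) (auto simp: size)
  then have total: "mem_frame ({Suc cur} \<union> {cur + item_size..<cur + 2 * item_size}) m m''"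
    by (simp add: m''_def size)
  then show "mem_frame {Suc cur..<cur + 2 * item_size} m m''" by (rule mem_frame_mono) (auto simp: size)
  show "items m'' base (its @ [v])"
  proof (rule items_snoc[OF _ assms(3)])
    show "items m'' base its" by (rule items_mem_frame[OF assms(2) total]) (auto simp: cur_def)
    show "m'' ! (base + length its * item_size + 1) = addr v"
      using mem_frameD[OF frame, of "Suc cur"] assms(4) size by (simp add: m''_def cur_def)
    have "has_hash m'' (cur + item_size + 2) (concat its @ v)"
      by (rule has_hash_mem_frame[OF hash, of "{cur + item_size}"]) (simp_all add: m''_def)
    moreover have "m'' ! (cur + item_size) = length (concat its @ v)"
      using assms(4) size length by (simp add: m''_def)
    ultimately show "prefix_record m'' (base + Suc (length its) * item_size) (concat its @ v)"
      by (simp add: prefix_record_def cur_def algebra_simps)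
  qed
qed

lemma runs_advance_item:
  assumes "layout_regs r" "length m = mem_size" "r r_item + item_size < mem_size" "r r_total + r r_len \<le> N"
    "r r_len \<le> r r_rest" "r r_rest \<le> N" "Suc (r r_count) < mem_size"
    and "runs w (block ps)
      (r(r_total := r r_total + r r_len, r_item := r r_item + item_size, r_rest := r r_rest - r r_len,
         r_count := Suc (r r_count)), m[r r_item + item_size := r r_total + r r_len]) T Q"
  shows "runs w (block (advance_item @ ps)) (r, m) (5 + T) Q"
proof -
  have "binop_val w Sub (r r_rest) (r r_len) = r r_rest - r r_len"
    using assms(6) words(2) by (intro sub_word assms(5)) linarith
  moreover have "(r r_total + r r_len) mod 2 ^ w = r r_total + r r_len" using assms(4) words(2) by simp
  ultimately show ?thesis
    unfolding advance_item_def
    using assms(2,3,8) layout_regsD[OF assms(1)] mod_word[OF assms(3)] mod_word[OF assms(7)]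
    by (simp add: runs_Store del: binop_val.simps(2))
qed

lemma item_room:
  assumes "base \<in> {items_i_addr, items_j_addr}" "n < cap"
  shows "base + n * item_size + 3 * item_size \<le> base + (cap + 2) * item_size"
    and "base + n * item_size + 3 * item_size < mem_size" "stack_addr < base" "Suc n < mem_size"
proof -
  have "(n + 3) * item_size \<le> (cap + 2) * item_size" using assms(2) by (intro mult_le_mono1) simp
  then show room: "base + n * item_size + 3 * item_size \<le> base + (cap + 2) * item_size"
    unfolding add_mult_distrib by linarith
  show "base + n * item_size + 3 * item_size < mem_size" "stack_addr < base" "Suc n < mem_size"
    using room items_area[OF assms(1)] acc_area assms(2) by linarith+
qed

lemma items_last_hash: "items m base its \<Longrightarrow> has_hash m (base + length its * item_size + 2) (concat its)"
  by (auto simp: items_def prefix_record_def)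

lemma runs_finish_item:
  fixes base its
  defines "cur \<equiv> base + length its * item_size"
  assumes "length m = mem_size" "layout_regs r" "base \<in> {items_i_addr, items_j_addr}" "items m base its"
    "item_regs base its r"
    and v: "v \<in> F" "r r_len = length v" "length v \<le> r r_rest"
    and bounds: "r r_rest \<le> N" "length (concat its) + length v \<le> N" "length its < cap"
    and hash: "has_hash m' (cur + item_size + 2) (concat its @ v)"
    and memory: "mem_frame {cur + item_size + 2..<cur + item_size + 2 + ndigits} (m[Suc cur := addr v]) m'"
    and frame: "reg_frame ({26, 31, 32, 33} \<union> scratch) r r'"
    and cont: "\<And>r' m'. items m' base (its @ [v]) \<Longrightarrow> item_regs base (its @ [v]) r' \<Longrightarrow> r' r_rest = r r_rest - length v \<Longrightarrow>
      reg_frame ({16, 20, 24, 25, 26, 31, 32, 33} \<union> scratch) r r' \<Longrightarrow> mem_frame (items_area base) m m' \<Longrightarrow>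
      runs w (block ps) (r', m') T Q"
  shows "runs w (block (advance_item @ ps)) (r', m') (5 + T) Q"
proof -
  note room = item_room[OF assms(4) bounds(3), folded cur_def]
  have r': "r' r_total = length (concat its)" "r' r_len = length v" "r' r_item = cur" "r' r_rest = r r_rest"
    "r' r_count = length its"
    using reg_frameD[OF frame] assms(6) v(2) by (simp_all add: item_regs_def cur_def)
  let ?m = "m'[cur + item_size := length (concat its) + length v]"
  have items: "items ?m base (its @ [v])" "mem_frame {Suc cur..<cur + 2 * item_size} m ?m"
    using items_append_record[OF assms(5) v(1), of m'] hash memory room(2) assms(2) by (simp_all add: cur_def)
  have "base \<le> cur" by (simp add: cur_def)
  then have "mem_frame (items_area base) m ?m"
    by (intro mem_frame_mono[OF items(2)]) (use room(1) in auto)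
  moreover have frame': "reg_frame ({16, 20, 24, 25, 26, 31, 32, 33} \<union> scratch) r r'"
    using frame by (rule reg_frame_mono) auto
  ultimately have "runs w (block ps) (r'(r_total := length (concat its) + length v, r_item := cur + item_size,
      r_rest := r r_rest - length v, r_count := Suc (length its)), ?m) T Q"
    by (intro cont[OF items(1)]) (simp_all add: item_regs_def cur_def)
  moreover have "layout_regs r'" by (rule layout_regs_frame[OF assms(3) frame]) auto
  moreover have "length m' = mem_size" using mem_frame_length[OF memory] assms(2) by simp
  ultimately show ?thesis
    using bounds v(3) room by (intro runs_advance_item) (simp_all add: r')
qed

lemma runs_take_item:
  assumes "index_mem m" "layout_regs r" "base \<in> {items_i_addr, items_j_addr}" "items m base its"
    "item_regs base its r"
    and v: "v \<in> F" "r r_node = addr v" "r r_len = length v" "length v \<le> r r_rest"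
    and bounds: "r r_rest \<le> N" "length (concat its) + length v \<le> N" "length its < cap"
    and "\<And>r' m'. items m' base (its @ [v]) \<Longrightarrow> item_regs base (its @ [v]) r' \<Longrightarrow> r' r_rest = r r_rest - length v \<Longrightarrow>
      reg_frame ({16, 20, 24, 25, 26, 31, 32, 33} \<union> scratch) r r' \<Longrightarrow> mem_frame (items_area base) m m' \<Longrightarrow>
      runs w (block ps) (r', m') T Q"
    and "take_item_time + T \<le> T'"
  shows "runs w (block (take_item @ ps)) (r, m) T' Q"
proof -
  define cur where "cur = base + length its * item_size"
  let ?m = "m[Suc cur := addr v]"
  let ?r = "r(r_temp := Suc cur, r_hash_in := cur + 2, r_hash_node := addr v, r_hash_out := cur + 2 + item_size)"
  have base_le: "base \<le> cur" by (simp add: cur_def)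
  note fits = item_room(2-4)[OF assms(3) bounds(3), folded cur_def]
  have mods: "Suc cur mod 2 ^ w = Suc cur" "Suc (Suc cur) mod 2 ^ w = Suc (Suc cur)"
    "Suc (Suc (cur + item_size)) mod 2 ^ w = Suc (Suc (cur + item_size))"
    using fits(1) by (simp_all add: mod_word item_size_def)
  note regs = layout_regsD[OF assms(2)] assms(5)[unfolded item_regs_def, folded cur_def]
  have m: "length m = mem_size" using assms(1) by (simp add: index_mem_def)
  have m': "index_mem ?m" by (rule index_mem_frame[OF assms(1), of "{Suc cur}"]) (use fits(2) base_le in auto)
  have "runs w (block (concat_hash @ advance_item @ ps)) (?r, ?m) (5 + (hash_time + T)) Q"
  proof (rule runs_concat_hash)
    show "arithmetic_regs ?r" using regs(1) by (simp add: arithmetic_regs_def)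
    show "arithmetic_mem ?m" by (rule arithmetic_mem[OF m'])
    have "has_hash ?m (cur + 2) (concat its)"
      by (rule has_hash_mem_frame[OF items_last_hash[OF assms(4), folded cur_def], of "{Suc cur}"]) simp_all
    then show "has_hash ?m (?r r_hash_in) (concat its)" by simp
    show "node_hash ?m (?r r_hash_node) v" using index_mem_node(2)[OF m' v(1)] by simp
    show "?r r_hash_out + ndigits < length ?m" using fits(1) m by (simp add: item_size_def)
    fix r2 m2 assume hash: "has_hash m2 (?r r_hash_out) (concat its @ v)"
      and memory: "mem_frame {?r r_hash_out..<?r r_hash_out + ndigits} ?m m2"
      and frame: "reg_frame scratch ?r r2"
    have out: "?r r_hash_out = cur + item_size + 2" by simp
    have "reg_frame ({26, 31, 32, 33} \<union> scratch) r r2"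
      by (rule reg_frame_trans[OF _ frame, of "{26, 31, 32, 33}"]) auto
    then show "runs w (block (advance_item @ ps)) (r2, m2) (5 + T) Q"
      by (rule runs_finish_item[OF m assms(2-5) v(1,3,4) bounds
        hash[unfolded out, unfolded cur_def] memory[unfolded out, unfolded cur_def]])
        (rule assms(13))
  qed simp
  then have "runs w (block (take_item @ ps)) (r, m) (5 + (5 + (hash_time + T))) Q"
    unfolding take_item_def using regs v mods fits(1) addr_less(3)[OF v(1)] m
    by (simp add: runs_Store item_size_def)
  then show ?thesis by (rule runs_mono) (use assms(14) in \<open>auto simp: take_item_time_def\<close>)
qed

end

context lce_index
begin

abbreviation work_area :: "nat \<Rightarrow> nat set" where
  "work_area base \<equiv> {stack_addr..<stack_addr + cap} \<union> items_area base"

abbreviation collect_regs :: "reg set" where "collect_regs \<equiv> {16} \<union> {19..34} \<union> scratch"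

definition collecting :: "nat \<Rightarrow> 'a list \<Rightarrow> 'a list list \<Rightarrow> 'a list list \<Rightarrow> (reg \<Rightarrow> nat) \<Rightarrow> nat list \<Rightarrow> bool" where
  "collecting base t st its r m \<longleftrightarrow> base \<in> {items_i_addr, items_j_addr} \<and> index_mem m \<and> layout_regs r \<and>
     stack m st \<and> r r_top = stack_addr + length st \<and> items m base its \<and> item_regs base its r \<and>
     concat its @ take (r r_rest) (drop (r r_skip) (concat st)) = t \<and> length t \<le> N \<and>
     r r_skip + r r_rest \<le> length (concat st) \<and> length (concat st) \<le> N \<and>
     length its + potential (r r_skip) (r r_rest) st \<le> cap"

lemma collectingD:
  assumes "collecting base t st its r m"
  shows "base \<in> {items_i_addr, items_j_addr}" "index_mem m" "layout_regs r" "stack m st"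
    "r r_top = stack_addr + length st" "items m base its" "item_regs base its r"
    "concat its @ take (r r_rest) (drop (r r_skip) (concat st)) = t" "length t \<le> N"
    "r r_skip + r r_rest \<le> length (concat st)" "length (concat st) \<le> N"
    "length its + potential (r r_skip) (r r_rest) st \<le> cap"
  using assms by (simp_all add: collecting_def)

definition progress ::
  "nat \<Rightarrow> 'a list \<Rightarrow> 'a list list \<Rightarrow> (reg \<Rightarrow> nat) \<Rightarrow> nat list \<Rightarrow> (reg \<Rightarrow> nat) \<Rightarrow> nat list \<Rightarrow> bool" where
  "progress base t st r m r' m' \<longleftrightarrow> reg_frame collect_regs r r' \<and> mem_frame (work_area base) m m' \<and>
     (\<exists>st' its'. collecting base t st' its' r' m' \<and>
       potential (r' r_skip) (r' r_rest) st' < potential (r r_skip) (r r_rest) st)"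

definition popped :: "'a list \<Rightarrow> 'a list list \<Rightarrow> (reg \<Rightarrow> nat) \<Rightarrow> reg \<Rightarrow> nat" where
  "popped v st r = r(r_top := stack_addr + length st, r_node := addr v, r_len := length v)"

lemma layout_regs_popped: "layout_regs r \<Longrightarrow> layout_regs (popped v st r)"
  by (simp add: popped_def layout_regs_def arithmetic_regs_def)

lemma runs_skip_node:
  assumes "collecting base t (v # st) its r m" "0 < r r_skip" "length v \<le> r r_skip"
  shows "runs w (block [Op Sub r_skip r_skip r_len]) (popped v st r, m) 1 (\<lambda>(r', m'). progress base t (v # st) r m r' m')"
proof -
  note state_facts = collectingD[OF assms(1)]
  let ?r = "(popped v st r)(r_skip := r r_skip - length v)"
  have less: "potential (r r_skip - length v) (r r_rest) st < potential (r r_skip) (r r_rest) (v # st)"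
    by (rule potential_skip[OF assms(2,3)])
  have "layout_regs ?r"
    using layout_regs_popped[OF state_facts(3)] by (simp add: layout_regs_def arithmetic_regs_def)
  then have "collecting base t st its ?r m"
    using state_facts less stack_top[OF state_facts(4)] assms(3)
    by (simp add: collecting_def popped_def item_regs_def)
  then have "progress base t (v # st) r m ?r m"
    unfolding progress_def using less by (intro conjI exI) (auto simp: popped_def)
  moreover have "binop_val w Sub (r r_skip) (length v) = r r_skip - length v"
    using state_facts(10,11) words(2) by (intro sub_word assms(3)) linarith
  ultimately show ?thesis by (simp add: popped_def del: binop_val.simps(2))
qed

lemma runs_expand_node:
  assumes "collecting base t (v # st) its r m"
    "0 < r r_skip \<and> r r_skip < length v \<or> r r_skip = 0 \<and> 0 < r r_rest \<and> r r_rest < length v"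
  shows "runs w (block expand) (popped v st r, m) 9 (\<lambda>(r', m'). progress base t (v # st) r m r' m')"
proof -
  note state_facts = collectingD[OF assms(1)]
  let ?st = "left v # right v # st" and ?a = "stack_addr + length st"
  let ?r = "(popped v st r)(r_temp := addr (left v), r_temp2 := addr (right v), r_top := ?a + 2)"
  let ?m = "push_children ?a v m"
  have v: "v \<in> F" "stack m st" using stack_top[OF state_facts(4)] by auto
  have len: "2 \<le> length v" using assms(2) by linarith
  note children = children[OF v(1) len]
  have less: "potential (r r_skip) (r r_rest) ?st < potential (r r_skip) (r r_rest) (v # st)"
    by (rule potential_expand[OF v(1) assms(2)])
  then have room: "length st + 2 \<le> cap" using state_facts(12) by (simp add: potential_def)
  have frame: "mem_frame {?a, Suc ?a} m ?m" by (rule push_children_mem_frame) simp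
  have top: "?a + 2 < mem_size" using room items_area[OF state_facts(1)] acc_area by linarith
  have "collecting base t ?st its ?r ?m" unfolding collecting_def
  proof (intro conjI)
    show "index_mem ?m" by (rule index_mem_frame[OF state_facts(2) frame]) auto
    show "stack ?m ?st" using stack_push_children[OF v(2,1) len] top state_facts(2)
      by (simp add: index_mem_def)
    show "items ?m base its" by (rule items_mem_frame[OF state_facts(6) frame])
      (use room items_area[OF state_facts(1)] in auto)
    show "layout_regs ?r" using layout_regs_popped[OF state_facts(3)]
      by (simp add: layout_regs_def arithmetic_regs_def)
    have "concat ?st = concat (v # st)" using children(3) by simp
    then show "concat its @ take (?r r_rest) (drop (?r r_skip) (concat ?st)) = t"
      "?r r_skip + ?r r_rest \<le> length (concat ?st)" "length (concat ?st) \<le> N"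
      using state_facts(8,10,11) by (simp_all only: popped_def) simp_all
  qed (use state_facts less in \<open>auto simp: popped_def item_regs_def\<close>)
  moreover have "mem_frame (work_area base) m ?m" by (rule mem_frame_mono[OF frame]) (use room in auto)
  ultimately have post: "progress base t (v # st) r m ?r ?m"
    unfolding progress_def using less by (intro conjI exI) (auto simp: popped_def)
  have "runs w (block (expand @ [])) (popped v st r, m) 9 (\<lambda>(r', m'). progress base t (v # st) r m r' m')"
    by (rule runs_expand[OF state_facts(2) layout_regs_popped[OF state_facts(3)] v(1) len, where T = 0])
      (use post top in \<open>simp_all add: popped_def\<close>)
  then show ?thesis by simp
qed

lemma runs_take_node:
  assumes "collecting base t (v # st) its r m" "r r_skip = 0" "0 < r r_rest" "length v \<le> r r_rest"
  shows "runs w (block take_item) (popped v st r, m) take_item_time (\<lambda>(r', m'). progress base t (v # st) r m r' m')"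
proof -
  note state_facts = collectingD[OF assms(1)]
  have v: "v \<in> F" "stack m st" using stack_top[OF state_facts(4)] by auto
  have less: "potential 0 (r r_rest - length v) st < potential 0 (r r_rest) (v # st)"
    by (rule potential_take[OF assms(3,4)])
  have len: "length (concat its) + r r_rest = length t"
    using arg_cong[OF state_facts(8), of length] state_facts(10) assms(2) by simp
  have "runs w (block (take_item @ [])) (popped v st r, m) take_item_time (\<lambda>(r', m'). progress base t (v # st) r m r' m')"
  proof (rule runs_take_item[OF state_facts(2) layout_regs_popped[OF state_facts(3)] state_facts(1,6) _ v(1),
    where T = 0])
    fix r' m' assume its': "items m' base (its @ [v])" "item_regs base (its @ [v]) r'"
      and rest: "r' r_rest = popped v st r r_rest - length v"
      and regs: "reg_frame ({16, 20, 24, 25, 26, 31, 32, 33} \<union> scratch) (popped v st r) r'"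
      and memory: "mem_frame (items_area base) m m'"
    have rest: "r' r_rest = r r_rest - length v" "r' r_skip = 0" "r' r_top = stack_addr + length st"
      using rest assms(2) by (simp_all add: reg_frameD[OF regs] popped_def)
    have frame: "reg_frame collect_regs r r'"
      by (rule reg_frame_trans[OF _ regs, of "{21, 22, 23}"]) (auto simp: popped_def)
    have "collecting base t st (its @ [v]) r' m'" unfolding collecting_def
    proof (intro conjI)
      show "index_mem m'" by (rule index_mem_frame[OF state_facts(2) memory])
        (use items_area[OF state_facts(1)] in auto)
      show "stack m' st"
        by (rule stack_mem_frame[OF v(2) memory])
        (use state_facts(12) less items_area[OF state_facts(1)] in \<open>auto simp: potential_def\<close>)
      show "layout_regs r'" by (rule layout_regs_frame[OF state_facts(3) frame]) auto
      show "concat (its @ [v]) @ take (r' r_rest) (drop (r' r_skip) (concat st)) = t"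
        using state_facts(8) assms(2,4) by (simp add: rest)
    qed (use state_facts its' rest less assms(2,4) in auto)
    moreover have "mem_frame (work_area base) m m'" by (rule mem_frame_mono[OF memory]) auto
    ultimately have "progress base t (v # st) r m r' m'"
      unfolding progress_def using frame less rest assms(2) by (intro conjI exI) auto
    then show "runs w (block []) (r', m') 0 (\<lambda>(r', m'). progress base t (v # st) r m r' m')" by simp
  qed (use state_facts assms less len in \<open>auto simp: popped_def item_regs_def\<close>)
  then show ?thesis by simp
qed

lemma runs_collect_step:
  assumes "collecting base t st its r m" "0 < r r_rest"
  shows "runs w (block collect_step) (r, m) (14 + take_item_time) (\<lambda>(r', m'). progress base t st r m r' m')"
proof -
  note state_facts = collectingD[OF assms(1)]
  obtain v q where st: "st = v # q" using state_facts(10) assms(2) by (cases st) auto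
  let ?post = "\<lambda>(r', m'). progress base t st r m r' m'"
  let ?r = "popped v q r"
  have regs: "?r r_zero = 0" "?r r_skip = r r_skip" "?r r_rest = r r_rest" "?r r_len = length v"
    using layout_regsD(3)[OF state_facts(3)] by (simp_all add: popped_def)
  note runs = runs_skip_node runs_expand_node runs_take_node
  have "runs w (block ([Cond (LessEq r_len r_skip) (block [Op Sub r_skip r_skip r_len]) (block expand)] @ []))
      (?r, m) (10 + take_item_time) ?post" if "0 < r r_skip"
    unfolding append_Nil2
    by (rule runs_Cond) (use runs(1,2)[OF assms(1)[unfolded st]] that in \<open>auto simp: regs st take_item_time_def elim: runs_mono\<close>)
  moreover have "runs w (block ([Cond (LessEq r_len r_rest) (block take_item) (block expand)] @ []))
      (?r, m) (10 + take_item_time) ?post" if "r r_skip = 0"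
    unfolding append_Nil2
    by (rule runs_Cond) (use runs(2,3)[OF assms(1)[unfolded st]] that assms(2) in \<open>auto simp: regs st take_item_time_def elim: runs_mono\<close>)
  ultimately have "runs w (block [Cond (Less r_zero r_skip)
      (block [Cond (LessEq r_len r_skip) (block [Op Sub r_skip r_skip r_len]) (block expand)])
      (block [Cond (LessEq r_len r_rest) (block take_item) (block expand)])]) (?r, m) (11 + take_item_time) ?post"
    by (intro runs_Cond) (auto simp: regs)
  moreover have "length q \<le> cap" using state_facts(12) by (simp add: potential_def st)
  ultimately show ?thesis unfolding collect_step_def
    by (intro runs_pop[OF state_facts(2,3), where v = v and st = q and T = "11 + take_item_time"])
      (use state_facts(4,5) in \<open>simp_all add: st popped_def\<close>)
qed

lemma runs_collect_loop:
  assumes "collecting base t st its r m"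
    and "\<And>r' m' its'. items m' base its' \<Longrightarrow> concat its' = t \<Longrightarrow> r' r_count = length its' \<Longrightarrow> length its' \<le> cap \<Longrightarrow>
      reg_frame collect_regs r r' \<Longrightarrow> mem_frame (work_area base) m m' \<Longrightarrow> runs w (block ps) (r', m') T Q"
    and "Suc (cap * (15 + take_item_time)) + T \<le> T'"
  shows "runs w (block (While (Less r_zero r_rest) (block collect_step) # ps)) (r, m) T' Q"
proof (rule runs_While[where I = "\<lambda>r' m' n. reg_frame collect_regs r r' \<and> mem_frame (work_area base) m m' \<and>
    (\<exists>st its. collecting base t st its r' m' \<and> n = potential (r' r_skip) (r' r_rest) st)"])
  show "reg_frame collect_regs r r \<and> mem_frame (work_area base) m m \<and>
      (\<exists>st' its. collecting base t st' its r m \<and> potential (r r_skip) (r r_rest) st = potential (r r_skip) (r r_rest) st')"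
    using assms(1) by auto
next
  fix r1 m1 n assume "reg_frame collect_regs r r1 \<and> mem_frame (work_area base) m m1 \<and>
      (\<exists>st its. collecting base t st its r1 m1 \<and> n = potential (r1 r_skip) (r1 r_rest) st)"
    and test: "cmp_val (Less r_zero r_rest) r1"
  then obtain st its where frames: "reg_frame collect_regs r r1" "mem_frame (work_area base) m m1"
    and collecting: "collecting base t st its r1 m1" and n: "n = potential (r1 r_skip) (r1 r_rest) st"
    by blast
  have "0 < r1 r_rest" using test layout_regsD(3)[OF collectingD(3)[OF collecting]] by simp
  show "runs w (block collect_step) (r1, m1) (14 + take_item_time) (\<lambda>(r', m'). \<exists>n' < n. reg_frame collect_regs r r' \<and>
      mem_frame (work_area base) m m' \<and> (\<exists>st its. collecting base t st its r' m' \<and> n' = potential (r' r_skip) (r' r_rest) st))"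
  proof (rule runs_mono[OF runs_collect_step[OF collecting \<open>0 < r1 r_rest\<close>] order_refl])
    fix s assume "case s of (r', m') \<Rightarrow> progress base t st r1 m1 r' m'"
    then obtain r' m' st' its'
      where s: "s = (r', m')" "reg_frame collect_regs r1 r'" "mem_frame (work_area base) m1 m'"
      "collecting base t st' its' r' m'" "potential (r' r_skip) (r' r_rest) st' < n"
      unfolding progress_def n by (cases s) auto
    moreover have "reg_frame collect_regs r r'" "mem_frame (work_area base) m m'"
      by (rule reg_frame_trans[OF frames(1) s(2) order_refl order_refl], rule mem_frame_trans[OF frames(2) s(3) order_refl order_refl])
    ultimately show "case s of (r', m') \<Rightarrow> \<exists>n' < n. reg_frame collect_regs r r' \<and> mem_frame (work_area base) m m' \<and>
        (\<exists>st its. collecting base t st its r' m' \<and> n' = potential (r' r_skip) (r' r_rest) st)" by blast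
  qed
next
  fix r1 m1 n assume "reg_frame collect_regs r r1 \<and> mem_frame (work_area base) m m1 \<and>
      (\<exists>st its. collecting base t st its r1 m1 \<and> n = potential (r1 r_skip) (r1 r_rest) st)"
    and test: "\<not> cmp_val (Less r_zero r_rest) r1"
  then obtain st its where frames: "reg_frame collect_regs r r1" "mem_frame (work_area base) m m1"
    and collecting: "collecting base t st its r1 m1" by blast
  have "r1 r_rest = 0" using test layout_regsD(3)[OF collectingD(3)[OF collecting]] by simp
  then show "runs w (block ps) (r1, m1) T Q"
    using collectingD[OF collecting] frames by (intro assms(2)) (auto simp: item_regs_def)
next
  have "potential (r r_skip) (r r_rest) st * Suc (14 + take_item_time) \<le> cap * (15 + take_item_time)"
    using collectingD(12)[OF assms(1)] by (intro mult_le_mono) simp_all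
  then show "Suc (potential (r r_skip) (r r_rest) st * Suc (14 + take_item_time)) + T \<le> T'"
    using assms(3) by linarith
qed

lemma collecting_start:
  assumes "base \<in> {items_i_addr, items_j_addr}" "index_mem m" "layout_regs r" "r r_top = stack_addr + 1"
    "item_regs base [] r" "r r_skip + r r_rest \<le> N" "m ! stack_addr = addr S" "m ! base = 0"
    "segment m (base + 2) ndigits = segment m modulus_addr ndigits"
  shows "collecting base (take (r r_rest) (drop (r r_skip) S)) [S] [] r m"
proof -
  have "number m modulus_addr" "val m modulus_addr = P"
    using arithmetic_mem[OF assms(2)] by (auto simp: arithmetic_mem_def)
  moreover have "base + 2 + ndigits < length m"
  proof -
    have "2 * item_size \<le> (cap + 2) * item_size" by (intro mult_le_mono1) simp
    moreover have "ndigits + 2 \<le> item_size" by (simp add: item_size_def)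
    ultimately show ?thesis using assms(2) items_area(2)[OF assms(1)] acc_area
      unfolding index_mem_def by linarith
  qed
  ultimately have "has_hash m (base + 2) []"
    using assms(9) modulus_gt_1 by (simp add: has_hash_def number_def cong_def)
  then have "items m base []" using assms(8) by (simp add: items_Nil prefix_record_def)
  moreover have "potential (r r_skip) (r r_rest) [S] \<le> cap" by (simp add: potential_def cap_def)
  ultimately show ?thesis using assms S_in_F by (simp add: collecting_def stack_def)
qed

lemma runs_start_items:
  assumes "index_mem m" "layout_regs r" "base \<in> {items_i_addr, items_j_addr}" "r r_items = base"
    "r r_skip + r r_rest \<le> N"
    and "\<And>r' m'. collecting base (take (r r_rest) (drop (r r_skip) S)) [S] [] r' m' \<Longrightarrow> reg_frame collect_regs r r' \<Longrightarrow>
      mem_frame (work_area base) m m' \<Longrightarrow> runs w (block ps) (r', m') T Q"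
  shows "runs w (block (start_items @ ps)) (r, m) (10 + (4 * ndigits + T)) Q"
proof -
  let ?m = "m[stack_addr := addr S, base := 0]"
  let ?r = "r(r_top := stack_addr + 1, r_item := base, r_total := 0, r_count := 0, r_ptr := modulus_addr, r_ptr2 := base + 2)"
  have "2 * item_size \<le> (cap + 2) * item_size" "ndigits + 2 \<le> item_size"
    by (intro mult_le_mono1) (simp_all add: item_size_def)
  then have bounds: "base + 2 + ndigits < mem_size" "stack_addr + cap < base"
    "base + 2 + ndigits \<le> base + (cap + 2) * item_size"
    using items_area[OF assms(3)] acc_area by linarith+
  have m: "length m = mem_size" using assms(1) by (simp add: index_mem_def)
  have "0 < cap" by (simp add: cap_def)
  then have frame: "mem_frame (work_area base) m ?m" using bounds by (simp add: item_size_def)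
  have modulus: "modulus_addr + ndigits < stack_addr" "modulus_addr < mem_size"
    using stack_addr_less by (simp_all add: modulus_addr_def stack_addr_def)
  have "runs w (block (copy_words ndigits @ ps)) (?r, ?m) (4 * ndigits + T) Q"
  proof (rule runs_copy_words)
    fix r1 m1 assume copied: "mem_frame {?r r_ptr2..<?r r_ptr2 + ndigits} ?m m1"
      "segment m1 (?r r_ptr2) ndigits = segment ?m (?r r_ptr) ndigits"
      and regs_copied: "reg_frame {r_word, r_ptr, r_ptr2} ?r r1"
    have frame: "mem_frame (work_area base) m m1"
      by (rule mem_frame_trans[OF frame copied(1)]) (use bounds(3) in auto)
    have regs: "reg_frame collect_regs r r1"
      by (rule reg_frame_trans[OF _ regs_copied, of collect_regs]) auto
    have r1: "layout_regs r1" by (rule layout_regs_frame[OF assms(2) regs]) auto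
    have args: "r1 r_skip = r r_skip" "r1 r_rest = r r_rest" by (simp_all add: reg_frameD[OF regs_copied])
    have "collecting base (take (r r_rest) (drop (r r_skip) S)) [S] [] r1 m1"
      unfolding args[symmetric]
    proof (rule collecting_start[OF assms(3) _ r1])
      show "index_mem m1" by (rule index_mem_frame[OF assms(1) frame]) (use bounds(2) in auto)
      show "m1 ! stack_addr = addr S" "m1 ! base = 0"
        using mem_frameD[OF copied(1)] bounds m by (simp_all add: nth_list_update)
      have "segment m1 modulus_addr ndigits = segment ?m modulus_addr ndigits"
        by (rule segment_mem_frame[OF copied(1)]) (use bounds(2) modulus(1) in auto)
      then show "segment m1 (base + 2) ndigits = segment m1 modulus_addr ndigits" using copied(2) by simp
    qed (use assms(5) args regs_copied in \<open>simp_all add: item_regs_def reg_frameD\<close>)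
    then show "runs w (block ps) (r1, m1) T Q" using regs frame by (rule assms(6))
  qed (use layout_regsD(2)[OF assms(2)] bounds modulus m mem_size_le in auto)
  then show ?thesis
    unfolding start_items_def
    using layout_regsD[OF assms(2)] assms(4) bounds modulus m addr_less(3)[OF S_in_F] stack_addr_less
      mod_word[of stack_addr] mod_word[of "Suc stack_addr"] mod_word[of base] mod_word[of "Suc base"]
      mod_word[of "Suc (Suc base)"] mod_word[OF modulus(2)]
    by (simp add: runs_Store)
qed

lemma runs_collect_items:
  assumes "index_mem m" "layout_regs r" "base \<in> {items_i_addr, items_j_addr}" "r r_items = base"
    "r r_skip + r r_rest \<le> N"
    and "\<And>r' m' its. items m' base its \<Longrightarrow> concat its = take (r r_rest) (drop (r r_skip) S) \<Longrightarrow> r' r_count = length its \<Longrightarrow>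
      length its \<le> cap \<Longrightarrow> reg_frame collect_regs r r' \<Longrightarrow> mem_frame (work_area base) m m' \<Longrightarrow> runs w (block ps) (r', m') T Q"
    and "collect_time * (cap + 1) + T \<le> T'"
  shows "runs w (block (collect_items @ ps)) (r, m) T' Q"
proof -
  let ?loop = "While (Less r_zero r_rest) (block collect_step)"
  have "runs w (block (start_items @ ?loop # ps)) (r, m) (10 + (4 * ndigits + (Suc (cap * (15 + take_item_time)) + T))) Q"
  proof (rule runs_start_items[OF assms(1-5)])
    fix r1 m1 assume collecting: "collecting base (take (r r_rest) (drop (r r_skip) S)) [S] [] r1 m1"
      and start: "reg_frame collect_regs r r1" "mem_frame (work_area base) m m1"
    show "runs w (block (?loop # ps)) (r1, m1) (Suc (cap * (15 + take_item_time)) + T) Q"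
    proof (rule runs_collect_loop[OF collecting])
      fix r' m' its assume "items m' base its" "concat its = take (r r_rest) (drop (r r_skip) S)"
        "r' r_count = length its"
        "length its \<le> cap" and frames: "reg_frame collect_regs r1 r'" "mem_frame (work_area base) m1 m'"
      then show "runs w (block ps) (r', m') T Q"
        using reg_frame_trans[OF start(1) frames(1) order_refl order_refl]
          mem_frame_trans[OF start(2) frames(2) order_refl order_refl] by (intro assms(6))
    qed simp_all
  qed
  then have "runs w (block (collect_items @ ps)) (r, m) (10 + (4 * ndigits + (Suc (cap * (15 + take_item_time)) + T))) Q"
    by (simp add: collect_items_def)
  then show ?thesis by (rule runs_mono) (use assms(7) in \<open>simp_all add: collect_time_def algebra_simps\<close>)
qed

end

section \<open>Binary search\<close>

definition search_update :: "reg \<Rightarrow> reg \<Rightarrow> reg \<Rightarrow> reg \<Rightarrow> cmp \<Rightarrow> prog list" where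
  "search_update low high middle next c =
     [Cond c (block [Move low middle]) (block [Move high middle]), Op Add next low r_one]"

definition search_step :: "reg \<Rightarrow> reg \<Rightarrow> reg \<Rightarrow> reg \<Rightarrow> prog list \<Rightarrow> cmp \<Rightarrow> prog list" where
  "search_step low high middle next test c =
     [Op Add middle low high, Const r_temp 2, Op Div middle middle r_temp] @ test @ search_update low high middle next c"

definition binary_search :: "reg \<Rightarrow> reg \<Rightarrow> reg \<Rightarrow> reg \<Rightarrow> prog list \<Rightarrow> cmp \<Rightarrow> prog list" where
  "binary_search low high middle next test c =
     [Op Add next low r_one, While (Less next high) (block (search_step low high middle next test c))]"

locale search =
  fixes w :: nat and low high middle "next" :: reg and test :: "prog list" and c :: cmp and k n :: nat
    and below :: "nat \<Rightarrow> bool" and inv :: "(reg \<Rightarrow> nat) \<Rightarrow> nat list \<Rightarrow> bool"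
  assumes distinct_regs: "distinct [low, high, middle, next, r_temp, r_one, r_zero]"
    and word: "2 * n + 2 < 2 ^ w"
    and inv_regs: "inv r m \<Longrightarrow> r r_one = 1 \<and> r r_zero = 0"
    and inv_frame: "inv r m \<Longrightarrow> reg_frame {low, high, middle, next, r_temp} r r' \<Longrightarrow> inv r' m"
    and runs_test: "inv r m \<Longrightarrow> r middle < n \<Longrightarrow>
      (\<And>r' m'. inv r' m' \<Longrightarrow> (cmp_val c r' \<longleftrightarrow> below (r middle)) \<Longrightarrow> r' low = r low \<Longrightarrow> r' high = r high \<Longrightarrow>
        r' middle = r middle \<Longrightarrow> runs w (block ps) (r', m') T Q) \<Longrightarrow>
      runs w (block (test @ ps)) (r, m) (k + T) Q"
begin

definition bracket :: "(reg \<Rightarrow> nat) \<Rightarrow> nat list \<Rightarrow> nat \<Rightarrow> bool" where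
  "bracket r m j \<longleftrightarrow> inv r m \<and> r next = Suc (r low) \<and> r low < r high \<and> r high \<le> n \<and> below (r low) \<and>
     (r high = n \<or> \<not> below (r high)) \<and> r high - r low \<le> 2 ^ j"

lemma runs_search_update:
  assumes bracket: "bracket r m (Suc j)" and "Suc (r low) < r high" and inv: "inv r' m'"
    and r': "r' low = r low" "r' high = r high" "r' middle = (r low + r high) div 2"
    and test: "cmp_val c r' \<longleftrightarrow> below (r' middle)"
  shows "runs w (block (search_update low high middle next c)) (r', m') 3 (\<lambda>(r', m'). bracket r' m' j)"
proof -
  define mid where "mid = (r low + r high) div 2"
  have mid: "r low < mid" "mid < r high" "mid < n" "r high - mid \<le> 2 ^ j" "mid - r low \<le> 2 ^ j"
    using assms(1,2) unfolding bracket_def mid_def by auto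
  note r' = r'[folded mid_def]
  have less: "mid < 2 ^ w" "Suc mid < 2 ^ w" "Suc (r low) < 2 ^ w" using mid word by linarith+
  have new: "bracket (r'(a := mid, next := Suc v)) m' j"
    if "if below mid then a = low \<and> v = mid else a = high \<and> v = r low"
    for a v
  proof -
    have "inv (r'(a := mid, next := Suc v)) m'" using inv_frame[OF inv] that by (auto split: if_splits)
    then show ?thesis using that bracket mid distinct_regs
      unfolding bracket_def by (auto simp: r' split: if_splits)
  qed
  show ?thesis unfolding search_update_def
  proof (rule runs_Cond)
    assume "cmp_val c (fst (r', m'))"
    then have "bracket (r'(low := mid, next := Suc mid)) m' j"
      using new[of low mid] test r' distinct_regs by simp
    then show "runs w (block ([Move low middle] @ [Op Add next low r_one])) (r', m') (3 - 1) (\<lambda>(r', m'). bracket r' m' j)"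
      using inv_regs[OF inv] r' less distinct_regs by auto
  next
    assume "\<not> cmp_val c (fst (r', m'))"
    then have "bracket (r'(high := mid, next := Suc (r low))) m' j"
      using new[of high "r low"] test r' distinct_regs by simp
    then show "runs w (block ([Move high middle] @ [Op Add next low r_one])) (r', m') (3 - 1) (\<lambda>(r', m'). bracket r' m' j)"
      using inv_regs[OF inv] r' less distinct_regs by auto
  qed simp
qed

lemma runs_search_step:
  assumes bracket: "bracket r m j" and less: "Suc (r low) < r high"
  shows "runs w (block (search_step low high middle next test c)) (r, m) (6 + k) (\<lambda>(r', m'). \<exists>j' < j. bracket r' m' j')"
proof -
  have "j \<noteq> 0"
  proof
    assume "j = 0"
    then have "r high - r low \<le> 1" using bracket by (simp add: bracket_def)
    with less show False by linarith
  qed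
  then obtain i where j: "j = Suc i" by (cases j) auto
  let ?r = "r(r_temp := 2, middle := (r low + r high) div 2)"
  have inv: "inv r m" using bracket by (simp add: bracket_def)
  have "inv ?r m" by (rule inv_frame[OF inv]) simp
  then have "runs w (block (test @ search_update low high middle next c)) (?r, m) (k + 3)
      (\<lambda>(r', m'). \<exists>j' < j. bracket r' m' j')"
  proof (rule runs_test)
    fix r1 m1 assume "inv r1 m1" "cmp_val c r1 \<longleftrightarrow> below (?r middle)" "r1 low = ?r low" "r1 high = ?r high"
      "r1 middle = ?r middle"
    then have "runs w (block (search_update low high middle next c)) (r1, m1) 3 (\<lambda>(r', m'). bracket r' m' i)"
      using runs_search_update[OF bracket[unfolded j] less] distinct_regs by auto
    then show "runs w (block (search_update low high middle next c)) (r1, m1) 3 (\<lambda>(r', m'). \<exists>j' < j. bracket r' m' j')"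
      by (rule runs_mono) (auto simp: j)
  next
    have "r low + r high < 2 * n" using less bracket unfolding bracket_def by linarith
    then show "?r middle < n" using distinct_regs by simp
  qed
  moreover have "(r low + r high) mod 2 ^ w = r low + r high" "2 mod 2 ^ w = (2::nat)"
    using bracket word unfolding bracket_def by auto
  ultimately show ?thesis using distinct_regs by (simp add: search_step_def add.commute[of k])
qed

lemma runs_binary_search:
  assumes "inv r m" "r low = 0" "r high = n" "0 < n" "below 0"
    and "\<And>r' m'. inv r' m' \<Longrightarrow> r' low < n \<Longrightarrow> below (r' low) \<Longrightarrow> Suc (r' low) = n \<or> \<not> below (Suc (r' low)) \<Longrightarrow>
      runs w (block ps) (r', m') T Q"
    and "2 + bit_length n * (7 + k) + T \<le> T'"
  shows "runs w (block (binary_search low high middle next test c @ ps)) (r, m) T' Q"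
proof -
  let ?body = "search_step low high middle next test c"
  have "runs w (block (While (Less next high) (block ?body) # ps)) (r(next := 1), m) (1 + bit_length n * (7 + k) + T) Q"
  proof (rule runs_While[where I = bracket])
    have "inv (r(next := 1)) m" by (rule inv_frame[OF assms(1)]) simp
    then show "bracket (r(next := 1)) m (bit_length n)"
      using assms(2-5) distinct_regs less_two_power_bit_length[of n] by (auto simp: bracket_def)
  next
    fix r m j assume "bracket r m j" "cmp_val (Less next high) r"
    then show "runs w (block ?body) (r, m) (6 + k) (\<lambda>(r', m'). \<exists>j' < j. bracket r' m' j')"
      using runs_search_step[of r m j] by (auto simp: bracket_def)
  next
    fix r m j assume bracket: "bracket r m j" and "\<not> cmp_val (Less next high) r"
    then have "r high = Suc (r low)" by (auto simp: bracket_def)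
    then show "runs w (block ps) (r, m) T Q" using bracket by (intro assms(6)) (auto simp: bracket_def)
  qed simp
  moreover have "w \<noteq> 0" using word by (intro notI) simp
  ultimately have "runs w (block (binary_search low high middle next test c @ ps)) (r, m)
      (1 + (1 + bit_length n * (7 + k) + T)) Q"
    unfolding binary_search_def using assms(2) inv_regs[OF assms(1)] by simp
  then show ?thesis by (rule runs_mono) (use assms(7) in auto)
qed

end

section \<open>Comparing prefixes of the windows\<close>

definition load_offset :: "prog list" where
  "load_offset = [Op Mult r_hash_in r_probe r_item_size, Op Add r_hash_in r_hash_in r_items, Load r_hash_in r_hash_in]"

definition locate :: "prog list" where
  "locate = [Const r_first 0, Move r_last r_count] @
     binary_search r_first r_last r_probe r_temp2 load_offset (LessEq r_hash_in r_skip)"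

definition append_node :: "reg \<Rightarrow> prog list" where
  "append_node a = [Move r_hash_in r_acc, Move r_hash_node a, Move r_hash_out r_acc] @ concat_hash"

definition descend_step :: "prog list" where
  "descend_step = [Load r_len r_node, Cond (LessEq r_len r_rest)
     (block (append_node r_node @ [Op Sub r_rest r_rest r_len]))
     (block [Op Add r_temp r_node r_one, Load r_temp r_temp, Load r_temp2 r_temp, Cond (LessEq r_temp2 r_rest)
       (block (append_node r_temp @
         [Op Sub r_rest r_rest r_temp2, Const r_temp 2, Op Add r_temp r_node r_temp, Load r_node r_temp]))
       (block [Move r_node r_temp])])]"

definition start_descent :: "prog list" where
  "start_descent = [Op Mult r_temp r_first r_item_size, Op Add r_temp r_temp r_items, Load r_temp2 r_temp,
     Op Sub r_rest r_skip r_temp2, Op Add r_temp r_temp r_one, Load r_node r_temp, Op Add r_ptr r_temp r_one,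
     Move r_ptr2 r_acc] @ copy_words ndigits"

definition descend :: "prog list" where
  "descend = start_descent @ [While (Less r_zero r_rest) (block descend_step)]"

context lce_index
begin

lemma item_addr_less:
  assumes "base \<in> {items_i_addr, items_j_addr}" "i \<le> n" "n \<le> cap"
  shows "base + i * item_size + item_size < acc_i_addr" "base + i * item_size + item_size < mem_size"
proof -
  have "(i + 1) * item_size < (cap + 2) * item_size"
    using assms(2,3) by (intro mult_strict_right_mono) (simp_all add: item_size_def)
  then show "base + i * item_size + item_size < acc_i_addr"
    using items_area(2)[OF assms(1)] unfolding add_mult_distrib by linarith
  then show "base + i * item_size + item_size < mem_size" using acc_area by linarith
qed

lemma cap_less: "2 * cap + 4 < mem_size"
proof -
  have "(cap + 2) * 2 \<le> (cap + 2) * item_size" by (intro mult_le_mono2) (simp add: item_size_def)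
  then show ?thesis using items_area(2)[of items_i_addr] acc_area by simp
qed

lemma runs_load_offset:
  assumes "index_mem m" "layout_regs r" "base \<in> {items_i_addr, items_j_addr}" "items m base its"
    "r r_items = base"
    "r r_probe < length its" "length its \<le> cap"
    and "runs w (block ps) (r(r_hash_in := length (concat (take (r r_probe) its))), m) T Q"
  shows "runs w (block (load_offset @ ps)) (r, m) (3 + T) Q"
proof -
  let ?a = "base + r r_probe * item_size"
  have "?a < mem_size" "r r_probe * item_size < mem_size" "m ! ?a = length (concat (take (r r_probe) its))"
    using item_addr_less(2)[OF assms(3) less_imp_le[OF assms(6)] assms(7)] assms(4,6)
    by (auto simp: items_def prefix_record_def)
  then show ?thesis
    unfolding load_offset_def using assms(1,5,8) layout_regsD[OF assms(2)]
    by (simp add: runs_Load index_mem_def mod_word add.commute[of _ base])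
qed

lemma runs_locate:
  assumes "index_mem m" "layout_regs r" "base \<in> {items_i_addr, items_j_addr}" "items m base its"
    "r r_items = base"
    "r r_count = length its" "its \<noteq> []" "length its \<le> cap" "r r_skip \<le> length (concat its)"
    and "\<And>r'. r' r_first < length its \<Longrightarrow> length (concat (take (r' r_first) its)) \<le> r r_skip \<Longrightarrow>
      r r_skip \<le> length (concat (take (Suc (r' r_first)) its)) \<Longrightarrow> reg_frame {26..31} r r' \<Longrightarrow> runs w (block ps) (r', m) T Q"
    and "4 + bit_length cap * 10 + T \<le> T'"
  shows "runs w (block (locate @ ps)) (r, m) T' Q"
proof -
  let ?inv = "\<lambda>r' m'. m' = m \<and> reg_frame {26..31} r r'"
  let ?below = "\<lambda>i. length (concat (take i its)) \<le> r r_skip"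
  note regs = layout_regsD[OF assms(2)]
  interpret search w r_first r_last r_probe r_temp2 load_offset "LessEq r_hash_in r_skip" 3 "length its" ?below ?inv
  proof
    show "2 * length its + 2 < 2 ^ w" using cap_less assms(8) mem_size_le by linarith
    show "r' r_one = 1 \<and> r' r_zero = 0" if "?inv r' m'" for r' m'
      using that regs by (simp add: reg_frameD[of "{26..31}" r r'])
    show "?inv r'' m'" if "?inv r' m'" "reg_frame {r_first, r_last, r_probe, r_temp2, r_temp} r' r''"
      for r' m' r''
      using that reg_frame_trans[of "{26..31}" r r' _ r'' "{26..31}"] by auto
  next
    fix r1 m1 ps T Q assume inv: "?inv r1 m1" and mid: "r1 r_probe < length its"
      and cont: "\<And>r' m'. ?inv r' m' \<Longrightarrow> cmp_val (LessEq r_hash_in r_skip) r' = ?below (r1 r_probe) \<Longrightarrow>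
        r' r_first = r1 r_first \<Longrightarrow> r' r_last = r1 r_last \<Longrightarrow> r' r_probe = r1 r_probe \<Longrightarrow> runs w (block ps) (r', m') T Q"
    have frame: "reg_frame {26..31} r r1" and m1: "m1 = m" using inv by simp_all
    have r1: "r1 r_items = base" "r1 r_skip = r r_skip" using assms(5) by (simp_all add: reg_frameD[OF frame])
    have "layout_regs r1" by (rule layout_regs_frame[OF assms(2) frame]) auto
    then show "runs w (block (load_offset @ ps)) (r1, m1) (3 + T) Q"
      unfolding m1 using assms(1,3,4,8) r1(1) mid
      by (intro runs_load_offset[where base = base and its = its]) (use cont frame r1(2) in auto)
  qed simp
  let ?r = "r(r_first := 0, r_last := length its)"
  have "runs w (block (binary_search r_first r_last r_probe r_temp2 load_offset (LessEq r_hash_in r_skip) @ ps)) (?r, m)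
      (2 + bit_length (length its) * (7 + 3) + T) Q"
  proof (rule runs_binary_search)
    fix r' m' assume "?inv r' m'" "r' r_first < length its" "?below (r' r_first)"
      "Suc (r' r_first) = length its \<or> \<not> ?below (Suc (r' r_first))"
    then show "runs w (block ps) (r', m') T Q" using assms(9) by (auto intro!: assms(10))
  qed (use assms(7) in auto)
  then have "runs w (block (locate @ ps)) (r, m) (2 + (2 + bit_length (length its) * 10 + T)) Q"
    unfolding locate_def using assms(6) regs cap_less assms(8) mod_word[of "length its"] by simp
  then show ?thesis
  proof (rule runs_mono)
    have "bit_length (length its) * 10 \<le> bit_length cap * 10"
      using floorlog_mono[OF assms(8)] by (intro mult_le_mono1)
    then show "2 + (2 + bit_length (length its) * 10 + T) \<le> T'" using assms(11) by linarith
  qed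
qed

lemma runs_append_node:
  assumes "index_mem m" "layout_regs r" "acc \<in> {acc_i_addr, acc_j_addr}" "r r_acc = acc" "has_hash m acc u"
    "v \<in> F" "r a = addr v" "a \<in> {r_node, r_temp}"
    and "\<And>r' m'. has_hash m' acc (u @ v) \<Longrightarrow> mem_frame {acc..<acc + ndigits} m m' \<Longrightarrow>
      reg_frame ({31, 32, 33} \<union> scratch) r r' \<Longrightarrow> runs w (block ps) (r', m') T Q"
    and "3 + hash_time + T \<le> T'"
  shows "runs w (block (append_node a @ ps)) (r, m) T' Q"
proof -
  let ?r = "r(r_hash_in := acc, r_hash_node := addr v, r_hash_out := acc)"
  have acc: "acc + ndigits < mem_size" using acc_area assms(3) by auto
  have "runs w (block (concat_hash @ ps)) (?r, m) (hash_time + T) Q"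
  proof (rule runs_concat_hash[OF _ arithmetic_mem[OF assms(1)]])
    show "arithmetic_regs ?r" using layout_regsD(1)[OF assms(2)] by (simp add: arithmetic_regs_def)
    show "node_hash m (?r r_hash_node) v" using index_mem_node(2)[OF assms(1,6)] by simp
    fix r' m' assume "has_hash m' (?r r_hash_out) (u @ v)"
      "mem_frame {?r r_hash_out..<?r r_hash_out + ndigits} m m'" and frame: "reg_frame scratch ?r r'"
    moreover have "reg_frame ({31, 32, 33} \<union> scratch) r r'"
      by (rule reg_frame_trans[OF _ frame, of "{31, 32, 33}"]) auto
    ultimately show "runs w (block ps) (r', m') T Q" by (intro assms(9)) simp_all
  qed (use assms(1,5) acc in \<open>simp_all add: index_mem_def\<close>)
  then have "runs w (block (append_node a @ ps)) (r, m) (3 + (hash_time + T)) Q"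
    unfolding append_node_def
    using assms(4,7,8) layout_regsD[OF assms(2)] mod_word[of acc] acc addr_less(3)[OF assms(6)] by auto
  then show ?thesis by (rule runs_mono) (use assms(10) in auto)
qed

abbreviation descend_regs :: "reg set" where "descend_regs \<equiv> {20, 22, 23, 26, 27, 31, 32, 33} \<union> scratch"

definition descending :: "nat \<Rightarrow> 'a list \<Rightarrow> 'a list \<Rightarrow> (reg \<Rightarrow> nat) \<Rightarrow> nat list \<Rightarrow> bool" where
  "descending acc t v r m \<longleftrightarrow> acc \<in> {acc_i_addr, acc_j_addr} \<and> index_mem m \<and> layout_regs r \<and> r r_acc = acc \<and>
     v \<in> F \<and> r r_node = addr v \<and> r r_rest \<le> length v \<and> (\<exists>u. has_hash m acc u \<and> u @ take (r r_rest) v = t)"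

lemma descendingD:
  assumes "descending acc t v r m"
  shows "acc \<in> {acc_i_addr, acc_j_addr}" "index_mem m" "layout_regs r" "r r_acc = acc" "v \<in> F"
    "r r_node = addr v"
    "r r_rest \<le> length v" "\<exists>u. has_hash m acc u \<and> u @ take (r r_rest) v = t"
  using assms by (simp_all add: descending_def)

definition descended ::
  "nat \<Rightarrow> 'a list \<Rightarrow> 'a list \<Rightarrow> (reg \<Rightarrow> nat) \<Rightarrow> nat list \<Rightarrow> (reg \<Rightarrow> nat) \<Rightarrow> nat list \<Rightarrow> bool" where
  "descended acc t v r m r' m' \<longleftrightarrow> reg_frame descend_regs r r' \<and> mem_frame {acc..<acc + ndigits} m m' \<and>
     (\<exists>v'. descending acc t v' r' m' \<and> (r' r_rest = 0 \<or> height v' < height v))"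

lemma descendedI:
  assumes "descending acc t v r m" "reg_frame descend_regs r r'" "mem_frame {acc..<acc + ndigits} m m'"
    "v' \<in> F" "r' r_node = addr v'" "r' r_rest \<le> length v'" "has_hash m' acc u" "u @ take (r' r_rest) v' = t"
    "r' r_rest = 0 \<or> height v' < height v"
  shows "descended acc t v r m r' m'"
proof -
  note state_facts = descendingD[OF assms(1)]
  have "index_mem m'"
    by (rule index_mem_frame[OF state_facts(2) assms(3)])
      (use state_facts(1) items_area[of items_i_addr] acc_area in auto)
  moreover have "layout_regs r'" by (rule layout_regs_frame[OF state_facts(3) assms(2)]) auto
  moreover have "r' r_acc = acc" using reg_frameD[OF assms(2)] state_facts(4) by simp
  ultimately have "descending acc t v' r' m'" using state_facts(1) assms(4-8) by (auto simp: descending_def)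
  then show ?thesis using assms(2,3,9) by (auto simp: descended_def)
qed

lemma length_less_word: "v \<in> F \<Longrightarrow> length v < 2 ^ w"
  using length_le words(2) by fastforce

lemma runs_descend_all:
  assumes "descending acc t v r m" "length v \<le> r r_rest"
  shows "runs w (block (append_node r_node @ [Op Sub r_rest r_rest r_len])) (r(r_len := length v), m) (4 + hash_time)
    (\<lambda>(r', m'). descended acc t v r m r' m')"
proof -
  note state_facts = descendingD[OF assms(1)]
  obtain u where u: "has_hash m acc u" "u @ take (r r_rest) v = t" using state_facts(8) by blast
  have rest: "r r_rest = length v" using state_facts(7) assms(2) by simp
  show ?thesis
  proof (rule runs_append_node[OF state_facts(2) _ state_facts(1) _ u(1) state_facts(5)])
    show "layout_regs (r(r_len := length v))"
      using state_facts(3) by (simp add: layout_regs_def arithmetic_regs_def)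
    fix r' m' assume hash: "has_hash m' acc (u @ v)" and memory: "mem_frame {acc..<acc + ndigits} m m'"
      and regs: "reg_frame ({31, 32, 33} \<union> scratch) (r(r_len := length v)) r'"
    have frame: "reg_frame descend_regs r r'" by (rule reg_frame_trans[OF _ regs, of "{23}"]) auto
    have r': "r' r_rest = length v" "r' r_len = length v" "r' r_node = addr v"
      using reg_frameD[OF regs] rest state_facts(6) by simp_all
    have "descended acc t v r m (r'(r_rest := 0)) m'"
      by (rule descendedI[OF assms(1) _ memory state_facts(5) _ _ hash])
      (use frame u(2) rest r'(3) in simp_all)
    moreover have "binop_val w Sub (length v) (length v) = 0"
      using sub_word[of "length v" "length v" w] length_less_word[OF state_facts(5)] by simp
    ultimately show "runs w (block [Op Sub r_rest r_rest r_len]) (r', m') 1 (\<lambda>(r', m'). descended acc t v r m r' m')"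
      using r' by (simp del: binop_val.simps(2))
  qed (use state_facts in simp_all)
qed

lemma runs_descend_right:
  assumes "descending acc t v r m" "length (left v) \<le> r r_rest" "r r_rest < length v" "2 \<le> length v"
  shows "runs w (block (append_node r_temp @
      [Op Sub r_rest r_rest r_temp2, Const r_temp 2, Op Add r_temp r_node r_temp, Load r_node r_temp]))
    (r(r_len := length v, r_temp := addr (left v), r_temp2 := length (left v)), m) (7 + hash_time)
    (\<lambda>(r', m'). descended acc t v r m r' m')"
proof -
  note state_facts = descendingD[OF assms(1)]
  note children = children[OF state_facts(5) assms(4)]
  obtain u where u: "has_hash m acc u" "u @ take (r r_rest) v = t" using state_facts(8) by blast
  let ?r = "r(r_len := length v, r_temp := addr (left v), r_temp2 := length (left v))"
  show ?thesis
  proof (rule runs_append_node[OF state_facts(2) _ state_facts(1) _ u(1) children(1)])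
    show "layout_regs ?r" using state_facts(3) by (simp add: layout_regs_def arithmetic_regs_def)
    fix r' m' assume hash: "has_hash m' acc (u @ left v)" and memory: "mem_frame {acc..<acc + ndigits} m m'"
      and regs: "reg_frame ({31, 32, 33} \<union> scratch) ?r r'"
    let ?rest = "r r_rest - length (left v)"
    let ?r' = "r'(r_rest := ?rest, r_temp := addr v + 2, r_node := addr (right v))"
    have frame: "reg_frame descend_regs r r'" by (rule reg_frame_trans[OF _ regs, of "{23, 26, 27}"]) auto
    have r': "r' r_rest = r r_rest" "r' r_temp2 = length (left v)" "r' r_node = addr v"
      using reg_frameD[OF regs] state_facts(6) by simp_all
    have len: "length v = length (left v) + length (right v)"
      using arg_cong[OF children(3), of length] by simp
    have "take (r r_rest) v = left v @ take ?rest (right v)" using assms(2) by (subst children(3)) simp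
    then have post: "descended acc t v r m ?r' m'"
      by (intro descendedI[OF assms(1) _ memory children(2) _ _ hash])
      (use frame u(2) assms(3) len children(5) in auto)
    have index: "index_mem m'"
      by (rule index_mem_frame[OF state_facts(2) memory])
      (use state_facts(1) items_area[of items_i_addr] acc_area in auto)
    have "addr v + 2 < mem_size" using addr_less(2)[OF state_facts(5)] by (simp add: node_size_def)
    moreover have "binop_val w Sub (r r_rest) (length (left v)) = ?rest"
      using length_less_word[OF state_facts(5)] assms(3) by (intro sub_word assms(2)) linarith
    ultimately show "runs w (block [Op Sub r_rest r_rest r_temp2, Const r_temp 2, Op Add r_temp r_node r_temp,
        Load r_node r_temp]) (r', m') 4 (\<lambda>(r', m'). descended acc t v r m r' m')"
      using post r' index_mem_node(4)[OF index state_facts(5) assms(4)] index mod_word[of "addr v + 2"]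
      by (simp add: runs_Load index_mem_def del: binop_val.simps(2))
  qed (use state_facts in simp_all)
qed

lemma runs_descend_left:
  assumes "descending acc t v r m" "0 < r r_rest" "r r_rest < length (left v)" "2 \<le> length v"
  shows "runs w (block [Move r_node r_temp]) (r(r_len := length v, r_temp := addr (left v), r_temp2 := length (left v)), m) 1
    (\<lambda>(r', m'). descended acc t v r m r' m')"
proof -
  note state_facts = descendingD[OF assms(1)]
  note children = children[OF state_facts(5) assms(4)]
  obtain u where u: "has_hash m acc u" "u @ take (r r_rest) v = t" using state_facts(8) by blast
  have "take (r r_rest) v = take (r r_rest) (left v)" using assms(3) by (subst children(3)) simp
  then have "descended acc t v r m (r(r_len := length v, r_temp := addr (left v), r_temp2 := length (left v), r_node := addr (left v))) m"
    by (intro descendedI[OF assms(1) _ _ children(1) _ _ u(1)]) (use u(2) assms(3) children(4) in auto)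
  then show ?thesis using layout_regsD(3)[OF state_facts(3)] addr_less(3)[OF children(1)]
    by (simp add: fun_upd_twist)
qed

lemma runs_descend_step:
  assumes "descending acc t v r m" "0 < r r_rest"
  shows "runs w (block descend_step) (r, m) (13 + hash_time) (\<lambda>(r', m'). descended acc t v r m r' m')"
proof -
  note state_facts = descendingD[OF assms(1)]
  let ?post = "\<lambda>(r', m'). descended acc t v r m r' m'"
  have addr: "addr v + 2 < mem_size" using addr_less(2)[OF state_facts(5)] by (simp add: node_size_def)
  have inner: "runs w (block [Op Add r_temp r_node r_one, Load r_temp r_temp, Load r_temp2 r_temp,
      Cond (LessEq r_temp2 r_rest) (block (append_node r_temp @
        [Op Sub r_rest r_rest r_temp2, Const r_temp 2, Op Add r_temp r_node r_temp, Load r_node r_temp]))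
      (block [Move r_node r_temp])]) (r(r_len := length v), m) (11 + hash_time) ?post"
    if less: "r r_rest < length v"
  proof -
    have len: "2 \<le> length v" using less assms(2) by linarith
    note left = children(1)[OF state_facts(5) len]
    let ?r = "r(r_len := length v, r_temp := addr (left v), r_temp2 := length (left v))"
    have "runs w (block [Cond (LessEq r_temp2 r_rest) (block (append_node r_temp @
        [Op Sub r_rest r_rest r_temp2, Const r_temp 2, Op Add r_temp r_node r_temp, Load r_node r_temp]))
      (block [Move r_node r_temp])]) (?r, m) (8 + hash_time) ?post"
      by (rule runs_Cond)
        (use runs_descend_right[OF assms(1) _ less len] runs_descend_left[OF assms(1,2) _ len] in
          \<open>auto elim: runs_mono\<close>)
    then show ?thesis
      using state_facts(2,6) index_mem_node(3)[OF state_facts(2,5) len] index_mem_node(1)[OF state_facts(2) left] addr_less(2)[OF left] addr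
        layout_regsD(2)[OF state_facts(3)] mod_word[of "Suc (addr v)"]
      by (simp add: runs_Load index_mem_def)
  qed
  have "runs w (block [Cond (LessEq r_len r_rest) (block (append_node r_node @ [Op Sub r_rest r_rest r_len]))
      (block [Op Add r_temp r_node r_one, Load r_temp r_temp, Load r_temp2 r_temp, Cond (LessEq r_temp2 r_rest)
       (block (append_node r_temp @
         [Op Sub r_rest r_rest r_temp2, Const r_temp 2, Op Add r_temp r_node r_temp, Load r_node r_temp]))
       (block [Move r_node r_temp])])]) (r(r_len := length v), m) (12 + hash_time) ?post"
    by (rule runs_Cond) (use runs_descend_all[OF assms(1)] inner in \<open>auto elim: runs_mono\<close>)
  then show ?thesis unfolding descend_step_def
    using state_facts(2,6) index_mem_node(1)[OF state_facts(2,5)] addr by (simp add: runs_Load index_mem_def)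
qed

end

definition prefix_hash :: "reg \<Rightarrow> reg \<Rightarrow> reg \<Rightarrow> prog list" where
  "prefix_hash i n a = [Move r_items i, Move r_count n, Move r_acc a] @ locate @ descend"

definition prefix_hash_time :: nat where "prefix_hash_time = hash_time + 4 * ndigits + 30"

context lce_index
begin

lemma runs_descend_loop:
  assumes "descending acc t v r m" "height v \<le> h"
    and "\<And>r' m'. has_hash m' acc t \<Longrightarrow> mem_frame {acc..<acc + ndigits} m m' \<Longrightarrow> reg_frame descend_regs r r' \<Longrightarrow>
      runs w (block ps) (r', m') T Q"
    and "Suc (Suc h * (14 + hash_time)) + T \<le> T'"
  shows "runs w (block (While (Less r_zero r_rest) (block descend_step) # ps)) (r, m) T' Q"
proof (rule runs_While[where I = "\<lambda>r' m' n. mem_frame {acc..<acc + ndigits} m m' \<and> reg_frame descend_regs r r' \<and>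
    (\<exists>v. descending acc t v r' m' \<and> n = (if r' r_rest = 0 then 0 else Suc (height v)))"])
  let ?n = "if r r_rest = 0 then 0 else Suc (height v)"
  show "mem_frame {acc..<acc + ndigits} m m \<and> reg_frame descend_regs r r \<and>
      (\<exists>v. descending acc t v r m \<and> ?n = (if r r_rest = 0 then 0 else Suc (height v)))"
    using assms(1) by auto
  have "?n * Suc (13 + hash_time) \<le> Suc h * (14 + hash_time)" using assms(2) by (intro mult_le_mono) simp_all
  then show "Suc (?n * Suc (13 + hash_time)) + T \<le> T'" using assms(4) by linarith
next
  fix r1 m1 n assume "mem_frame {acc..<acc + ndigits} m m1 \<and> reg_frame descend_regs r r1 \<and>
      (\<exists>v. descending acc t v r1 m1 \<and> n = (if r1 r_rest = 0 then 0 else Suc (height v)))"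
    and test: "cmp_val (Less r_zero r_rest) r1"
  then obtain v where frames: "mem_frame {acc..<acc + ndigits} m m1" "reg_frame descend_regs r r1"
    and descending: "descending acc t v r1 m1" and n: "n = (if r1 r_rest = 0 then 0 else Suc (height v))"
    by blast
  have rest: "0 < r1 r_rest" using test layout_regsD(3)[OF descendingD(3)[OF descending]] by simp
  show "runs w (block descend_step) (r1, m1) (13 + hash_time) (\<lambda>(r', m'). \<exists>n' < n.
      mem_frame {acc..<acc + ndigits} m m' \<and> reg_frame descend_regs r r' \<and>
      (\<exists>v. descending acc t v r' m' \<and> n' = (if r' r_rest = 0 then 0 else Suc (height v))))"
  proof (rule runs_mono[OF runs_descend_step[OF descending rest] order_refl])
    fix s assume "case s of (r', m') \<Rightarrow> descended acc t v r1 m1 r' m'"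
    then obtain r' m' v' where s: "s = (r', m')" "reg_frame descend_regs r1 r'"
      "mem_frame {acc..<acc + ndigits} m1 m'"
      "descending acc t v' r' m'" "r' r_rest = 0 \<or> height v' < height v"
      unfolding descended_def by (cases s) auto
    moreover have "reg_frame descend_regs r r'" "mem_frame {acc..<acc + ndigits} m m'"
      by (rule reg_frame_trans[OF frames(2) s(2) order_refl order_refl], rule mem_frame_trans[OF frames(1) s(3) order_refl order_refl])
    moreover have "(if r' r_rest = 0 then 0 else Suc (height v')) < n" using s(5) rest by (auto simp: n)
    ultimately show "case s of (r', m') \<Rightarrow> \<exists>n' < n. mem_frame {acc..<acc + ndigits} m m' \<and> reg_frame descend_regs r r' \<and>
        (\<exists>v. descending acc t v r' m' \<and> n' = (if r' r_rest = 0 then 0 else Suc (height v)))" by blast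
  qed
next
  fix r1 m1 n assume "mem_frame {acc..<acc + ndigits} m m1 \<and> reg_frame descend_regs r r1 \<and>
      (\<exists>v. descending acc t v r1 m1 \<and> n = (if r1 r_rest = 0 then 0 else Suc (height v)))"
    and test: "\<not> cmp_val (Less r_zero r_rest) r1"
  then obtain v where frames: "mem_frame {acc..<acc + ndigits} m m1" "reg_frame descend_regs r r1"
    and descending: "descending acc t v r1 m1" by blast
  have "r1 r_rest = 0" using test layout_regsD(3)[OF descendingD(3)[OF descending]] by simp
  then have "has_hash m1 acc t" using descendingD(8)[OF descending] by auto
  then show "runs w (block ps) (r1, m1) T Q" using frames by (rule assms(3))
qed

lemma take_concat_split:
  assumes "i < length xss" "length (concat (take i xss)) \<le> n" "n \<le> length (concat (take (Suc i) xss))"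
  shows "take n (concat xss) = concat (take i xss) @ take (n - length (concat (take i xss))) (xss ! i)"
    and "n - length (concat (take i xss)) \<le> length (xss ! i)"
proof -
  have Suc: "concat (take (Suc i) xss) = concat (take i xss) @ xss ! i"
    using assms(1) by (simp add: take_Suc_conv_app_nth)
  have "concat xss = concat (take (Suc i) xss) @ concat (drop (Suc i) xss)"
    by (metis append_take_drop_id concat_append)
  then show "take n (concat xss) = concat (take i xss) @ take (n - length (concat (take i xss))) (xss ! i)"
    using assms(2,3) by (simp add: Suc)
  show "n - length (concat (take i xss)) \<le> length (xss ! i)" using assms(3) by (simp add: Suc)
qed

lemma items_nth:
  assumes "base \<in> {items_i_addr, items_j_addr}" "items m base its" "i < length its" "length its \<le> cap"
  shows "its ! i \<in> F" "base + i * item_size + item_size < acc_i_addr"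
    and "m ! (base + i * item_size) = length (concat (take i its))"
    "m ! Suc (base + i * item_size) = addr (its ! i)"
    and "has_hash m (base + i * item_size + 2) (concat (take i its))"
  using item_addr_less(1)[OF assms(1) less_imp_le[OF assms(3)] assms(4)] assms(2,3) nth_mem
  by (auto simp: items_def prefix_record_def)

lemma runs_start_descent:
  assumes "index_mem m" "layout_regs r" "base \<in> {items_i_addr, items_j_addr}" "items m base its"
    "r r_items = base"
    "length its \<le> cap" "length (concat its) \<le> N" "acc \<in> {acc_i_addr, acc_j_addr}" "r r_acc = acc"
    and i: "r r_first < length its" "length (concat (take (r r_first) its)) \<le> r r_skip"
      "r r_skip \<le> length (concat (take (Suc (r r_first)) its))"
    and "\<And>r' m'. descending acc (take (r r_skip) (concat its)) (its ! r r_first) r' m' \<Longrightarrow>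
      mem_frame {acc..<acc + ndigits} m m' \<Longrightarrow> reg_frame ({20..34} \<union> scratch) r r' \<Longrightarrow> runs w (block ps) (r', m') T Q"
  shows "runs w (block (start_descent @ ps)) (r, m) (8 + (4 * ndigits + T)) Q"
proof -
  let ?i = "r r_first"
  define a where "a = base + ?i * item_size"
  define u where "u = concat (take ?i its)"
  define v where "v = its ! ?i"
  note split = take_concat_split[OF i, folded u_def v_def]
  note regs = layout_regsD[OF assms(2)]
  note item = items_nth[OF assms(3,4) i(1) assms(6), folded a_def u_def v_def]
  have acc: "acc_i_addr \<le> acc" "acc + ndigits < mem_size" "acc_i_addr < mem_size"
    using assms(8) acc_area by auto
  let ?r = "r(r_temp2 := length u, r_rest := r r_skip - length u, r_temp := Suc a, r_node := addr v, r_ptr := a + 2, r_ptr2 := acc)"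
  have "runs w (block (copy_words ndigits @ ps)) (?r, m) (4 * ndigits + T) Q"
  proof (rule runs_copy_words)
    fix r1 m1 assume copied: "mem_frame {?r r_ptr2..<?r r_ptr2 + ndigits} m m1"
      "segment m1 (?r r_ptr2) ndigits = segment m (?r r_ptr) ndigits"
      and regs1: "reg_frame {r_word, r_ptr, r_ptr2} ?r r1"
    have memory: "mem_frame {acc..<acc + ndigits} m m1" using copied(1) by simp
    have frame: "reg_frame ({20..34} \<union> scratch) r r1"
      by (rule reg_frame_trans[OF _ regs1, of "{20..34} \<union> scratch"]) auto
    have "has_hash m1 acc u"
      using item(5) copied(2) acc mem_frame_length[OF memory] assms(1)
      by (simp add: has_hash_def number_def index_mem_def)
    moreover have "index_mem m1"
      by (rule index_mem_frame[OF assms(1) memory]) (use acc items_area[of items_i_addr] in auto)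
    moreover have "layout_regs r1" by (rule layout_regs_frame[OF assms(2) frame]) auto
    ultimately have "descending acc (take (r r_skip) (concat its)) v r1 m1"
      using assms(8,9) item(1) split by (auto simp: descending_def reg_frameD[OF regs1])
    then show "runs w (block ps) (r1, m1) T Q" using memory frame unfolding v_def by (rule assms(13))
  qed (use regs(2) item(2) acc assms(1) mem_size_le in \<open>auto simp: index_mem_def item_size_def\<close>)
  moreover have "binop_val w Sub (r r_skip) (length u) = r r_skip - length u"
  proof (rule sub_word)
    show "length u \<le> r r_skip" using i(2) by (simp add: u_def)
    have "length (take (r r_skip) (concat its)) = r r_skip"
      using split i(2) by (simp add: u_def)
    then have "r r_skip \<le> N" using assms(7) by simp
    then show "r r_skip < 2 ^ w" using words(2) by linarith
  qed
  moreover have "a < mem_size" "Suc a < mem_size" "Suc (Suc a) < mem_size" "?i * item_size < mem_size"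
    using item(2) acc(3) unfolding item_size_def a_def by linarith+
  ultimately show ?thesis
    unfolding start_descent_def using regs assms(1,5,9) item acc addr_less(3)[OF item(1)]
    by (simp add: runs_Load index_mem_def mod_word a_def[symmetric] add.commute[of _ base] fun_upd_twist del: binop_val.simps(2))
qed

lemma runs_descend:
  assumes "index_mem m" "layout_regs r" "base \<in> {items_i_addr, items_j_addr}" "items m base its"
    "r r_items = base"
    "length its \<le> cap" "length (concat its) \<le> N" "acc \<in> {acc_i_addr, acc_j_addr}" "r r_acc = acc"
    and "r r_first < length its" "length (concat (take (r r_first) its)) \<le> r r_skip"
      "r r_skip \<le> length (concat (take (Suc (r r_first)) its))"
    and "height (its ! r r_first) \<le> h"
    and "\<And>r' m'. has_hash m' acc (take (r r_skip) (concat its)) \<Longrightarrow> mem_frame {acc..<acc + ndigits} m m' \<Longrightarrow>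
      reg_frame ({20..34} \<union> scratch) r r' \<Longrightarrow> runs w (block ps) (r', m') T Q"
    and "9 + 4 * ndigits + Suc h * (14 + hash_time) + T \<le> T'"
  shows "runs w (block (descend @ ps)) (r, m) T' Q"
proof -
  let ?loop = "While (Less r_zero r_rest) (block descend_step)"
  let ?T = "Suc (Suc h * (14 + hash_time)) + T"
  have "runs w (block (start_descent @ ?loop # ps)) (r, m) (8 + (4 * ndigits + ?T)) Q"
  proof (rule runs_start_descent[OF assms(1-12)])
    fix r1 m1 assume descending: "descending acc (take (r r_skip) (concat its)) (its ! r r_first) r1 m1"
      and start: "mem_frame {acc..<acc + ndigits} m m1" "reg_frame ({20..34} \<union> scratch) r r1"
    show "runs w (block (?loop # ps)) (r1, m1) ?T Q"
    proof (rule runs_descend_loop[OF descending])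
      fix r' m' assume "has_hash m' acc (take (r r_skip) (concat its))"
        "mem_frame {acc..<acc + ndigits} m1 m'"
        "reg_frame descend_regs r1 r'"
      then show "runs w (block ps) (r', m') T Q"
        using mem_frame_trans[OF start(1), of _ m'] reg_frame_trans[OF start(2), of descend_regs r']
        by (intro assms(14)) auto
    qed (use assms(13) in simp_all)
  qed
  then have "runs w (block (descend @ ps)) (r, m) (8 + (4 * ndigits + ?T)) Q" by (simp add: descend_def)
  then show ?thesis by (rule runs_mono) (use assms(15) in simp_all)
qed

lemma runs_prefix_hash:
  assumes "index_mem m" "layout_regs r" "base \<in> {items_i_addr, items_j_addr}" "items m base its" "its \<noteq> []"
    "length its \<le> cap" "length (concat its) \<le> N" "acc \<in> {acc_i_addr, acc_j_addr}"
    "r r_skip \<le> length (concat its)"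
    and regs: "r i = base" "r n = length its" "r a = acc" "{n, a} \<inter> {r_items, r_count, r_acc} = {}"
    and height: "\<And>v. v \<in> set its \<Longrightarrow> height v \<le> h"
    and "\<And>r' m'. has_hash m' acc (take (r r_skip) (concat its)) \<Longrightarrow> mem_frame {acc..<acc + ndigits} m m' \<Longrightarrow>
      reg_frame ({15, 16} \<union> {20..34} \<union> scratch) r r' \<Longrightarrow> runs w (block ps) (r', m') T Q"
    and "prefix_hash_time * (bit_length cap + h + 2) + T \<le> T'"
  shows "runs w (block (prefix_hash i n a @ ps)) (r, m) T' Q"
proof -
  let ?r = "r(r_items := base, r_count := length its, r_acc := acc)"
  let ?T = "9 + 4 * ndigits + Suc h * (14 + hash_time) + T"
  have layout: "layout_regs ?r" using assms(2) by (simp add: layout_regs_def arithmetic_regs_def)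
  have "runs w (block (locate @ descend @ ps)) (?r, m) (4 + bit_length cap * 10 + ?T) Q"
  proof (rule runs_locate[OF assms(1) layout assms(3,4)])
    fix r1 assume located: "r1 r_first < length its" "length (concat (take (r1 r_first) its)) \<le> ?r r_skip"
      "?r r_skip \<le> length (concat (take (Suc (r1 r_first)) its))" and frame1: "reg_frame {26..31} ?r r1"
    have r1: "r1 r_items = base" "r1 r_acc = acc" "r1 r_skip = r r_skip"
      by (simp_all add: reg_frameD[OF frame1])
    have "layout_regs r1" by (rule layout_regs_frame[OF layout frame1]) auto
    then show "runs w (block (descend @ ps)) (r1, m) ?T Q"
    proof (rule runs_descend[OF assms(1) _ assms(3,4) r1(1) assms(6-8) r1(2)])
      fix r' m' assume hash: "has_hash m' acc (take (r1 r_skip) (concat its))"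
        "mem_frame {acc..<acc + ndigits} m m'"
        and frame: "reg_frame ({20..34} \<union> scratch) r1 r'"
      have "reg_frame ({15, 16} \<union> {20..34} \<union> scratch) r r1"
        by (rule reg_frame_trans[OF _ frame1, of "{15, 16, 34}"]) auto
      then have "reg_frame ({15, 16} \<union> {20..34} \<union> scratch) r r'" by (rule reg_frame_trans[OF _ frame]) auto
      then show "runs w (block ps) (r', m') T Q" using hash by (intro assms(15)) (simp_all add: r1(3))
    qed (use located r1(3) height nth_mem in auto)
  qed (use assms in auto)
  moreover have "base < mem_size" "acc < mem_size" "length its < mem_size"
    using items_area[OF assms(3)] acc_area assms(8) cap_less assms(6) by auto
  ultimately have "runs w (block (prefix_hash i n a @ ps)) (r, m) (3 + (4 + bit_length cap * 10 + ?T)) Q"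
    unfolding prefix_hash_def using regs layout_regsD(3)[OF assms(2)] by (simp add: mod_word)
  then show ?thesis
  proof (rule runs_mono)
    let ?k = prefix_hash_time
    have "bit_length cap * 10 \<le> bit_length cap * ?k" "Suc h * (14 + hash_time) \<le> Suc h * ?k"
      "16 + 4 * ndigits \<le> ?k"
      by (intro mult_le_mono2, simp add: prefix_hash_time_def)+ (simp add: prefix_hash_time_def)
    moreover have "?k * (bit_length cap + h + 2) = bit_length cap * ?k + Suc h * ?k + ?k"
      by (simp add: algebra_simps)
    ultimately show "3 + (4 + bit_length cap * 10 + ?T) \<le> T'" using assms(16) by linarith
  qed
qed

end

definition normalize :: "reg \<Rightarrow> prog list" where
  "normalize a = [Move r_hash_in a, Move r_hash_out a] @ normalize_hash"

definition compare_hashes :: "prog list" where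
  "compare_hashes = normalize r_acc_i @ normalize r_acc_j @ [Const r_flag 1, Move r_ptr r_acc_i, Move r_ptr2 r_acc_j] @
     compare_words ndigits @ [Move r_equal r_flag]"

definition compare :: "prog list" where
  "compare = prefix_hash r_items_i r_count_i r_acc_i @ prefix_hash r_items_j r_count_j r_acc_j @ compare_hashes"

definition compare_hashes_time :: nat where "compare_hashes_time = 2 * hash_time + 6 * ndigits + 8"
definition compare_time :: nat where "compare_time = 2 * prefix_hash_time + compare_hashes_time"

context lce_index
begin

definition normalized :: "nat list \<Rightarrow> nat \<Rightarrow> 'a list \<Rightarrow> bool" where
  "normalized m a u \<longleftrightarrow> number m a \<and> val m a \<in> {1..P} \<and> [val m a * \<beta> ^ ndigits = hash c b u] (mod P)"

lemma normalized_mem_frame: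
  "normalized m a u \<Longrightarrow> mem_frame X m m' \<Longrightarrow> {a..<a + ndigits} \<inter> X = {} \<Longrightarrow> normalized m' a u"
  unfolding normalized_def using number_mem_frame[of m a X m'] by simp

lemma normalized_eq_iff:
  assumes "normalized m a u" "normalized m a' v"
  shows "segment m a ndigits = segment m a' ndigits \<longleftrightarrow> [hash c b u = hash c b v] (mod P)"
proof
  assume "segment m a ndigits = segment m a' ndigits"
  with assms show "[hash c b u = hash c b v] (mod P)" unfolding normalized_def by (metis cong_sym cong_trans)
next
  assume "[hash c b u = hash c b v] (mod P)"
  with assms have "[val m a * \<beta> ^ ndigits = val m a' * \<beta> ^ ndigits] (mod P)"
    unfolding normalized_def by (meson cong_sym cong_trans)
  then have "val m a mod P = val m a' mod P" unfolding cong_base_power_cancel by (simp add: cong_def)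
  moreover have "val m a \<in> {1..P}" "val m a' \<in> {1..P}" using assms by (simp_all add: normalized_def)
  ultimately have "val m a = val m a'" by (cases "val m a = P"; cases "val m a' = P") auto
  then show "segment m a ndigits = segment m a' ndigits"
    using assms by (intro digits_val_inj) (auto simp: normalized_def number_def)
qed

lemma index_mem_acc_frame: "index_mem m \<Longrightarrow> mem_frame X m m' \<Longrightarrow> X \<subseteq> {acc_i_addr..} \<Longrightarrow> index_mem m'"
  using items_area[of items_i_addr] by (elim index_mem_frame) (auto simp: subset_iff)

lemma runs_normalize:
  assumes "index_mem m" "layout_regs r" "acc \<in> {acc_i_addr, acc_j_addr}" "r a = acc" "a \<noteq> r_hash_in"
    "has_hash m acc u"
    and "\<And>r' m'. normalized m' acc u \<Longrightarrow> mem_frame {acc..<acc + ndigits} m m' \<Longrightarrow> reg_frame ({31, 33} \<union> scratch) r r' \<Longrightarrow>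
      runs w (block ps) (r', m') T Q"
    and "2 + hash_time + T \<le> T'"
  shows "runs w (block (normalize a @ ps)) (r, m) T' Q"
proof -
  let ?r = "r(r_hash_in := acc, r_hash_out := acc)"
  have acc: "acc + ndigits < mem_size" using acc_area assms(3) by auto
  have "runs w (block (normalize_hash @ ps)) (?r, m) (hash_time + T) Q"
  proof (rule runs_normalize_hash[OF _ arithmetic_mem[OF assms(1)]])
    show "arithmetic_regs ?r" using layout_regsD(1)[OF assms(2)] by (simp add: arithmetic_regs_def)
    fix r' m' assume "number m' (?r r_hash_out)" "val m' (?r r_hash_out) \<in> {1..P}"
      "[val m' (?r r_hash_out) * \<beta> ^ ndigits = hash c b u] (mod P)"
      "mem_frame {?r r_hash_out..<?r r_hash_out + ndigits} m m'" and frame: "reg_frame scratch ?r r'"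
    moreover have "reg_frame ({31, 33} \<union> scratch) r r'"
      by (rule reg_frame_trans[OF _ frame, of "{31, 33}"]) auto
    ultimately show "runs w (block ps) (r', m') T Q" by (intro assms(7)) (simp_all add: normalized_def)
  qed (use assms(1,6) acc in \<open>simp_all add: index_mem_def\<close>)
  then have "runs w (block (normalize a @ ps)) (r, m) (2 + (hash_time + T)) Q"
    unfolding normalize_def using assms(4,5) layout_regsD(3)[OF assms(2)] acc by (simp add: mod_word)
  then show ?thesis by (rule runs_mono) (use assms(8) in auto)
qed

lemma runs_compare_normalized:
  assumes "index_mem m" "layout_regs r" "normalized m acc_i_addr u" "normalized m acc_j_addr v"
    and "\<And>r'. cmp_val (Equal r_equal r_one) r' \<longleftrightarrow> [hash c b u = hash c b v] (mod P) \<Longrightarrow>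
      reg_frame ({r_equal} \<union> scratch) r r' \<Longrightarrow> runs w (block ps) (r', m) T Q"
    and "4 + 6 * ndigits + T \<le> T'"
  shows "runs w (block ([Const r_flag 1, Move r_ptr r_acc_i, Move r_ptr2 r_acc_j] @ compare_words ndigits @
    [Move r_equal r_flag] @ ps)) (r, m) T' Q"
proof -
  note regs = layout_regsD[OF assms(2)]
  let ?r = "r(r_flag := 1, r_ptr := acc_i_addr, r_ptr2 := acc_j_addr)"
  have "runs w (block (compare_words ndigits @ [Move r_equal r_flag] @ ps)) (?r, m) (6 * ndigits + (1 + T)) Q"
  proof (rule runs_compare_words)
    fix r1 assume flag: "r1 r_flag = (if segment m (?r r_ptr) ndigits = segment m (?r r_ptr2) ndigits then ?r r_flag else 0)"
      and frame1: "reg_frame {58..62} ?r r1"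
    have frame: "reg_frame scratch r r1" by (rule reg_frame_trans[OF _ frame1, of scratch]) auto
    have flag: "r1 r_flag = (if [hash c b u = hash c b v] (mod P) then 1 else 0)"
      using flag normalized_eq_iff[OF assms(3,4)] by simp
    have r1: "r1 r_one = 1" "r1 r_zero = 0" using frame regs by (simp_all add: reg_frameD)
    have "runs w (block ps) (r1(r_equal := r1 r_flag), m) T Q"
    proof (rule assms(5))
      have "reg_frame ({r_equal} \<union> scratch) r r1" by (rule reg_frame_mono[OF frame]) auto
      then show "reg_frame ({r_equal} \<union> scratch) r (r1(r_equal := r1 r_flag))" by simp
    qed (use flag r1 in simp)
    moreover have "r1 r_flag mod 2 ^ w = r1 r_flag" using flag by simp
    ultimately show "runs w (block ([Move r_equal r_flag] @ ps)) (r1, m) (1 + T) Q" using r1 by simp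
  qed (use regs(2) acc_area mem_size_le assms(1) in \<open>simp_all add: index_mem_def\<close>)
  then have "runs w (block ([Const r_flag 1, Move r_ptr r_acc_i, Move r_ptr2 r_acc_j] @ compare_words ndigits @
      [Move r_equal r_flag] @ ps)) (r, m) (3 + (6 * ndigits + (1 + T))) Q"
    using regs acc_area by (simp add: mod_word)
  then show ?thesis by (rule runs_mono) (use assms(6) in auto)
qed

lemma runs_compare_hashes:
  assumes "index_mem m" "layout_regs r" "has_hash m acc_i_addr u" "has_hash m acc_j_addr v"
    and "\<And>r' m'. cmp_val (Equal r_equal r_one) r' \<longleftrightarrow> [hash c b u = hash c b v] (mod P) \<Longrightarrow>
      mem_frame {acc_i_addr..} m m' \<Longrightarrow> reg_frame ({r_equal, r_hash_in, r_hash_out} \<union> scratch) r r' \<Longrightarrow>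
      runs w (block ps) (r', m') T Q"
    and "compare_hashes_time + T \<le> T'"
  shows "runs w (block (compare_hashes @ ps)) (r, m) T' Q"
  unfolding compare_hashes_def append_assoc
proof (rule runs_normalize[OF assms(1,2) _ layout_regsD(9)[OF assms(2)] _ assms(3)])
  let ?X = "{r_equal, r_hash_in, r_hash_out} \<union> scratch"
  fix r1 m1 assume norm_i: "normalized m1 acc_i_addr u"
    and memory1: "mem_frame {acc_i_addr..<acc_i_addr + ndigits} m m1"
    and frame1: "reg_frame ({31, 33} \<union> scratch) r r1"
  have layout1: "layout_regs r1" by (rule layout_regs_frame[OF assms(2) frame1]) auto
  have index1: "index_mem m1" by (rule index_mem_acc_frame[OF assms(1) memory1]) auto
  have hash_j: "has_hash m1 acc_j_addr v"
    by (rule has_hash_mem_frame[OF assms(4) memory1]) (use acc_area in auto)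
  let ?rest = "[Const r_flag 1, Move r_ptr r_acc_i, Move r_ptr2 r_acc_j] @ compare_words ndigits @ [Move r_equal r_flag] @ ps"
  show "runs w (block (normalize r_acc_j @ ?rest)) (r1, m1) (2 + hash_time + (4 + 6 * ndigits + T)) Q"
  proof (rule runs_normalize[OF index1 layout1 _ layout_regsD(10)[OF layout1] _ hash_j])
    fix r2 m2 assume norm_j: "normalized m2 acc_j_addr v"
      and memory2: "mem_frame {acc_j_addr..<acc_j_addr + ndigits} m1 m2"
      and frame2: "reg_frame ({31, 33} \<union> scratch) r1 r2"
    have layout2: "layout_regs r2" by (rule layout_regs_frame[OF layout1 frame2]) auto
    have memory: "mem_frame {acc_i_addr..} m m2"
      by (rule mem_frame_trans[OF memory1 memory2]) (use acc_area in auto)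
    have frame: "reg_frame ?X r r2" by (rule reg_frame_trans[OF frame1 frame2]) auto
    have norm_i: "normalized m2 acc_i_addr u"
      by (rule normalized_mem_frame[OF norm_i memory2]) (use acc_area in auto)
    have index2: "index_mem m2" by (rule index_mem_acc_frame[OF assms(1) memory]) simp
    show "runs w (block ?rest) (r2, m2) (4 + 6 * ndigits + T) Q"
    proof (rule runs_compare_normalized[OF index2 layout2 norm_i norm_j])
      fix r' assume "cmp_val (Equal r_equal r_one) r' \<longleftrightarrow> [hash c b u = hash c b v] (mod P)"
        and frame': "reg_frame ({r_equal} \<union> scratch) r2 r'"
      moreover have "reg_frame ?X r r'" by (rule reg_frame_trans[OF frame frame']) auto
      ultimately show "runs w (block ps) (r', m2) T Q" using memory by (intro assms(5))
    qed simp
  qed simp_all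
qed (use assms(6) in \<open>simp_all add: compare_hashes_time_def\<close>)

abbreviation compare_regs :: "reg set" where "compare_regs \<equiv> {10, 15, 16} \<union> {20..34} \<union> scratch"

lemma items_acc_frame:
  assumes "items m base its" "base \<in> {items_i_addr, items_j_addr}" "length its \<le> cap" "mem_frame X m m'"
    "X \<subseteq> {acc_i_addr..}"
  shows "items m' base its"
  by (rule items_mem_frame[OF assms(1,4)])
  (use item_addr_less(1)[OF assms(2) order_refl assms(3)] assms(5) in auto)

lemma runs_compare:
  assumes "index_mem m" "layout_regs r" "items m items_i_addr xs" "items m items_j_addr ys"
    and xs: "r r_count_i = length xs" "xs \<noteq> []" "length xs \<le> cap" "length (concat xs) \<le> N"
    "r r_skip \<le> length (concat xs)"
    and ys: "r r_count_j = length ys" "ys \<noteq> []" "length ys \<le> cap" "length (concat ys) \<le> N"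
    "r r_skip \<le> length (concat ys)"
    and height: "\<And>v. v \<in> set xs \<union> set ys \<Longrightarrow> height v \<le> h"
    and "\<And>r' m'. cmp_val (Equal r_equal r_one) r' \<longleftrightarrow>
        [hash c b (take (r r_skip) (concat xs)) = hash c b (take (r r_skip) (concat ys))] (mod P) \<Longrightarrow>
      mem_frame {acc_i_addr..} m m' \<Longrightarrow> reg_frame compare_regs r r' \<Longrightarrow> runs w (block ps) (r', m') T Q"
    and "compare_time * (bit_length cap + h + 2) + T \<le> T'"
  shows "runs w (block (compare @ ps)) (r, m) T' Q"
  unfolding compare_def append_assoc
proof (rule runs_prefix_hash[OF assms(1,2) _ assms(3) xs(2-4) _ xs(5)])
  let ?u = "take (r r_skip) (concat xs)" and ?v = "take (r r_skip) (concat ys)"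
    and ?k = "bit_length cap + h + 2"
  have "compare_hashes_time \<le> compare_hashes_time * ?k" by simp
  then show "prefix_hash_time * ?k + (prefix_hash_time * ?k + (compare_hashes_time + T)) \<le> T'"
    using assms(17) unfolding compare_time_def add_mult_distrib by linarith
  fix r1 m1 assume hash_i: "has_hash m1 acc_i_addr ?u"
    and memory1: "mem_frame {acc_i_addr..<acc_i_addr + ndigits} m m1"
    and frame1: "reg_frame ({15, 16} \<union> {20..34} \<union> scratch) r r1"
  have layout1: "layout_regs r1" by (rule layout_regs_frame[OF assms(2) frame1]) auto
  have index1: "index_mem m1" by (rule index_mem_acc_frame[OF assms(1) memory1]) auto
  have items1: "items m1 items_j_addr ys" by (rule items_acc_frame[OF assms(4) _ ys(3) memory1]) auto
  have r1: "r1 r_skip = r r_skip" "r1 r_count_j = length ys"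
    using ys(1) by (simp_all add: reg_frameD[OF frame1])
  show "runs w (block (prefix_hash r_items_j r_count_j r_acc_j @ compare_hashes @ ps)) (r1, m1)
      (prefix_hash_time * ?k + (compare_hashes_time + T)) Q"
  proof (rule runs_prefix_hash[OF index1 layout1 _ items1 ys(2-4)])
    fix r2 m2 assume "has_hash m2 acc_j_addr (take (r1 r_skip) (concat ys))"
      and memory2: "mem_frame {acc_j_addr..<acc_j_addr + ndigits} m1 m2"
      and frame2: "reg_frame ({15, 16} \<union> {20..34} \<union> scratch) r1 r2"
    then have hash_j: "has_hash m2 acc_j_addr ?v" by (simp add: r1)
    have layout2: "layout_regs r2" by (rule layout_regs_frame[OF layout1 frame2]) auto
    have memory: "mem_frame {acc_i_addr..} m m2"
      by (rule mem_frame_trans[OF memory1 memory2]) (use acc_area in auto)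
    have frame: "reg_frame compare_regs r r2" by (rule reg_frame_trans[OF frame1 frame2]) auto
    have hash_i: "has_hash m2 acc_i_addr ?u"
      by (rule has_hash_mem_frame[OF hash_i memory2]) (use acc_area in auto)
    have index2: "index_mem m2" by (rule index_mem_acc_frame[OF assms(1) memory]) simp
    show "runs w (block (compare_hashes @ ps)) (r2, m2) (compare_hashes_time + T) Q"
    proof (rule runs_compare_hashes[OF index2 layout2 hash_i hash_j])
      fix r' m' assume "cmp_val (Equal r_equal r_one) r' \<longleftrightarrow> [hash c b ?u = hash c b ?v] (mod P)"
        and memory': "mem_frame {acc_i_addr..} m2 m'"
        and frame': "reg_frame ({r_equal, r_hash_in, r_hash_out} \<union> scratch) r2 r'"
      moreover have "mem_frame {acc_i_addr..} m m'" by (rule mem_frame_trans[OF memory memory']) auto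
      moreover have "reg_frame compare_regs r r'" by (rule reg_frame_trans[OF frame frame']) auto
      ultimately show "runs w (block ps) (r', m') T Q" by (intro assms(16))
    qed simp
  qed (use layout_regsD(8,10)[OF layout1] r1 ys(5) height in auto)
qed (use layout_regsD(7,9)[OF assms(2)] xs(1) height in auto)

end

section \<open>The query\<close>

lemma take_eq_iff_le_longest_common_prefix:
  assumes "d \<le> length xs" "d \<le> length ys"
  shows "take d xs = take d ys \<longleftrightarrow> d \<le> length (longest_common_prefix xs ys)"
proof
  assume eq: "take d xs = take d ys"
  have "prefix (take d xs) xs" "prefix (take d xs) ys" by (rule take_is_prefix, subst eq, rule take_is_prefix)
  then have "prefix (take d xs) (longest_common_prefix xs ys)" by (rule longest_common_prefix_max_prefix)
  then show "d \<le> length (longest_common_prefix xs ys)" using assms prefix_length_le by fastforce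
next
  assume d: "d \<le> length (longest_common_prefix xs ys)"
  obtain u v where "xs = longest_common_prefix xs ys @ u" "ys = longest_common_prefix xs ys @ v"
    using longest_common_prefix_prefix1[of xs ys] longest_common_prefix_prefix2[of xs ys]
    unfolding prefix_def by blast
  then have "take d xs = take d (longest_common_prefix xs ys)"
    "take d ys = take d (longest_common_prefix xs ys)"
    using d by (metis append_Nil2 diff_is_0_eq take0 take_append)+
  then show "take d xs = take d ys" by simp
qed

definition collect_window :: "reg \<Rightarrow> reg \<Rightarrow> reg \<Rightarrow> prog list" where
  "collect_window p i n = [Move r_skip p, Move r_rest r_window, Move r_items i] @ collect_items @ [Move n r_count]"

definition collect :: "prog list" where
  "collect = collect_window r_i r_items_i r_count_i @ collect_window r_j r_items_j r_count_j"

definition bisect :: "prog list" where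
  "bisect = [Move r_low r_zero, Move r_high r_window] @
     binary_search r_low r_high r_middle r_next ([Move r_skip r_middle] @ compare) (Equal r_equal r_one) @
     [Move r_answer r_low, Move r_done r_one]"

text \<open>Squaring a guess above the integer square root of \<open>N\<close> might overflow.\<close>

definition grow :: "prog list" where
  "grow = [Cond (Less r_guess r_room)
     (block [Cond (LessEq r_guess r_sqrt) (block [Op Mult r_guess r_guess r_guess]) (block [Move r_guess r_length])])
     (block [Move r_answer r_room, Move r_done r_one])]"

definition phase :: "prog list" where
  "phase = [Cond (Less r_guess r_room) (block [Move r_window r_guess]) (block [Move r_window r_room])] @ collect @
     [Move r_skip r_window] @ compare @ [Cond (Equal r_equal r_one) (block grow) (block bisect)]"

definition setup_query :: "prog list" where
  "setup_query = [Const r_one 1, Op Sub r_i r_answer r_one, Op Sub r_j r_arg r_one, Load r_root r_zero,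
     Load r_base r_one, Const r_temp 2, Load r_inv r_temp, Const r_temp 3, Load r_guess r_temp, Const r_temp 4,
     Load r_sqrt r_temp, Const r_temp 5, Load r_stack r_temp, Const r_temp 6, Load r_items_i r_temp, Const r_temp 7,
     Load r_items_j r_temp, Const r_temp 8, Load r_acc_i r_temp, Const r_temp 9, Load r_acc_j r_temp,
     Const r_item_size item_size, Load r_length r_root,
     Cond (Less r_i r_j) (block [Op Sub r_room r_length r_j]) (block [Op Sub r_room r_length r_i])]"

definition query :: prog where
  "query = block (setup_query @ [While (Equal r_done r_zero) (block phase)])"

definition phase_time :: nat where "phase_time = 180 * collect_time + 66 * compare_time + 40"

context lce_index
begin

abbreviation ext :: "nat \<Rightarrow> nat \<Rightarrow> nat" where "ext i j \<equiv> lce S (Suc i) (Suc j)"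

definition room :: "nat \<Rightarrow> nat \<Rightarrow> nat" where "room i j = N - max i j"

lemma ext_le_room: "ext i j \<le> room i j"
  using prefix_length_le[OF longest_common_prefix_prefix1[of "drop i S" "drop j S"]]
    prefix_length_le[OF longest_common_prefix_prefix2[of "drop i S" "drop j S"]]
  by (auto simp: lce_def room_def)

lemma hash_cong_iff:
  assumes "d \<le> room i j" "i < N" "j < N"
  shows "[hash c b (take d (drop i S)) = hash c b (take d (drop j S))] (mod P) \<longleftrightarrow> d \<le> ext i j"
proof -
  have "i + d \<le> N" "j + d \<le> N" using assms by (auto simp: room_def)
  moreover have "take d (drop i S) = take d (drop j S) \<longleftrightarrow> d \<le> ext i j"
    unfolding lce_def diff_Suc_1
    by (rule take_eq_iff_le_longest_common_prefix) (use assms in \<open>auto simp: room_def\<close>)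
  ultimately show ?thesis
    using collision_free[unfolded collision_free_def, rule_format, of i d j] by (auto simp: cong_def)
qed

definition query_env :: "nat \<Rightarrow> nat \<Rightarrow> (reg \<Rightarrow> nat) \<Rightarrow> bool" where
  "query_env i j r \<longleftrightarrow> layout_regs r \<and> r r_i = i \<and> r r_j = j \<and> r r_room = room i j \<and> r r_sqrt = floor_sqrt N \<and>
     r r_length = N \<and> i < N \<and> j < N"

lemma query_envD:
  assumes "query_env i j r"
  shows "layout_regs r" "r r_i = i" "r r_j = j" "r r_room = room i j" "r r_sqrt = floor_sqrt N"
    "r r_length = N"
    "i < N" "j < N" "r r_one = 1" "r r_zero = 0" "0 < room i j" "room i j \<le> N"
  using assms layout_regsD(2,3)[of r] by (auto simp: query_env_def room_def)

lemma query_env_frame: "query_env i j r \<Longrightarrow> reg_frame X r r' \<Longrightarrow> X \<inter> constant_regs = {} \<Longrightarrow> query_env i j r'"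
proof -
  assume r: "query_env i j r" and frame: "reg_frame X r r'" "X \<inter> constant_regs = {}"
  then have "r' a = r a" if "a \<in> constant_regs" for a using that by (intro reg_frameD[of X]) auto
  with r layout_regs_frame[OF _ frame] show "query_env i j r'" by (simp add: query_env_def)
qed

lemma mod_word_N: "x \<le> N \<Longrightarrow> x mod 2 ^ w = x"
  using words(2) by simp

definition windows :: "nat \<Rightarrow> nat \<Rightarrow> nat \<Rightarrow> (reg \<Rightarrow> nat) \<Rightarrow> nat list \<Rightarrow> bool" where
  "windows i j d r m \<longleftrightarrow> index_mem m \<and> query_env i j r \<and> r r_window = d \<and> 0 < d \<and> d \<le> room i j \<and>
     (\<exists>xs ys. items m items_i_addr xs \<and> items m items_j_addr ys \<and> r r_count_i = length xs \<and> r r_count_j = length ys \<and>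
       length xs \<le> cap \<and> length ys \<le> cap \<and> concat xs = take d (drop i S) \<and> concat ys = take d (drop j S))"

lemma windowsD:
  assumes "windows i j d r m"
  shows "index_mem m" "query_env i j r" "r r_window = d" "0 < d" "d \<le> room i j" "d \<le> N"
  using assms query_envD(12)[of i j r] by (auto simp: windows_def)

lemma windows_frame:
  assumes "windows i j d r m" "reg_frame X r r'" "X \<inter> (constant_regs \<union> {11, 17, 18}) = {}"
    "mem_frame Y m m'" "Y \<subseteq> {acc_i_addr..}"
  shows "windows i j d r' m'"
proof -
  note window_facts = windowsD[OF assms(1)]
  obtain xs ys where its: "items m items_i_addr xs" "items m items_j_addr ys" "r r_count_i = length xs"
    "r r_count_j = length ys" "length xs \<le> cap" "length ys \<le> cap" "concat xs = take d (drop i S)"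
    "concat ys = take d (drop j S)" using assms(1) unfolding windows_def by blast
  have "items m' items_i_addr xs" "items m' items_j_addr ys"
    using items_acc_frame[OF its(1) _ its(5) assms(4,5)] items_acc_frame[OF its(2) _ its(6) assms(4,5)]
    by simp_all
  moreover have "r' r_window = r r_window" "r' r_count_i = r r_count_i" "r' r_count_j = r r_count_j"
    using reg_frameD[OF assms(2)] assms(3) by auto
  moreover have "index_mem m'" "query_env i j r'"
    using index_mem_acc_frame[OF window_facts(1) assms(4,5)] query_env_frame[OF window_facts(2) assms(2)] assms(3) by auto
  ultimately show ?thesis unfolding windows_def using window_facts its by auto
qed

lemma runs_collect_window:
  assumes "index_mem m" "query_env i j r" "r r_window = d" "x + d \<le> N" "base \<in> {items_i_addr, items_j_addr}"
    "r p = x" "r a = base" "p \<in> {r_i, r_j}" "a \<in> {r_items_i, r_items_j}" "n \<in> {r_count_i, r_count_j}"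
    and "\<And>r' m' xs. items m' base xs \<Longrightarrow> concat xs = take d (drop x S) \<Longrightarrow> r' n = length xs \<Longrightarrow> length xs \<le> cap \<Longrightarrow>
      reg_frame ({15, n} \<union> collect_regs) r r' \<Longrightarrow> mem_frame (work_area base) m m' \<Longrightarrow> runs w (block ps) (r', m') T Q"
    and "collect_time * (cap + 1) + 4 + T \<le> T'"
  shows "runs w (block (collect_window p a n @ ps)) (r, m) T' Q"
proof -
  let ?r = "r(r_skip := x, r_rest := d, r_items := base)"
  let ?X = "{15, n} \<union> collect_regs"
  note env_facts = query_envD[OF assms(2)]
  define T1 where "T1 = collect_time * (cap + 1) + (1 + T)"
  have layout: "layout_regs ?r" using env_facts(1) by (simp add: layout_regs_def arithmetic_regs_def)
  have "runs w (block (collect_items @ [Move n r_count] @ ps)) (?r, m) T1 Q" unfolding T1_def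
  proof (rule runs_collect_items[OF assms(1) layout assms(5)])
    fix r1 m1 xs assume xs: "items m1 base xs" "concat xs = take (?r r_rest) (drop (?r r_skip) S)"
      "r1 r_count = length xs"
      "length xs \<le> cap" and frame1: "reg_frame collect_regs ?r r1"
      and memory: "mem_frame (work_area base) m m1"
    have frame: "reg_frame ?X r r1" by (rule reg_frame_trans[OF _ frame1, of ?X]) auto
    have "runs w (block ps) (r1(n := length xs), m1) T Q"
      by (rule assms(11)[OF xs(1) _ _ xs(4) _ memory]) (use xs(2) frame in simp_all)
    moreover have "length xs mod 2 ^ w = length xs" using xs(4) cap_less by (intro mod_word) linarith
    moreover have "r1 r_zero = 0" using env_facts(10) by (simp add: reg_frameD[OF frame1])
    ultimately show "runs w (block ([Move n r_count] @ ps)) (r1, m1) (1 + T) Q" using xs(3) by simp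
  qed (use assms(4) in simp_all)
  moreover have "x mod 2 ^ w = x" "d mod 2 ^ w = d" using assms(4) by (auto intro!: mod_word_N)
  moreover have "base mod 2 ^ w = base" using items_area[OF assms(5)] acc_area by (intro mod_word) linarith
  ultimately have "runs w (block (collect_window p a n @ ps)) (r, m) (3 + T1) Q"
    unfolding collect_window_def using assms(3,6-9) env_facts(10) by auto
  then show ?thesis by (rule runs_mono) (use assms(12) in \<open>simp_all add: T1_def\<close>)
qed

lemma runs_collect:
  assumes "index_mem m" "query_env i j r" "r r_window = d" "0 < d" "d \<le> room i j"
    and "\<And>r' m'. windows i j d r' m' \<Longrightarrow> reg_frame ({15, 17, 18} \<union> collect_regs) r r' \<Longrightarrow> runs w (block ps) (r', m') T Q"
    and "2 * (collect_time * (cap + 1) + 4) + T \<le> T'"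
  shows "runs w (block (collect @ ps)) (r, m) T' Q"
  unfolding collect_def append_assoc
proof (rule runs_collect_window[OF assms(1-3)])
  let ?X = "{15, 17, 18} \<union> collect_regs"
  note env_facts = query_envD[OF assms(2)]
  have fits: "i + d \<le> N" "j + d \<le> N" using assms(5) env_facts(7,8) by (auto simp: room_def)
  show "i + d \<le> N" by (rule fits)
  fix r1 m1 xs assume xs: "items m1 items_i_addr xs" "concat xs = take d (drop i S)"
    "r1 r_count_i = length xs" "length xs \<le> cap"
    and frame1: "reg_frame ({15, r_count_i} \<union> collect_regs) r r1"
    and memory1: "mem_frame (work_area items_i_addr) m m1"
  have env1: "query_env i j r1" by (rule query_env_frame[OF assms(2) frame1]) auto
  have index1: "index_mem m1" by (rule index_mem_frame[OF assms(1) memory1])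
    (use items_area[of items_i_addr] in auto)
  have window1: "r1 r_window = d" using assms(3) by (simp add: reg_frameD[OF frame1])
  show "runs w (block (collect_window r_j r_items_j r_count_j @ ps)) (r1, m1) (collect_time * (cap + 1) + 4 + T) Q"
  proof (rule runs_collect_window[OF index1 env1 window1 fits(2)])
    fix r' m' ys assume ys: "items m' items_j_addr ys" "concat ys = take d (drop j S)"
      "r' r_count_j = length ys" "length ys \<le> cap"
      and frame2: "reg_frame ({15, r_count_j} \<union> collect_regs) r1 r'"
      and memory2: "mem_frame (work_area items_j_addr) m1 m'"
    have frame: "reg_frame ?X r r'" by (rule reg_frame_trans[OF frame1 frame2]) auto
    have "items m' items_i_addr xs"
    proof (rule items_mem_frame[OF xs(1) memory2])
      have "items_i_addr + length xs * item_size + item_size \<le> items_j_addr"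
        using mult_le_mono1[of "length xs + 1" "cap + 2" item_size] xs(4) by (simp add: items_j_addr_def)
      moreover have "stack_addr + cap < items_i_addr" using items_area(1)[of items_i_addr] by simp
      ultimately show "work_area items_j_addr \<inter> {items_i_addr..<items_i_addr + length xs * item_size + item_size} \<subseteq>
          {Suc (items_i_addr + length xs * item_size)}" by auto
    qed
    moreover have "index_mem m'"
      by (rule index_mem_frame[OF index1 memory2]) (use items_area[of items_j_addr] in auto)
    moreover have "query_env i j r'" by (rule query_env_frame[OF env1 frame2]) auto
    moreover have "r' r_window = d" "r' r_count_i = length xs"
      using window1 xs(3) by (simp_all add: reg_frameD[OF frame2])
    ultimately have "windows i j d r' m'" unfolding windows_def using assms(4,5) xs ys by blast
    then show "runs w (block ps) (r', m') T Q" using frame by (rule assms(6))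
  qed (use layout_regsD(8)[OF query_envD(1)[OF env1]] query_envD(3)[OF env1] in simp_all)
qed (use assms(7) query_envD(2)[OF assms(2)] layout_regsD(7)[OF query_envD(1)[OF assms(2)]] in simp_all)

end

context lce_index
begin

definition compare_cost :: "nat \<Rightarrow> nat" where
  "compare_cost d = compare_time * (bit_length cap + 22 * bit_length d + 2)"

lemma height_le_if_length_le: "v \<in> F \<Longrightarrow> length v \<le> d \<Longrightarrow> height v \<le> 22 * bit_length d"
  using height_least[OF height_le_F, of v] floorlog_mono[of "length v" d 2] by linarith

lemma runs_compare_windows:
  assumes "windows i j d r m" "r r_skip = x" "x \<le> d"
    and "\<And>r' m'. windows i j d r' m' \<Longrightarrow> cmp_val (Equal r_equal r_one) r' \<longleftrightarrow> x \<le> ext i j \<Longrightarrow>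
      reg_frame compare_regs r r' \<Longrightarrow> runs w (block ps) (r', m') T Q"
    and "compare_cost d + T \<le> T'"
  shows "runs w (block (compare @ ps)) (r, m) T' Q"
proof -
  note window_facts = windowsD[OF assms(1)]
  note env_facts = query_envD[OF window_facts(2)]
  obtain xs ys where its: "items m items_i_addr xs" "items m items_j_addr ys" "r r_count_i = length xs"
    "r r_count_j = length ys" "length xs \<le> cap" "length ys \<le> cap" "concat xs = take d (drop i S)"
    "concat ys = take d (drop j S)" using assms(1) unfolding windows_def by blast
  have "i + d \<le> N" "j + d \<le> N" using window_facts(5) env_facts(7,8) by (auto simp: room_def)
  then have len: "length (concat xs) = d" "length (concat ys) = d" using its(7,8) by simp_all
  have nonempty: "xs \<noteq> []" "ys \<noteq> []" using len window_facts(4) by auto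
  have item_le: "length v \<le> length (concat zs)" if "v \<in> set zs" for v :: "'a list" and zs
    using that by (auto simp: in_set_conv_decomp)
  have height: "height v \<le> 22 * bit_length d" if "v \<in> set xs \<union> set ys" for v
  proof (rule height_le_if_length_le)
    show "v \<in> F" using that its(1,2) by (auto simp: items_def)
    show "length v \<le> d" using that item_le[of v xs] item_le[of v ys] len by auto
  qed
  have prefixes: "take x (concat xs) = take x (drop i S)" "take x (concat ys) = take x (drop j S)"
    using assms(3) by (simp_all add: its(7,8) min_absorb1)
  show ?thesis
  proof (rule runs_compare[OF window_facts(1) env_facts(1) its(1-3) nonempty(1) its(5) _ _ its(4) nonempty(2) its(6)])
    fix r' m' assume "cmp_val (Equal r_equal r_one) r' \<longleftrightarrow>
        [hash c b (take (r r_skip) (concat xs)) = hash c b (take (r r_skip) (concat ys))] (mod P)"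
      and memory: "mem_frame {acc_i_addr..} m m'" and regs: "reg_frame compare_regs r r'"
    then have "cmp_val (Equal r_equal r_one) r' \<longleftrightarrow> x \<le> ext i j"
      using hash_cong_iff[of x i j] assms(2,3) window_facts(5) env_facts(7,8) prefixes by simp
    moreover have "windows i j d r' m'" by (rule windows_frame[OF assms(1) regs _ memory]) auto
    ultimately show "runs w (block ps) (r', m') T Q" using regs by (intro assms(4))
  qed (use len window_facts(6) assms(2,3,5) height in \<open>simp_all add: compare_cost_def\<close>)
qed

lemma runs_compare_at:
  assumes "windows i j d r m" "r a \<le> d"
    and "\<And>r' m'. windows i j d r' m' \<Longrightarrow> cmp_val (Equal r_equal r_one) r' \<longleftrightarrow> r a \<le> ext i j \<Longrightarrow>
      reg_frame ({r_skip} \<union> compare_regs) r r' \<Longrightarrow> runs w (block ps) (r', m') T Q"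
  shows "runs w (block (Move r_skip a # compare @ ps)) (r, m) (1 + (compare_cost d + T)) Q"
proof -
  note window_facts = windowsD[OF assms(1)]
  let ?r = "r(r_skip := r a)"
  have windows: "windows i j d ?r m" by (rule windows_frame[OF assms(1), of "{r_skip}" _ "{}"]) auto
  have "runs w (block (compare @ ps)) (?r, m) (compare_cost d + T) Q"
  proof (rule runs_compare_windows[OF windows _ assms(2)])
    fix r' m' assume "windows i j d r' m'" "cmp_val (Equal r_equal r_one) r' \<longleftrightarrow> r a \<le> ext i j"
      and frame: "reg_frame compare_regs ?r r'"
    moreover have "reg_frame ({r_skip} \<union> compare_regs) r r'"
      by (rule reg_frame_trans[OF _ frame, of "{r_skip}"]) auto
    ultimately show "runs w (block ps) (r', m') T Q" by (intro assms(3))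
  qed simp_all
  moreover have "r a mod 2 ^ w = r a" using assms(2) window_facts(6) by (intro mod_word_N) simp
  ultimately show ?thesis using query_envD(10)[OF window_facts(2)] by simp
qed

lemma search_bisect:
  assumes "d \<le> N"
  shows "search w r_low r_high r_middle r_next ([Move r_skip r_middle] @ compare) (Equal r_equal r_one)
    (1 + compare_cost d) d (\<lambda>x. x \<le> ext i j) (windows i j d)"
proof unfold_locales
  show "2 * d + 2 < 2 ^ w" using assms words(2) by linarith
  show "r' r_one = 1 \<and> r' r_zero = 0" if "windows i j d r' m'" for r' m'
    using query_envD(9,10)[OF windowsD(2)[OF that]] by simp
  show "windows i j d r'' m'" if "windows i j d r' m'"
    "reg_frame {r_low, r_high, r_middle, r_next, r_temp} r' r''" for r' r'' m'
    by (rule windows_frame[OF that _ mem_frame_refl, of "{}"]) auto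
next
  fix r1 m1 ps T Q assume windows: "windows i j d r1 m1" and mid: "r1 r_middle < d"
    and cont: "\<And>r' m'. windows i j d r' m' \<Longrightarrow> cmp_val (Equal r_equal r_one) r' = (r1 r_middle \<le> ext i j) \<Longrightarrow>
      r' r_low = r1 r_low \<Longrightarrow> r' r_high = r1 r_high \<Longrightarrow> r' r_middle = r1 r_middle \<Longrightarrow> runs w (block ps) (r', m') T Q"
  have "runs w (block (Move r_skip r_middle # compare @ ps)) (r1, m1) (1 + (compare_cost d + T)) Q"
  proof (rule runs_compare_at[OF windows less_imp_le[OF mid]])
    fix r' m' assume "windows i j d r' m'" "cmp_val (Equal r_equal r_one) r' \<longleftrightarrow> r1 r_middle \<le> ext i j"
      and frame: "reg_frame ({r_skip} \<union> compare_regs) r1 r'"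
    then show "runs w (block ps) (r', m') T Q" by (intro cont) (simp_all add: reg_frameD[OF frame])
  qed
  then show "runs w (block (([Move r_skip r_middle] @ compare) @ ps)) (r1, m1) (1 + compare_cost d + T) Q"
    by (simp only: append_Cons append_Nil add.assoc)
qed simp

lemma runs_bisect:
  assumes "windows i j d r m" "ext i j < d"
    and "\<And>r' m'. index_mem m' \<Longrightarrow> query_env i j r' \<Longrightarrow> r' r_answer = ext i j \<Longrightarrow> r' r_done = 1 \<Longrightarrow>
      runs w (block ps) (r', m') T Q"
    and "6 + bit_length d * (8 + compare_cost d) + T \<le> T'"
  shows "runs w (block (bisect @ ps)) (r, m) T' Q"
proof -
  note window_facts = windowsD[OF assms(1)]
  note env_facts = query_envD[OF window_facts(2)]
  let ?test = "[Move r_skip r_middle] @ compare"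
  interpret search w r_low r_high r_middle r_next ?test "Equal r_equal r_one" "1 + compare_cost d" d
    "\<lambda>x. x \<le> ext i j" "windows i j d"
    by (rule search_bisect[OF window_facts(6)])
  let ?r = "r(r_low := 0, r_high := d)"
  have start: "windows i j d ?r m" by (rule windows_frame[OF assms(1), of "{r_low, r_high}" _ "{}"]) auto
  have "runs w (block (binary_search r_low r_high r_middle r_next ?test (Equal r_equal r_one) @
      [Move r_answer r_low, Move r_done r_one] @ ps)) (?r, m) (2 + bit_length d * (7 + (1 + compare_cost d)) + (2 + T)) Q"
  proof (rule runs_binary_search[OF start])
    fix r1 m1 assume windows: "windows i j d r1 m1" and low: "r1 r_low < d" "r1 r_low \<le> ext i j"
      "Suc (r1 r_low) = d \<or> \<not> Suc (r1 r_low) \<le> ext i j"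
    note new_window_facts = windowsD[OF windows]
    note new_env_facts = query_envD[OF new_window_facts(2)]
    have "r1 r_low = ext i j" using low assms(2) by linarith
    moreover have "query_env i j (r1(r_answer := ext i j, r_done := 1))"
      by (rule query_env_frame[OF new_window_facts(2), of "{r_answer, r_done}"]) auto
    then have "runs w (block ps) (r1(r_answer := ext i j, r_done := 1), m1) T Q"
      by (intro assms(3) new_window_facts(1)) simp_all
    moreover have "ext i j mod 2 ^ w = ext i j" using assms(2) window_facts(6) by (intro mod_word_N) simp
    ultimately show "runs w (block ([Move r_answer r_low, Move r_done r_one] @ ps)) (r1, m1) (2 + T) Q"
      using new_env_facts(9,10) by simp
  qed (use window_facts(4) in simp_all)
  then have "runs w (block (bisect @ ps)) (r, m) (2 + (2 + bit_length d * (7 + (1 + compare_cost d)) + (2 + T))) Q"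
    unfolding bisect_def using window_facts(3) env_facts(10) mod_word_N[OF window_facts(6)] by simp
  then show ?thesis by (rule runs_mono) (use assms(4) in auto)
qed

definition next_guess :: "nat \<Rightarrow> nat" where "next_guess D = (if D \<le> floor_sqrt N then D\<^sup>2 else N)"

definition phase_result :: "nat \<Rightarrow> nat \<Rightarrow> nat \<Rightarrow> state \<Rightarrow> bool" where
  "phase_result i j D = (\<lambda>(r, m). index_mem m \<and> query_env i j r \<and>
     (r r_done = 1 \<and> r r_answer = ext i j \<or>
      r r_done = 0 \<and> D \<le> ext i j \<and> D < room i j \<and> r r_guess = next_guess D))"

lemma next_guess_le: "next_guess D \<le> N"
  using order_trans[OF power_mono[of D "floor_sqrt N" 2] floor_sqrt_power2_le] by (simp add: next_guess_def)

lemma runs_grow: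
  assumes "windows i j (min D (room i j)) r m" "min D (room i j) \<le> ext i j" "r r_guess = D" "r r_done = 0"
  shows "runs w (block grow) (r, m) 3 (phase_result i j D)"
proof -
  note window_facts = windowsD[OF assms(1)]
  note env_facts = query_envD[OF window_facts(2)]
  have "runs w (block [Cond (LessEq r_guess r_sqrt) (block [Op Mult r_guess r_guess r_guess]) (block [Move r_guess r_length])])
      (r, m) 2 (phase_result i j D)" if less: "D < room i j"
  proof -
    have "query_env i j (r(r_guess := next_guess D))"
      by (rule query_env_frame[OF window_facts(2), of "{r_guess}"]) auto
    then have result: "phase_result i j D (r(r_guess := next_guess D), m)"
      using window_facts(1) assms(2,4) less by (simp add: phase_result_def)
    have "D * D = next_guess D" if "D \<le> floor_sqrt N"
      using that by (simp add: next_guess_def power2_eq_square)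
    moreover have "N = next_guess D" if "\<not> D \<le> floor_sqrt N" using that by (simp add: next_guess_def)
    ultimately show ?thesis
      using result assms(3) env_facts mod_word_N[OF next_guess_le] by (intro runs_Cond) auto
  qed
  moreover have "runs w (block [Move r_answer r_room, Move r_done r_one]) (r, m) 2 (phase_result i j D)"
    if "\<not> D < room i j"
  proof -
    have "query_env i j (r(r_answer := room i j, r_done := 1))"
      by (rule query_env_frame[OF window_facts(2), of "{r_answer, r_done}"]) auto
    moreover have "ext i j = room i j" using that assms(2) ext_le_room[of i j] by simp
    ultimately show ?thesis using window_facts(1) env_facts mod_word_N[OF env_facts(12)]
      by (simp add: phase_result_def)
  qed
  ultimately show ?thesis unfolding grow_def using assms(3) env_facts(4) by (intro runs_Cond) auto
qed

lemma bit_length_mult_le: "bit_length (x * y) \<le> bit_length x + bit_length y"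
proof -
  have "x * y < 2 ^ bit_length x * 2 ^ bit_length y"
    by (rule mult_strict_mono) (use less_two_power_bit_length in auto)
  then show ?thesis by (simp add: bit_length_le_iff power_add)
qed

lemma phase_time_le:
  assumes "1 \<le> q" "bit_length N \<le> q\<^sup>2" "bit_length d \<le> q"
  shows "2 * (collect_time * (cap + 1) + 4) + compare_cost d + bit_length d * (8 + compare_cost d) + 10 \<le> phase_time * q\<^sup>2"
proof -
  have q: "q \<le> q\<^sup>2" "1 \<le> q\<^sup>2" using assms(1) by (auto simp: power2_eq_square)
  have "1 \<le> bit_length N" using N_pos by (simp add: bit_length_pos_iff Suc_le_eq)
  then have cap: "cap \<le> 89 * q\<^sup>2" "cap + 1 \<le> 90 * q\<^sup>2" using cap_le assms(2) by linarith+
  have "bit_length cap \<le> bit_length (89 * q\<^sup>2)" by (rule floorlog_mono[OF cap(1)])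
  also have "\<dots> \<le> bit_length 89 + bit_length (q\<^sup>2)" by (rule bit_length_mult_le)
  also have "bit_length 89 \<le> 7" by (simp add: bit_length_le_iff)
  also have "bit_length (q\<^sup>2) \<le> bit_length q + bit_length q"
    unfolding power2_eq_square by (rule bit_length_mult_le)
  also have "bit_length q \<le> q" by (simp add: bit_length_le_iff)
  finally have "bit_length cap + 22 * bit_length d + 2 \<le> 33 * q" using assms by linarith
  then have compare: "compare_cost d \<le> compare_time * (33 * q)"
    unfolding compare_cost_def by (rule mult_le_mono2)
  also have "compare_time * (33 * q) \<le> compare_time * (33 * q\<^sup>2)" using q by simp
  finally have once: "compare_cost d \<le> 33 * (compare_time * q\<^sup>2)" by simp
  have "bit_length d * (8 + compare_cost d) \<le> q * (8 + compare_time * (33 * q))"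
    using compare assms(3) by (intro mult_le_mono) auto
  also have "\<dots> = 33 * (compare_time * q\<^sup>2) + 8 * q" by (simp add: power2_eq_square algebra_simps)
  finally have search: "bit_length d * (8 + compare_cost d) \<le> 33 * (compare_time * q\<^sup>2) + 8 * q\<^sup>2"
    using q by linarith
  have "collect_time * (cap + 1) \<le> collect_time * (90 * q\<^sup>2)" using cap(2) by (rule mult_le_mono2)
  then have collect: "collect_time * (cap + 1) \<le> 90 * (collect_time * q\<^sup>2)" by simp
  have "phase_time * q\<^sup>2 = 180 * (collect_time * q\<^sup>2) + 66 * (compare_time * q\<^sup>2) + 40 * q\<^sup>2"
    by (simp add: phase_time_def algebra_simps)
  moreover have "2 * (collect_time * (cap + 1) + 4) \<le> 180 * (collect_time * q\<^sup>2) + 8" using collect by simp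
  ultimately show ?thesis using once search q(2) by linarith
qed

lemma runs_grow_or_bisect:
  assumes "windows i j (min D (room i j)) r m" "r r_guess = D" "r r_done = 0"
    and test: "cmp_val (Equal r_equal r_one) r \<longleftrightarrow> min D (room i j) \<le> ext i j"
  defines "d \<equiv> min D (room i j)"
  shows "runs w (block [Cond (Equal r_equal r_one) (block grow) (block bisect)]) (r, m)
    (bit_length d * (8 + compare_cost d) + 7) (phase_result i j D)" (is "runs w _ _ ?T _")
proof (rule runs_Cond)
  assume "cmp_val (Equal r_equal r_one) (fst (r, m))"
  then show "runs w (block (grow @ [])) (r, m) (?T - 1) (phase_result i j D)"
    using runs_grow[of i j D r m] assms by (auto elim: runs_mono)
next
  assume "\<not> cmp_val (Equal r_equal r_one) (fst (r, m))"
  then have "ext i j < min D (room i j)" using test by (simp add: min_le_iff_disj not_le)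
  from runs_bisect[OF assms(1) this, of "[]" 0]
  show "runs w (block (bisect @ [])) (r, m) (?T - 1) (phase_result i j D)"
    by (simp add: phase_result_def d_def)
qed simp

lemma runs_phase:
  assumes "index_mem m" "query_env i j r" "r r_guess = D" "1 \<le> D" "D < 2 ^ w"
    "bit_length N \<le> (bit_length D)\<^sup>2"
    "r r_done = 0"
  shows "runs w (block phase) (r, m) (phase_time * (bit_length D)\<^sup>2) (phase_result i j D)"
proof -
  define d where "d = min D (room i j)"
  note env_facts = query_envD[OF assms(2)]
  have d: "0 < d" "d \<le> room i j" "d \<le> N" using env_facts(11,12) assms(4) by (auto simp: d_def)
  let ?branch = "[Cond (Equal r_equal r_one) (block grow) (block bisect)]"
  define T3 where "T3 = bit_length d * (8 + compare_cost d) + 7"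
  define T2 where "T2 = 1 + (compare_cost d + T3)"
  define T1 where "T1 = 2 * (collect_time * (cap + 1) + 4) + T2"
  let ?r = "r(r_window := d)"
  have env: "query_env i j ?r" by (rule query_env_frame[OF assms(2), of "{r_window}"]) auto
  have collect: "runs w (block (collect @ [Move r_skip r_window] @ compare @ ?branch)) (?r, m) T1 (phase_result i j D)"
    unfolding T1_def
  proof (rule runs_collect[OF assms(1) env _ d(1,2)])
    fix r1 m1 assume windows: "windows i j d r1 m1"
      and frame1: "reg_frame ({15, 17, 18} \<union> collect_regs) ?r r1"
    note window = windowsD(3)[OF windows]
    show "runs w (block ([Move r_skip r_window] @ compare @ ?branch)) (r1, m1) T2 (phase_result i j D)"
      unfolding T2_def append_Cons append_Nil
    proof (rule runs_compare_at[OF windows])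
      fix r2 m2 assume "windows i j d r2 m2" "cmp_val (Equal r_equal r_one) r2 \<longleftrightarrow> r1 r_window \<le> ext i j"
        and frame2: "reg_frame ({r_skip} \<union> compare_regs) r1 r2"
      then show "runs w (block ?branch) (r2, m2) T3 (phase_result i j D)"
        using runs_grow_or_bisect[of i j D r2 m2] assms(3,7) window
        by (simp add: d_def T3_def reg_frameD[OF frame1] reg_frameD[OF frame2])
    qed (simp add: window)
  qed simp_all
  have "runs w (block phase) (r, m) (2 + T1) (phase_result i j D)" unfolding phase_def append_Cons append_Nil
    by (rule runs_Cond) (use collect assms(3) env_facts(4,10) mod_word_N[OF d(3)] in \<open>auto simp: d_def min_def split: if_splits\<close>)
  moreover have "2 + T1 \<le> phase_time * (bit_length D)\<^sup>2"
    using phase_time_le[of "bit_length D" d] assms(4,6) floorlog_mono[of d D 2] bit_length_pos_iff[of D]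
    by (simp add: T1_def T2_def T3_def d_def)
  ultimately show ?thesis by (rule runs_mono)
qed

end

lemma bit_length_power2 [simp]: "bit_length (2 ^ e) = Suc e"
  using bit_length_le_iff[of "2 ^ e" "Suc e"] less_bit_length_iff[of e "2 ^ e"] by simp

context lce_index
begin

definition valid_guess :: "nat \<Rightarrow> bool" where
  "valid_guess D \<longleftrightarrow> 1 \<le> D \<and> D < 2 ^ w \<and> bit_length N \<le> (bit_length D)\<^sup>2 \<and> ((\<exists>e \<ge> 1. D = 2 ^ e) \<or> D = N)"

lemma bit_length_first_guess: "bit_length N \<le> (bit_length first_guess)\<^sup>2"
  "(bit_length first_guess)\<^sup>2 \<le> 4 * bit_length N"
  and one_le_floor_sqrt: "1 \<le> floor_sqrt (bit_length N)"
proof -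
  let ?e = "floor_sqrt (bit_length N)"
  have "1 \<le> bit_length N" using N_pos by (simp add: bit_length_pos_iff Suc_le_eq)
  then show "1 \<le> ?e" by (simp add: le_floor_sqrt_iff)
  show "bit_length N \<le> (bit_length first_guess)\<^sup>2"
    using Suc_floor_sqrt_power2_gt[of "bit_length N"] by (simp add: first_guess_def)
  have "(Suc ?e)\<^sup>2 \<le> (2 * ?e)\<^sup>2" using \<open>1 \<le> ?e\<close> by (intro power_mono) auto
  also have "\<dots> \<le> 4 * bit_length N"
    using floor_sqrt_power2_le[of "bit_length N"] by (simp add: power_mult_distrib)
  finally show "(bit_length first_guess)\<^sup>2 \<le> 4 * bit_length N" by (simp add: first_guess_def)
qed

lemma valid_first_guess: "valid_guess first_guess"
  unfolding valid_guess_def using bit_length_first_guess(1) one_le_floor_sqrt first_guess_less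
  by (auto simp: first_guess_def)

lemma valid_next_guess:
  assumes "valid_guess D" "D < N"
  shows "valid_guess (next_guess D)"
proof -
  obtain e where e: "1 \<le> e" "D = 2 ^ e" using assms by (auto simp: valid_guess_def)
  have "D \<le> D\<^sup>2" by (simp add: e(2) power2_nat_le_imp_le)
  then have next_guess_ge: "D \<le> next_guess D" using assms(2) by (simp add: next_guess_def)
  then have "bit_length N \<le> (bit_length (next_guess D))\<^sup>2"
    using assms(1) power_mono[OF floorlog_mono[OF next_guess_ge, of 2], of 2]
    unfolding valid_guess_def by linarith
  moreover have "(\<exists>e \<ge> 1. next_guess D = 2 ^ e) \<or> next_guess D = N"
  proof (cases "D \<le> floor_sqrt N")
    case True
    then have "next_guess D = 2 ^ (e * 2)" by (simp add: next_guess_def e(2) power_mult)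
    with e(1) show ?thesis by (intro disjI1 exI[of _ "e * 2"]) simp
  qed (simp add: next_guess_def)
  moreover have "1 \<le> next_guess D" "next_guess D < 2 ^ w"
    using assms(1) next_guess_ge next_guess_le[of D] words(2) by (auto simp: valid_guess_def)
  ultimately show ?thesis by (simp add: valid_guess_def)
qed

text \<open>If the phase with guess \<open>D\<close> is not the last one, \<open>D \<le> ext i j\<close>. As \<open>(bit_length D)\<^sup>2\<close> at least doubles
  with each squaring and at most quadruples, the later phases are paid by the difference in the second summand.\<close>

definition guess_cost :: "nat \<Rightarrow> nat \<Rightarrow> nat \<Rightarrow> nat" where
  "guess_cost i j D = (bit_length D)\<^sup>2 +
     (if D \<le> ext i j \<and> D < room i j then 8 * (bit_length (ext i j))\<^sup>2 - 4 * (bit_length D)\<^sup>2 else 0)"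

lemma bit_length_next_guess_le: "bit_length (next_guess D) \<le> 2 * bit_length D"
proof -
  have "next_guess D \<le> D * D"
  proof (cases "D \<le> floor_sqrt N")
    case False
    then have "(Suc (floor_sqrt N))\<^sup>2 \<le> D\<^sup>2" by (intro power_mono) auto
    then show ?thesis using Suc_floor_sqrt_power2_gt[of N] False
      by (simp add: next_guess_def power2_eq_square)
  qed (simp add: next_guess_def power2_eq_square)
  then show ?thesis using floorlog_mono[of "next_guess D" "D * D" 2] bit_length_mult_le[of D D] by linarith
qed

lemma guess_cost_next:
  assumes "valid_guess D" "D \<le> ext i j" "D < room i j" "i < N"
  shows "(bit_length D)\<^sup>2 + guess_cost i j (next_guess D) \<le> guess_cost i j D"
proof -
  define a a' x where "a = (bit_length D)\<^sup>2" and "a' = (bit_length (next_guess D))\<^sup>2"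
    and "x = (bit_length (ext i j))\<^sup>2"
  have "a' \<le> (2 * bit_length D)\<^sup>2" unfolding a'_def by (rule power_mono[OF bit_length_next_guess_le]) simp
  then have quadruple: "a' \<le> 4 * a" by (simp add: a_def power_mult_distrib)
  have ax: "a \<le> x" unfolding a_def x_def by (rule power_mono[OF floorlog_mono[OF assms(2)]]) simp
  have cost: "guess_cost i j D = a + (8 * x - 4 * a)"
    using assms(2,3) by (simp add: guess_cost_def a_def x_def)
  show ?thesis
  proof (cases "next_guess D \<le> ext i j \<and> next_guess D < room i j")
    case True
    obtain e where e: "1 \<le> e" "D = 2 ^ e" using assms(1,3) by (auto simp: valid_guess_def room_def)
    have "next_guess D \<noteq> N" using True by (auto simp: room_def)
    then have "next_guess D = 2 ^ (e * 2)" by (auto simp: next_guess_def e(2) power_mult split: if_splits)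
    then have "a = (Suc e)\<^sup>2" "a' = (Suc (e * 2))\<^sup>2" by (simp_all add: a_def a'_def e(2))
    moreover have "2 * (Suc e)\<^sup>2 \<le> (Suc (e * 2))\<^sup>2" using e(1) by (cases e) (simp_all add: power2_eq_square)
    ultimately have double: "2 * a \<le> a'" by simp
    have "a' \<le> x" unfolding a'_def x_def using True by (intro power_mono floorlog_mono) auto
    moreover have "guess_cost i j (next_guess D) = a' + (8 * x - 4 * a')"
      using True by (simp add: guess_cost_def a'_def x_def)
    ultimately show ?thesis unfolding cost a_def[symmetric] using double ax by linarith
  next
    case False
    then have "guess_cost i j (next_guess D) = a'" by (auto simp: guess_cost_def a'_def)
    then show ?thesis unfolding cost a_def[symmetric] using quadruple ax by linarith
  qed
qed

lemma guess_cost_first_guess_le: "guess_cost i j first_guess \<le> 4 * bit_length N + 8 * (bit_length (ext i j))\<^sup>2"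
  using bit_length_first_guess(2) unfolding guess_cost_def by (intro add_mono) auto

lemma runs_setup_query:
  assumes "index_mem m" "i < N" "j < N"
    and "\<And>r. query_env i j r \<Longrightarrow> r r_guess = first_guess \<Longrightarrow> r r_done = 0 \<Longrightarrow> runs w (block ps) (r, m) T Q"
    and "25 + T \<le> T'"
  shows "runs w (block (setup_query @ ps)) (query_regs (Suc i) (Suc j), m) T' Q"
proof -
  define r where "r = (query_regs (Suc i) (Suc j))(r_one := 1, r_i := i, r_j := j, r_root := addr S, r_base := \<beta>,
    r_inv := pinv, r_guess := first_guess, r_sqrt := floor_sqrt N, r_stack := stack_addr, r_items_i := items_i_addr,
    r_items_j := items_j_addr, r_acc_i := acc_i_addr, r_temp := 9, r_acc_j := acc_j_addr, r_item_size := item_size, r_length := N)"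
  have sub: "binop_val w Sub N x = N - x" if "x \<le> N" for x using that words(2) by (intro sub_word) linarith+
  have "query_env i j (r(r_room := room i j))"
    using assms(2,3) by (simp add: query_env_def layout_regs_def arithmetic_regs_def r_def query_regs_def)
  then have "runs w (block ps) (r(r_room := room i j), m) T Q"
    by (rule assms(4)) (simp_all add: r_def query_regs_def)
  then have last: "runs w (block (Cond (Less r_i r_j) (block [Op Sub r_room r_length r_j]) (block [Op Sub r_room r_length r_i]) # ps))
      (r, m) (2 + T) Q"
    by (intro runs_Cond)
      (use sub assms(2,3) in \<open>auto simp: r_def room_def max_def split: if_splits simp del: binop_val.simps(2)\<close>)
  have "binop_val w Sub (Suc i) 1 = i" "binop_val w Sub (Suc j) 1 = j"
    using sub_word[of 1 "Suc i" w] sub_word[of 1 "Suc j" w] assms(2,3) words(2) by simp_all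
  moreover have "k mod 2 ^ w = k" if "k \<le> 200" for k :: nat
    using that mem_size_gt by (intro mod_word) linarith
  moreover have "item_size \<le> 200" by (simp add: item_size_def ndigits_def)
  moreover have "length m = mem_size" "addr S < mem_size"
    using assms(1) addr_less(2)[OF S_in_F] by (simp_all add: index_mem_def)
  ultimately have "runs w (block (setup_query @ ps)) (query_regs (Suc i) (Suc j), m) (23 + (2 + T)) Q"
    unfolding setup_query_def
    using last mem_size_gt index_mem_header[OF assms(1)] index_mem_header(2)[OF assms(1), unfolded One_nat_def]
      index_mem_node(1)[OF assms(1) S_in_F]
    by (simp add: runs_Load r_def query_regs_def fun_upd_twist del: binop_val.simps(2))
  then show ?thesis by (rule runs_mono) (use assms(5) in auto)
qed

definition phases_invariant :: "nat \<Rightarrow> nat \<Rightarrow> (reg \<Rightarrow> nat) \<Rightarrow> nat list \<Rightarrow> nat \<Rightarrow> bool" where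
  "phases_invariant i j r m n \<longleftrightarrow> index_mem m \<and> query_env i j r \<and>
     (r r_done = 1 \<and> r r_answer = ext i j \<and> 0 < n \<or>
      r r_done = 0 \<and> valid_guess (r r_guess) \<and> (phase_time + 2) * guess_cost i j (r r_guess) \<le> n)"

lemma phases_invariant_step:
  assumes "phase_result i j D (r, m)" "valid_guess D" "(phase_time + 2) * guess_cost i j D \<le> n" "i < N"
  shows "\<exists>n'. phases_invariant i j r m n' \<and> Suc (phase_time * (bit_length D)\<^sup>2) + n' \<le> n"
proof -
  have "0 < bit_length D" using assms(2) by (simp add: valid_guess_def bit_length_pos_iff)
  then have pos: "1 \<le> (bit_length D)\<^sup>2" by simp
  have env: "index_mem m" "query_env i j r" using assms(1) by (simp_all add: phase_result_def)
  consider (found) "r r_done = 1" "r r_answer = ext i j"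
    | (grown) "r r_done = 0" "D \<le> ext i j" "D < room i j" "r r_guess = next_guess D"
    using assms(1) by (auto simp: phase_result_def)
  then show ?thesis
  proof cases
    case found
    have "(phase_time + 2) * (bit_length D)\<^sup>2 \<le> (phase_time + 2) * guess_cost i j D"
      by (intro mult_le_mono2) (simp add: guess_cost_def)
    then have "Suc (phase_time * (bit_length D)\<^sup>2) + 1 \<le> n"
      using assms(3) pos unfolding add_mult_distrib by linarith
    then show ?thesis using env found by (intro exI[of _ 1]) (simp add: phases_invariant_def)
  next
    case grown
    let ?n = "(phase_time + 2) * guess_cost i j (next_guess D)"
    have "(bit_length D)\<^sup>2 + guess_cost i j (next_guess D) \<le> guess_cost i j D"
      using assms(2,4) grown by (intro guess_cost_next) auto
    then have "(phase_time + 2) * ((bit_length D)\<^sup>2 + guess_cost i j (next_guess D)) \<le> n"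
      using assms(3) mult_le_mono2 order_trans by blast
    then have "Suc (phase_time * (bit_length D)\<^sup>2) + ?n \<le> n"
      using pos unfolding add_mult_distrib2 add_mult_distrib by linarith
    moreover have "valid_guess (next_guess D)"
      using grown assms(2) by (intro valid_next_guess) (auto simp: room_def)
    ultimately show ?thesis using env grown by (intro exI[of _ ?n]) (simp add: phases_invariant_def)
  qed
qed

lemma runs_phases:
  assumes "index_mem m" "query_env i j r" "r r_guess = first_guess" "r r_done = 0"
  shows "runs w (block [While (Equal r_done r_zero) (block phase)]) (r, m) ((phase_time + 2) * guess_cost i j first_guess)
    (\<lambda>(r', m'). index_mem m' \<and> r' r_answer = ext i j)"
proof (rule runs_While_budget[where T = 0 and I = "phases_invariant i j"])
  fix r m n assume inv: "phases_invariant i j r m n" and test: "cmp_val (Equal r_done r_zero) r"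
  have env: "index_mem m" "query_env i j r" using inv by (simp_all add: phases_invariant_def)
  define D where "D = r r_guess"
  have r: "r r_done = 0" "valid_guess D" "(phase_time + 2) * guess_cost i j D \<le> n"
    using inv test query_envD(10)[OF env(2)] by (auto simp: phases_invariant_def D_def)
  then have guess: "1 \<le> D" "D < 2 ^ w" "bit_length N \<le> (bit_length D)\<^sup>2" by (simp_all add: valid_guess_def)
  have "runs w (block phase) (r, m) (phase_time * (bit_length D)\<^sup>2)
      (\<lambda>(r', m'). \<exists>n'. phases_invariant i j r' m' n' \<and> Suc (phase_time * (bit_length D)\<^sup>2) + n' \<le> n)"
    by (rule runs_mono[OF runs_phase[OF env D_def[symmetric] guess r(1)] order_refl])
      (use phases_invariant_step[OF _ r(2,3) query_envD(7)[OF env(2)]] in auto)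
  then show "\<exists>k. runs w (block phase) (r, m) k (\<lambda>(r', m'). \<exists>n'. phases_invariant i j r' m' n' \<and> Suc k + n' \<le> n)"
    by blast
qed (use assms valid_first_guess query_envD(10) in \<open>auto simp: phases_invariant_def\<close>)

lemma runs_query:
  assumes "index_mem m" "i < N" "j < N"
  shows "runs w query (query_regs (Suc i) (Suc j), m) (25 + (phase_time + 2) * (4 * bit_length N + 8 * (bit_length (ext i j))\<^sup>2))
    (\<lambda>(r', m'). index_mem m' \<and> r' r_answer = ext i j)"
  unfolding query_def
proof (rule runs_setup_query[OF assms])
  fix r assume "query_env i j r" "r r_guess = first_guess" "r r_done = 0"
  then show "runs w (block [While (Equal r_done r_zero) (block phase)]) (r, m) ((phase_time + 2) * guess_cost i j first_guess)
      (\<lambda>(r', m'). index_mem m' \<and> r' r_answer = ext i j)" by (rule runs_phases[OF assms(1)])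
qed (intro add_left_mono mult_le_mono2 guess_cost_first_guess_le)

end

section \<open>Index size and query time\<close>

lemma bit_length_le_log: "real (bit_length n) \<le> 1 + log 2 (real (max 1 n))"
  by (cases "n = 0") (auto simp: floorlog_def max_def)

lemma query_time_le:
  assumes "t \<le> 25 + K * (4 * bit_length n + 8 * (bit_length l)\<^sup>2)" "0 < n" and C: "20 * real K + 25 \<le> C"
  shows "real t \<le> C * (1 + log 2 (real n) + (log 2 (real (max 1 l)))\<^sup>2)"
proof -
  define x y where "x = log 2 (real n)" and "y = log 2 (real (max 1 l))"
  have x: "0 \<le> x" "real (bit_length n) \<le> 1 + x"
    using assms(2) bit_length_le_log[of n] by (simp_all add: x_def max_def Suc_le_eq)
  have "(real (bit_length l))\<^sup>2 \<le> (1 + y)\<^sup>2" unfolding y_def by (intro power_mono bit_length_le_log) simp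
  also have "\<dots> \<le> 2 + 2 * y\<^sup>2" using sum_squares_bound[of 1 y] by (simp add: power2_sum)
  finally have "4 * real (bit_length n) + 8 * (real (bit_length l))\<^sup>2 \<le> 20 * (1 + x + y\<^sup>2)"
    using x zero_le_power2[of y] unfolding distrib_left by linarith
  then have "real K * (4 * real (bit_length n) + 8 * (real (bit_length l))\<^sup>2) \<le> real K * (20 * (1 + x + y\<^sup>2))"
    by (rule mult_left_mono) simp
  moreover have "real t \<le> 25 + real K * (4 * real (bit_length n) + 8 * (real (bit_length l))\<^sup>2)"
    using of_nat_mono[OF assms(1), where 'a = real] by (simp only: of_nat_simps of_nat_numeral of_nat_power)
  moreover have "25 \<le> 25 * (1 + x + y\<^sup>2)" using x(1) by simp
  ultimately have "real t \<le> 25 * (1 + x + y\<^sup>2) + real K * (20 * (1 + x + y\<^sup>2))"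
    by (meson add_mono order_trans)
  also have "\<dots> = (20 * real K + 25) * (1 + x + y\<^sup>2)" by (simp add: algebra_simps)
  also have "\<dots> \<le> C * (1 + x + y\<^sup>2)" using C x(1) by (intro mult_right_mono) auto
  finally show ?thesis unfolding x_def y_def .
qed

lemma (in lce_index) solves_lce_query:
  assumes "real mem_size \<le> space" and C: "20 * real (phase_time + 2) + 25 \<le> C"
  shows "solves_lce w query S space (\<lambda>l. C * (1 + log 2 (real (length S)) + (log 2 (real (max 1 l)))\<^sup>2))"
  unfolding solves_lce_def
proof (intro exI[of _ "{m. index_mem m \<and> (\<forall>x \<in> set m. x < 2 ^ w)}"] conjI ballI)
  show "{m. index_mem m \<and> (\<forall>x \<in> set m. x < 2 ^ w)} \<noteq> {}" using ex_index_mem by blast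
next
  fix m assume "m \<in> {m. index_mem m \<and> (\<forall>x \<in> set m. x < 2 ^ w)}"
  then show "real (length m) \<le> space" "\<And>x. x \<in> set m \<Longrightarrow> x < 2 ^ w"
    using assms(1) by (simp_all add: index_mem_def)
next
  fix m i j assume m: "m \<in> {m. index_mem m \<and> (\<forall>x \<in> set m. x < 2 ^ w)}" and ij: "i \<in> {1..N}" "j \<in> {1..N}"
  obtain i' j' where i'j': "i = Suc i'" "j = Suc j'" "i' < N" "j' < N" using ij by (cases i; cases j) auto
  then have "runs w query (query_regs i j, m) (25 + (phase_time + 2) * (4 * bit_length N + 8 * (bit_length (lce S i j))\<^sup>2))
      (\<lambda>(r', m'). index_mem m' \<and> r' 0 = lce S i j)"
    using runs_query[of m i' j'] m i'j' by simp
  then obtain t r' m' where run: "exec w query (query_regs i j, m) t (r', m')" "index_mem m'"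
    "r' 0 = lce S i j"
    and t: "t \<le> 25 + (phase_time + 2) * (4 * bit_length N + 8 * (bit_length (lce S i j))\<^sup>2)"
    unfolding runs_def by auto
  have "word_state w (query_regs i j, m)"
    using m ij words(2) by (auto simp: word_state_def query_regs_def)
  then have "\<forall>x \<in> set m'. x < 2 ^ w" using exec_word_state[OF run(1)] by (simp add: word_state_def)
  then show "\<exists>t r m'. exec w query (query_regs i j, m) t (r, m') \<and> r 0 = lce S i j \<and>
      m' \<in> {m. index_mem m \<and> (\<forall>x \<in> set m. x < 2 ^ w)} \<and>
      real t \<le> C * (1 + log 2 (real N) + (log 2 (real (max 1 (lce S i j))))\<^sup>2)"
    using run query_time_le[OF t N_pos C] by blast
qed

lemma ex_neg_inverse_mod:
  fixes p q :: nat
  assumes "coprime p q" "0 < q"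
  shows "\<exists>x < q. (p * x + 1) mod q = 0"
proof -
  obtain y where "[p * y = 1] (mod q)" using cong_solve_coprime_nat[OF assms(1)] by auto
  then have "[p * y * (q - 1) + 1 = 1 * (q - 1) + 1] (mod q)" by (intro cong_add cong_mult cong_refl)
  then have "(p * (y * (q - 1)) + 1) mod q = 0" using assms(2) by (simp add: cong_def mult.assoc)
  then have "(p * (y * (q - 1) mod q) + 1) mod q = 0" by (metis mod_add_left_eq mod_mult_right_eq)
  then show ?thesis using assms(2) by (intro exI[of _ "y * (q - 1) mod q"]) simp
qed

lemma ex_montgomery_modulus:
  assumes "0 < n" "32 * n \<le> 2 ^ w"
  obtains \<beta> P pinv where "montgomery w \<beta> P pinv" "prime P" "n ^ 4 < P" "coprime \<beta> P"
proof -
  define t where "t = bit_length n div 2 + 2"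
  define \<beta> :: nat where "\<beta> = 2 ^ t"
  have n_bounds: "2 ^ (bit_length n - 1) \<le> n" "n < 2 ^ bit_length n" "0 < bit_length n"
    using floorlog_bounds[of n 2] assms(1) by (simp_all add: bit_length_pos_iff)
  have "2 * t \<le> (bit_length n - 1) + 5" using n_bounds(3) by (simp add: t_def)
  then have "(2::nat) ^ (2 * t) \<le> 2 ^ ((bit_length n - 1) + 5)" by (intro power_increasing) auto
  also have "\<dots> \<le> 32 * n" using n_bounds(1) by (simp add: power_add)
  finally have square: "\<beta> * \<beta> \<le> 2 ^ w" using assms(2) by (simp add: \<beta>_def mult_2 power_add)
  have "(2::nat) ^ bit_length n \<le> 2 ^ (t * 2)" by (rule power_increasing) (auto simp: t_def)
  then have "n \<le> \<beta> ^ 2" using n_bounds(2) by (simp add: \<beta>_def power_mult)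
  then have fourth: "n ^ 4 \<le> \<beta> ^ 8" using power_mono[of n "\<beta> ^ 2" 4] by (simp flip: power_mult)
  have base: "4 \<le> \<beta>" using power_increasing[of 2 t "2::nat"] by (simp add: \<beta>_def t_def)
  obtain P :: nat where P: "prime P" "2 ^ (8 * t) < P" "P \<le> 2 ^ (2 * (8 * t))"
    using ex_prime_between_powers[of "8 * t"] by (auto simp: t_def)
  then have bounds: "\<beta> ^ 8 < P" "P \<le> \<beta> ^ 16" by (simp_all add: \<beta>_def mult.commute flip: power_mult)
  have "\<beta> ^ 1 \<le> \<beta> ^ 8" using base by (intro power_increasing) auto
  then have "2 < P" using bounds(1) base by simp
  then have "odd P" using prime_odd_nat[OF P(1)] by simp
  then have coprime: "coprime \<beta> P" by (simp add: \<beta>_def)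
  then obtain pinv where pinv: "pinv < \<beta>" "(P * pinv + 1) mod \<beta> = 0"
    using ex_neg_inverse_mod[of P \<beta>] base by (auto simp: coprime_commute)
  have "4 * P \<le> \<beta> * \<beta> ^ 16" by (rule mult_le_mono[OF base bounds(2)])
  then have "4 * P \<le> \<beta> ^ (ndigits - 1)" by (simp add: ndigits_def flip: power_Suc)
  then have "montgomery w \<beta> P pinv" using base square \<open>2 < P\<close> pinv by unfold_locales simp_all
  then show thesis using P(1) _ coprime by (rule that) (use fourth bounds(1) in linarith)
qed

lemma has_tree_restrict_length: "has_tree F g u h \<Longrightarrow> length u \<le> n \<Longrightarrow> has_tree {s \<in> F. length s \<le> n} g u h"
  by (induction rule: has_tree.induct) (auto intro: has_tree.intros)

lemma slp_balanced_family:
  assumes "slp_represents G S"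
  obtains F where "finite F" "S \<in> F" "\<And>s. s \<in> F \<Longrightarrow> length s \<le> length S"
    "\<And>s. s \<in> F \<Longrightarrow> height_le F s (22 * bit_length (length s))"
    "index_size_bound (card F) (length S) \<le> 8000 * slp_size G"
    "index_size_bound (card F) (length S) \<le> 16000 * length S"
proof -
  obtain V where V: "closed_family V" "finite V" "S \<in> V" "card V \<le> slp_size G" "card V \<le> 2 * length S"
    using slp_closed_family[OF assms] .
  obtain F0 where F0: "finite F0" "V \<subseteq> F0" "card F0 \<le> 106 * card V"
    "\<And>s. s \<in> F0 \<Longrightarrow> height_le F0 s (22 * bit_length (length s))"
    using ex_balanced_family[OF V(2,1)] V(3) by blast
  let ?F = "{s \<in> F0. length s \<le> length S}"
  have "card ?F \<le> 106 * card V" using F0(3) card_mono[OF F0(1), of ?F] by auto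
  moreover have "bit_length (length S) \<le> card V" by (rule closed_family_bit_length_le[OF V(1-3)])
  moreover have "1 \<le> card V" using V(2,3) by (auto simp: Suc_le_eq card_gt_0_iff)
  ultimately have size: "index_size_bound (card ?F) (length S) \<le> 8000 * card V"
    unfolding index_size_bound_def by linarith
  show thesis
  proof (rule that[of ?F])
    show "height_le ?F s (22 * bit_length (length s))" if "s \<in> ?F" for s
      using that has_tree_restrict_length[OF F0(4)] by simp
  qed (use F0 V size in auto)
qed

lemma ex_lce_index:
  assumes "slp_represents G S" "16000 * length S \<le> 2 ^ w"
  obtains \<beta> P pinv c b F where "lce_index w \<beta> P pinv c b F S"
    "index_size_bound (card F) (length S) \<le> 8000 * slp_size G"
proof -
  obtain F where F: "finite F" "S \<in> F" "\<And>s. s \<in> F \<Longrightarrow> length s \<le> length S"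
    "\<And>s. s \<in> F \<Longrightarrow> height_le F s (22 * bit_length (length s))"
    "index_size_bound (card F) (length S) \<le> 8000 * slp_size G"
    "index_size_bound (card F) (length S) \<le> 16000 * length S"
    using slp_balanced_family[OF assms(1)] by blast
  have S: "S \<noteq> []" using has_tree_nonempty[OF F(4)[OF F(2)]] .
  then obtain \<beta> P pinv where "montgomery w \<beta> P pinv" and P: "prime P" "length S ^ 4 < P" and "coprime \<beta> P"
    using ex_montgomery_modulus[of "length S" w] assms(2) by auto
  obtain c where c: "bij_betw c (set S) {0..<card (set S)}" using ex_bij_betw_finite_nat[of "set S"] by auto
  have "card (set S) < P"
    using card_length[of S] power_increasing[of 1 4 "length S"] P(2) S by (simp add: Suc_le_eq)
  then have "c x < P" if "x \<in> set S" for x using bij_betw_apply[OF c that] by simp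
  then obtain b where b: "0 < b" "b < P" "collision_free c b P S"
    using ex_collision_free_base[OF P(1) S P(2) bij_betw_imp_inj_on[OF c]] by blast
  have "\<not> P dvd b" using b(1,2) by (auto dest: dvd_imp_le)
  then have "coprime b P" using prime_imp_coprime[OF P(1)] coprime_commute by blast
  moreover have "index_size_bound (card F) (length S) \<le> 2 ^ w" "2 * length S + 2 < 2 ^ w"
    using F(6) assms(2) S by (auto simp: neq_Nil_conv)
  ultimately have "lce_index w \<beta> P pinv c b F S"
    using F b(3) \<open>coprime \<beta> P\<close> \<open>montgomery w \<beta> P pinv\<close>
    by (intro lce_index.intro hashing.intro hashing_axioms.intro lce_index_axioms.intro)
  then show thesis using F(5) by (rule that)
qed

theorem theorem2:
  shows "\<exists>(p :: prog) (k :: nat) (C :: real). \<forall>(G :: (nat, nat) cfg) (S :: nat list) (w :: nat).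
    slp_represents G S \<longrightarrow> k * length S \<le> 2 ^ w \<longrightarrow>
    solves_lce w p S
      (C * real (slp_size G))
      (\<lambda>l. C * (1 + log 2 (real (length S)) + (log 2 (real (max 1 l)))\<^sup>2))"
proof (intro exI allI impI)
  define C where "C = 20 * real (phase_time + 2) + 8000"
  fix G :: "(nat, nat) cfg" and S :: "nat list" and w :: nat
  assume slp: "slp_represents G S" and words: "16000 * length S \<le> 2 ^ w"
  obtain \<beta> P pinv and c :: "nat \<Rightarrow> nat" and b F where "lce_index w \<beta> P pinv c b F S"
    and size: "index_size_bound (card F) (length S) \<le> 8000 * slp_size G"
    using ex_lce_index[OF slp words] by blast
  then interpret lce_index w \<beta> P pinv c b F S by simp
  have "mem_size \<le> 8000 * slp_size G" using mem_size_le_bound size by (rule le_trans)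
  then have "real mem_size \<le> 8000 * real (slp_size G)" by linarith
  also have "\<dots> \<le> C * real (slp_size G)" by (intro mult_right_mono) (simp_all add: C_def)
  finally show "solves_lce w query S (C * real (slp_size G))
      (\<lambda>l. C * (1 + log 2 (real (length S)) + (log 2 (real (max 1 l)))\<^sup>2))"
    by (rule solves_lce_query) (simp add: C_def)
qed

end
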